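(* Let $(M,Q^M)$ be a formal DG manifold, let $L=\operatorname{Coder}(S(M),S(M))$ be the differential graded Lie algebra of coderivations of $S(M)$, let $U=L[1]$ with the DG structure $Q^U$ corresponding to the DGL structure of $L$, and let $Q$ be the canonical degree $1$ vectorfield on $U\times M$ (all defined in the context). Then $(U,Q^U,Q)$ is a universal deformation of $(M,Q^M)$, i.e. it is a deformation of $(M,Q^M)$ and for each deformation $(B,Q^B,Q')$ of $(M,Q^M)$ there exists a morphism of deformations $(F,f):(B,Q^B,Q')\to(U,Q^U,Q)$, where $f$ is uniquely defined. More precisely, the mapping $Q'\mapsto f=(f_n)_{n\ge1}$, where $$\bigl(\uparrow f_n(b_1\odot\cdots\odot b_n)\bigr)_k(m_1,\dots,m_k):=Q'_{n+k}(b_1,\dots,b_n,m_1,\dots,m_k)\qquad(b_i\in B,\ m_j\in M),$$ defines a one-to-one correspondence between deformations of $M$ with base $(B,Q^B)$ and morphisms $B\to U$ of formal DG manifolds.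
   Context: Conventions. $k$ is a ground ring of characteristic zero (containing $\mathbb{Q}$); modules are $\mathbb{Z}$-graded $k$-modules, with the Koszul sign rule $(f\otimes g)(a\otimes b)=(-1)^{|g||a|}f(a)\otimes g(b)$. $S(W)=\bigoplus_{n\ge0}W^{\odot n}$ is the graded symmetric algebra, with product $\odot$. In exponents an element stands for its degree. For $\sigma\in\Sigma_n$, $\epsilon(\sigma)$ is defined by $w_{\sigma(1)}\odot\cdots\odot w_{\sigma(n)}=\epsilon(\sigma)\,w_1\odot\cdots\odot w_n$. $\mathrm{Sh}(j,n)$ is the set of $\sigma\in\Sigma_n$ with $\sigma(1)<\dots<\sigma(j)$ and $\sigma(j+1)<\dots<\sigma(n)$. The comultiplication $\Delta$ on $S(W)$ is $\Delta(1)=1\otimes1$ and $\Delta(w)=w\otimes1+\Delta^+(w)+1\otimes w$ for $w\in\bigoplus_{n\ge1}W^{\odot n}$, where $\Delta^+(w_1\odot\cdots\odot w_n)=\sum_{j=1}^{n-1}\sum_{\sigma\in\mathrm{Sh}(j,n)}\epsilon(\sigma)\,w_{\sigma(1)}\odot\cdots\odot w_{\sigma(j)}\otimes w_{\sigma(j+1)}\odot\cdots\odot w_{\sigma(n)}$. Formal DG manifolds. A formal supermanifold is a graded module $M$ with distinguished point $0$. A morphism $f:M\to N$ of formal supermanifolds is a sequence $(f_n)_{n\ge1}$ of degree $0$ linear maps $f_n:M^{\odot n}\to N$; equivalently, it is a degree $0$ coalgebra morphism $S(M)\to S(N)$ with $1\mapsto1$ whose components $M^{\odot n}\to N$ are the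 $f_n$, and composition is composition of coalgebra morphisms. A vectorfield of degree $j$ on $M$ is a degree $j$ coderivation $Q$ of $S(M)$; it is determined by its components $Q_n:M^{\odot n}\to M$ ($n\ge0$) via $Q(w_1\odot\cdots\odot w_n)=\sum_{l=0}^n\sum_{\sigma\in\mathrm{Sh}(l,n)}\epsilon(\sigma)\,Q_l(w_{\sigma(1)},\dots,w_{\sigma(l)})\odot w_{\sigma(l+1)}\odot\cdots\odot w_{\sigma(n)}$, $Q(1)=Q_0(1)$. A DG structure on $M$ is a vectorfield $Q^M$ of degree $1$ with $[Q^M,Q^M]=0$ (equivalently $(Q^M)^2=0$); $(M,Q^M)$ is then a formal DG manifold. Morphisms of formal DG manifolds are morphisms of formal supermanifolds whose coalgebra morphism commutes with the vectorfields. $\mathrm{DG\text{-}Manf}^L$ is the full subcategory of those $(M,Q^M)$ with $Q^M_0=0$. The product $B\times M$ has underlying module $B\oplus M$; vectorfields on $B$ or on $M$ are viewed as vectorfields on $B\times M$ (components vanish on products involving factors from the other summand). Deformations. Let $(M,Q^M)$ be a formal DG manifold and $(B,Q^B)$ in $\mathrm{DG\text{-}Manf}^L$. A deformation $(B,Q^B,Q)$ of $M$ with base $B$ is a degree $1$ vectorfield $Q$ on $B\times M$ with $Q_0=0$ such that: (i) $Q|_{\{0\}\times M}=0$; (ii) $\tilde Q:=Q^M+Q^B+Q$ is a DG structure on $B\times M$; (iii) the projection $B\times M\to B$ is a morphism of formal DG manifolds (equivalently, all components of $Q$ have values in $\{0\}\times M$). A morphism $(B,Q^B,Q)\to(B',Q^{B'},Q')$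 of deformations of $M$ is a pair $(F,f)$, with $F:(B\times M,\tilde Q)\to(B'\times M,\tilde Q')$ (where $\tilde Q'=Q^M+Q^{B'}+Q'$) and $f:(B,Q^B)\to(B',Q^{B'})$ morphisms of formal DG manifolds, such that the square formed by $F$, $f$ and the two projections to $B$ and $B'$ is cartesian and $F$ is compatible with the inclusions of $M$ into $B\times M$ and $B'\times M$. The objects $L$, $U$, $Q$. $L=\operatorname{Coder}(S(M),S(M))$ is the graded module of coderivations of $S(M)$, graded by degree, with bracket $[s,t]=s\circ t-(-1)^{st}t\circ s$ and differential $d(s)=(-1)^s[s,Q^M]$. For $s\in L$, $s_n:M^{\odot n}\to M$ denotes its $n$-th component. $L[1]^i=L^{i+1}$; $\downarrow:L\to L[1]$ is the canonical map of degree $-1$ and $\uparrow=\downarrow^{-1}$. On $U=L[1]$, $Q^U$ has components $Q^U_1=\downarrow\circ d\circ\uparrow$, $Q^U_2=-\downarrow\circ[\cdot,\cdot]\circ(\uparrow\otimes\uparrow)$ (Koszul rule), and all other components are zero. The vectorfield $Q$ on $U\times M$ has components $Q_n$, $n\ge1$, with values in $M$, given by $Q_n(u,m_1,\dots,m_{n-1})=(\uparrow u)_{n-1}(m_1,\dots,m_{n-1})$ for $u\in U$, $m_i\in M$, extended graded symmetrically and vanishing on products in which the number of factors from $U$ is not exactly one.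
   Formalization: "f is uniquely defined" is proved among morphisms (F,f) whose F commutes with the projections to M (F = f × id_M); among all morphisms of deformations f is not unique, since gauge transformations of M over B give other f. *)

theory Defs
  imports "HOL-Combinatorics.Permutations" "HOL-Algebra.AbelCoset" "HOL-Algebra.Module"
begin

section \<open>Graded modules\<close>

text \<open>
  The ground ring is a nonzero commutative ring in which every positive integer is
  invertible, i.e. a commutative ring containing the rationals.
\<close>

definition ground_ring :: "'k ring \<Rightarrow> bool" where
  "ground_ring R \<longleftrightarrow> cring R \<and> \<one>\<^bsub>R\<^esub> \<noteq> \<zero>\<^bsub>R\<^esub> \<and> (\<forall>n::nat. n > 0 \<longrightarrow> [n] \<cdot>\<^bsub>R\<^esub> \<one>\<^bsub>R\<^esub> \<in> Units R)"

text \<open>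
  A \<open>\<int>\<close>-graded module is the family of its homogeneous parts. The fields \<open>mult\<close> and \<open>one\<close> of the
  record are never used.
\<close>

type_synonym ('k, 'm) gmod = "int \<Rightarrow> ('k, 'm) module"

definition graded_module :: "'k ring \<Rightarrow> ('k, 'm) gmod \<Rightarrow> bool" where
  "graded_module R W \<longleftrightarrow> (\<forall>i. module R (W i))"

definition lin_maps :: "'k ring \<Rightarrow> ('k, 'a) module \<Rightarrow> ('k, 'b) module \<Rightarrow> ('a \<Rightarrow> 'b) set" where
  "lin_maps R A B = {\<phi> \<in> carrier A \<rightarrow>\<^sub>E carrier B.
     (\<forall>x\<in>carrier A. \<forall>y\<in>carrier A. \<phi> (x \<oplus>\<^bsub>A\<^esub> y) = \<phi> x \<oplus>\<^bsub>B\<^esub> \<phi> y) \<and>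
     (\<forall>a\<in>carrier R. \<forall>x\<in>carrier A. \<phi> (a \<odot>\<^bsub>A\<^esub> x) = a \<odot>\<^bsub>B\<^esub> \<phi> x)}"

text \<open>
  A graded map is a family indexed by the degree of the argument. Its members are extensional, so
  that equality of graded maps is equality in HOL.
\<close>

definition graded_maps ::
  "'k ring \<Rightarrow> ('k, 'a) gmod \<Rightarrow> ('k, 'b) gmod \<Rightarrow> int \<Rightarrow> (int \<Rightarrow> 'a \<Rightarrow> 'b) set" where
  "graded_maps R A B j = {\<phi>. \<forall>d. \<phi> d \<in> lin_maps R (A d) (B (d + j))}"

text \<open>Composition of graded maps the first of which (\<open>\<phi>\<close>, defined on \<open>A\<close>) has degree 0.\<close>

definition gcomp ::
  "('k, 'a) gmod \<Rightarrow> (int \<Rightarrow> 'b \<Rightarrow> 'c) \<Rightarrow> (int \<Rightarrow> 'a \<Rightarrow> 'b) \<Rightarrow> int \<Rightarrow> 'a \<Rightarrow> 'c" where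
  "gcomp A \<psi> \<phi> = (\<lambda>d. \<lambda>x\<in>carrier (A d). \<psi> d (\<phi> d x))"

definition dsum :: "('k, 'a) gmod \<Rightarrow> ('k, 'b) gmod \<Rightarrow> ('k, 'a \<times> 'b) gmod" where
  "dsum A B = (\<lambda>i.
     \<lparr>carrier = carrier (A i) \<times> carrier (B i), monoid.mult = undefined, one = undefined,
      zero = (\<zero>\<^bsub>A i\<^esub>, \<zero>\<^bsub>B i\<^esub>),
      add = (\<lambda>x y. (fst x \<oplus>\<^bsub>A i\<^esub> fst y, snd x \<oplus>\<^bsub>B i\<^esub> snd y)),
      smult = (\<lambda>a x. (a \<odot>\<^bsub>A i\<^esub> fst x, a \<odot>\<^bsub>B i\<^esub> snd x))\<rparr>)"

definition shift :: "('k, 'a) gmod \<Rightarrow> ('k, 'a) gmod" where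
  "shift L = (\<lambda>i. L (i + 1))"

text \<open>The sign \<open>(-1)\<^sup>e\<close> as a scalar.\<close>

definition ksign :: "'k ring \<Rightarrow> int \<Rightarrow> 'k" where
  "ksign R e = (if even e then \<one>\<^bsub>R\<^esub> else \<ominus>\<^bsub>R\<^esub> \<one>\<^bsub>R\<^esub>)"


section \<open>Modules given by generators and relations\<close>

definition free_mod :: "'k ring \<Rightarrow> 'x set \<Rightarrow> ('k, 'x \<Rightarrow> 'k) module" where
  "free_mod R X =
     \<lparr>carrier = {c. (\<forall>x. c x \<in> carrier R) \<and> (\<forall>x. x \<notin> X \<longrightarrow> c x = \<zero>\<^bsub>R\<^esub>) \<and> finite {x. c x \<noteq> \<zero>\<^bsub>R\<^esub>}},
      monoid.mult = undefined, one = undefined,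
      zero = (\<lambda>x. \<zero>\<^bsub>R\<^esub>), add = (\<lambda>c c' x. c x \<oplus>\<^bsub>R\<^esub> c' x), smult = (\<lambda>a c x. a \<otimes>\<^bsub>R\<^esub> c x)\<rparr>"

definition basis_vec :: "'k ring \<Rightarrow> 'x \<Rightarrow> 'x \<Rightarrow> 'k" where
  "basis_vec R x = (\<lambda>y. if y = x then \<one>\<^bsub>R\<^esub> else \<zero>\<^bsub>R\<^esub>)"

inductive_set lin_span :: "'k ring \<Rightarrow> ('k, 'a) module \<Rightarrow> 'a set \<Rightarrow> 'a set" for R F S where
  lin_span_zero: "\<zero>\<^bsub>F\<^esub> \<in> lin_span R F S"
| lin_span_step: "\<lbrakk>a \<in> carrier R; r \<in> S; x \<in> lin_span R F S\<rbrakk> \<Longrightarrow> (a \<odot>\<^bsub>F\<^esub> r) \<oplus>\<^bsub>F\<^esub> x \<in> lin_span R F S"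

definition quot_mod :: "('k, 'a) module \<Rightarrow> 'a set \<Rightarrow> ('k, 'a set) module" where
  "quot_mod F N =
     \<lparr>carrier = a_rcosets\<^bsub>F\<^esub> N, monoid.mult = undefined, one = undefined, zero = N, add = set_add F,
      smult = (\<lambda>a A. \<Union>x\<in>A. N +>\<^bsub>F\<^esub> (a \<odot>\<^bsub>F\<^esub> x))\<rparr>"

definition pres_mod :: "'k ring \<Rightarrow> 'x set \<Rightarrow> ('x \<Rightarrow> 'k) set \<Rightarrow> ('k, ('x \<Rightarrow> 'k) set) module" where
  "pres_mod R X S = quot_mod (free_mod R X) (lin_span R (free_mod R X) S)"

definition pres_gen :: "'k ring \<Rightarrow> 'x set \<Rightarrow> ('x \<Rightarrow> 'k) set \<Rightarrow> 'x \<Rightarrow> ('x \<Rightarrow> 'k) set" where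
  "pres_gen R X S x = lin_span R (free_mod R X) S +>\<^bsub>free_mod R X\<^esub> basis_vec R x"

text \<open>
  The linear map from a presented module to \<open>P\<close> with value \<open>\<phi> x\<close> on the generator \<open>x\<close>. Below it is
  only used for \<open>\<phi>\<close> compatible with the relations, so that the choice of a representative of the
  coset \<open>A\<close> does not matter.
\<close>

definition pres_lift :: "'k ring \<Rightarrow> ('k, 'p) module \<Rightarrow> ('x \<Rightarrow> 'p) \<Rightarrow> ('x \<Rightarrow> 'k) set \<Rightarrow> 'p" where
  "pres_lift R P \<phi> A =
     (let c = (SOME c. c \<in> A) in finsum P (\<lambda>x. c x \<odot>\<^bsub>P\<^esub> \<phi> x) {x. c x \<noteq> \<zero>\<^bsub>R\<^esub>})"


section \<open>The graded symmetric coalgebra\<close>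

text \<open>
  A word is a list of homogeneous elements, each paired with its degree; the word
  \<open>[(i\<^sub>1, w\<^sub>1), \<dots>, (i\<^sub>n, w\<^sub>n)]\<close> stands for the product of \<open>w\<^sub>1, \<dots>, w\<^sub>n\<close> in \<open>S(W)\<close>.
\<close>

type_synonym 'w word = "(int \<times> 'w) list"

definition wdeg :: "'w word \<Rightarrow> int" where
  "wdeg w = sum_list (map fst w)"

definition words :: "('k, 'w) gmod \<Rightarrow> 'w word set" where
  "words W = {w. \<forall>(i, x)\<in>set w. x \<in> carrier (W i)}"

definition words_of_deg :: "('k, 'w) gmod \<Rightarrow> int \<Rightarrow> 'w word set" where
  "words_of_deg W d = {w \<in> words W. wdeg w = d}"

text \<open>
  Multilinearity and graded commutativity. (That squares of odd elements vanish follows, as 2 is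
  invertible.)
\<close>

definition sym_rels :: "'k ring \<Rightarrow> ('k, 'w) gmod \<Rightarrow> int \<Rightarrow> ('w word \<Rightarrow> 'k) set" where
  "sym_rels R W d = (let X = words_of_deg W d; F = free_mod R X; e = basis_vec R in
     {e (u @ (i, x \<oplus>\<^bsub>W i\<^esub> y) # v) \<ominus>\<^bsub>F\<^esub> (e (u @ (i, x) # v) \<oplus>\<^bsub>F\<^esub> e (u @ (i, y) # v)) | u v i x y.
        u @ (i, x) # v \<in> X \<and> u @ (i, y) # v \<in> X} \<union>
     {e (u @ (i, a \<odot>\<^bsub>W i\<^esub> x) # v) \<ominus>\<^bsub>F\<^esub> (a \<odot>\<^bsub>F\<^esub> e (u @ (i, x) # v)) | u v i x a.
        a \<in> carrier R \<and> u @ (i, x) # v \<in> X} \<union>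
     {e (u @ (i, x) # (j, y) # v) \<ominus>\<^bsub>F\<^esub> (ksign R (i * j) \<odot>\<^bsub>F\<^esub> e (u @ (j, y) # (i, x) # v)) | u v i x j y.
        u @ (i, x) # (j, y) # v \<in> X})"

type_synonym ('k, 'w) sym = "('w word \<Rightarrow> 'k) set"

definition Sym :: "'k ring \<Rightarrow> ('k, 'w) gmod \<Rightarrow> ('k, ('k, 'w) sym) gmod" where
  "Sym R W = (\<lambda>d. pres_mod R (words_of_deg W d) (sym_rels R W d))"

definition smon :: "'k ring \<Rightarrow> ('k, 'w) gmod \<Rightarrow> 'w word \<Rightarrow> ('k, 'w) sym" where
  "smon R W w = pres_gen R (words_of_deg W (wdeg w)) (sym_rels R W (wdeg w)) w"

text \<open>
  Permutations act on the positions \<open>0, \<dots>, n - 1\<close>, and \<open>permute_list \<sigma> w\<close> is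
  \<open>w\<^bsub>\<sigma>(0)\<^esub> \<dots> w\<^bsub>\<sigma>(n-1)\<^esub>\<close>. The sign \<open>\<epsilon>(\<sigma>)\<close> collects a factor \<open>(-1)\<^bsup>|x||y|\<^esup>\<close> for each
  pair of letters \<open>x\<close>, \<open>y\<close> whose order is reversed.
\<close>

definition Sh :: "nat \<Rightarrow> nat \<Rightarrow> (nat \<Rightarrow> nat) set" where
  "Sh j n = {\<sigma>. \<sigma> permutes {..<n} \<and> strict_mono_on {..<j} \<sigma> \<and> strict_mono_on {j..<n} \<sigma>}"

definition koszul :: "'k ring \<Rightarrow> 'w word \<Rightarrow> (nat \<Rightarrow> nat) \<Rightarrow> 'k" where
  "koszul R w \<sigma> = ksign R (\<Sum>(p, q) \<in> {(p, q). p < q \<and> q < length w \<and> \<sigma> q < \<sigma> p}.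
     fst (w ! \<sigma> p) * fst (w ! \<sigma> q))"

type_synonym ('k, 'a, 'b) tens = "((int \<times> 'a) \<times> (int \<times> 'b) \<Rightarrow> 'k) set"

definition tens_pairs :: "('k, 'a) gmod \<Rightarrow> ('k, 'b) gmod \<Rightarrow> int \<Rightarrow> ((int \<times> 'a) \<times> (int \<times> 'b)) set" where
  "tens_pairs A B d = {((i, x), (j, y)) | i x j y. i + j = d \<and> x \<in> carrier (A i) \<and> y \<in> carrier (B j)}"

definition tens_rels ::
  "'k ring \<Rightarrow> ('k, 'a) gmod \<Rightarrow> ('k, 'b) gmod \<Rightarrow> int \<Rightarrow> ((int \<times> 'a) \<times> (int \<times> 'b) \<Rightarrow> 'k) set" where
  "tens_rels R A B d = (let X = tens_pairs A B d; F = free_mod R X; e = basis_vec R in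
     {e ((i, x \<oplus>\<^bsub>A i\<^esub> x'), (j, y)) \<ominus>\<^bsub>F\<^esub> (e ((i, x), (j, y)) \<oplus>\<^bsub>F\<^esub> e ((i, x'), (j, y))) | i x x' j y.
        ((i, x), (j, y)) \<in> X \<and> ((i, x'), (j, y)) \<in> X} \<union>
     {e ((i, x), (j, y \<oplus>\<^bsub>B j\<^esub> y')) \<ominus>\<^bsub>F\<^esub> (e ((i, x), (j, y)) \<oplus>\<^bsub>F\<^esub> e ((i, x), (j, y'))) | i x j y y'.
        ((i, x), (j, y)) \<in> X \<and> ((i, x), (j, y')) \<in> X} \<union>
     {e ((i, a \<odot>\<^bsub>A i\<^esub> x), (j, y)) \<ominus>\<^bsub>F\<^esub> (a \<odot>\<^bsub>F\<^esub> e ((i, x), (j, y))) | i x j y a.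
        a \<in> carrier R \<and> ((i, x), (j, y)) \<in> X} \<union>
     {e ((i, x), (j, a \<odot>\<^bsub>B j\<^esub> y)) \<ominus>\<^bsub>F\<^esub> (a \<odot>\<^bsub>F\<^esub> e ((i, x), (j, y))) | i x j y a.
        a \<in> carrier R \<and> ((i, x), (j, y)) \<in> X})"

definition tensor ::
  "'k ring \<Rightarrow> ('k, 'a) gmod \<Rightarrow> ('k, 'b) gmod \<Rightarrow> ('k, ('k, 'a, 'b) tens) gmod" where
  "tensor R A B = (\<lambda>d. pres_mod R (tens_pairs A B d) (tens_rels R A B d))"

text \<open>\<open>tens R A B i x j y\<close> is \<open>x \<otimes> y\<close> for \<open>x\<close> of degree \<open>i\<close> and \<open>y\<close> of degree \<open>j\<close>.\<close>

definition tens ::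
  "'k ring \<Rightarrow> ('k, 'a) gmod \<Rightarrow> ('k, 'b) gmod \<Rightarrow> int \<Rightarrow> 'a \<Rightarrow> int \<Rightarrow> 'b \<Rightarrow> ('k, 'a, 'b) tens" where
  "tens R A B i x j y = pres_gen R (tens_pairs A B (i + j)) (tens_rels R A B (i + j)) ((i, x), (j, y))"

text \<open>\<open>\<phi> \<otimes> \<psi>\<close> for \<open>\<phi>\<close>, \<open>\<psi>\<close> of degrees \<open>p\<close>, \<open>q\<close>, with values in \<open>A' \<otimes> B'\<close>.\<close>

definition tens_map ::
  "'k ring \<Rightarrow> ('k, 'c) gmod \<Rightarrow> ('k, 'd) gmod \<Rightarrow> int \<Rightarrow> (int \<Rightarrow> 'a \<Rightarrow> 'c) \<Rightarrow> int \<Rightarrow> (int \<Rightarrow> 'b \<Rightarrow> 'd) \<Rightarrow>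
   int \<Rightarrow> ('k, 'a, 'b) tens \<Rightarrow> ('k, 'c, 'd) tens" where
  "tens_map R A' B' p \<phi> q \<psi> d = pres_lift R (tensor R A' B' (d + p + q))
     (\<lambda>((i, x), (j, y)). ksign R (q * i) \<odot>\<^bsub>tensor R A' B' (d + p + q)\<^esub>
        tens R A' B' (i + p) (\<phi> i x) (j + q) (\<psi> j y))"

text \<open>
  The summands for \<open>j = 0\<close> and \<open>j = n\<close> are \<open>1 \<otimes> w\<close> and \<open>w \<otimes> 1\<close>; for the empty word they
  coincide and give the single summand \<open>1 \<otimes> 1\<close>.
\<close>

definition comult :: "'k ring \<Rightarrow> ('k, 'w) gmod \<Rightarrow>
    int \<Rightarrow> ('k, 'w) sym \<Rightarrow> ('k, ('k, 'w) sym, ('k, 'w) sym) tens" where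
  "comult R W d = pres_lift R (tensor R (Sym R W) (Sym R W) d)
     (\<lambda>w. finsum (tensor R (Sym R W) (Sym R W) d)
        (\<lambda>(j, \<sigma>). let u = take j (permute_list \<sigma> w); v = drop j (permute_list \<sigma> w) in
           koszul R w \<sigma> \<odot>\<^bsub>tensor R (Sym R W) (Sym R W) d\<^esub>
             tens R (Sym R W) (Sym R W) (wdeg u) (smon R W u) (wdeg v) (smon R W v))
        (SIGMA j:{..length w}. Sh j (length w)))"

text \<open>The projection of \<open>S(W)\<close> onto \<open>W\<close>.\<close>

definition proj1 :: "'k ring \<Rightarrow> ('k, 'w) gmod \<Rightarrow> int \<Rightarrow> ('k, 'w) sym \<Rightarrow> 'w" where
  "proj1 R W d = pres_lift R (W d) (\<lambda>w. if length w = 1 then snd (hd w) else \<zero>\<^bsub>W d\<^esub>)"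

text \<open>
  The components of a map \<open>D : S(W) \<rightarrow> S(V)\<close> of degree \<open>j\<close>, all at once: on a word of length \<open>n\<close>
  this is the value of the \<open>n\<close>-th component.
\<close>

definition component :: "'k ring \<Rightarrow> ('k, 'w) gmod \<Rightarrow> ('k, 'v) gmod \<Rightarrow> int \<Rightarrow>
    (int \<Rightarrow> ('k, 'w) sym \<Rightarrow> ('k, 'v) sym) \<Rightarrow> 'w word \<Rightarrow> 'v" where
  "component R W V j D w = proj1 R V (wdeg w + j) (D (wdeg w) (smon R W w))"


section \<open>Formal supermanifolds and formal DG manifolds\<close>

definition smf_morphisms :: "'k ring \<Rightarrow> ('k, 'w) gmod \<Rightarrow> ('k, 'v) gmod \<Rightarrow>
    (int \<Rightarrow> ('k, 'w) sym \<Rightarrow> ('k, 'v) sym) set" where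
  "smf_morphisms R W V = {F \<in> graded_maps R (Sym R W) (Sym R V) 0.
     F 0 (smon R W []) = smon R V [] \<and>
     (\<forall>d. \<forall>x\<in>carrier (Sym R W d).
        comult R V d (F d x) = tens_map R (Sym R V) (Sym R V) 0 F 0 F d (comult R W d x))}"

text \<open>The morphism whose only component is the degree 0 linear map \<open>\<phi>\<close>.\<close>

definition strict_morphism :: "'k ring \<Rightarrow> ('k, 'w) gmod \<Rightarrow> ('k, 'v) gmod \<Rightarrow> (int \<Rightarrow> 'w \<Rightarrow> 'v) \<Rightarrow>
    int \<Rightarrow> ('k, 'w) sym \<Rightarrow> ('k, 'v) sym" where
  "strict_morphism R W V \<phi> = (\<lambda>d. \<lambda>x\<in>carrier (Sym R W d).
     pres_lift R (Sym R V d) (\<lambda>w. smon R V (map (\<lambda>(i, y). (i, \<phi> i y)) w)) x)"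

definition coderivations :: "'k ring \<Rightarrow> ('k, 'w) gmod \<Rightarrow> int \<Rightarrow>
    (int \<Rightarrow> ('k, 'w) sym \<Rightarrow> ('k, 'w) sym) set" where
  "coderivations R W j = {D \<in> graded_maps R (Sym R W) (Sym R W) j.
     \<forall>d. \<forall>x\<in>carrier (Sym R W d).
       comult R W (d + j) (D d x) =
         tens_map R (Sym R W) (Sym R W) j D 0 (\<lambda>i y. y) d (comult R W d x)
         \<oplus>\<^bsub>tensor R (Sym R W) (Sym R W) (d + j)\<^esub>
         tens_map R (Sym R W) (Sym R W) 0 (\<lambda>i y. y) j D d (comult R W d x)}"

type_synonym ('k, 'w) vfield = "int \<Rightarrow> ('k, 'w) sym \<Rightarrow> ('k, 'w) sym"

definition Coder :: "'k ring \<Rightarrow> ('k, 'w) gmod \<Rightarrow> ('k, ('k, 'w) vfield) gmod" where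
  "Coder R W = (\<lambda>j.
     \<lparr>carrier = coderivations R W j, monoid.mult = undefined, one = undefined,
      zero = (\<lambda>d. \<lambda>x\<in>carrier (Sym R W d). \<zero>\<^bsub>Sym R W (d + j)\<^esub>),
      add = (\<lambda>s t d. \<lambda>x\<in>carrier (Sym R W d). s d x \<oplus>\<^bsub>Sym R W (d + j)\<^esub> t d x),
      smult = (\<lambda>a s d. \<lambda>x\<in>carrier (Sym R W d). a \<odot>\<^bsub>Sym R W (d + j)\<^esub> s d x)\<rparr>)"

text \<open>The graded commutator of coderivations \<open>s\<close>, \<open>t\<close> of degrees \<open>i\<close>, \<open>j\<close>.\<close>

definition bracket :: "'k ring \<Rightarrow> ('k, 'w) gmod \<Rightarrow> int \<Rightarrow> int \<Rightarrow>
    ('k, 'w) vfield \<Rightarrow> ('k, 'w) vfield \<Rightarrow> ('k, 'w) vfield" where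
  "bracket R W i j s t = (\<lambda>d. \<lambda>x\<in>carrier (Sym R W d).
     s (d + j) (t d x) \<ominus>\<^bsub>Sym R W (d + (i + j))\<^esub>
       (ksign R (i * j) \<odot>\<^bsub>Sym R W (d + (i + j))\<^esub> t (d + i) (s d x)))"

text \<open>
  The vectorfield of degree \<open>j\<close> with components \<open>q\<close>; here \<open>q\<close> gives the values of all components,
  as in \<^const>\<open>component\<close>.
\<close>

definition vfield_of :: "'k ring \<Rightarrow> ('k, 'w) gmod \<Rightarrow> int \<Rightarrow> ('w word \<Rightarrow> 'w) \<Rightarrow> ('k, 'w) vfield" where
  "vfield_of R W j q = (\<lambda>d. \<lambda>x\<in>carrier (Sym R W d). pres_lift R (Sym R W (d + j))
     (\<lambda>w. finsum (Sym R W (d + j))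
        (\<lambda>(l, \<sigma>). let u = take l (permute_list \<sigma> w); v = drop l (permute_list \<sigma> w) in
           koszul R w \<sigma> \<odot>\<^bsub>Sym R W (d + j)\<^esub> smon R W ((wdeg u + j, q u) # v))
        (SIGMA l:{..length w}. Sh l (length w))) x)"

definition dg_structure :: "'k ring \<Rightarrow> ('k, 'w) gmod \<Rightarrow> ('k, 'w) vfield \<Rightarrow> bool" where
  "dg_structure R W Q \<longleftrightarrow> Q \<in> coderivations R W 1 \<and> bracket R W 1 1 Q Q = \<zero>\<^bsub>Coder R W 2\<^esub>"

definition dg_manifold :: "'k ring \<Rightarrow> ('k, 'w) gmod \<Rightarrow> ('k, 'w) vfield \<Rightarrow> bool" where
  "dg_manifold R W Q \<longleftrightarrow> graded_module R W \<and> dg_structure R W Q"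

text \<open>The objects of \<open>DG-Manf\<^sup>L\<close>.\<close>

definition dg_manifold_L :: "'k ring \<Rightarrow> ('k, 'w) gmod \<Rightarrow> ('k, 'w) vfield \<Rightarrow> bool" where
  "dg_manifold_L R W Q \<longleftrightarrow> dg_manifold R W Q \<and> component R W W 1 Q [] = \<zero>\<^bsub>W 1\<^esub>"

definition dg_morphisms :: "'k ring \<Rightarrow> ('k, 'w) gmod \<Rightarrow> ('k, 'w) vfield \<Rightarrow>
    ('k, 'v) gmod \<Rightarrow> ('k, 'v) vfield \<Rightarrow> (int \<Rightarrow> ('k, 'w) sym \<Rightarrow> ('k, 'v) sym) set" where
  "dg_morphisms R W Q V P = {F \<in> smf_morphisms R W V.
     \<forall>d. \<forall>x\<in>carrier (Sym R W d). F (d + 1) (Q d x) = P d (F d x)}"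

text \<open>
  The square
  \<open>X \<rightarrow> X'\<close> (top, \<open>F\<close>), \<open>B \<rightarrow> B'\<close> (bottom, \<open>f\<close>), \<open>p : X \<rightarrow> B\<close>, \<open>p' : X' \<rightarrow> B'\<close>
  is a pullback in the category of formal DG manifolds. A definition in HOL cannot quantify over
  types, so the type \<open>'t\<close> of the elements of the test objects is a parameter; it is arbitrary.
\<close>

definition cartesian :: "'t itself \<Rightarrow> 'k ring \<Rightarrow>
    ('k, 'x) gmod \<Rightarrow> ('k, 'x) vfield \<Rightarrow> ('k, 'y) gmod \<Rightarrow> ('k, 'y) vfield \<Rightarrow>
    ('k, 'b) gmod \<Rightarrow> ('k, 'b) vfield \<Rightarrow>
    (int \<Rightarrow> ('k, 'x) sym \<Rightarrow> ('k, 'y) sym) \<Rightarrow> (int \<Rightarrow> ('k, 'b) sym \<Rightarrow> ('k, 'c) sym) \<Rightarrow>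
    (int \<Rightarrow> ('k, 'x) sym \<Rightarrow> ('k, 'b) sym) \<Rightarrow> (int \<Rightarrow> ('k, 'y) sym \<Rightarrow> ('k, 'c) sym) \<Rightarrow> bool" where
  "cartesian (_ :: 't itself) R X QX X' QX' B QB F f p p' \<longleftrightarrow>
     gcomp (Sym R X) p' F = gcomp (Sym R X) f p \<and>
     (\<forall>(T :: ('k, 't) gmod) QT. dg_manifold R T QT \<longrightarrow>
       (\<forall>g \<in> dg_morphisms R T QT B QB. \<forall>h \<in> dg_morphisms R T QT X' QX'.
          gcomp (Sym R T) f g = gcomp (Sym R T) p' h \<longrightarrow>
          (\<exists>!k. k \<in> dg_morphisms R T QT X QX \<and>
             gcomp (Sym R T) p k = g \<and> gcomp (Sym R T) F k = h)))"


section \<open>Deformations\<close>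

text \<open>The underlying graded module of \<open>B \<times> M\<close> is \<^term>\<open>dsum B M\<close>.\<close>

definition prB :: "'k ring \<Rightarrow> ('k, 'b) gmod \<Rightarrow> ('k, 'm) gmod \<Rightarrow>
    int \<Rightarrow> ('k, 'b \<times> 'm) sym \<Rightarrow> ('k, 'b) sym" where
  "prB R B M = strict_morphism R (dsum B M) B (\<lambda>i. fst)"

definition prM :: "'k ring \<Rightarrow> ('k, 'b) gmod \<Rightarrow> ('k, 'm) gmod \<Rightarrow>
    int \<Rightarrow> ('k, 'b \<times> 'm) sym \<Rightarrow> ('k, 'm) sym" where
  "prM R B M = strict_morphism R (dsum B M) M (\<lambda>i. snd)"

definition inM :: "'k ring \<Rightarrow> ('k, 'b) gmod \<Rightarrow> ('k, 'm) gmod \<Rightarrow>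
    int \<Rightarrow> ('k, 'm) sym \<Rightarrow> ('k, 'b \<times> 'm) sym" where
  "inM R B M = strict_morphism R M (dsum B M) (\<lambda>i m. (\<zero>\<^bsub>B i\<^esub>, m))"

text \<open>
  Vectorfields on the factors, viewed on \<open>B \<times> M\<close>. By multilinearity, a component that vanishes as
  soon as one factor lies in the other summand only depends on the projections of its arguments.
\<close>

definition vfB :: "'k ring \<Rightarrow> ('k, 'b) gmod \<Rightarrow> ('k, 'm) gmod \<Rightarrow>
    ('k, 'b) vfield \<Rightarrow> ('k, 'b \<times> 'm) vfield" where
  "vfB R B M Q = vfield_of R (dsum B M) 1
     (\<lambda>w. (component R B B 1 Q (map (\<lambda>(i, x). (i, fst x)) w), \<zero>\<^bsub>M (wdeg w + 1)\<^esub>))"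

definition vfM :: "'k ring \<Rightarrow> ('k, 'b) gmod \<Rightarrow> ('k, 'm) gmod \<Rightarrow>
    ('k, 'm) vfield \<Rightarrow> ('k, 'b \<times> 'm) vfield" where
  "vfM R B M Q = vfield_of R (dsum B M) 1
     (\<lambda>w. (\<zero>\<^bsub>B (wdeg w + 1)\<^esub>, component R M M 1 Q (map (\<lambda>(i, x). (i, snd x)) w)))"

text \<open>The total vectorfield \<open>Q\<^sup>M + Q\<^sup>B + Q\<close> on \<open>B \<times> M\<close>.\<close>

definition total_vf :: "'k ring \<Rightarrow> ('k, 'm) gmod \<Rightarrow> ('k, 'm) vfield \<Rightarrow>
    ('k, 'b) gmod \<Rightarrow> ('k, 'b) vfield \<Rightarrow> ('k, 'b \<times> 'm) vfield \<Rightarrow> ('k, 'b \<times> 'm) vfield" where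
  "total_vf R M QM B QB Q =
     vfM R B M QM \<oplus>\<^bsub>Coder R (dsum B M) 1\<^esub> vfB R B M QB \<oplus>\<^bsub>Coder R (dsum B M) 1\<^esub> Q"

definition deformation :: "'k ring \<Rightarrow> ('k, 'm) gmod \<Rightarrow> ('k, 'm) vfield \<Rightarrow>
    ('k, 'b) gmod \<Rightarrow> ('k, 'b) vfield \<Rightarrow> ('k, 'b \<times> 'm) vfield \<Rightarrow> bool" where
  "deformation R M QM B QB Q \<longleftrightarrow>
     dg_manifold_L R B QB \<and>
     Q \<in> coderivations R (dsum B M) 1 \<and>
     component R (dsum B M) (dsum B M) 1 Q [] = \<zero>\<^bsub>dsum B M 1\<^esub> \<and>
     (\<forall>d. \<forall>x\<in>carrier (Sym R M d). Q d (inM R B M d x) = \<zero>\<^bsub>Sym R (dsum B M) (d + 1)\<^esub>) \<and>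
     dg_structure R (dsum B M) (total_vf R M QM B QB Q) \<and>
     prB R B M \<in> dg_morphisms R (dsum B M) (total_vf R M QM B QB Q) B QB"

definition deformation_morphism :: "'t itself \<Rightarrow> 'k ring \<Rightarrow> ('k, 'm) gmod \<Rightarrow> ('k, 'm) vfield \<Rightarrow>
    ('k, 'b) gmod \<Rightarrow> ('k, 'b) vfield \<Rightarrow> ('k, 'b \<times> 'm) vfield \<Rightarrow>
    ('k, 'c) gmod \<Rightarrow> ('k, 'c) vfield \<Rightarrow> ('k, 'c \<times> 'm) vfield \<Rightarrow>
    (int \<Rightarrow> ('k, 'b \<times> 'm) sym \<Rightarrow> ('k, 'c \<times> 'm) sym) \<Rightarrow>
    (int \<Rightarrow> ('k, 'b) sym \<Rightarrow> ('k, 'c) sym) \<Rightarrow> bool" where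
  "deformation_morphism t R M QM B QB Q B' QB' Q' F f \<longleftrightarrow>
     F \<in> dg_morphisms R (dsum B M) (total_vf R M QM B QB Q) (dsum B' M) (total_vf R M QM B' QB' Q') \<and>
     f \<in> dg_morphisms R B QB B' QB' \<and>
     cartesian t R (dsum B M) (total_vf R M QM B QB Q) (dsum B' M) (total_vf R M QM B' QB' Q')
       B QB F f (prB R B M) (prB R B' M) \<and>
     gcomp (Sym R M) F (inM R B M) = inM R B' M"


section \<open>The universal deformation\<close>

text \<open>
  \<open>U = L[1]\<close> for \<open>L = Coder(S(M), S(M))\<close>. As \<open>U\<^sup>i\<close> and \<open>L\<^bsup>i+1\<^esup>\<close> are the same module, the maps
  \<open>\<down>\<close> and \<open>\<up>\<close> are the identity on elements and only change the degree.
\<close>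

definition Umod :: "'k ring \<Rightarrow> ('k, 'm) gmod \<Rightarrow> ('k, ('k, 'm) vfield) gmod" where
  "Umod R M = shift (Coder R M)"

text \<open>The differential \<open>d(s) = (-1)\<^sup>s [s, Q\<^sup>M]\<close> of \<open>L\<close> on elements of degree \<open>i\<close>.\<close>

definition Ldiff :: "'k ring \<Rightarrow> ('k, 'm) gmod \<Rightarrow> ('k, 'm) vfield \<Rightarrow> int \<Rightarrow>
    ('k, 'm) vfield \<Rightarrow> ('k, 'm) vfield" where
  "Ldiff R M QM i s = ksign R i \<odot>\<^bsub>Coder R M (i + 1)\<^esub> bracket R M i 1 s QM"

text \<open>
  An element of \<open>U\<close> of degree \<open>i\<close> has degree \<open>i + 1\<close> in \<open>L\<close>. The Koszul rule gives
  \<open>(\<up> \<otimes> \<up>)(u \<otimes> v) = (-1)\<^bsup>|u|\<^esup> \<up>u \<otimes> \<up>v\<close> in the second clause.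
\<close>

definition QU_comp :: "'k ring \<Rightarrow> ('k, 'm) gmod \<Rightarrow> ('k, 'm) vfield \<Rightarrow>
    ('k, 'm) vfield word \<Rightarrow> ('k, 'm) vfield" where
  "QU_comp R M QM w = (case w of
     [(i, u)] \<Rightarrow> Ldiff R M QM (i + 1) u
   | [(i, u), (j, v)] \<Rightarrow>
       \<ominus>\<^bsub>Umod R M (i + j + 1)\<^esub> (ksign R i \<odot>\<^bsub>Umod R M (i + j + 1)\<^esub> bracket R M (i + 1) (j + 1) u v)
   | _ \<Rightarrow> \<zero>\<^bsub>Umod R M (wdeg w + 1)\<^esub>)"

definition QU :: "'k ring \<Rightarrow> ('k, 'm) gmod \<Rightarrow> ('k, 'm) vfield \<Rightarrow> ('k, ('k, 'm) vfield) vfield" where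
  "QU R M QM = vfield_of R (Umod R M) 1 (QU_comp R M QM)"

text \<open>
  The canonical vectorfield on \<open>U \<times> M\<close>: the \<open>p\<close>-th summand is obtained by moving the \<open>U\<close>-part of
  the \<open>p\<close>-th factor to the front and taking the \<open>M\<close>-parts of all other factors.
\<close>

definition Qcan_comp :: "'k ring \<Rightarrow> ('k, 'm) gmod \<Rightarrow>
    (('k, 'm) vfield \<times> 'm) word \<Rightarrow> ('k, 'm) vfield \<times> 'm" where
  "Qcan_comp R M w = (\<zero>\<^bsub>Umod R M (wdeg w + 1)\<^esub>,
     finsum (M (wdeg w + 1))
       (\<lambda>p. ksign R (fst (w ! p) * wdeg (take p w)) \<odot>\<^bsub>M (wdeg w + 1)\<^esub>
          component R M M (fst (w ! p) + 1) (fst (snd (w ! p)))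
            (map (\<lambda>(i, x). (i, snd x)) (take p w @ drop (Suc p) w)))
       {..<length w})"

definition Qcan :: "'k ring \<Rightarrow> ('k, 'm) gmod \<Rightarrow> ('k, ('k, 'm) vfield \<times> 'm) vfield" where
  "Qcan R M = vfield_of R (dsum (Umod R M) M) 1 (Qcan_comp R M)"

text \<open>
  The formula relating a deformation \<open>Q'\<close> with base \<open>B\<close> and a morphism \<open>f : B \<rightarrow> U\<close>:
  \<open>(\<up>f\<^sub>n(b\<^sub>1 \<dots> b\<^sub>n))\<^sub>k(m\<^sub>1, \<dots>, m\<^sub>k) = Q'\<^bsub>n+k\<^esub>(b\<^sub>1, \<dots>, b\<^sub>n, m\<^sub>1, \<dots>, m\<^sub>k)\<close> for \<open>n \<ge> 1\<close> and \<open>k \<ge> 0\<close>,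
  where the values of \<open>Q'\<close>, which lie in \<open>{0} \<times> M\<close>, are read in \<open>M\<close>.
\<close>

definition classifies :: "'k ring \<Rightarrow> ('k, 'm) gmod \<Rightarrow> ('k, 'b) gmod \<Rightarrow> ('k, 'b \<times> 'm) vfield \<Rightarrow>
    (int \<Rightarrow> ('k, 'b) sym \<Rightarrow> ('k, ('k, 'm) vfield) sym) \<Rightarrow> bool" where
  "classifies R M B Q' f \<longleftrightarrow> (\<forall>bs \<in> words B. \<forall>ms \<in> words M. bs \<noteq> [] \<longrightarrow>
     component R M M (wdeg bs + 1) (component R B (Umod R M) 0 f bs) ms =
     snd (component R (dsum B M) (dsum B M) 1 Q'
       (map (\<lambda>(i, b). (i, (b, \<zero>\<^bsub>M i\<^esub>))) bs @ map (\<lambda>(i, m). (i, (\<zero>\<^bsub>B i\<^esub>, m))) ms)))"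

end

theory Submission
 imports Defs
begin

text \<open>
 In characteristic zero a primitive element of \<open>S(V)\<close> without linear part vanishes: multiplication after
 comultiplication is \<open>2\<^sup>n\<close> on words of length \<open>n\<close>. Hence coalgebra morphisms and coderivations are
 determined by their components, and equations between them can be checked after projecting to \<open>V\<close>.

 The components of a vectorfield \<open>Q'\<close> on \<open>B \<times> M\<close> with values in \<open>M\<close> form a family \<open>\<phi>\<close> of coderivations
 of \<open>S(M)\<close>, indexed by the words in \<open>B\<close>; with \<open>Q\<^sup>M\<close> at the empty word it describes the total vectorfield.
 Evaluated on words \<open>b\<^sub>1 \<dots> b\<^sub>n m\<^sub>1 \<dots> m\<^sub>k\<close>, the \<open>M\<close>-part of the square of the total vectorfield is the failure
 of the coalgebra morphism \<open>B \<rightarrow> U\<close> with components \<open>\<phi>\<close> to commute with \<open>Q\<^sup>B\<close> and \<open>Q\<^sup>U\<close>. So deformations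
 correspond to morphisms. For \<open>B = U\<close> the canonical family belongs to the identity, whence the \<open>M\<close>-part
 of the square vanishes, and \<open>(Q\<^sup>U)\<^sup>2 = 0\<close> follows because this family is faithful.

 A morphism \<open>F\<close> over \<open>f\<close> that respects the projections to \<open>M\<close> is the pair of \<open>f\<close> after \<open>B \<times> M \<rightarrow> B\<close> and the
 projection to \<open>M\<close>; it commutes with the vectorfields exactly if the components of \<open>f\<close> are \<open>\<phi>\<close>.
\<close>

text \<open>Elements of S(W) and of tensor products are cosets of formal combinations, so a map out
  of them is given on words and shown to respect the relations (\<open>symfun\<close>); equations
  are checked on monomials. The definitions sum over shuffles, which resist induction. They are
  replaced by \<open>ssum\<close>, a recursion that sends each letter to the left or the right part;
  coassociativity, cocommutativity and multiplicativity become inductions on the word. The delicate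
  existence statement is that prescribed components give a coalgebra morphism: \<open>expF\<close>
  singles out the factor containing the first letter, which makes components and comultiplication
  accessible but hides the symmetry. Uniqueness of f is asserted for F compatible with the
  projections to M. This fixes a gauge: an automorphism of B x M over B that is the identity on M
  carries Q' to another deformation, whose classifying morphism is then also covered by a morphism
  from Q'. Degrees are indices and not part of the elements, hence the many hypotheses such as
  \<open>e = d + j\<close>.\<close>

abbreviation gplus ("(_ \<oplus>[_]/ _)" [65, 0, 66] 65) where "x \<oplus>[P] y == x \<oplus>\<^bsub>P\<^esub> y"
abbreviation gsmult ("(_ \<odot>[_]/ _)" [70, 0, 71] 70) where "a \<odot>[P] x == a \<odot>\<^bsub>P\<^esub> x"
abbreviation gminus ("(_ \<ominus>[_]/ _)" [65, 0, 66] 65) where "x \<ominus>[P] y == x \<ominus>\<^bsub>P\<^esub> y"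
abbreviation gneg ("(\<ominus>[_]/ _)" [0, 81] 80) where "\<ominus>[P] x == \<ominus>\<^bsub>P\<^esub> x"
abbreviation gzero ("\<zero>[_]") where "\<zero>[P] == \<zero>\<^bsub>P\<^esub>"

text \<open>Unlike \<open>lin_maps\<close> this asks for no extensionality, so lambda terms built
  from linear maps qualify directly.\<close>

definition mlin :: "'k ring => ('k, 'a) module => ('k, 'b) module => ('a => 'b) => bool" where
 "mlin R A B h \<longleftrightarrow> (\<forall>x\<in>carrier A. h x \<in> carrier B) \<and>
   (\<forall>x\<in>carrier A. \<forall>y\<in>carrier A. h (x \<oplus>[A] y) = h x \<oplus>[B] h y) \<and>
   (\<forall>a\<in>carrier R. \<forall>x\<in>carrier A. h (a \<odot>[A] x) = a \<odot>[B] h x)"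

lemma lin_maps_iff: "h \<in> lin_maps R A B \<longleftrightarrow> h \<in> extensional (carrier A) \<and> mlin R A B h"
 by (auto simp: lin_maps_def mlin_def PiE_def)

text \<open>The sum inside \<open>pres_lift\<close>, taken on coefficient functions instead of
  chosen members of cosets. That \<open>pres_lift\<close> is well defined reduces to the linearity
  of this map.\<close>

definition free_ext :: "'k ring => ('k, 'p) module => ('x => 'p) => ('x => 'k) => 'p" where
 "free_ext R P \<phi> c = finsum P (%x. c x \<odot>[P] \<phi> x) {x. c x \<noteq> \<zero>[R]}"

locale ground =
 fixes R :: "'k ring" (structure)
 assumes ground_ring: "ground_ring R"
begin

abbreviation (input) "Sy == Sym R"
abbreviation (input) "sm == smon R"
abbreviation (input) "ks == ksign R"
abbreviation (input) "cpt == component R"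
abbreviation (input) "pr == proj1 R"
abbreviation (input) "coder == coderivations R"
abbreviation (input) "lin == mlin R"
abbreviation (input) "cmu == comult R"
abbreviation (input) "fr == free_mod R"
abbreviation (input) "gr == graded_module R"
abbreviation (input) "smf == smf_morphisms R"
abbreviation (input) "bv == basis_vec R"
abbreviation (input) "ten == %W. tens R (Sym R W) (Sym R W)"
abbreviation (input) "tmap == %W. tens_map R (Sym R W) (Sym R W)"

sublocale cring R
 using ground_ring by (simp add: ground_ring_def)

lemma nat_unit: "(n::nat) > 0 ==> [n] \<cdot> \<one> \<in> Units R"
 using ground_ring by (simp add: ground_ring_def)

subsection \<open>Modules and linear maps\<close>

context
 fixes P :: "('k, 'p) module"
 assumes P: "module R P"
begin

interpretation module R P by (fact P)

text \<open>The library facts are restated with \<open>module R P\<close> as hypothesis, since the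
  modules below vary with a degree and cannot be interpreted as locales once and for all.\<close>

lemma m_add [simp]: "[|x \<in> carrier P; y \<in> carrier P|] ==> x \<oplus>[P] y \<in> carrier P"
 by simp

lemma m_zero [simp]: "\<zero>[P] \<in> carrier P"
 by simp

lemma m_neg [simp]: "x \<in> carrier P ==> \<ominus>[P] x \<in> carrier P"
 by simp

lemma m_minus [simp]: "[|x \<in> carrier P; y \<in> carrier P|] ==> x \<ominus>[P] y \<in> carrier P"
 by simp

lemma m_smult [simp]: "[|a \<in> carrier R; x \<in> carrier P|] ==> a \<odot>[P] x \<in> carrier P"
 by simp

lemma m_zero_l [simp]: "x \<in> carrier P ==> \<zero>[P] \<oplus>[P] x = x"
 by simp

lemma m_zero_r [simp]: "x \<in> carrier P ==> x \<oplus>[P] \<zero>[P] = x"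
 by simp

lemma madd_assoc: "[|x \<in> carrier P; y \<in> carrier P; z \<in> carrier P|] ==> (x \<oplus>[P] y) \<oplus>[P] z = x \<oplus>[P] (y \<oplus>[P] z)"
 by (rule M.a_assoc)

lemma madd_comm: "[|x \<in> carrier P; y \<in> carrier P|] ==> x \<oplus>[P] y = y \<oplus>[P] x"
 by (rule M.a_comm)

lemma madd_lcomm: "[|x \<in> carrier P; y \<in> carrier P; z \<in> carrier P|] ==> x \<oplus>[P] (y \<oplus>[P] z) = y \<oplus>[P] (x \<oplus>[P] z)"
 by (rule M.a_lcomm)

lemma m_smult_add: "[|a \<in> carrier R; x \<in> carrier P; y \<in> carrier P|] ==> a \<odot>[P] (x \<oplus>[P] y) = a \<odot>[P] x \<oplus>[P] a \<odot>[P] y"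
 by (rule smult_r_distr)

lemma m_smult_addl: "[|a \<in> carrier R; b \<in> carrier R; x \<in> carrier P|] ==> (a \<oplus> b) \<odot>[P] x = a \<odot>[P] x \<oplus>[P] b \<odot>[P] x"
 by (rule smult_l_distr)

lemma m_smult_smult: "[|a \<in> carrier R; b \<in> carrier R; x \<in> carrier P|] ==> a \<odot>[P] (b \<odot>[P] x) = (a \<otimes> b) \<odot>[P] x"
 by (rule smult_assoc1[symmetric])

lemma m_smult_one [simp]: "x \<in> carrier P ==> \<one> \<odot>[P] x = x"
 by (rule smult_one)

lemma m_smult_zero [simp]: "a \<in> carrier R ==> a \<odot>[P] \<zero>[P] = \<zero>[P]"
 by (rule smult_r_null)

lemma m_zero_smult [simp]: "x \<in> carrier P ==> \<zero> \<odot>[P] x = \<zero>[P]"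
 by (rule smult_l_null)

lemma m_neg_smult: "[|a \<in> carrier R; x \<in> carrier P|] ==> (\<ominus> a) \<odot>[P] x = \<ominus>[P] (a \<odot>[P] x)"
 by (rule smult_l_minus)

lemma m_smult_neg: "[|a \<in> carrier R; x \<in> carrier P|] ==> a \<odot>[P] (\<ominus>[P] x) = \<ominus>[P] (a \<odot>[P] x)"
 by (rule smult_r_minus)

lemma m_neg_neg [simp]: "x \<in> carrier P ==> \<ominus>[P] (\<ominus>[P] x) = x"
 by simp

lemma m_neg_add: "[|x \<in> carrier P; y \<in> carrier P|] ==> \<ominus>[P] (x \<oplus>[P] y) = \<ominus>[P] x \<oplus>[P] \<ominus>[P] y"
 by (rule M.minus_add)

lemma m_r_neg [simp]: "x \<in> carrier P ==> x \<oplus>[P] \<ominus>[P] x = \<zero>[P]"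
 by (rule M.r_neg)

lemma m_l_neg [simp]: "x \<in> carrier P ==> \<ominus>[P] x \<oplus>[P] x = \<zero>[P]"
 by (rule M.l_neg)

lemma m_neg_zero [simp]: "\<ominus>[P] \<zero>[P] = \<zero>[P]"
 by simp

lemma m_minus_eq: "x \<ominus>[P] y = x \<oplus>[P] \<ominus>[P] y"
 by (rule a_minus_def)

lemma m_minus_zero_iff: "[|x \<in> carrier P; y \<in> carrier P|] ==> x \<ominus>[P] y = \<zero>[P] \<longleftrightarrow> x = y"
 by (metis M.add.inv_solve_right' M.l_zero M.minus_minus M.zero_closed a_minus_def M.a_inv_closed M.minus_equality M.r_neg)

lemma m_add_cancel: "[|x \<in> carrier P; y \<in> carrier P; z \<in> carrier P|] ==> x \<oplus>[P] y = x \<oplus>[P] z \<longleftrightarrow> y = z"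
 by simp

text \<open>Characteristic zero enters through this cancellation: it is applied to positive
  integers, which are units of the ground ring.\<close>

lemma m_unit_cancel:
 assumes "a \<in> Units R" "x \<in> carrier P" "a \<odot>[P] x = \<zero>[P]"
 shows "x = \<zero>[P]"
proof -
 have "x = inv a \<odot>[P] (a \<odot>[P] x)"
  using assms(1,2) by (simp add: smult_assoc1[symmetric] Units_closed)
 then show ?thesis
  using assms by simp
qed

lemma m_finsum [simp]: "(!!i. i \<in> I ==> f i \<in> carrier P) ==> finsum P f I \<in> carrier P"
 by (rule M.finsum_closed) auto

lemma m_finsum_cong: "[|I = J; !!i. i \<in> J ==> f i = g i; !!i. i \<in> J ==> g i \<in> carrier P|] ==> finsum P f I = finsum P g J"
 by (rule M.finsum_cong') auto

lemma m_finsum_superset: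
 assumes "finite J" "I \<subseteq> J" "!!i. i \<in> J - I ==> f i = \<zero>[P]" "!!i. i \<in> J ==> f i \<in> carrier P"
 shows "finsum P f I = finsum P f J"
 using assms by (intro M.add.finprod_mono_neutral_cong_left) auto

lemma m_finsum_add:
 assumes "!!i. i \<in> I ==> f i \<in> carrier P" "!!i. i \<in> I ==> g i \<in> carrier P"
 shows "finsum P (%i. f i \<oplus>[P] g i) I = finsum P f I \<oplus>[P] finsum P g I"
 using assms by (intro M.finsum_addf) auto

lemma m_finsum_insert:
 assumes "finite I" "i \<notin> I" "!!j. j \<in> insert i I ==> f j \<in> carrier P"
 shows "finsum P f (insert i I) = f i \<oplus>[P] finsum P f I"
 using assms by (intro M.finsum_insert) auto

lemma m_finsum_empty [simp]: "finsum P f {} = \<zero>[P]"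
 by simp

lemma m_finsum_Un:
 assumes "finite I" "finite J" "I \<inter> J = {}" "!!i. i \<in> I \<union> J ==> f i \<in> carrier P"
 shows "finsum P f (I \<union> J) = finsum P f I \<oplus>[P] finsum P f J"
 using assms by (intro M.finsum_Un_disjoint) auto

lemma m_finsum_reindex:
 assumes "inj_on h I" "!!i. i \<in> I ==> f (h i) \<in> carrier P"
 shows "finsum P f (h ` I) = finsum P (%i. f (h i)) I"
 using assms by (intro M.finsum_reindex) auto

lemma m_finsum_zero: "(!!i. i \<in> I ==> f i = \<zero>[P]) ==> finsum P f I = \<zero>[P]"
 using m_finsum_cong[of I I f "%_. \<zero>[P]"] by (simp add: M.finsum_zero)

end

lemmas madd_ac = madd_assoc madd_comm madd_lcomm

lemma mlin_closed: "lin A B h ==> x \<in> carrier A ==> h x \<in> carrier B"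
 and mlin_add: "lin A B h ==> x \<in> carrier A ==> y \<in> carrier A ==> h (x \<oplus>[A] y) = h x \<oplus>[B] h y"
 and mlin_smult: "lin A B h ==> a \<in> carrier R ==> x \<in> carrier A ==> h (a \<odot>[A] x) = a \<odot>[B] h x"
 by (auto simp: mlin_def)

lemma mlinI:
 assumes "!!x. x \<in> carrier A ==> h x \<in> carrier B"
  and "!!x y. [|x \<in> carrier A; y \<in> carrier A|] ==> h (x \<oplus>[A] y) = h x \<oplus>[B] h y"
  and "!!a x. [|a \<in> carrier R; x \<in> carrier A|] ==> h (a \<odot>[A] x) = a \<odot>[B] h x"
 shows "lin A B h"
 using assms by (auto simp: mlin_def)

lemma mlin_zero:
 assumes "module R A" "module R B" "lin A B h"
 shows "h \<zero>[A] = \<zero>[B]"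
proof -
 have "h (\<zero> \<odot>[A] \<zero>[A]) = \<zero> \<odot>[B] h \<zero>[A]"
  using assms by (intro mlin_smult[OF assms(3)]) auto
 then show ?thesis
  using assms by (simp add: mlin_closed[OF assms(3)])
qed

lemma neg_eq_smult: "module R P ==> x \<in> carrier P ==> \<ominus>[P] x = (\<ominus> \<one>) \<odot>[P] x"
 for P :: "('k, 'p) module"
 by (subst m_neg_smult) auto

lemma mlin_neg:
 assumes "module R A" "module R B" "lin A B h" "x \<in> carrier A"
 shows "h (\<ominus>[A] x) = \<ominus>[B] h x"
 using assms by (simp add: neg_eq_smult mlin_smult mlin_closed)

lemma mlin_minus:
 assumes "module R A" "module R B" "lin A B h" "x \<in> carrier A" "y \<in> carrier A"
 shows "h (x \<ominus>[A] y) = h x \<ominus>[B] h y"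
 using assms by (simp add: m_minus_eq mlin_neg mlin_add)

lemma mlin_comp: "lin A B h ==> lin B C k ==> lin A C (%x. k (h x))"
 by (auto simp: mlin_def)

lemma mlin_id: "lin A A (%x. x)"
 by (auto simp: mlin_def)

lemma mlin_plus:
 assumes "module R B" "lin A B h" "lin A B k"
 shows "lin A B (%x. h x \<oplus>[B] k x)"
 using assms by (intro mlinI) (auto simp: mlin_add mlin_smult mlin_closed m_smult_add madd_ac)

lemma mlin_scale:
 assumes "module R B" "lin A B h" "c \<in> carrier R"
 shows "lin A B (%x. c \<odot>[B] h x)"
 using assms by (intro mlinI) (auto simp: mlin_add mlin_smult mlin_closed m_smult_add m_smult_smult m_comm)

lemma mlin_zero_map: "module R B ==> lin A B (%x. \<zero>[B])"
 by (intro mlinI) auto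

lemma mlin_const_smult: "module R B ==> c \<in> carrier R ==> lin B B (%x. c \<odot>[B] x)"
 by (rule mlin_scale[OF _ mlin_id])

lemma mlin_cong:
 assumes "lin A B h" "module R A" "!!x. x \<in> carrier A ==> k x = h x"
 shows "lin A B k"
 using assms by (auto simp: mlin_def)

lemma mlin_finsum:
 assumes "module R A" "module R B" "lin A B h" "finite I" "!!i. i \<in> I ==> f i \<in> carrier A"
 shows "h (finsum A f I) = finsum B (%i. h (f i)) I"
 using assms(4,5)
proof (induction I)
 case empty
 then show ?case using assms by (simp add: mlin_zero)
next
 case (insert i I)
 then show ?case
  using assms(1-3) m_finsum_insert[of A I i f] m_finsum_insert[of B I i "%i. h (f i)"]
  by (auto simp: mlin_add mlin_closed)
qed

subsection \<open>Presented modules\<close>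

lemma free_mod_module: "module R (fr X)"
proof (rule moduleI)
 have fin2: "finite {x. c x \<oplus> c' x \<noteq> \<zero>}"
  if "finite {x. c x \<noteq> \<zero>}" "finite {x. c' x \<noteq> \<zero>}" for c c' :: "'a => 'k"
  using that by (rule_tac finite_subset[of _ "{x. c x \<noteq> \<zero>} \<union> {x. c' x \<noteq> \<zero>}"]) auto
 have fin1: "finite {x. a \<otimes> c x \<noteq> \<zero>}" if "a \<in> carrier R" "finite {x. c x \<noteq> \<zero>}" for a and c :: "'a => 'k"
  using that by (rule_tac finite_subset[of _ "{x. c x \<noteq> \<zero>}"]) auto
 show "cring R" by (rule is_cring)
 show "abelian_group (fr X)"
 proof (rule abelian_groupI)
  fix c assume c: "c \<in> carrier (fr X)"
  have "(%x. \<ominus> c x) \<in> carrier (fr X)"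
   using c by (auto simp: free_mod_def elim: rev_finite_subset)
  then show "\<exists>c'\<in>carrier (fr X). c' \<oplus>[fr X] c = \<zero>[fr X]"
   using c by (rule_tac bexI[of _ "%x. \<ominus> c x"]) (auto simp: free_mod_def fun_eq_iff l_neg)
 qed (auto simp: free_mod_def fin2 a_ac fun_eq_iff)
qed (auto simp: free_mod_def l_distr r_distr m_assoc fun_eq_iff elim!: rev_finite_subset)

lemma basis_vec_closed [simp]: "x \<in> X ==> bv x \<in> carrier (fr X)"
 by (auto simp: free_mod_def basis_vec_def)

lemma free_induct [consumes 1, case_names zero step]:
 assumes "c \<in> carrier (fr X)"
  and "Q \<zero>[fr X]"
  and step: "!!a x c. [|a \<in> carrier R; x \<in> X; c \<in> carrier (fr X); Q c|] ==>
   Q (a \<odot>[fr X] bv x \<oplus>[fr X] c)"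
 shows "Q c"
proof -
 have "finite {x. c x \<noteq> \<zero>}"
  using assms(1) by (simp add: free_mod_def)
 then show ?thesis
  using assms(1)
 proof (induction "{x. c x \<noteq> \<zero>}" arbitrary: c rule: finite_induct)
  case empty
  then have "c = \<zero>[fr X]"
   by (auto simp: free_mod_def)
  then show ?case using assms(2) by simp
 next
  case (insert x I)
  define c' where "c' = c(x := \<zero>)"
  have I: "I = {y. c' y \<noteq> \<zero>}"
   using insert.hyps(2,4) by (auto simp: c'_def)
  have fin: "finite {y. c' y \<noteq> \<zero>}"
   using insert.hyps(1) I by simp
  have x: "x \<in> X"
   using insert.hyps(4) insert.prems by (auto simp: free_mod_def)
  have c': "c' \<in> carrier (fr X)"
   using insert.prems fin by (simp add: free_mod_def) (simp add: c'_def)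
  have c: "c y \<in> carrier R" for y
   using insert.prems by (auto simp: free_mod_def)
  have "c = c x \<odot>[fr X] bv x \<oplus>[fr X] c'"
   using c by (auto simp: free_mod_def c'_def basis_vec_def)
  then show ?case
   using step[OF _ x c' insert.hyps(3)[OF I c'], of "c x"] c by simp
 qed
qed

lemma free_ext_superset:
 assumes "module R P" "c \<in> carrier (fr X)" "\<phi> \<in> X \<rightarrow> carrier P"
  and "finite Y" "{x. c x \<noteq> \<zero>} \<subseteq> Y" "Y \<subseteq> X"
 shows "free_ext R P \<phi> c = finsum P (%x. c x \<odot>[P] \<phi> x) Y"
 unfolding free_ext_def using assms
 by (intro m_finsum_superset) (auto simp: free_mod_def Pi_iff subset_iff)

lemma mlin_free_ext:
 assumes P: "module R P" and \<phi>: "\<phi> \<in> X \<rightarrow> carrier P"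
 shows "lin (fr X) P (free_ext R P \<phi>)"
proof (rule mlinI)
 have supp: "finite {x. c x \<noteq> \<zero>}" "{x. c x \<noteq> \<zero>} \<subseteq> X" "!!x. c x \<in> carrier R"
  if "c \<in> carrier (fr X)" for c
  using that by (auto simp: free_mod_def)
 have \<phi>': "\<phi> x \<in> carrier P" if "x \<in> X" for x
  using \<phi> that by auto
 show "free_ext R P \<phi> c \<in> carrier P" if "c \<in> carrier (fr X)" for c
  unfolding free_ext_def using P \<phi>' supp[OF that] by (intro m_finsum) auto
 show "free_ext R P \<phi> (c \<oplus>[fr X] c') = free_ext R P \<phi> c \<oplus>[P] free_ext R P \<phi> c'"
  if c: "c \<in> carrier (fr X)" and c': "c' \<in> carrier (fr X)" for c c'
 proof -
  have cc': "c \<oplus>[fr X] c' \<in> carrier (fr X)"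
   using c c' by (rule m_add[OF free_mod_module])
  \<comment> \<open>The supports of the two summands and of their sum may differ because
    coefficients can cancel; all three sums are therefore taken over the union.\<close>
  let ?Y = "{x. c x \<noteq> \<zero>} \<union> {x. c' x \<noteq> \<zero>}"
  have Y: "finite ?Y" "?Y \<subseteq> X"
   using supp[OF c] supp[OF c'] by auto
  have "{x. (c \<oplus>[fr X] c') x \<noteq> \<zero>} \<subseteq> ?Y"
   by (auto simp: free_mod_def)
  then have "free_ext R P \<phi> (c \<oplus>[fr X] c') =
    finsum P (%x. (c \<oplus>[fr X] c') x \<odot>[P] \<phi> x) ?Y"
   by (rule free_ext_superset[OF P cc' \<phi> Y(1) _ Y(2)])
  also have "... = finsum P (%x. c x \<odot>[P] \<phi> x \<oplus>[P] c' x \<odot>[P] \<phi> x) ?Y"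
   using Y supp[OF c] supp[OF c'] P \<phi>'
   by (intro m_finsum_cong) (auto simp: free_mod_def m_smult_addl subset_iff)
  also have "... = free_ext R P \<phi> c \<oplus>[P] free_ext R P \<phi> c'"
   using P \<phi>' supp[OF c] supp[OF c'] Y
   by (subst m_finsum_add) (auto simp: free_ext_superset[OF P _ \<phi> Y(1) _ Y(2)] c c' subset_iff)
  finally show ?thesis .
 qed
 show "free_ext R P \<phi> (a \<odot>[fr X] c) = a \<odot>[P] free_ext R P \<phi> c"
  if a: "a \<in> carrier R" and c: "c \<in> carrier (fr X)" for a c
 proof -
  have ac: "a \<odot>[fr X] c \<in> carrier (fr X)"
   using a c by (rule m_smult[OF free_mod_module])
  let ?Y = "{x. c x \<noteq> \<zero>}"
  have s: "{x. (a \<odot>[fr X] c) x \<noteq> \<zero>} \<subseteq> ?Y"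
   using a by (auto simp: free_mod_def)
  have "free_ext R P \<phi> (a \<odot>[fr X] c) = finsum P (%x. a \<odot>[P] (c x \<odot>[P] \<phi> x)) ?Y"
   unfolding free_ext_superset[OF P ac \<phi> supp(1)[OF c] s supp(2)[OF c]]
   using supp[OF c] P \<phi>' a
   by (intro m_finsum_cong) (auto simp: free_mod_def m_smult_smult subset_iff)
  also have "... = a \<odot>[P] free_ext R P \<phi> c"
   unfolding free_ext_def using supp[OF c] P \<phi>' a
   by (intro mlin_finsum[symmetric, OF P P mlin_const_smult]) auto
  finally show ?thesis .
 qed
qed

lemma free_ext_basis:
 assumes "module R P" "\<phi> \<in> X \<rightarrow> carrier P" "x \<in> X"
 shows "free_ext R P \<phi> (bv x) = \<phi> x"
proof -
 have "free_ext R P \<phi> (bv x) = finsum P (%y. bv x y \<odot>[P] \<phi> y) {x}"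
  by (rule free_ext_superset[OF assms(1) basis_vec_closed[OF assms(3)] assms(2)])
   (use assms(3) in \<open>auto simp: basis_vec_def\<close>)
 also have "... = \<phi> x"
  using assms(2,3) by (subst m_finsum_insert[OF assms(1)]) (auto simp: basis_vec_def assms(1) funcset_mem[OF assms(2,3)])
 finally show ?thesis .
qed

definition coset :: "'y set => ('y => 'k) set => ('y => 'k) => ('y => 'k) set" where
 "coset X S c = lin_span R (fr X) S +>\<^bsub>fr X\<^esub> c"

context
 fixes X :: "'x set" and S :: "('x => 'k) set"
 assumes S: "S \<subseteq> carrier (fr X)"
begin

interpretation F: module R "fr X"
 by (rule free_mod_module)

abbreviation (input) "N \<equiv> lin_span R (fr X) S"

lemma lin_span_carrier: "x \<in> N ==> x \<in> carrier (fr X)"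
 by (induction rule: lin_span.induct) (use S in auto)

lemma lin_span_add: "x \<in> N ==> y \<in> N ==> x \<oplus>[fr X] y \<in> N"
proof (induction rule: lin_span.induct)
 case lin_span_zero
 then show ?case by (simp add: lin_span_carrier)
next
 case (lin_span_step a r x)
 then show ?case
  using S by (subst F.M.a_assoc) (auto intro: lin_span_carrier lin_span.lin_span_step)
qed

lemma lin_span_smult: "b \<in> carrier R ==> x \<in> N ==> b \<odot>[fr X] x \<in> N"
proof (rotate_tac, induction rule: lin_span.induct)
 case lin_span_zero
 then show ?case by (simp add: lin_span.lin_span_zero)
next
 case (lin_span_step a r x)
 have "b \<odot>[fr X] (a \<odot>[fr X] r \<oplus>[fr X] x) =
   (b \<otimes> a) \<odot>[fr X] r \<oplus>[fr X] b \<odot>[fr X] x"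
  using lin_span_step S by (subst F.smult_r_distr) (auto simp: F.smult_assoc1 lin_span_carrier)
 then show ?case
  using lin_span_step by (auto intro: lin_span.lin_span_step)
qed

lemma lin_span_subgroup: "abelian_subgroup N (fr X)"
proof (rule abelian_subgroupI3)
 show "additive_subgroup N (fr X)"
 proof (rule additive_subgroupI, rule F.M.add.subgroupI)
  show "N \<subseteq> carrier (fr X)"
   using lin_span_carrier by auto
  show "N \<noteq> {}"
   using lin_span.lin_span_zero by fast
  show "\<ominus>[fr X] x \<in> N" if "x \<in> N" for x
   using lin_span_smult[of "\<ominus> \<one>" x] that lin_span_carrier[OF that] by (simp add: F.smult_l_minus)
 qed (auto intro: lin_span_add)
qed (rule F.abelian_group_axioms)

interpretation N: abelian_subgroup N "fr X"
 by (rule lin_span_subgroup)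

lemma coset_eq_iff:
 assumes "c \<in> carrier (fr X)" "c' \<in> carrier (fr X)"
 shows "coset X S c = coset X S c' \<longleftrightarrow> c \<ominus>[fr X] c' \<in> N"
proof -
 have "coset X S c = coset X S c' \<longleftrightarrow> c \<in> N +>\<^bsub>fr X\<^esub> c'"
  unfolding coset_def using assms
  by (metis N.a_rcos_self N.a_repr_independence')
 also have "... \<longleftrightarrow> c \<ominus>[fr X] c' \<in> N"
  using assms by (simp add: N.a_rcos_module a_minus_def)
 finally show ?thesis .
qed

lemma coset_self: "c \<in> carrier (fr X) ==> c \<in> coset X S c"
 by (simp add: coset_def N.a_rcos_self)

lemma coset_memD: "c' \<in> coset X S c ==> c \<in> carrier (fr X) ==> c' \<in> carrier (fr X) \<and> coset X S c' = coset X S c"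
 unfolding coset_def
 using N.a_elemrcos_carrier N.a_repr_independence' by blast

lemma pres_mod_carrier: "carrier (pres_mod R X S) = coset X S ` carrier (fr X)"
 by (auto simp: pres_mod_def quot_mod_def A_RCOSETS_def' coset_def)

lemma pres_mod_zero: "\<zero>[pres_mod R X S] = coset X S \<zero>[fr X]"
 by (simp add: pres_mod_def quot_mod_def coset_def F.M.a_coset_add_zero subsetI lin_span_carrier)

lemma pres_mod_add:
 assumes "c \<in> carrier (fr X)" "c' \<in> carrier (fr X)"
 shows "coset X S c \<oplus>[pres_mod R X S] coset X S c' = coset X S (c \<oplus>[fr X] c')"
 unfolding coset_def pres_mod_def quot_mod_def
 using N.a_rcos_sum[OF assms] by simp

lemma pres_mod_smult:
 assumes a: "a \<in> carrier R" and c: "c \<in> carrier (fr X)"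
 shows "a \<odot>[pres_mod R X S] coset X S c = coset X S (a \<odot>[fr X] c)"
proof -
 \<comment> \<open>Scalar multiplication in \<open>quot_mod\<close> is a union over all
   representatives; it collapses because all of them give the same coset.\<close>
 have const: "coset X S (a \<odot>[fr X] x) = coset X S (a \<odot>[fr X] c)" if "x \<in> coset X S c" for x
 proof -
  have x: "x \<in> carrier (fr X)" "coset X S x = coset X S c"
   using coset_memD[OF that c] by auto
  then have "x \<ominus>[fr X] c \<in> N"
   using c coset_eq_iff by blast
  then have "a \<odot>[fr X] (x \<ominus>[fr X] c) \<in> N"
   by (rule lin_span_smult[OF a])
  moreover have "a \<odot>[fr X] (x \<ominus>[fr X] c) =
    a \<odot>[fr X] x \<ominus>[fr X] a \<odot>[fr X] c"
   using x a c by (simp add: a_minus_def F.smult_r_distr F.smult_r_minus)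
  ultimately show ?thesis
   using x a c by (simp add: coset_eq_iff)
 qed
 have "coset X S c \<noteq> {}"
  using coset_self[OF c] by blast
 then have eq: "(\<Union>x\<in>coset X S c. coset X S (a \<odot>[fr X] x)) = coset X S (a \<odot>[fr X] c)"
  by (rule SUP_eq_const) (rule const)
 have "a \<odot>[pres_mod R X S] A = (\<Union>x\<in>A. coset X S (a \<odot>[fr X] x))" for A
  by (simp add: pres_mod_def quot_mod_def coset_def)
 then show ?thesis
  by (simp only: eq)
qed

lemma pres_mod_module: "module R (pres_mod R X S)"
proof (rule moduleI)
 show "abelian_group (pres_mod R X S)"
 proof (rule abelian_groupI)
  fix A assume "A \<in> carrier (pres_mod R X S)"
  then obtain c where c: "c \<in> carrier (fr X)" "A = coset X S c"
   by (auto simp: pres_mod_carrier)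
  then have "coset X S (\<ominus>[fr X] c) \<oplus>[pres_mod R X S] A = \<zero>[pres_mod R X S]"
   by (simp add: pres_mod_add pres_mod_zero F.M.l_neg)
  then show "\<exists>B\<in>carrier (pres_mod R X S). B \<oplus>[pres_mod R X S] A = \<zero>[pres_mod R X S]"
   using c by (auto simp: pres_mod_carrier)
 qed (auto simp: pres_mod_carrier pres_mod_zero pres_mod_add F.M.a_ac)
qed (auto simp: pres_mod_carrier pres_mod_add pres_mod_smult is_cring
  F.smult_l_distr F.smult_r_distr F.smult_assoc1)

lemma mlin_coset: "lin (fr X) (pres_mod R X S) (coset X S)"
 by (intro mlinI) (auto simp: pres_mod_carrier pres_mod_add pres_mod_smult)

lemma pres_gen_eq: "pres_gen R X S x = coset X S (bv x)"
 by (simp add: pres_gen_def coset_def)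

lemma pres_gen_closed: "x \<in> X ==> pres_gen R X S x \<in> carrier (pres_mod R X S)"
 by (auto simp: pres_gen_eq pres_mod_carrier)

lemma pres_rel: "r \<in> S ==> coset X S r = \<zero>[pres_mod R X S]"
proof -
 assume r: "r \<in> S"
 then have r': "r \<in> carrier (fr X)"
  using S by auto
 have "\<one> \<odot>[fr X] r \<oplus>[fr X] \<zero>[fr X] \<in> N"
  using r by (intro lin_span.intros) auto
 then show "coset X S r = \<zero>[pres_mod R X S]"
  using r' by (simp add: pres_mod_zero coset_eq_iff a_minus_def)
qed

lemma pres_induct [consumes 1, case_names zero step]:
 assumes "A \<in> carrier (pres_mod R X S)"
  and "Q \<zero>[pres_mod R X S]"
  and "!!a x A. [|a \<in> carrier R; x \<in> X; A \<in> carrier (pres_mod R X S); Q A|] ==>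
   Q (a \<odot>[pres_mod R X S] pres_gen R X S x \<oplus>[pres_mod R X S] A)"
 shows "Q A"
proof -
 obtain c where c: "c \<in> carrier (fr X)" "A = coset X S c"
  using assms(1) by (auto simp: pres_mod_carrier)
 have "Q (coset X S c)"
  using c(1)
 proof (induction rule: free_induct)
  case zero
  then show ?case using assms(2) by (simp add: pres_mod_zero)
 next
  case (step a x c)
  then show ?case
   using assms(3)[of a x "coset X S c"]
   by (auto simp: pres_mod_carrier pres_gen_eq pres_mod_smult pres_mod_add)
 qed
 then show ?thesis by (simp add: c)
qed

lemma mlin_ext_pres:
 assumes "module R P" "lin (pres_mod R X S) P h" "lin (pres_mod R X S) P h'"
  and "!!x. x \<in> X ==> h (pres_gen R X S x) = h' (pres_gen R X S x)"
  and "A \<in> carrier (pres_mod R X S)"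
 shows "h A = h' A"
 using assms(5)
proof (induction rule: pres_induct)
 case zero
 then show ?case
  using assms by (simp add: mlin_zero[OF pres_mod_module])
next
 case (step a x A)
 then show ?case
  using assms pres_mod_module by (simp add: mlin_add[OF assms(2)] mlin_add[OF assms(3)]
    mlin_smult[OF assms(2)] mlin_smult[OF assms(3)] pres_gen_closed)
qed

text \<open>The universal property of generators and relations. If the free extension kills the
  relations, it kills their span, and so it takes the same value on the chosen representative as on
  any other.\<close>

lemma pres_lift:
 assumes P: "module R P" and \<phi>: "\<phi> \<in> X \<rightarrow> carrier P"
  and rel: "!!r. r \<in> S ==> free_ext R P \<phi> r = \<zero>[P]"
 shows "lin (pres_mod R X S) P (pres_lift R P \<phi>)"
  and "x \<in> X ==> pres_lift R P \<phi> (pres_gen R X S x) = \<phi> x"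
proof -
 note lin = mlin_free_ext[OF P \<phi>]
 have N: "free_ext R P \<phi> c = \<zero>[P]" if "c \<in> N" for c
  using that
 proof (induction rule: lin_span.induct)
  case lin_span_zero
  then show ?case by (rule mlin_zero[OF free_mod_module P lin])
 next
  case (lin_span_step a r x)
  then show ?case
   using S rel P by (subst mlin_add[OF lin])
    (auto simp: mlin_smult[OF lin] lin_span_carrier subset_iff)
 qed
 have val: "pres_lift R P \<phi> (coset X S c) = free_ext R P \<phi> c"
  if c: "c \<in> carrier (fr X)" for c
 proof -
  define c' where "c' = (SOME c'. c' \<in> coset X S c)"
  have "c' \<in> coset X S c"
   unfolding c'_def some_in_eq using coset_self[OF c] by blast
  then have c': "c' \<in> carrier (fr X)" "coset X S c' = coset X S c"
   using coset_memD[OF _ c] by blast+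
  then have "free_ext R P \<phi> (c' \<ominus>[fr X] c) = \<zero>[P]"
   using c coset_eq_iff by (intro N) blast
  then have "free_ext R P \<phi> c' = free_ext R P \<phi> c"
   using c c' P by (simp add: mlin_minus[OF free_mod_module P lin] m_minus_zero_iff mlin_closed[OF lin])
  then show ?thesis
   by (simp add: pres_lift_def c'_def[symmetric] free_ext_def)
 qed
 show "lin (pres_mod R X S) P (pres_lift R P \<phi>)"
  by (rule mlinI) (auto simp: pres_mod_carrier pres_mod_add pres_mod_smult val
    mlin_closed[OF lin] mlin_add[OF lin] mlin_smult[OF lin])
 show "pres_lift R P \<phi> (pres_gen R X S x) = \<phi> x" if "x \<in> X"
  using that by (simp add: pres_gen_eq val free_ext_basis[OF P \<phi>])
qed

end

end

section \<open>Words and sums over their splittings\<close>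

lemma wdeg_simps [simp]:
 "wdeg [] = 0" "wdeg (x # w) = fst x + wdeg w" "wdeg (u @ v) = wdeg u + wdeg v"
 by (simp_all add: wdeg_def)

lemma words_simps [simp]:
 "[] \<in> words W" "x # w \<in> words W \<longleftrightarrow> snd x \<in> carrier (W (fst x)) \<and> w \<in> words W"
 "u @ v \<in> words W \<longleftrightarrow> u \<in> words W \<and> v \<in> words W"
 by (auto simp: words_def)

text \<open>Only multisets are compared, the order is forgotten. This suffices for degrees, lengths
  and membership in \<open>words\<close>, and it is stable under exchanging and regrouping the
  parts.\<close>

definition splits :: "'w word => 'w word => 'w word => bool" where
 "splits w a b \<longleftrightarrow> mset a + mset b = mset w"

definition splits3 :: "'w word => 'w word => 'w word => 'w word => bool" where
 "splits3 w a b c \<longleftrightarrow> mset a + mset b + mset c = mset w"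

lemma splits_Nil [simp]: "splits [] a b \<longleftrightarrow> a = [] \<and> b = []"
 by (auto simp: splits_def)

lemma splits_Cons [simp]: "splits w a b ==> splits (x # w) (x # a) b" "splits w a b ==> splits (x # w) a (x # b)"
 by (auto simp: splits_def)

lemma splits3_Cons [simp]: "splits3 w a b c ==> splits3 (x # w) (x # a) b c"
 "splits3 w a b c ==> splits3 (x # w) a (x # b) c" "splits3 w a b c ==> splits3 (x # w) a b (x # c)"
 by (auto simp: splits3_def)

lemma splits3I: "splits w c d ==> splits c a b ==> splits3 w a b d" "splits w a c ==> splits c b d ==> splits3 w a b d"
 unfolding splits3_def splits_def by (metis add.assoc)+

lemma splits_comm: "splits w a b ==> splits w b a"
 by (simp add: splits_def add.commute)

lemma splits3_comm: "splits3 w a b c ==> splits3 w b a c"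
 by (simp add: splits3_def add.commute)

lemma splits_self [simp]: "splits w w []" "splits w [] w"
 by (auto simp: splits_def)

lemma wdeg_mset: "wdeg w = (\<Sum>x\<in>#mset w. fst x)"
 by (simp add: wdeg_def flip: sum_mset_sum_list)

lemma splits_wdeg: "splits w a b ==> wdeg w = wdeg a + wdeg b"
 by (simp add: splits_def wdeg_mset flip: image_mset_union sum_mset.union)

lemma splits_set: "splits w a b ==> set w = set a \<union> set b"
 unfolding splits_def by (simp flip: set_mset_mset set_mset_union)

lemma splits3_set: "splits3 w a b c ==> set w = set a \<union> set b \<union> set c"
 unfolding splits3_def by (simp flip: set_mset_mset set_mset_union)

lemma splits_words: "splits w a b ==> w \<in> words W \<longleftrightarrow> a \<in> words W \<and> b \<in> words W"
 using splits_set[of w a b] by (auto simp: words_def)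

lemma splitsD:
 assumes "splits w a b" "w \<in> words W"
 shows "a \<in> words W" "b \<in> words W" "wdeg w = wdeg a + wdeg b"
 using assms by (simp_all add: splits_words splits_wdeg)

lemma splits_length: "splits w a b ==> length w = length a + length b"
 by (simp add: splits_def flip: size_mset size_union)

lemma splits_length_less: "splits w a b ==> b \<noteq> [] ==> length a < length w" "splits w a b ==> a \<noteq> [] ==> length b < length w"
 by (auto simp: splits_length)

lemma splits3_wdeg: "splits3 w a b c ==> wdeg w = wdeg a + wdeg b + wdeg c"
 by (simp add: splits3_def wdeg_mset flip: image_mset_union sum_mset.union)

lemma splits3_words: "splits3 w a b c ==> w \<in> words W \<longleftrightarrow> a \<in> words W \<and> b \<in> words W \<and> c \<in> words W"
 using splits3_set[of w a b c] by (auto simp: words_def)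

text \<open>Sum over all ways to distribute the letters of the word over two subwords, with the Koszul sign of the shuffle.\<close>
primrec ssum :: "'k ring => ('k, 'p) module => 'w word => ('w word => 'w word => 'p) => 'p" where
 "ssum R P [] = (%G. G [] [])"
| "ssum R P (x # w) = (%G. ssum R P w (%a b. G (x # a) b) \<oplus>[P]
   ssum R P w (%a b. ksign R (fst x * wdeg a) \<odot>[P] G a (x # b)))"

text \<open>Only splittings of the word matter. Through \<open>conv_cong\<close> this fact makes the
  recursion of \<open>expF\<close> descend to shorter words.\<close>

lemma ssum_cong [fundef_cong]:
 assumes "w = w'" "!!a b. splits w' a b ==> G a b = H a b"
 shows "ssum R P w G = ssum R P w' H"
 unfolding assms(1) using assms(2)
proof (induction w' arbitrary: G H)
 case (Cons x w)
 have 1: "ssum R P w (%a b. G (x # a) b) = ssum R P w (%a b. H (x # a) b)"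
  by (rule Cons.IH) (auto intro: Cons.prems)
 have 2: "ssum R P w (%a b. ksign R (fst x * wdeg a) \<odot>[P] G a (x # b)) =
   ssum R P w (%a b. ksign R (fst x * wdeg a) \<odot>[P] H a (x # b))"
  by (rule Cons.IH) (simp add: Cons.prems)
 show ?case
  unfolding ssum.simps 1 2 ..
qed simp

lemma ssum_map:
 assumes "!!x. fst (f x) = fst x"
 shows "ssum R P (map f w) G = ssum R P w (%a b. G (map f a) (map f b))"
proof (induction w arbitrary: G)
 case (Cons x w)
 have "wdeg (map f a) = wdeg a" for a
  by (induction a) (auto simp: assms)
 with Cons show ?case by (simp add: assms)
qed simp

context ground
begin

abbreviation (input) "ss == ssum R"

lemma ksign_closed [simp]: "ks e \<in> carrier R"
 by (simp add: ksign_def)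

lemma ksign_add: "ks (e + f) = ks e \<otimes> ks f"
 by (simp add: ksign_def l_minus)

lemma ksign_cong: "even e = even f ==> ks e = ks f"
 by (simp add: ksign_def)

lemma ksign_zero [simp]: "ks 0 = \<one>"
 by (simp add: ksign_def)

lemma ksmult_cong: "even e = even f ==> x = y ==> ks e \<odot>[P] x = ks f \<odot>[P] y"
 by (simp add: ksign_def)

lemma ksign_even: "even e ==> ks e = \<one>"
 and ksign_odd: "odd e ==> ks e = \<ominus> \<one>"
 by (simp_all add: ksign_def)

lemma ksign_sq [simp]: "ks e \<otimes> ks e = \<one>"
 by (simp add: ksign_def l_minus)

lemma m_ksign_ksign: "module R P ==> x \<in> carrier P ==> ks e \<odot>[P] (ks f \<odot>[P] x) = ks (e + f) \<odot>[P] x"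
 for P :: "('k, 'p) module"
 by (simp add: m_smult_smult ksign_add)

context
 fixes P :: "('k, 'p) module"
 assumes P [simp]: "module R P"
begin

lemma ssum_closed [simp]:
 "(!!a b. splits w a b ==> G a b \<in> carrier P) ==> ss P w G \<in> carrier P"
 by (induction w arbitrary: G) auto

lemma ssum_add:
 assumes "!!a b. splits w a b ==> G a b \<in> carrier P" "!!a b. splits w a b ==> H a b \<in> carrier P"
 shows "ss P w (%a b. G a b \<oplus>[P] H a b) = ss P w G \<oplus>[P] ss P w H"
 using assms
proof (induction w arbitrary: G H)
 case (Cons x w)
 have "ss P (x # w) (%a b. G a b \<oplus>[P] H a b) =
   ss P w (%a b. G (x # a) b \<oplus>[P] H (x # a) b) \<oplus>[P]
   ss P w (%a b. ks (fst x * wdeg a) \<odot>[P] G a (x # b) \<oplus>[P]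
    ks (fst x * wdeg a) \<odot>[P] H a (x # b))"
  using Cons.prems by (simp add: m_smult_add cong: ssum_cong)
 also have "... = ss P (x # w) G \<oplus>[P] ss P (x # w) H"
  using Cons.prems by (simp add: Cons.IH madd_ac)
 finally show ?case .
qed simp

lemma ssum_zero:
 assumes "!!a b. splits w a b ==> G a b = \<zero>[P]"
 shows "ss P w G = \<zero>[P]"
 using assms by (induction w arbitrary: G) (auto cong: ssum_cong)

text \<open>The counit law in summed form: in the surviving summand all letters stay on the left,
  none passes another, and no sign arises.\<close>

lemma ssum_left:
 assumes "!!a b. splits w a b ==> b \<noteq> [] ==> G a b = \<zero>[P]" "G w [] \<in> carrier P"
 shows "ss P w G = G w []"
 using assms
proof (induction w arbitrary: G)
 case (Cons x w)
 have "ss P w (%a b. G (x # a) b) = G (x # w) []"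
  using Cons.prems by (intro Cons.IH) auto
 moreover have "ss P w (%a b. ks (fst x * wdeg a) \<odot>[P] G a (x # b)) = \<zero>[P]"
  using Cons.prems by (intro ssum_zero) auto
 ultimately show ?case using Cons.prems by simp
qed simp

lemma ssum_right:
 assumes "!!a b. splits w a b ==> a \<noteq> [] ==> G a b = \<zero>[P]" "G [] w \<in> carrier P"
 shows "ss P w G = G [] w"
 using assms
proof (induction w arbitrary: G)
 case (Cons x w)
 have "ss P w (%a b. ks (fst x * wdeg a) \<odot>[P] G a (x # b)) = G [] (x # w)"
  using Cons.prems Cons.IH[of "%a b. ks (fst x * wdeg a) \<odot>[P] G a (x # b)"] by simp
 moreover have "ss P w (%a b. G (x # a) b) = \<zero>[P]"
  using Cons.prems by (intro ssum_zero) auto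
 ultimately show ?case using Cons.prems by simp
qed simp

end

lemma ssum_mlin:
 assumes P: "module R P" and P': "module R P'" and h: "lin P P' h"
  and "!!a b. splits w a b ==> G a b \<in> carrier P"
 shows "h (ss P w G) = ss P' w (%a b. h (G a b))"
 using assms(4)
proof (induction w arbitrary: G)
 case (Cons x w)
 then show ?case
  using P P' by (simp add: mlin_add[OF h] mlin_smult[OF h] cong: ssum_cong)
qed simp

context
 fixes P :: "('k, 'p) module"
 assumes P [simp]: "module R P"
begin

lemma ssum_smult:
 assumes "c \<in> carrier R" "!!a b. splits w a b ==> G a b \<in> carrier P"
 shows "c \<odot>[P] ss P w G = ss P w (%a b. c \<odot>[P] G a b)"
 using assms by (intro ssum_mlin mlin_const_smult) auto

text \<open>Both sides distribute the letters over three parts. Induction on the word compares the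
  placements of the first letter.\<close>

lemma ssum_coassoc:
 assumes "!!a b c. splits3 w a b c ==> K a b c \<in> carrier P"
 shows "ss P w (%c d. ss P c (%a b. K a b d)) = ss P w (%a c. ss P c (%b d. K a b d))"
 using assms
proof (induction w arbitrary: K)
 case (Cons x w)
 note [simp] = Cons.prems splits3I[of w]
 let ?S = "ss P"
 \<comment> \<open>\<open>K1\<close>, \<open>K2\<close>, \<open>K3\<close> collect the terms in
   which \<open>x\<close> falls into the first, second or third part, with the sign of
   \<open>x\<close> passing the parts before it.\<close>
 define K1 where "K1 = (%a b d. K (x # a) b d)"
 define K2 where "K2 = (%a b d. ks (fst x * wdeg a) \<odot>[P] K a (x # b) d)"
 define K3 where "K3 = (%a b d. ks (fst x * (wdeg a + wdeg b)) \<odot>[P] K a b (x # d))"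
 have K: "K1 a b c \<in> carrier P" "K2 a b c \<in> carrier P" "K3 a b c \<in> carrier P" if "splits3 w a b c" for a b c
  using that by (simp_all add: K1_def K2_def K3_def)
 have c1: "?S c (%a b. Ki a b d) \<in> carrier P" if "Ki \<in> {K1, K2, K3}" "splits w c d" for Ki c d
  using that K by (intro ssum_closed) (auto dest: splits3I)
 have c2: "?S c (%b d. Ki a b d) \<in> carrier P" if "Ki \<in> {K1, K2, K3}" "splits w a c" for Ki a c
  using that K by (intro ssum_closed) (auto dest: splits3I)
 have 1: "?S w (%c d. ?S (x # c) (%a b. K a b d)) =
   ?S w (%c d. ?S c (%a b. K1 a b d)) \<oplus>[P] ?S w (%c d. ?S c (%a b. K2 a b d))"
 proof -
  have "?S w (%c d. ?S (x # c) (%a b. K a b d)) =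
    ?S w (%c d. ?S c (%a b. K1 a b d) \<oplus>[P] ?S c (%a b. K2 a b d))"
   by (simp add: K1_def K2_def)
  also have "... = ?S w (%c d. ?S c (%a b. K1 a b d)) \<oplus>[P] ?S w (%c d. ?S c (%a b. K2 a b d))"
   using c1 by (intro ssum_add) auto
  finally show ?thesis .
 qed
 have 2: "?S w (%c d. ks (fst x * wdeg c) \<odot>[P] ?S c (%a b. K a b (x # d))) = ?S w (%c d. ?S c (%a b. K3 a b d))"
 proof (intro ssum_cong refl)
  fix c d assume cd: "splits w c d"
  have "ks (fst x * wdeg c) \<odot>[P] ?S c (%a b. K a b (x # d)) =
    ?S c (%a b. ks (fst x * wdeg c) \<odot>[P] K a b (x # d))"
   using cd by (intro ssum_smult) (auto intro!: Cons.prems dest: splits3I)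
  also have "... = ?S c (%a b. K3 a b d)"
   by (intro ssum_cong refl) (simp add: K3_def splits_wdeg)
  finally show "ks (fst x * wdeg c) \<odot>[P] ?S c (%a b. K a b (x # d)) = ?S c (%a b. K3 a b d)" .
 qed
 have 3: "ks (fst x * wdeg a) \<odot>[P] ?S (x # c) (%b d. K a b d) =
   ?S c (%b d. K2 a b d) \<oplus>[P] ?S c (%b d. K3 a b d)" if ac: "splits w a c" for a c
 proof -
  have cl: "K a (x # b) d \<in> carrier P" "K a b (x # d) \<in> carrier P" if "splits c b d" for b d
   using ac that splits3I(2)[OF ac that] by auto
  have "ks (fst x * wdeg a) \<odot>[P] ?S (x # c) (%b d. K a b d) =
   ?S c (%b d. ks (fst x * wdeg a) \<odot>[P] K a (x # b) d) \<oplus>[P]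
   ?S c (%b d. ks (fst x * wdeg a) \<odot>[P] (ks (fst x * wdeg b) \<odot>[P] K a b (x # d)))"
   using cl by (simp add: m_smult_add ssum_smult)
  also have "... = ?S c (%b d. K2 a b d) \<oplus>[P] ?S c (%b d. K3 a b d)"
   using cl by (intro arg_cong2[where f = "add P"] ssum_cong refl)
    (auto simp: K2_def K3_def m_ksign_ksign distrib_left)
  finally show ?thesis .
 qed
 have 4: "?S w (%a c. ks (fst x * wdeg a) \<odot>[P] ?S (x # c) (%b d. K a b d)) =
   ?S w (%a c. ?S c (%b d. K2 a b d)) \<oplus>[P] ?S w (%a c. ?S c (%b d. K3 a b d))"
 proof -
  have "?S w (%a c. ks (fst x * wdeg a) \<odot>[P] ?S (x # c) (%b d. K a b d)) =
    ?S w (%a c. ?S c (%b d. K2 a b d) \<oplus>[P] ?S c (%b d. K3 a b d))"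
   by (intro ssum_cong refl 3)
  also have "... = ?S w (%a c. ?S c (%b d. K2 a b d)) \<oplus>[P] ?S w (%a c. ?S c (%b d. K3 a b d))"
   using c2 by (intro ssum_add) auto
  finally show ?thesis .
 qed
 have IH: "?S w (%c d. ?S c (%a b. Ki a b d)) = ?S w (%a c. ?S c (%b d. Ki a b d))" if "Ki \<in> {K1, K2, K3}" for Ki
  using K that by (intro Cons.IH) auto
 have "?S (x # w) (%c d. ?S c (%a b. K a b d)) =
   (?S w (%c d. ?S c (%a b. K1 a b d)) \<oplus>[P] ?S w (%c d. ?S c (%a b. K2 a b d))) \<oplus>[P] ?S w (%c d. ?S c (%a b. K3 a b d))"
  using 1 2 by (simp only: ssum.simps)
 also have "... = ?S w (%a c. ?S c (%b d. K1 a b d)) \<oplus>[P]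
   (?S w (%a c. ?S c (%b d. K2 a b d)) \<oplus>[P] ?S w (%a c. ?S c (%b d. K3 a b d)))"
  using c2 by (simp add: IH madd_assoc)
 also have "... = ?S (x # w) (%a c. ?S c (%b d. K a b d))"
  using 4 by (simp add: K1_def)
 finally show ?case .
qed simp

text \<open>Exchanging the parts turns the branch with \<open>x\<close> on the left into the branch
  with \<open>x\<close> on the right; the induction hypothesis treats the other letters, and the
  signs agree modulo 2.\<close>

lemma ssum_cocomm:
 assumes "!!a b. splits w a b ==> G a b \<in> carrier P"
 shows "ss P w G = ss P w (%a b. ks (wdeg a * wdeg b) \<odot>[P] G b a)"
 using assms
proof (induction w arbitrary: G)
 case (Cons x w)
 note [simp] = Cons.prems splits_comm[of w]
 have 1: "ss P w (%a b. G (x # a) b) =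
   ss P w (%a b. ks (fst x * wdeg a) \<odot>[P] (ks (wdeg a * wdeg (x # b)) \<odot>[P] G (x # b) a))"
  by (subst Cons.IH, simp, intro ssum_cong refl, simp add: m_ksign_ksign, intro ksmult_cong refl) auto
 have 2: "ss P w (%a b. ks (fst x * wdeg a) \<odot>[P] G a (x # b)) =
   ss P w (%a b. ks (wdeg (x # a) * wdeg b) \<odot>[P] G b (x # a))"
  by (subst Cons.IH, simp, intro ssum_cong refl, simp add: m_ksign_ksign, intro ksmult_cong refl) auto
 show ?case
  unfolding ssum.simps 1 2 by (rule madd_comm) auto
qed simp

text \<open>Regroup so that the first two parts form one word, interchange them by
  \<open>ssum_cocomm\<close>, and regroup back.\<close>

lemma ssum_exchange:
 assumes K: "!!a b c. splits3 w a b c ==> K a b c \<in> carrier P"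
 shows "ss P w (%a c. ss P c (%b d. K a b d)) =
  ss P w (%b c. ss P c (%a d. ks (wdeg a * wdeg b) \<odot>[P] K a b d))"
proof -
 have "ss P w (%a c. ss P c (%b d. K a b d)) = ss P w (%c d. ss P c (%a b. K a b d))"
  by (rule ssum_coassoc[symmetric]) (rule K)
 also have "... = ss P w (%c d. ss P c (%b a. ks (wdeg b * wdeg a) \<odot>[P] K a b d))"
  by (intro ssum_cong refl ssum_cocomm) (auto intro!: K dest: splits3I)
 also have "... = ss P w (%b c. ss P c (%a d. ks (wdeg b * wdeg a) \<odot>[P] K a b d))"
  by (rule ssum_coassoc) (auto intro!: m_smult K dest: splits3_comm)
 finally show ?thesis by (simp add: mult.commute)
qed

text \<open>Multiplicativity of the comultiplication: when two splittings are multiplied, the right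
  part \<open>b\<close> of \<open>u\<close> has to pass the left part \<open>a'\<close> of
  \<open>v\<close>.\<close>

lemma ssum_append:
 assumes "!!a b a' b'. splits u a b ==> splits v a' b' ==> G (a @ a') (b @ b') \<in> carrier P"
 shows "ss P (u @ v) G =
  ss P u (%a b. ss P v (%a' b'. ks (wdeg b * wdeg a') \<odot>[P] G (a @ a') (b @ b')))"
 using assms
proof (induction u arbitrary: G)
 case Nil
 then show ?case by (auto intro!: ssum_cong)
next
 case (Cons x u)
 have cl: "G (x # a @ a') (b @ b') \<in> carrier P" "G (a @ a') (x # b @ b') \<in> carrier P"
  if "splits u a b" "splits v a' b'" for a b a' b'
  using Cons.prems[of "x # a" b a' b'] Cons.prems[of a "x # b" a' b'] that by auto
 have 1: "ss P (u @ v) (%a b. G (x # a) b) =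
  ss P u (%a b. ss P v (%a' b'. ks (wdeg b * wdeg a') \<odot>[P] G ((x # a) @ a') (b @ b')))"
  by (subst Cons.IH) (auto simp: cl)
 have 2: "ss P (u @ v) (%a b. ks (fst x * wdeg a) \<odot>[P] G a (x # b)) =
  ss P u (%a b. ks (fst x * wdeg a) \<odot>[P]
   ss P v (%a' b'. ks (wdeg (x # b) * wdeg a') \<odot>[P] G (a @ a') ((x # b) @ b')))"
  by (subst Cons.IH, simp add: cl, intro ssum_cong refl, simp add: cl ssum_smult m_ksign_ksign cong: ssum_cong,
   intro ssum_cong ksmult_cong refl) auto
 show ?case
  by (simp only: append_Cons ssum.simps 1 2)
qed

end

end

section \<open>Symmetric multilinear functions on words\<close>

text \<open>Exactly the compatibility with \<open>sym_rels\<close> that is needed to descend to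
  S(W). The target is a family of modules, so that maps of nonzero degree are covered by shifting
  \<open>P\<close>.\<close>

definition symfun :: "'k ring => ('k, 'w) gmod => ('k, 'p) gmod => ('w word => 'p) => bool" where
 "symfun R W P \<phi> \<longleftrightarrow>
   (\<forall>w\<in>words W. \<phi> w \<in> carrier (P (wdeg w))) \<and>
   (\<forall>u\<in>words W. \<forall>v\<in>words W. \<forall>i. \<forall>x\<in>carrier (W i). \<forall>y\<in>carrier (W i).
    \<phi> (u @ (i, x \<oplus>[W i] y) # v) = \<phi> (u @ (i, x) # v) \<oplus>[P (wdeg u + (i + wdeg v))] \<phi> (u @ (i, y) # v)) \<and>
   (\<forall>u\<in>words W. \<forall>v\<in>words W. \<forall>i. \<forall>x\<in>carrier (W i). \<forall>a\<in>carrier R.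
    \<phi> (u @ (i, a \<odot>[W i] x) # v) = a \<odot>[P (wdeg u + (i + wdeg v))] \<phi> (u @ (i, x) # v)) \<and>
   (\<forall>u\<in>words W. \<forall>v\<in>words W. \<forall>i j. \<forall>x\<in>carrier (W i). \<forall>y\<in>carrier (W j).
    \<phi> (u @ (i, x) # (j, y) # v) = ksign R (i * j) \<odot>[P (wdeg u + (i + (j + wdeg v)))] \<phi> (u @ (j, y) # (i, x) # v))"

lemma symfunI:
 assumes "!!w. w \<in> words W ==> \<phi> w \<in> carrier (P (wdeg w))"
  and "!!u v i x y. [|u \<in> words W; v \<in> words W; x \<in> carrier (W i); y \<in> carrier (W i)|] ==>
   \<phi> (u @ (i, x \<oplus>[W i] y) # v) = \<phi> (u @ (i, x) # v) \<oplus>[P (wdeg u + (i + wdeg v))] \<phi> (u @ (i, y) # v)"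
  and "!!u v i x a. [|u \<in> words W; v \<in> words W; x \<in> carrier (W i); a \<in> carrier R|] ==>
   \<phi> (u @ (i, a \<odot>[W i] x) # v) = a \<odot>[P (wdeg u + (i + wdeg v))] \<phi> (u @ (i, x) # v)"
  and "!!u v i j x y. [|u \<in> words W; v \<in> words W; x \<in> carrier (W i); y \<in> carrier (W j)|] ==>
   \<phi> (u @ (i, x) # (j, y) # v) = ksign R (i * j) \<odot>[P (wdeg u + (i + (j + wdeg v)))] \<phi> (u @ (j, y) # (i, x) # v)"
 shows "symfun R W P \<phi>"
 using assms unfolding symfun_def by blast

lemma symfun_closed:
 "[|symfun R W P \<phi>; w \<in> words W; d = wdeg w|] ==> \<phi> w \<in> carrier (P d)"
 and symfun_add:
 "[|symfun R W P \<phi>; u \<in> words W; v \<in> words W; x \<in> carrier (W i); y \<in> carrier (W i); d = wdeg u + (i + wdeg v)|] ==>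
  \<phi> (u @ (i, x \<oplus>[W i] y) # v) = \<phi> (u @ (i, x) # v) \<oplus>[P d] \<phi> (u @ (i, y) # v)"
 and symfun_smult:
 "[|symfun R W P \<phi>; u \<in> words W; v \<in> words W; x \<in> carrier (W i); a \<in> carrier R; d = wdeg u + (i + wdeg v)|] ==>
  \<phi> (u @ (i, a \<odot>[W i] x) # v) = a \<odot>[P d] \<phi> (u @ (i, x) # v)"
 and symfun_swap:
 "[|symfun R W P \<phi>; u \<in> words W; v \<in> words W; x \<in> carrier (W i); y \<in> carrier (W j); d = wdeg u + (i + (j + wdeg v))|] ==>
  \<phi> (u @ (i, x) # (j, y) # v) = ksign R (i * j) \<odot>[P d] \<phi> (u @ (j, y) # (i, x) # v)"
 unfolding symfun_def by blast+

lemmas symfun_add0 = symfun_add[where u = "[]", simplified]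
 and symfun_smult0 = symfun_smult[where u = "[]", simplified]
 and symfun_swap0 = symfun_swap[where u = "[]", simplified]

definition bisym :: "'k ring => ('k, 'w) gmod => ('k, 'v) gmod => ('k, 'p) gmod => ('w word => 'v word => 'p) => bool" where
 "bisym R W V P G \<longleftrightarrow> (\<forall>b\<in>words V. symfun R W (%d. P (d + wdeg b)) (%a. G a b)) \<and>
   (\<forall>a\<in>words W. symfun R V (%d. P (wdeg a + d)) (%b. G a b))"

lemma bisym_left: "bisym R W V P G ==> b \<in> words V ==> symfun R W (%d. P (d + wdeg b)) (%a. G a b)"
 and bisym_right: "bisym R W V P G ==> a \<in> words W ==> symfun R V (%d. P (wdeg a + d)) (%b. G a b)"
 by (auto simp: bisym_def)

lemma bisym_closed: "[|bisym R W V P G; a \<in> words W; b \<in> words V; d = wdeg a + wdeg b|] ==> G a b \<in> carrier (P d)"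
 using symfun_closed[OF bisym_left] by fastforce

lemma bisym_left_add:
 "[|bisym R W V P G; v \<in> words W; b \<in> words V; x \<in> carrier (W i); y \<in> carrier (W i); d = i + wdeg v + wdeg b|] ==>
  G ((i, x \<oplus>[W i] y) # v) b = G ((i, x) # v) b \<oplus>[P d] G ((i, y) # v) b"
 using symfun_add0[OF bisym_left, of R W V P G b v x i y "i + wdeg v"] by simp

lemma bisym_right_add:
 "[|bisym R W V P G; v \<in> words V; a \<in> words W; x \<in> carrier (V i); y \<in> carrier (V i); d = wdeg a + (i + wdeg v)|] ==>
  G a ((i, x \<oplus>[V i] y) # v) = G a ((i, x) # v) \<oplus>[P d] G a ((i, y) # v)"
 using symfun_add0[OF bisym_right, of R W V P G a v x i y "i + wdeg v"] by simp

lemma bisym_left_smult: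
 "[|bisym R W V P G; v \<in> words W; b \<in> words V; x \<in> carrier (W i); c \<in> carrier R; d = i + wdeg v + wdeg b|] ==>
  G ((i, c \<odot>[W i] x) # v) b = c \<odot>[P d] G ((i, x) # v) b"
 using symfun_smult0[OF bisym_left, of R W V P G b v x i c "i + wdeg v"] by simp

lemma bisym_right_smult:
 "[|bisym R W V P G; v \<in> words V; a \<in> words W; x \<in> carrier (V i); c \<in> carrier R; d = wdeg a + (i + wdeg v)|] ==>
  G a ((i, c \<odot>[V i] x) # v) = c \<odot>[P d] G a ((i, x) # v)"
 using symfun_smult0[OF bisym_right, of R W V P G a v x i c "i + wdeg v"] by simp

lemma bisym_left_swap:
 "[|bisym R W V P G; v \<in> words W; b \<in> words V; x \<in> carrier (W i); y \<in> carrier (W j); d = i + (j + wdeg v) + wdeg b|] ==>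
  G ((i, x) # (j, y) # v) b = ksign R (i * j) \<odot>[P d] G ((j, y) # (i, x) # v) b"
 using symfun_swap0[OF bisym_left, of R W V P G b v x i y j "i + (j + wdeg v)"] by simp

lemma bisym_right_swap:
 "[|bisym R W V P G; v \<in> words V; a \<in> words W; x \<in> carrier (V i); y \<in> carrier (V j); d = wdeg a + (i + (j + wdeg v))|] ==>
  G a ((i, x) # (j, y) # v) = ksign R (i * j) \<odot>[P d] G a ((j, y) # (i, x) # v)"
 using symfun_swap0[OF bisym_right, of R W V P G a v x i y j "i + (j + wdeg v)"] by simp

context ground
begin

abbreviation (input) "symf == symfun R"

lemma gm [simp]: "gr W ==> module R (W d)"
 for W :: "('k, 'w) gmod"
 by (simp add: graded_module_def)

lemma gmI: "(!!d. module R (W d)) ==> gr W"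
 for W :: "('k, 'w) gmod"
 by (simp add: graded_module_def)

lemma gm_shift [simp]: "gr W ==> gr (%d. W (c + d))"
 "gr W ==> gr (%d. W (d + c))"
 for W :: "('k, 'w) gmod"
 by (simp_all add: graded_module_def)

lemma symfun_cong:
 assumes \<phi>: "symf W P \<phi>" and eq: "!!w. w \<in> words W ==> \<psi> w = \<phi> w" and W: "gr W"
 shows "symf W P \<psi>"
proof (rule symfunI)
 show "\<psi> w \<in> carrier (P (wdeg w))" if "w \<in> words W" for w
  using symfun_closed[OF \<phi> that refl] that by (simp add: eq)
 show "\<psi> (u @ (i, y \<oplus>[W i] z) # v) = \<psi> (u @ (i, y) # v) \<oplus>[P (wdeg u + (i + wdeg v))] \<psi> (u @ (i, z) # v)"
  if "u \<in> words W" "v \<in> words W" "y \<in> carrier (W i)" "z \<in> carrier (W i)" for u v i y z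
  using that W symfun_add[OF \<phi> that refl] by (simp add: eq)
 show "\<psi> (u @ (i, a \<odot>[W i] y) # v) = a \<odot>[P (wdeg u + (i + wdeg v))] \<psi> (u @ (i, y) # v)"
  if "u \<in> words W" "v \<in> words W" "y \<in> carrier (W i)" "a \<in> carrier R" for u v i y a
  using that W symfun_smult[OF \<phi> that refl] by (simp add: eq)
 show "\<psi> (u @ (i, y) # (j, z) # v) = ks (i * j) \<odot>[P (wdeg u + (i + (j + wdeg v)))] \<psi> (u @ (j, z) # (i, y) # v)"
  if "u \<in> words W" "v \<in> words W" "y \<in> carrier (W i)" "z \<in> carrier (W j)" for u v i j y z
  using that symfun_swap[OF \<phi> that refl] by (simp add: eq)
qed

lemma symfun_Cons:
 assumes "symf W P \<phi>" "snd x \<in> carrier (W (fst x))"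
 shows "symf W (%d. P (fst x + d)) (%w. \<phi> (x # w))"
proof (rule symfunI)
 show "\<phi> (x # w) \<in> carrier (P (fst x + wdeg w))" if "w \<in> words W" for w
  using assms that by (intro symfun_closed[OF assms(1)]) auto
 show "\<phi> (x # u @ (i, y \<oplus>[W i] z) # v) =
   \<phi> (x # u @ (i, y) # v) \<oplus>[P (fst x + (wdeg u + (i + wdeg v)))] \<phi> (x # u @ (i, z) # v)"
  if "u \<in> words W" "v \<in> words W" "y \<in> carrier (W i)" "z \<in> carrier (W i)" for u v i y z
  using assms that symfun_add[OF assms(1), of "x # u" v y i z] by (simp add: add.assoc)
 show "\<phi> (x # u @ (i, a \<odot>[W i] y) # v) = a \<odot>[P (fst x + (wdeg u + (i + wdeg v)))] \<phi> (x # u @ (i, y) # v)"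
  if "u \<in> words W" "v \<in> words W" "y \<in> carrier (W i)" "a \<in> carrier R" for u v i y a
  using assms that symfun_smult[OF assms(1), of "x # u" v y i a] by (simp add: add.assoc)
 show "\<phi> (x # u @ (i, y) # (j, z) # v) =
   ks (i * j) \<odot>[P (fst x + (wdeg u + (i + (j + wdeg v))))] \<phi> (x # u @ (j, z) # (i, y) # v)"
  if "u \<in> words W" "v \<in> words W" "y \<in> carrier (W i)" "z \<in> carrier (W j)" for u v i j y z
  using assms that symfun_swap[OF assms(1), of "x # u" v y i z j] by (simp add: add.assoc)
qed

lemma symfun_mlin:
 assumes "symf W P \<phi>" "!!d. lin (P d) (P' d) (h d)" "!!d. module R (P d)" "gr W"
 shows "symf W P' (%w. h (wdeg w) (\<phi> w))"
proof -
 note [simp] = mlin_add[OF assms(2)] mlin_smult[OF assms(2)] assms(3,4)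
 note cl = symfun_closed[OF assms(1)]
 show ?thesis
 proof (rule symfunI)
  show "h (wdeg w) (\<phi> w) \<in> carrier (P' (wdeg w))" if "w \<in> words W" for w
   using that by (intro mlin_closed[OF assms(2)] cl refl)
  show "h (wdeg (u @ (i, y \<oplus>[W i] z) # v)) (\<phi> (u @ (i, y \<oplus>[W i] z) # v)) =
   h (wdeg (u @ (i, y) # v)) (\<phi> (u @ (i, y) # v)) \<oplus>[P' (wdeg u + (i + wdeg v))]
    h (wdeg (u @ (i, z) # v)) (\<phi> (u @ (i, z) # v))"
   if "u \<in> words W" "v \<in> words W" "y \<in> carrier (W i)" "z \<in> carrier (W i)" for u v i y z
   using that cl[of "u @ (i, y) # v"] cl[of "u @ (i, z) # v"] by (simp add: symfun_add[OF assms(1)])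
  show "h (wdeg (u @ (i, a \<odot>[W i] y) # v)) (\<phi> (u @ (i, a \<odot>[W i] y) # v)) =
    a \<odot>[P' (wdeg u + (i + wdeg v))] h (wdeg (u @ (i, y) # v)) (\<phi> (u @ (i, y) # v))"
   if "u \<in> words W" "v \<in> words W" "y \<in> carrier (W i)" "a \<in> carrier R" for u v i y a
   using that cl[of "u @ (i, y) # v"] by (simp add: symfun_smult[OF assms(1)])
  show "h (wdeg (u @ (i, y) # (j, z) # v)) (\<phi> (u @ (i, y) # (j, z) # v)) =
    ks (i * j) \<odot>[P' (wdeg u + (i + (j + wdeg v)))]
     h (wdeg (u @ (j, z) # (i, y) # v)) (\<phi> (u @ (j, z) # (i, y) # v))"
   if "u \<in> words W" "v \<in> words W" "y \<in> carrier (W i)" "z \<in> carrier (W j)" for u v i j y z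
   using that cl[of "u @ (j, z) # (i, y) # v" "wdeg u + (i + (j + wdeg v))"]
   by (simp add: symfun_swap[OF assms(1) that refl] add.left_commute[of j])
 qed
qed

lemma symfun_scale:
 assumes "symf W P \<phi>" "!!d. c d \<in> carrier R" "!!d. module R (P d)" "gr W"
 shows "symf W P (%w. c (wdeg w) \<odot>[P (wdeg w)] \<phi> w)"
 using assms by (intro symfun_mlin[OF assms(1), where h = "%d x. c d \<odot>[P d] x"] mlin_const_smult) auto

lemma symfun_plus:
 assumes \<phi>: "symf W P \<phi>" and \<psi>: "symf W P \<psi>" and P: "!!d. module R (P d)"
 shows "symf W P (%w. \<phi> w \<oplus>[P (wdeg w)] \<psi> w)"
proof (rule symfunI)
 note cl = symfun_closed[OF \<phi>] symfun_closed[OF \<psi>]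
 note [simp] = P
 show "\<phi> w \<oplus>[P (wdeg w)] \<psi> w \<in> carrier (P (wdeg w))" if "w \<in> words W" for w
  using that by (intro m_add P cl) auto
 show "\<phi> (u @ (i, y \<oplus>[W i] z) # v) \<oplus>[P (wdeg (u @ (i, y \<oplus>[W i] z) # v))] \<psi> (u @ (i, y \<oplus>[W i] z) # v) =
   (\<phi> (u @ (i, y) # v) \<oplus>[P (wdeg (u @ (i, y) # v))] \<psi> (u @ (i, y) # v)) \<oplus>[P (wdeg u + (i + wdeg v))]
   (\<phi> (u @ (i, z) # v) \<oplus>[P (wdeg (u @ (i, z) # v))] \<psi> (u @ (i, z) # v))"
  if "u \<in> words W" "v \<in> words W" "y \<in> carrier (W i)" "z \<in> carrier (W i)" for u v i y z
  using that cl[of "u @ (i, y) # v"] cl[of "u @ (i, z) # v"]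
  by (simp add: symfun_add[OF \<phi>] symfun_add[OF \<psi>] madd_ac)
 show "\<phi> (u @ (i, a \<odot>[W i] y) # v) \<oplus>[P (wdeg (u @ (i, a \<odot>[W i] y) # v))] \<psi> (u @ (i, a \<odot>[W i] y) # v) =
   a \<odot>[P (wdeg u + (i + wdeg v))] (\<phi> (u @ (i, y) # v) \<oplus>[P (wdeg (u @ (i, y) # v))] \<psi> (u @ (i, y) # v))"
  if "u \<in> words W" "v \<in> words W" "y \<in> carrier (W i)" "a \<in> carrier R" for u v i y a
  using that cl[of "u @ (i, y) # v"] by (simp add: symfun_smult[OF \<phi>] symfun_smult[OF \<psi>] m_smult_add)
 show "\<phi> (u @ (i, y) # (j, z) # v) \<oplus>[P (wdeg (u @ (i, y) # (j, z) # v))] \<psi> (u @ (i, y) # (j, z) # v) =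
   ks (i * j) \<odot>[P (wdeg u + (i + (j + wdeg v)))] (\<phi> (u @ (j, z) # (i, y) # v)
    \<oplus>[P (wdeg (u @ (j, z) # (i, y) # v))] \<psi> (u @ (j, z) # (i, y) # v))"
  if "u \<in> words W" "v \<in> words W" "y \<in> carrier (W i)" "z \<in> carrier (W j)" for u v i j y z
  using that cl[of "u @ (j, z) # (i, y) # v" "wdeg u + (i + (j + wdeg v))"]
  by (simp add: symfun_swap[OF \<phi> that refl] symfun_swap[OF \<psi> that refl] m_smult_add add.left_commute[of j])
qed

lemma symfun_zero_letter:
 assumes "symf W P \<phi>" "gr W" "module R (P d)" "u \<in> words W" "v \<in> words W" "d = wdeg u + (i + wdeg v)"
 shows "\<phi> (u @ (i, \<zero>[W i]) # v) = \<zero>[P d]"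
proof -
 have "\<phi> (u @ (i, \<zero> \<odot>[W i] \<zero>[W i]) # v) = \<zero> \<odot>[P d] \<phi> (u @ (i, \<zero>[W i]) # v)"
  using assms by (intro symfun_smult[OF assms(1)]) auto
 moreover have "\<phi> (u @ (i, \<zero>[W i]) # v) \<in> carrier (P d)"
  using assms by (intro symfun_closed[OF assms(1)]) auto
 ultimately show ?thesis
  using assms by simp
qed

text \<open>Iterated adjacent swaps: every letter of \<open>v\<close> that \<open>x\<close> passes
  contributes its sign.\<close>

lemma symfun_move:
 assumes \<phi>: "symf W P \<phi>" and P: "module R (P d)" and x: "snd x \<in> carrier (W (fst x))"
  and "u \<in> words W" "v \<in> words W" "w \<in> words W" "d = wdeg (u @ v @ x # w)"
 shows "\<phi> (u @ v @ x # w) = ks (fst x * wdeg v) \<odot>[P d] \<phi> (u @ x # v @ w)"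
 using assms(4-)
proof (induction v arbitrary: u)
 case Nil
 then show ?case using P x symfun_closed[OF \<phi>, of "u @ x # w"] by simp
next
 case (Cons y v)
 have "\<phi> (u @ (y # v) @ x # w) = \<phi> ((u @ [y]) @ v @ x # w)"
  by simp
 also have "... = ks (fst x * wdeg v) \<odot>[P d] \<phi> ((u @ [y]) @ x # v @ w)"
  using Cons by (intro Cons.IH) auto
 also have "\<phi> ((u @ [y]) @ x # v @ w) = ks (fst y * fst x) \<odot>[P d] \<phi> (u @ x # y # v @ w)"
  using Cons.prems x symfun_swap[OF \<phi>, of u "v @ w" "snd y" "fst y" "snd x" "fst x" d] by simp
 also have "ks (fst x * wdeg v) \<odot>[P d] (ks (fst y * fst x) \<odot>[P d] \<phi> (u @ x # y # v @ w)) =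
   ks (fst x * wdeg v + fst y * fst x) \<odot>[P d] \<phi> (u @ x # y # v @ w)"
  using Cons.prems x P by (intro m_ksign_ksign symfun_closed[OF \<phi>]) auto
 finally show ?case
  by (simp add: algebra_simps)
qed

subsection \<open>Symmetry of sums over splittings\<close>

context
 fixes W :: "('k, 'w) gmod"
 assumes W [simp]: "gr W"
begin

text \<open>Inductions over splittings put the first letter into one of the parts. This lemma and
  \<open>bisym_Cons_right\<close> say that both resulting summands are again bisymmetric, with
  shifted target.\<close>

lemma bisym_Cons_left:
 assumes G: "bisym R W W P G" and x: "snd x \<in> carrier (W (fst x))"
 shows "bisym R W W (%d. P (fst x + d)) (%a b. G (x # a) b)"
proof -
 have "symf W (%d. P (fst x + (d + wdeg b))) (%a. G (x # a) b)" if "b \<in> words W" for b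
  using symfun_Cons[OF bisym_left[OF G that] x] by (simp add: add.assoc)
 moreover have "symf W (%d. P (fst x + (wdeg a + d))) (%b. G (x # a) b)" if "a \<in> words W" for a
  using bisym_right[OF G, of "x # a"] that x by (simp add: add.assoc)
 ultimately show ?thesis
  by (simp add: bisym_def)
qed

lemma bisym_scale:
 assumes G: "bisym R W W P G" and P: "gr P" and c: "!!d e. c d e \<in> carrier R"
 shows "bisym R W W P (%a b. c (wdeg a) (wdeg b) \<odot>[P (wdeg a + wdeg b)] G a b)"
 unfolding bisym_def using P c
 by (auto intro!: symfun_scale[OF bisym_left[OF G], where c = "%d. c d (wdeg _)"] 
   symfun_scale[OF bisym_right[OF G], where c = "%d. c (wdeg _) d"])

lemma bisym_Cons_right:
 assumes G: "bisym R W W P G" and P: "gr P" and x: "snd x \<in> carrier (W (fst x))"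
 shows "bisym R W W (%d. P (fst x + d)) (%a b. ks (fst x * wdeg a) \<odot>[P (fst x + (wdeg a + wdeg b))] G a (x # b))"
proof -
 have "symf W (%d. P (fst x + (wdeg a + d))) (%b. G a (x # b))" if "a \<in> words W" for a
  using symfun_Cons[OF bisym_right[OF G that] x] by (simp add: add.left_commute)
 moreover have "symf W (%d. P (fst x + (d + wdeg b))) (%a. G a (x # b))" if "b \<in> words W" for b
  using bisym_left[OF G, of "x # b"] that x by (simp add: add.left_commute)
 ultimately have "bisym R W W (%d. P (fst x + d)) (%a b. G a (x # b))"
  by (simp add: bisym_def)
 from bisym_scale[OF this, of "%d e. ks (fst x * d)"] P show ?thesis
  by simp
qed

lemma ssum_bisym_closed:
 assumes G: "bisym R W W P G" and P: "gr P" and w: "w \<in> words W" "d = wdeg w"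
 shows "ss (P d) w G \<in> carrier (P d)"
 using w P by (intro ssum_closed) (auto intro!: bisym_closed[OF G] simp: splits_words splits_wdeg)

lemma ssum_Cons_gm:
 assumes w: "w \<in> words W" and d: "d = fst x + wdeg w"
 shows "ss (P d) (x # w) G = ss (P d) w (%a b. G (x # a) b) \<oplus>[P d]
  ss (P d) w (%a b. ks (fst x * wdeg a) \<odot>[P (fst x + (wdeg a + wdeg b))] G a (x # b))"
proof -
 have "ss (P d) w (%a b. ks (fst x * wdeg a) \<odot>[P d] G a (x # b)) =
  ss (P d) w (%a b. ks (fst x * wdeg a) \<odot>[P (fst x + (wdeg a + wdeg b))] G a (x # b))"
  using d by (intro ssum_cong refl) (simp add: splits_wdeg)
 then show ?thesis by simp
qed

text \<open>If the letter is at the head, both branches are expanded by linearity of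
  \<open>G\<close>. Otherwise the head is distributed first, and the induction hypothesis is applied
  to the two new functions of the parts; hence \<open>P\<close> and \<open>G\<close> are arbitrary
  in the induction.\<close>

lemma ssum_letter_add:
 assumes "bisym R W W P G" "gr P" "u \<in> words W" "v \<in> words W"
  and "x \<in> carrier (W i)" "y \<in> carrier (W i)" "d = wdeg u + (i + wdeg v)"
 shows "ss (P d) (u @ (i, x \<oplus>[W i] y) # v) G = ss (P d) (u @ (i, x) # v) G \<oplus>[P d] ss (P d) (u @ (i, y) # v) G"
 using assms
proof (induction u arbitrary: P G d)
 case Nil
 note G = bisym_closed[OF Nil(1)]
 have 1: "ss (P d) v (%a b. G ((i, x \<oplus>[W i] y) # a) b) =
   ss (P d) v (%a b. G ((i, x) # a) b) \<oplus>[P d] ss (P d) v (%a b. G ((i, y) # a) b)"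
  using Nil by (subst ssum_add[symmetric])
   (auto simp: splits_words[of v] splits_wdeg[of v] intro!: G ssum_cong bisym_left_add[OF Nil(1)])
 have 2: "ss (P d) v (%a b. ks (i * wdeg a) \<odot>[P d] G a ((i, x \<oplus>[W i] y) # b)) =
   ss (P d) v (%a b. ks (i * wdeg a) \<odot>[P d] G a ((i, x) # b)) \<oplus>[P d]
   ss (P d) v (%a b. ks (i * wdeg a) \<odot>[P d] G a ((i, y) # b))"
 proof (subst ssum_add[symmetric])
  show "ss (P d) v (%a b. ks (i * wdeg a) \<odot>[P d] G a ((i, x \<oplus>[W i] y) # b)) =
   ss (P d) v (%a b. ks (i * wdeg a) \<odot>[P d] G a ((i, x) # b) \<oplus>[P d] ks (i * wdeg a) \<odot>[P d] G a ((i, y) # b))"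
  proof (intro ssum_cong refl)
   fix a b assume ab: "splits v a b"
   then have "a \<in> words W" "b \<in> words W" and d: "d = wdeg a + (i + wdeg b)"
    using Nil by (auto simp: splits_words[OF ab] splits_wdeg[OF ab])
   then have "G a ((i, x \<oplus>[W i] y) # b) = G a ((i, x) # b) \<oplus>[P d] G a ((i, y) # b)"
    using Nil by (intro bisym_right_add[OF Nil(1)]) auto
   moreover have "G a ((i, x) # b) \<in> carrier (P d)" "G a ((i, y) # b) \<in> carrier (P d)"
    using Nil \<open>a \<in> words W\<close> \<open>b \<in> words W\<close> d by (auto intro!: G)
   ultimately show "ks (i * wdeg a) \<odot>[P d] G a ((i, x \<oplus>[W i] y) # b) =
     ks (i * wdeg a) \<odot>[P d] G a ((i, x) # b) \<oplus>[P d] ks (i * wdeg a) \<odot>[P d] G a ((i, y) # b)"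
    using Nil by (simp add: m_smult_add)
  qed
 qed (use Nil in \<open>auto simp: splits_words[of v] splits_wdeg[of v] intro!: G m_smult\<close>)
 have cl: "ss (P d) v (%a b. G ((i, z) # a) b) \<in> carrier (P d)"
  "ss (P d) v (%a b. ks (i * wdeg a) \<odot>[P d] G a ((i, z) # b)) \<in> carrier (P d)" if "z \<in> carrier (W i)" for z
  using Nil that by (auto simp: splits_words[of v] splits_wdeg[of v] intro!: G m_smult ssum_closed)
 show ?case
  using Nil(2) cl[OF Nil(5)] cl[OF Nil(6)] by (simp add: 1 2 madd_ac)
next
 case (Cons z u)
 note cl = bisym_closed[OF Cons.prems(1)]
 have z: "snd z \<in> carrier (W (fst z))" and u: "u \<in> words W" and d: "d = fst z + (wdeg u + (i + wdeg v))"
  using Cons.prems by auto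
 note IH1 = Cons.IH[OF bisym_Cons_left[OF Cons.prems(1) z] gm_shift(1)[OF Cons.prems(2)] u Cons.prems(4-6) refl, folded d]
 note IH2 = Cons.IH[OF bisym_Cons_right[OF Cons.prems(1,2) z] gm_shift(1)[OF Cons.prems(2)] u Cons.prems(4-6) refl, folded d]
 have cl1: "ss (P d) (u @ (i, t) # v) (%a b. G (z # a) b) \<in> carrier (P d)" 
  "ss (P d) (u @ (i, t) # v) (%a b. ks (fst z * wdeg a) \<odot>[P (fst z + (wdeg a + wdeg b))] G a (z # b)) \<in> carrier (P d)"
  if "t \<in> carrier (W i)" for t
  using that Cons.prems u
   ssum_bisym_closed[OF bisym_Cons_left[OF Cons.prems(1) z] gm_shift(1)[OF Cons.prems(2)], of "u @ (i, t) # v"]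
   ssum_bisym_closed[OF bisym_Cons_right[OF Cons.prems(1,2) z] gm_shift(1)[OF Cons.prems(2)], of "u @ (i, t) # v"]
  by (auto simp: d)
 have exp: "ss (P d) (z # u @ (i, t) # v) G = ss (P d) (u @ (i, t) # v) (%a b. G (z # a) b) \<oplus>[P d]
   ss (P d) (u @ (i, t) # v) (%a b. ks (fst z * wdeg a) \<odot>[P (fst z + (wdeg a + wdeg b))] G a (z # b))"
  if "t \<in> carrier (W i)" for t
  using ssum_Cons_gm[of "u @ (i, t) # v" d z P G] that u Cons.prems by simp
 show ?case
  using Cons.prems(2) cl1[OF Cons.prems(5)] cl1[OF Cons.prems(6)] m_add[OF gm[OF W] Cons.prems(5,6)]
  by (simp add: exp Cons.prems(5,6) IH1 IH2 madd_ac del: ssum.simps)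
qed

lemma ssum_letter_smult:
 assumes "bisym R W W P G" "gr P" "u \<in> words W" "v \<in> words W"
  and "x \<in> carrier (W i)" "c \<in> carrier R" "d = wdeg u + (i + wdeg v)"
 shows "ss (P d) (u @ (i, c \<odot>[W i] x) # v) G = c \<odot>[P d] ss (P d) (u @ (i, x) # v) G"
 using assms
proof (induction u arbitrary: P G d)
 case Nil
 note G = bisym_closed[OF Nil(1)]
 have cl: "G ((i, x) # a) b \<in> carrier (P d)" "G a ((i, x) # b) \<in> carrier (P d)"
  and 1: "G ((i, c \<odot>[W i] x) # a) b = c \<odot>[P d] G ((i, x) # a) b"
  and 2: "G a ((i, c \<odot>[W i] x) # b) = c \<odot>[P d] G a ((i, x) # b)"
  if "splits v a b" for a b
  using Nil splits_words[OF that, of W] splits_wdeg[OF that]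
  by (auto intro!: G bisym_left_smult[OF Nil(1)] bisym_right_smult[OF Nil(1)])
 then show ?case
  using Nil(2,5,6) by (simp add: m_smult_add ssum_smult m_smult_smult m_comm cong: ssum_cong)
next
 case (Cons z u)
 have z: "snd z \<in> carrier (W (fst z))" and u: "u \<in> words W" and d: "d = fst z + (wdeg u + (i + wdeg v))"
  using Cons.prems by auto
 note IH1 = Cons.IH[OF bisym_Cons_left[OF Cons.prems(1) z] gm_shift(1)[OF Cons.prems(2)] u Cons.prems(4-6) refl, folded d]
 note IH2 = Cons.IH[OF bisym_Cons_right[OF Cons.prems(1,2) z] gm_shift(1)[OF Cons.prems(2)] u Cons.prems(4-6) refl, folded d]
 have cl1: "ss (P d) (u @ (i, t) # v) (%a b. G (z # a) b) \<in> carrier (P d)" 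
  "ss (P d) (u @ (i, t) # v) (%a b. ks (fst z * wdeg a) \<odot>[P (fst z + (wdeg a + wdeg b))] G a (z # b)) \<in> carrier (P d)"
  if "t \<in> carrier (W i)" for t
  using that Cons.prems u
   ssum_bisym_closed[OF bisym_Cons_left[OF Cons.prems(1) z] gm_shift(1)[OF Cons.prems(2)], of "u @ (i, t) # v"]
   ssum_bisym_closed[OF bisym_Cons_right[OF Cons.prems(1,2) z] gm_shift(1)[OF Cons.prems(2)], of "u @ (i, t) # v"]
  by (auto simp: d)
 have exp: "ss (P d) (z # u @ (i, t) # v) G = ss (P d) (u @ (i, t) # v) (%a b. G (z # a) b) \<oplus>[P d]
   ss (P d) (u @ (i, t) # v) (%a b. ks (fst z * wdeg a) \<odot>[P (fst z + (wdeg a + wdeg b))] G a (z # b))"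
  if "t \<in> carrier (W i)" for t
  using ssum_Cons_gm[of "u @ (i, t) # v" d z P G] that u Cons.prems by simp
 show ?case
  using Cons.prems(2) cl1[OF Cons.prems(5)] m_smult[OF gm[OF W] Cons.prems(6,5)]
  by (simp add: exp Cons.prems(5,6) IH1 IH2 m_smult_add del: ssum.simps)
qed

lemma ssum_letter_swap:
 assumes "bisym R W W P G" "gr P" "u \<in> words W" "v \<in> words W"
  and "x \<in> carrier (W i)" "y \<in> carrier (W j)" "d = wdeg u + (i + (j + wdeg v))"
 shows "ss (P d) (u @ (i, x) # (j, y) # v) G = ks (i * j) \<odot>[P d] ss (P d) (u @ (j, y) # (i, x) # v) G"
 using assms
proof (induction u arbitrary: P G d)
 case Nil
 note G = bisym_closed[OF Nil(1)]
 have cl: "G ((j, y) # (i, x) # a) b \<in> carrier (P d)" "G a ((j, y) # (i, x) # b) \<in> carrier (P d)"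
  "G ((j, y) # a) ((i, x) # b) \<in> carrier (P d)" "G ((i, x) # a) ((j, y) # b) \<in> carrier (P d)"
  and 1: "G ((i, x) # (j, y) # a) b = ks (i * j) \<odot>[P d] G ((j, y) # (i, x) # a) b"
  and 2: "G a ((i, x) # (j, y) # b) = ks (i * j) \<odot>[P d] G a ((j, y) # (i, x) # b)"
  if "splits v a b" for a b
  using Nil splits_words[OF that, of W] splits_wdeg[OF that]
  by (auto intro!: G bisym_left_swap[OF Nil(1)] bisym_right_swap[OF Nil(1)])
 let ?S = "ss (P d) v"
 \<comment> \<open>There are four placements of the two letters. If both go to the same part, the
   symmetry of \<open>G\<close> swaps them; the two mixed placements are interchanged with each
   other, and their signs differ by that of the two letters.\<close>
 have "ss (P d) ((i, x) # (j, y) # v) G =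
   (?S (%a b. ks (i * j) \<odot>[P d] G ((j, y) # (i, x) # a) b) \<oplus>[P d]
   ?S (%a b. ks (j * wdeg a) \<odot>[P d] G ((i, x) # a) ((j, y) # b))) \<oplus>[P d]
   (?S (%a b. ks (i * (j + wdeg a)) \<odot>[P d] G ((j, y) # a) ((i, x) # b)) \<oplus>[P d]
   ?S (%a b. ks (j * wdeg a + (i * wdeg a + i * j)) \<odot>[P d] G a ((j, y) # (i, x) # b)))"
  using Nil(2) cl by (simp add: 1 2 m_ksign_ksign cong: ssum_cong)
 moreover have "ss (P d) ((j, y) # (i, x) # v) G =
   (?S (%a b. G ((j, y) # (i, x) # a) b) \<oplus>[P d]
   ?S (%a b. ks (i * wdeg a) \<odot>[P d] G ((j, y) # a) ((i, x) # b))) \<oplus>[P d]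
   (?S (%a b. ks (j * (i + wdeg a)) \<odot>[P d] G ((i, x) # a) ((j, y) # b)) \<oplus>[P d]
   ?S (%a b. ks (i * wdeg a + j * wdeg a) \<odot>[P d] G a ((j, y) # (i, x) # b)))"
  using Nil(2) cl by (simp add: m_ksign_ksign cong: ssum_cong)
 moreover have "ks (i * j) \<odot>[P d] ?S (%a b. ks (i * wdeg a) \<odot>[P d] G ((j, y) # a) ((i, x) # b)) =
   ?S (%a b. ks (i * (j + wdeg a)) \<odot>[P d] G ((j, y) # a) ((i, x) # b))"
  using Nil(2) cl by (simp add: ssum_smult m_ksign_ksign distrib_left cong: ssum_cong)
 moreover have "ks (i * j) \<odot>[P d] ?S (%a b. ks (j * (i + wdeg a)) \<odot>[P d] G ((i, x) # a) ((j, y) # b)) =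
   ?S (%a b. ks (j * wdeg a) \<odot>[P d] G ((i, x) # a) ((j, y) # b))"
  using Nil(2) cl by (simp add: ssum_smult m_ksign_ksign cong: ssum_cong) (auto intro!: ssum_cong ksmult_cong)
 moreover have "ks (i * j) \<odot>[P d] ?S (%a b. ks (i * wdeg a + j * wdeg a) \<odot>[P d] G a ((j, y) # (i, x) # b)) =
   ?S (%a b. ks (j * wdeg a + (i * wdeg a + i * j)) \<odot>[P d] G a ((j, y) # (i, x) # b))"
  using Nil(2) cl by (simp add: ssum_smult m_ksign_ksign cong: ssum_cong) (auto intro!: ssum_cong ksmult_cong)
 moreover have "ks (i * j) \<odot>[P d] ?S (%a b. G ((j, y) # (i, x) # a) b) =
   ?S (%a b. ks (i * j) \<odot>[P d] G ((j, y) # (i, x) # a) b)"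
  using Nil(2) cl by (simp add: ssum_smult)
 ultimately show ?case
  using Nil(2) cl by (simp add: m_smult_add madd_ac del: ssum.simps)
next
 case (Cons z u)
 have z: "snd z \<in> carrier (W (fst z))" and u: "u \<in> words W" and d: "d = fst z + (wdeg u + (i + (j + wdeg v)))"
  using Cons.prems by auto
 note IH1 = Cons.IH[OF bisym_Cons_left[OF Cons.prems(1) z] gm_shift(1)[OF Cons.prems(2)] u Cons.prems(4-6) refl, folded d]
 note IH2 = Cons.IH[OF bisym_Cons_right[OF Cons.prems(1,2) z] gm_shift(1)[OF Cons.prems(2)] u Cons.prems(4-6) refl, folded d]
 let ?t = "u @ (j, y) # (i, x) # v" and ?s = "u @ (i, x) # (j, y) # v"
 have cl1: "ss (P d) ?t (%a b. G (z # a) b) \<in> carrier (P d)" 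
  "ss (P d) ?t (%a b. ks (fst z * wdeg a) \<odot>[P (fst z + (wdeg a + wdeg b))] G a (z # b)) \<in> carrier (P d)"
  using Cons.prems u
   ssum_bisym_closed[OF bisym_Cons_left[OF Cons.prems(1) z] gm_shift(1)[OF Cons.prems(2)], of ?t]
   ssum_bisym_closed[OF bisym_Cons_right[OF Cons.prems(1,2) z] gm_shift(1)[OF Cons.prems(2)], of ?t]
  by (auto simp: d add.left_commute[of j])
 have exp: "ss (P d) (z # t) G = ss (P d) t (%a b. G (z # a) b) \<oplus>[P d]
   ss (P d) t (%a b. ks (fst z * wdeg a) \<odot>[P (fst z + (wdeg a + wdeg b))] G a (z # b))"
  if "t \<in> {?s, ?t}" for t
  using that u Cons.prems by (intro ssum_Cons_gm) auto
 show ?case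
  using Cons.prems(2) cl1 exp by (simp add: IH1 IH2 m_smult_add del: ssum.simps)
qed

text \<open>Symmetry in each part makes the sum over all splittings symmetric in the whole word. For
  this reason the comultiplication and the coderivations descend to S(W).\<close>

lemma ssum_symfun:
 assumes "bisym R W W P G" "gr P"
 shows "symf W P (%w. ss (P (wdeg w)) w G)"
proof (rule symfunI)
 show "ss (P (wdeg w)) w G \<in> carrier (P (wdeg w))" if "w \<in> words W" for w
  using ssum_bisym_closed[OF assms that refl] .
qed (use ssum_letter_add[OF assms] ssum_letter_smult[OF assms] ssum_letter_swap[OF assms] in
 \<open>simp_all add: add.left_commute\<close>)

end

end

section \<open>Shuffles as subsets of positions\<close>

definition subword :: "'w word => nat set => 'w word" where
 "subword w A = map ((!) w) (filter (%i. i \<in> A) [0..<length w])"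

text \<open>The exponent of the Koszul sign that brings the positions in \<open>A\<close> to the
  front: a chosen position \<open>s\<close> passes every earlier position \<open>t\<close> that is
  not chosen.\<close>

definition inv_exp :: "'w word => nat set => int" where
 "inv_exp w A = (\<Sum>(s, t) \<in> {(s, t). s \<in> A \<and> t \<notin> A \<and> t < s \<and> s < length w}. fst (w ! s) * fst (w ! t))"

lemma subword_Nil [simp]: "subword [] A = []"
 by (simp add: subword_def)

lemma subword_Cons: "subword (x # w) A = (if 0 \<in> A then [x] else []) @ subword w {j. Suc j \<in> A}"
proof -
 have "[0..<length (x # w)] = 0 # map Suc [0..<length w]"
  by (simp add: upt_conv_Cons map_Suc_upt del: upt_Suc)
 then show ?thesis
  unfolding subword_def by (simp only: filter.simps filter_map list.map) (simp add: comp_def)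
qed

lemma splits_subword: "splits w (subword w A) (subword w (- A))"
proof (induction w arbitrary: A)
 case (Cons x w)
 have "{j. Suc j \<in> - A} = - {j. Suc j \<in> A}" by auto
 with Cons[of "{j. Suc j \<in> A}"] show ?case
  by (auto simp: subword_Cons splits_def)
qed simp

lemma wdeg_subword: "wdeg (subword w A) = (\<Sum>s\<in>{s. s < length w \<and> s \<in> A}. fst (w ! s))"
proof -
 have "wdeg (subword w A) = sum_list (map (%s. fst (w ! s)) (filter (%i. i \<in> A) [0..<length w]))"
  by (simp add: wdeg_def subword_def comp_def)
 also have "... = (\<Sum>s\<in>set (filter (%i. i \<in> A) [0..<length w]). fst (w ! s))"
  by (intro sum_list_distinct_conv_sum_set) auto
 also have "set (filter (%i. i \<in> A) [0..<length w]) = {s. s < length w \<and> s \<in> A}"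
  by auto
 finally show ?thesis .
qed

text \<open>A first letter that is not chosen is passed by every chosen letter behind it; this is
  the sign in the second branch of \<open>ssum\<close>.\<close>

lemma inv_exp_Cons:
 "inv_exp (x # w) A = inv_exp w {j. Suc j \<in> A} + (if 0 \<in> A then 0 else fst x * wdeg (subword w {j. Suc j \<in> A}))"
proof -
 let ?B = "{j. Suc j \<in> A}" and ?n = "length w"
 let ?S = "{(s, t). s \<in> ?B \<and> t \<notin> ?B \<and> t < s \<and> s < ?n}"
 let ?f = "%(s, t). fst ((x # w) ! s) * fst ((x # w) ! t)"
 have finS: "finite ?S"
  by (rule finite_subset[of _ "{..<?n} \<times> {..<?n}"]) auto
 let ?Z = "(if 0 \<in> A then {} else (%s. (Suc s, 0)) ` {s. s < ?n \<and> s \<in> ?B})"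
 have "{(s, t). s \<in> A \<and> t \<notin> A \<and> t < s \<and> s < length (x # w)} = map_prod Suc Suc ` ?S \<union> ?Z"
 proof (intro Set.set_eqI iffI)
  fix z assume z: "z \<in> {(s, t). s \<in> A \<and> t \<notin> A \<and> t < s \<and> s < length (x # w)}"
  obtain s t where st: "z = (s, t)" by (cases z)
  from z st obtain s' where s': "s = Suc s'" by (cases s) auto
  show "z \<in> map_prod Suc Suc ` ?S \<union> ?Z"
  proof (cases t)
   case 0
   then show ?thesis using z st s' by auto
  next
   case (Suc t')
   then have "z = map_prod Suc Suc (s', t')" "(s', t') \<in> ?S"
    using z st s' by auto
   then show ?thesis by blast
  qed
 qed (auto split: if_splits)
 moreover have "map_prod Suc Suc ` ?S \<inter> ?Z = {}"
  by auto
 ultimately have "inv_exp (x # w) A = sum ?f (map_prod Suc Suc ` ?S) + sum ?f ?Z"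
  unfolding inv_exp_def using finS by (simp only: sum.union_disjoint finite_imageI) (simp add: sum.union_disjoint)
 also have "sum ?f (map_prod Suc Suc ` ?S) = inv_exp w ?B"
  unfolding inv_exp_def by (subst sum.reindex) (auto simp: inj_on_def intro!: sum.cong)
 also have "sum ?f ?Z = (if 0 \<in> A then 0 else fst x * wdeg (subword w ?B))"
  by (auto simp: sum.reindex inj_on_def wdeg_subword sum_distrib_left mult.commute)
 finally show ?thesis .
qed

text \<open>A shuffle is determined by the set of positions that it puts first. The argument is a
  pair because the defining sums range over pairs of \<open>j\<close> and a shuffle.\<close>

definition block :: "nat \<times> (nat => nat) => nat set" where
 "block p = snd p ` {..<fst p}"

text \<open>Both blocks of a shuffle are listed increasingly, and an increasing list is determined
  by its set of entries.\<close>

lemma Sh_lists: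
 assumes "\<sigma> \<in> Sh j n" "j \<le> n"
 shows "map \<sigma> [0..<j] = filter (%i. i \<in> \<sigma> ` {..<j}) [0..<n]"
  and "map \<sigma> [j..<n] = filter (%i. i \<in> - (\<sigma> ` {..<j})) [0..<n]"
proof -
 have \<sigma>: "\<sigma> permutes {..<n}" and m1: "strict_mono_on {..<j} \<sigma>" and m2: "strict_mono_on {j..<n} \<sigma>"
  using assms by (auto simp: Sh_def)
 have inj: "inj \<sigma>" using \<sigma> by (rule permutes_inj)
 have im: "\<sigma> ` {..<n} = {..<n}" using \<sigma> by (rule permutes_image)
 have s1: "sorted_wrt (<) (map \<sigma> [0..<j])"
  using m1 by (auto simp: sorted_wrt_map sorted_wrt_iff_nth_less strict_mono_on_def)
 have s2: "sorted_wrt (<) (map \<sigma> [j..<n])"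
  unfolding sorted_wrt_iff_nth_less
 proof (intro allI impI)
  fix a b assume "a < b" "b < length (map \<sigma> [j..<n])"
  then show "map \<sigma> [j..<n] ! a < map \<sigma> [j..<n] ! b"
   using strict_mono_onD[OF m2, of "j + a" "j + b"] by simp
 qed
 have lt: "\<sigma> i < n" if "i < n" for i
  using im that by blast
 have e1: "set (map \<sigma> [0..<j]) = set (filter (%i. i \<in> \<sigma> ` {..<j}) [0..<n])"
  using lt assms(2) by (auto simp: atLeast0LessThan)
 have e2: "set (map \<sigma> [j..<n]) = set (filter (%i. i \<in> - (\<sigma> ` {..<j})) [0..<n])"
 proof (intro Set.set_eqI iffI)
  fix i assume "i \<in> set (filter (%i. i \<in> - (\<sigma> ` {..<j})) [0..<n])"
  then have i: "i < n" "i \<notin> \<sigma> ` {..<j}" by auto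
  then obtain k where "k < n" "i = \<sigma> k"
   using im by blast
  then have "j \<le> k" using i by (auto simp: image_iff not_less[symmetric])
  then show "i \<in> set (map \<sigma> [j..<n])" using \<open>k < n\<close> \<open>i = \<sigma> k\<close> by auto
 qed (use lt inj in \<open>auto dest: injD\<close>)
 show "map \<sigma> [0..<j] = filter (%i. i \<in> \<sigma> ` {..<j}) [0..<n]"
  by (rule sorted_distinct_set_unique)
   (use s1 e1 in \<open>auto simp: strict_sorted_iff sorted_wrt_filter simp del: set_map set_filter\<close>)
 show "map \<sigma> [j..<n] = filter (%i. i \<in> - (\<sigma> ` {..<j})) [0..<n]"
  by (rule sorted_distinct_set_unique)
   (use s2 e2 in \<open>auto simp: strict_sorted_iff sorted_wrt_filter simp del: set_map set_filter\<close>)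
qed

lemma Sh_subword:
 assumes "\<sigma> \<in> Sh j (length w)" "j \<le> length w"
 shows "take j (permute_list \<sigma> w) = subword w (\<sigma> ` {..<j})"
  and "drop j (permute_list \<sigma> w) = subword w (- (\<sigma> ` {..<j}))"
proof -
 have "permute_list \<sigma> w = map (%i. w ! \<sigma> i) [0..<length w]"
  by (simp add: permute_list_def)
 then have "take j (permute_list \<sigma> w) = map ((!) w) (map \<sigma> [0..<j])"
  and "drop j (permute_list \<sigma> w) = map ((!) w) (map \<sigma> [j..<length w])"
  using assms(2) by (simp_all add: take_map drop_map)
 then show "take j (permute_list \<sigma> w) = subword w (\<sigma> ` {..<j})"
  and "drop j (permute_list \<sigma> w) = subword w (- (\<sigma> ` {..<j}))"
  by (simp_all only: Sh_lists[OF assms] subword_def)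
qed

text \<open>A shuffle is increasing on each block, so an inversion consists of one position in the
  first block and one in the second.\<close>

lemma Sh_inv_exp:
 assumes "\<sigma> \<in> Sh j (length w)" "j \<le> length w"
 shows "(\<Sum>(p, q) \<in> {(p, q). p < q \<and> q < length w \<and> \<sigma> q < \<sigma> p}. fst (w ! \<sigma> p) * fst (w ! \<sigma> q)) =
  inv_exp w (\<sigma> ` {..<j})"
proof -
 let ?n = "length w"
 have \<sigma>: "\<sigma> permutes {..<?n}" and m1: "strict_mono_on {..<j} \<sigma>" and m2: "strict_mono_on {j..<?n} \<sigma>"
  using assms by (auto simp: Sh_def)
 have inj: "\<sigma> a = \<sigma> b \<longleftrightarrow> a = b" for a b
  using permutes_inj[OF \<sigma>] by (auto dest: injD)
 have im: "\<sigma> ` {..<?n} = {..<?n}" using \<sigma> by (rule permutes_image)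
 have "bij_betw (%(p, q). (\<sigma> p, \<sigma> q)) {(p, q). p < q \<and> q < ?n \<and> \<sigma> q < \<sigma> p}
   {(s, t). s \<in> \<sigma> ` {..<j} \<and> t \<notin> \<sigma> ` {..<j} \<and> t < s \<and> s < ?n}"
 proof (rule bij_betwI')
  fix z assume z: "z \<in> {(p, q). p < q \<and> q < ?n \<and> \<sigma> q < \<sigma> p}"
  obtain p q where pq: "z = (p, q)" by (cases z)
  have "\<not> q < j" using z pq strict_mono_onD[OF m1, of p q] by auto
  moreover have "p < j" using z pq strict_mono_onD[OF m2, of p q] by force
  moreover have "\<sigma> p < ?n" using z pq im by (metis (mono_tags, lifting) Product_Type.Collect_case_prodD fst_conv imageI lessThan_iff order.strict_trans snd_conv)
  ultimately show "(case z of (p, q) => (\<sigma> p, \<sigma> q)) \<in> {(s, t). s \<in> \<sigma> ` {..<j} \<and> t \<notin> \<sigma> ` {..<j} \<and> t < s \<and> s < ?n}"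
   using z pq by (auto simp: inj)
 next
  fix z assume z: "z \<in> {(s, t). s \<in> \<sigma> ` {..<j} \<and> t \<notin> \<sigma> ` {..<j} \<and> t < s \<and> s < ?n}"
  obtain s t where st: "z = (s, t)" by (cases z)
  then obtain p where p: "p < j" "s = \<sigma> p" using z by auto
  have "t \<in> \<sigma> ` {..<?n}" using z st unfolding im by auto
  then obtain q where q: "q < ?n" "t = \<sigma> q" by auto
  have "q \<ge> j" using z st q by (auto simp: not_less[symmetric])
  then show "\<exists>x\<in>{(p, q). p < q \<and> q < ?n \<and> \<sigma> q < \<sigma> p}. z = (case x of (p, q) => (\<sigma> p, \<sigma> q))"
   using z st p q by (intro bexI[of _ "(p, q)"]) auto
 qed (auto simp: inj)
 from sum.reindex_bij_betw[OF this, of "%(s, t). fst (w ! s) * fst (w ! t)"]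
 show ?thesis
  by (simp add: inv_exp_def case_prod_beta)
qed

text \<open>Injectivity: the cardinality of the block gives \<open>j\<close>, and
  \<open>Sh_lists\<close> recovers both increasing lists. Surjectivity: list the subset and then its
  complement in increasing order.\<close>

lemma block_bij: "bij_betw block (SIGMA j:{..n}. Sh j n) (Pow {..<n})"
proof (rule bij_betwI')
 fix p q assume p: "p \<in> (SIGMA j:{..n}. Sh j n)" and q: "q \<in> (SIGMA j:{..n}. Sh j n)"
 obtain j \<sigma> where p': "p = (j, \<sigma>)" by (cases p)
 obtain k \<tau> where q': "q = (k, \<tau>)" by (cases q)
 have perm: "\<sigma> permutes {..<n}" "\<tau> permutes {..<n}"
  using p q p' q' by (auto simp: Sh_def)
 show "(block p = block q) = (p = q)"
 proof
  assume eq: "block p = block q"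
  have "card (block p) = j" "card (block q) = k"
   using perm p' q' by (auto simp: block_def card_image permutes_inj_on)
  then have jk: "j = k" using eq by simp
  have S: "\<sigma> \<in> Sh j n" "\<tau> \<in> Sh j n" "j \<le> n"
   using p q p' q' jk by auto
  have "map \<sigma> [0..<j] = map \<tau> [0..<j]" "map \<sigma> [j..<n] = map \<tau> [j..<n]"
   using Sh_lists[OF S(1,3)] Sh_lists[OF S(2,3)] eq p' q' jk by (simp_all only: block_def fst_conv snd_conv)
  then have "\<forall>i\<in>{0..<j}. \<sigma> i = \<tau> i" "\<forall>i\<in>{j..<n}. \<sigma> i = \<tau> i"
   unfolding map_eq_conv by auto
  then have "\<sigma> i = \<tau> i" if "i < n" for i
   using that by (cases "i < j") auto
  moreover have "\<sigma> i = \<tau> i" if "\<not> i < n" for i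
   using that perm by (metis lessThan_iff permutes_not_in)
  ultimately have "\<sigma> = \<tau>" by blast
  with jk p' q' show "p = q" by simp
 qed simp
next
 fix p assume p: "p \<in> (SIGMA j:{..n}. Sh j n)"
 then have "snd p ` {..<fst p} \<subseteq> snd p ` {..<n}" and "snd p permutes {..<n}"
  by (auto simp: Sh_def)
 then show "block p \<in> Pow {..<n}"
  using permutes_image[of "snd p" "{..<n}"] by (simp add: block_def)
next
 fix A assume A: "A \<in> Pow {..<n}"
 then have fin: "finite A" using finite_subset by blast
 let ?a = "sorted_list_of_set A" and ?b = "sorted_list_of_set ({..<n} - A)"
 let ?xs = "?a @ ?b" and ?j = "card A"
 have j: "?j \<le> n"
  using card_mono[of "{..<n}" A] A by simp
 have la: "length ?a = ?j" and lb: "length ?b = n - ?j"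
  using A fin by (simp_all add: card_Diff_subset)
 have len: "length ?xs = n"
  unfolding length_append la lb using j by simp
 have set: "set ?xs = {..<n}" using A fin by auto
 have dist: "distinct ?xs" using fin by auto
 \<comment> \<open>The concatenated list read as a function, and the identity beyond
   \<open>n\<close>, as \<open>permutes\<close> demands.\<close>
 define \<sigma> where "\<sigma> = (%i. if i < n then ?xs ! i else i)"
 have "bij_betw ((!) ?xs) {..<n} {..<n}"
  by (rule bij_betw_nth[OF dist]) (simp_all only: len set)
 then have "bij_betw \<sigma> {..<n} {..<n}"
  by (rule bij_betw_cong[THEN iffD1, rotated]) (simp add: \<sigma>_def)
 then have perm: "\<sigma> permutes {..<n}"
  by (rule bij_imp_permutes) (simp add: \<sigma>_def)
 have n1: "\<sigma> i = ?a ! i" if "i < ?j" for i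
  using that j la unfolding \<sigma>_def nth_append by auto
 have n2: "\<sigma> i = ?b ! (i - ?j)" if "i < n" "\<not> i < ?j" for i
  using that la unfolding \<sigma>_def nth_append by auto
 have "strict_mono_on {..<?j} \<sigma>"
  unfolding strict_mono_on_def using sorted_wrt_nth_less[OF strict_sorted_list_of_set[of A]] la n1
  by (metis lessThan_iff)
 moreover have "strict_mono_on {?j..<n} \<sigma>"
 proof (rule strict_mono_onI)
  fix r s assume rs: "r \<in> {?j..<n}" "s \<in> {?j..<n}" "r < s"
  then have "?b ! (r - ?j) < ?b ! (s - ?j)"
   by (intro sorted_wrt_nth_less[OF strict_sorted_list_of_set]) (auto simp only: lb atLeastLessThan_iff)
  then show "\<sigma> r < \<sigma> s"
   using rs n2[of r] n2[of s] by auto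
 qed
 ultimately have "(?j, \<sigma>) \<in> (SIGMA j:{..n}. Sh j n)"
  using perm j by (simp add: Sh_def)
 moreover have "block (?j, \<sigma>) = A"
 proof -
  have "block (?j, \<sigma>) = \<sigma> ` {..<?j}"
   by (simp add: block_def)
  also have "... = (!) ?a ` {..<length ?a}"
   unfolding la by (intro image_cong refl) (simp add: n1)
  also have "... = set ?a"
   by (simp add: nth_image[of "length ?a" ?a, simplified] lessThan_atLeast0)
  finally show ?thesis using fin by simp
 qed
 ultimately show "\<exists>p\<in>(SIGMA j:{..n}. Sh j n). A = block p" by blast
qed

context ground
begin

text \<open>Subsets containing position 0 give the branch of \<open>ssum\<close> with the first
  letter on the left, the remaining subsets the branch with it on the right.\<close>

lemma finsum_Pow_ssum:
 fixes P :: "('k, 'p) module"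
 assumes P [simp]: "module R P" and "!!a b. splits w a b ==> G a b \<in> carrier P"
 shows "finsum P (%A. ks (inv_exp w A) \<odot>[P] G (subword w A) (subword w (- A))) (Pow {..<length w}) = ss P w G"
 using assms(2)
proof (induction w arbitrary: G)
 case Nil
 then have "G [] [] \<in> carrier P" by simp
 then show ?case
  using m_finsum_insert[OF P, of "{}" "{}" "%A. ks (inv_exp [] A) \<odot>[P] G [] []"] by (simp add: inv_exp_def)
next
 case (Cons x w)
 let ?n = "length w"
 let ?T = "%A. ks (inv_exp (x # w) A) \<odot>[P] G (subword (x # w) A) (subword (x # w) (- A))"
 let ?f = "%B. insert 0 (Suc ` B)" and ?g = "%B. Suc ` B :: nat set"
 have T: "?T A \<in> carrier P" for A
  using Cons.prems[OF splits_subword] by simp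
 have Pow: "Pow {..<length (x # w)} = ?f ` Pow {..<?n} \<union> ?g ` Pow {..<?n}"
 proof (intro Set.set_eqI iffI)
  fix A assume A: "A \<in> Pow {..<length (x # w)}"
  let ?B = "{j. Suc j \<in> A}"
  have "?B \<in> Pow {..<?n}" using A by auto
  moreover have "A = (if 0 \<in> A then ?f ?B else ?g ?B)"
   by (auto simp: image_iff) (metis not0_implies_Suc)+
  ultimately show "A \<in> ?f ` Pow {..<?n} \<union> ?g ` Pow {..<?n}"
   by (metis (no_types, lifting) UnI1 UnI2 image_eqI)
 qed auto
 have inj: "inj_on ?f (Pow {..<?n})" "inj_on ?g (Pow {..<?n})"
 proof -
  show "inj_on ?f (Pow {..<?n})"
  proof (rule inj_onI)
   fix B C :: "nat set" assume "?f B = ?f C"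
   then have "?f B - {0} = ?f C - {0}" by simp
   then show "B = C" by (auto simp: inj_image_eq_iff)
  qed
  show "inj_on ?g (Pow {..<?n})"
   by (auto simp: inj_on_def inj_image_eq_iff)
 qed
 have B: "{j. Suc j \<in> ?f B} = B" "{j. Suc j \<in> - ?f B} = - B" "{j. Suc j \<in> ?g B} = B" "{j. Suc j \<in> - ?g B} = - B"
  "{j. Suc j \<notin> Suc ` B} = - B" for B
  by auto
 have "finsum P ?T (Pow {..<length (x # w)}) = finsum P ?T (?f ` Pow {..<?n}) \<oplus>[P] finsum P ?T (?g ` Pow {..<?n})"
  unfolding Pow using T by (intro m_finsum_Un) auto
 also have "finsum P ?T (?f ` Pow {..<?n}) = finsum P (%B. ?T (?f B)) (Pow {..<?n})"
  using inj T by (intro m_finsum_reindex) auto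
 also have "... = ss P w (%a b. G (x # a) b)"
  using Cons.prems by (subst Cons.IH[symmetric]) (auto simp: inv_exp_Cons subword_Cons B)
 also have "finsum P ?T (?g ` Pow {..<?n}) = finsum P (%B. ?T (?g B)) (Pow {..<?n})"
  using inj T by (intro m_finsum_reindex) auto
 also have "... = ss P w (%a b. ks (fst x * wdeg a) \<odot>[P] G a (x # b))"
 proof -
  have "splits (x # w) (subword w B) (x # subword w (- B))" for B
   using splits_subword[of w B] by simp
  then have G: "G (subword w B) (x # subword w (- B)) \<in> carrier P" for B
   by (rule Cons.prems)
  have "finsum P (%B. ?T (?g B)) (Pow {..<?n}) = finsum P (%B. ks (inv_exp w B) \<odot>[P]
    (ks (fst x * wdeg (subword w B)) \<odot>[P] G (subword w B) (x # subword w (- B)))) (Pow {..<?n})"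
   using G by (intro m_finsum_cong) (auto simp: inv_exp_Cons subword_Cons B m_ksign_ksign)
  also have "... = ss P w (%a b. ks (fst x * wdeg a) \<odot>[P] G a (x # b))"
   using Cons.prems by (intro Cons.IH) auto
  finally show ?thesis .
 qed
 finally show ?case by simp
qed

text \<open>The bridge from the shuffles in \<open>comult\<close> and \<open>vfield_of\<close> to
  the recursive sum.\<close>

lemma finsum_Sh:
 fixes P :: "('k, 'p) module"
 assumes P [simp]: "module R P" and G: "!!a b. splits w a b ==> G a b \<in> carrier P"
 shows "finsum P (%(j, \<sigma>). koszul R w \<sigma> \<odot>[P] G (take j (permute_list \<sigma> w)) (drop j (permute_list \<sigma> w)))
  (SIGMA j:{..length w}. Sh j (length w)) = ss P w G"
proof -
 let ?T = "%A. ks (inv_exp w A) \<odot>[P] G (subword w A) (subword w (- A))"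
 let ?S = "SIGMA j:{..length w}. Sh j (length w)"
 have T: "?T A \<in> carrier P" for A
  using G[OF splits_subword] by simp
 have "finsum P (%(j, \<sigma>). koszul R w \<sigma> \<odot>[P] G (take j (permute_list \<sigma> w)) (drop j (permute_list \<sigma> w))) ?S =
   finsum P (%p. ?T (block p)) ?S"
  using T by (intro m_finsum_cong) (auto simp: koszul_def Sh_subword Sh_inv_exp block_def)
 also have "... = finsum P ?T (block ` ?S)"
  using T block_bij by (intro m_finsum_reindex[symmetric]) (auto simp: bij_betw_def)
 also have "... = ss P w G"
  using block_bij[of "length w"] finsum_Pow_ssum[OF P G] by (simp add: bij_betw_def)
 finally show ?thesis .
qed

end

definition gl :: "'k ring => ('k, 'a) gmod => ('k, 'b) gmod => int => (int => 'a => 'b) => bool" where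
 "gl R A B j \<phi> \<longleftrightarrow> (\<forall>d. mlin R (A d) (B (d + j)) (\<phi> d))"

definition bilin :: "'k ring => ('k, 'a) gmod => ('k, 'b) gmod => ('k, 'p) module => int => (int => 'a => int => 'b => 'p) => bool" where
 "bilin R A B P d h \<longleftrightarrow> (\<forall>i j. i + j = d \<longrightarrow> (\<forall>y\<in>carrier (B j). mlin R (A i) P (%x. h i x j y)) \<and>
   (\<forall>x\<in>carrier (A i). mlin R (B j) P (%y. h i x j y)))"

definition stens :: "'k ring => ('k, 'w) gmod => 'w word => 'w word => ('k, ('k, 'w) sym, ('k, 'w) sym) tens" where
 "stens R W a b = tens R (Sym R W) (Sym R W) (wdeg a) (smon R W a) (wdeg b) (smon R W b)"

abbreviation "SymTens R W \<equiv> tensor R (Sym R W) (Sym R W)"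

lemma graded_maps_iff: "\<phi> \<in> graded_maps R A B j \<longleftrightarrow> (\<forall>d. \<phi> d \<in> extensional (carrier (A d))) \<and> gl R A B j \<phi>"
 by (auto simp: graded_maps_def lin_maps_iff gl_def)

context ground
begin

abbreviation (input) "ST == %W. SymTens R W"

lemma glD: "gl R A B j \<phi> ==> e = d + j ==> lin (A d) (B e) (\<phi> d)"
 by (simp add: gl_def)

lemma gl_closed: "gl R A B j \<phi> ==> x \<in> carrier (A d) ==> e = d + j ==> \<phi> d x \<in> carrier (B e)"
 by (metis glD mlin_closed)

context
 fixes X :: "'x set" and S :: "('x => 'k) set"
 assumes S: "S \<subseteq> carrier (fr X)"
begin

lemma pres_gen_rel_add:
 assumes "bv a \<ominus>[fr X] (bv b \<oplus>[fr X] bv c) \<in> S" "a \<in> X" "b \<in> X" "c \<in> X"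
 shows "pres_gen R X S a = pres_gen R X S b \<oplus>[pres_mod R X S] pres_gen R X S c"
proof -
 note F = free_mod_module[of X] and P = pres_mod_module[OF S] and c = mlin_coset[OF S]
 have cl: "coset X S (bv x) \<in> carrier (pres_mod R X S)" if "x \<in> X" for x
  using that by (intro mlin_closed[OF c]) simp
 have "coset X S (bv a \<ominus>[fr X] (bv b \<oplus>[fr X] bv c)) =
  coset X S (bv a) \<ominus>[pres_mod R X S] (coset X S (bv b) \<oplus>[pres_mod R X S] coset X S (bv c))"
  using assms(2-) F by (simp add: mlin_minus[OF F P c] mlin_add[OF c])
 then have "coset X S (bv a) \<ominus>[pres_mod R X S]
   (coset X S (bv b) \<oplus>[pres_mod R X S] coset X S (bv c)) = \<zero>[pres_mod R X S]"
  by (rule trans[OF sym]) (rule pres_rel[OF S assms(1)])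
 then show ?thesis
  using assms(2-) P cl by (simp add: pres_gen_eq[OF S] m_minus_zero_iff)
qed

lemma pres_gen_rel_smult:
 assumes "bv a \<ominus>[fr X] (k \<odot>[fr X] bv b) \<in> S" "a \<in> X" "b \<in> X" "k \<in> carrier R"
 shows "pres_gen R X S a = k \<odot>[pres_mod R X S] pres_gen R X S b"
proof -
 note F = free_mod_module[of X] and P = pres_mod_module[OF S] and c = mlin_coset[OF S]
 have cl: "coset X S (bv x) \<in> carrier (pres_mod R X S)" if "x \<in> X" for x
  using that by (intro mlin_closed[OF c]) simp
 have "coset X S (bv a \<ominus>[fr X] (k \<odot>[fr X] bv b)) =
  coset X S (bv a) \<ominus>[pres_mod R X S] (k \<odot>[pres_mod R X S] coset X S (bv b))"
  using assms(2-) F by (simp add: mlin_minus[OF F P c] mlin_smult[OF c])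
 then have "coset X S (bv a) \<ominus>[pres_mod R X S]
   (k \<odot>[pres_mod R X S] coset X S (bv b)) = \<zero>[pres_mod R X S]"
  by (rule trans[OF sym]) (rule pres_rel[OF S assms(1)])
 then show ?thesis
  using assms(2-) P cl by (simp add: pres_gen_eq[OF S] m_minus_zero_iff)
qed

end

lemma free_ext_rel_add:
 fixes P :: "('k, 'p) module"
 assumes P: "module R P" and \<phi>: "\<phi> \<in> X \<rightarrow> carrier P" and X: "a \<in> X" "b \<in> X" "c \<in> X"
  and eq: "\<phi> a = \<phi> b \<oplus>[P] \<phi> c"
 shows "free_ext R P \<phi> (bv a \<ominus>[fr X] (bv b \<oplus>[fr X] bv c)) = \<zero>[P]"
proof -
 have "\<phi> b \<oplus>[P] \<phi> c \<in> carrier P"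
  using P \<phi> X funcset_mem[OF \<phi>] by simp
 then show ?thesis
  using P X free_mod_module[of X]
  by (simp add: mlin_minus[OF free_mod_module P mlin_free_ext[OF P \<phi>]] mlin_add[OF mlin_free_ext[OF P \<phi>]]
    free_ext_basis[OF P \<phi>] eq m_minus_zero_iff)
qed

lemma free_ext_rel_smult:
 fixes P :: "('k, 'p) module"
 assumes P: "module R P" and \<phi>: "\<phi> \<in> X \<rightarrow> carrier P" and X: "a \<in> X" "b \<in> X" "k \<in> carrier R"
  and eq: "\<phi> a = k \<odot>[P] \<phi> b"
 shows "free_ext R P \<phi> (bv a \<ominus>[fr X] (k \<odot>[fr X] bv b)) = \<zero>[P]"
proof -
 have "k \<odot>[P] \<phi> b \<in> carrier P"
  using P \<phi> X funcset_mem[OF \<phi>] by simp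
 then show ?thesis
  using P X free_mod_module[of X]
  by (simp add: mlin_minus[OF free_mod_module P mlin_free_ext[OF P \<phi>]] mlin_smult[OF mlin_free_ext[OF P \<phi>]]
    free_ext_basis[OF P \<phi>] eq m_minus_zero_iff)
qed

subsection \<open>The graded symmetric module\<close>

context
 fixes W :: "('k, 'w) gmod"
 assumes W [simp]: "gr W"
begin

lemma sym_rels_carrier: "sym_rels R W d \<subseteq> carrier (fr (words_of_deg W d))"
proof -
 let ?X = "words_of_deg W d"
 note F = free_mod_module[of ?X]
 have X: "u @ (i, x \<oplus>[W i] y) # v \<in> ?X" if "u @ (i, x) # v \<in> ?X" "u @ (i, y) # v \<in> ?X" for u v i x y
  using that by (auto simp: words_of_deg_def)
 have Y: "u @ (i, a \<odot>[W i] x) # v \<in> ?X" if "u @ (i, x) # v \<in> ?X" "a \<in> carrier R" for u v i x a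
  using that by (auto simp: words_of_deg_def)
 have Z: "u @ (j, y) # (i, x) # v \<in> ?X" if "u @ (i, x) # (j, y) # v \<in> ?X" for u v i x j y
  using that by (auto simp: words_of_deg_def)
 show ?thesis
  unfolding sym_rels_def Let_def
  by (auto intro!: m_minus[OF F] m_add[OF F] m_smult[OF F] basis_vec_closed intro: X Y Z)
qed

lemma sym_rels_mem:
 "[|u @ (i, x) # v \<in> words_of_deg W d; u @ (i, y) # v \<in> words_of_deg W d|] ==>
  bv (u @ (i, x \<oplus>[W i] y) # v) \<ominus>[fr (words_of_deg W d)]
   (bv (u @ (i, x) # v) \<oplus>[fr (words_of_deg W d)] bv (u @ (i, y) # v)) \<in> sym_rels R W d"
 "[|a \<in> carrier R; u @ (i, x) # v \<in> words_of_deg W d|] ==>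
  bv (u @ (i, a \<odot>[W i] x) # v) \<ominus>[fr (words_of_deg W d)]
   (a \<odot>[fr (words_of_deg W d)] bv (u @ (i, x) # v)) \<in> sym_rels R W d"
 "u @ (i, x) # (j, y) # v \<in> words_of_deg W d ==>
  bv (u @ (i, x) # (j, y) # v) \<ominus>[fr (words_of_deg W d)]
   (ks (i * j) \<odot>[fr (words_of_deg W d)] bv (u @ (j, y) # (i, x) # v)) \<in> sym_rels R W d"
 unfolding sym_rels_def Let_def
 subgoal by (rule UnI1, rule UnI1, rule CollectI, intro exI conjI, rule refl)
 subgoal by (rule UnI1, rule UnI2, rule CollectI, intro exI conjI, rule refl)
 subgoal by (rule UnI2, rule CollectI, intro exI conjI, rule refl)
 done

lemma gm_Sym [simp]: "gr (Sy W)"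
 by (rule gmI) (simp add: Sym_def pres_mod_module sym_rels_carrier)

lemma smon_closed: "w \<in> words W ==> d = wdeg w ==> sm W w \<in> carrier (Sy W d)"
 unfolding smon_def Sym_def by (simp, rule pres_gen_closed[OF sym_rels_carrier]) (simp add: words_of_deg_def)

lemma smon_symfun: "symf W (Sy W) (sm W)"
proof (rule symfunI)
 show "sm W w \<in> carrier (Sy W (wdeg w))" if "w \<in> words W" for w
  using that by (simp add: smon_closed)
 show "sm W (u @ (i, x \<oplus>[W i] y) # v) =
   sm W (u @ (i, x) # v) \<oplus>[Sy W (wdeg u + (i + wdeg v))] sm W (u @ (i, y) # v)"
  if "u \<in> words W" "v \<in> words W" "x \<in> carrier (W i)" "y \<in> carrier (W i)" for u v i x y
  unfolding smon_def Sym_def wdeg_simps fst_conv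
  by (rule pres_gen_rel_add[OF sym_rels_carrier sym_rels_mem(1)])
   (use that in \<open>auto simp: words_of_deg_def\<close>)
 show "sm W (u @ (i, a \<odot>[W i] x) # v) =
   a \<odot>[Sy W (wdeg u + (i + wdeg v))] sm W (u @ (i, x) # v)"
  if "u \<in> words W" "v \<in> words W" "x \<in> carrier (W i)" "a \<in> carrier R" for u v i x a
  unfolding smon_def Sym_def wdeg_simps fst_conv
  by (rule pres_gen_rel_smult[OF sym_rels_carrier sym_rels_mem(2)])
   (use that in \<open>auto simp: words_of_deg_def\<close>)
 show "sm W (u @ (i, x) # (j, y) # v) =
   ks (i * j) \<odot>[Sy W (wdeg u + (i + (j + wdeg v)))] sm W (u @ (j, y) # (i, x) # v)"
  if "u \<in> words W" "v \<in> words W" "x \<in> carrier (W i)" "y \<in> carrier (W j)" for u v i j x y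
  unfolding smon_def Sym_def wdeg_simps fst_conv add.left_commute[of j i]
  by (rule pres_gen_rel_smult[OF sym_rels_carrier sym_rels_mem(3)])
   (use that in \<open>auto simp: words_of_deg_def\<close>)
qed

text \<open>The universal property of S(W) in one degree. The function \<open>\<psi>\<close> is
  separate because the defining formulas mention the fixed degree \<open>d\<close> where a symmetric
  function has to mention \<open>wdeg w\<close>; the two agree on words of degree
  \<open>d\<close>.\<close>

lemma sym_lift:
 assumes \<phi>: "symf W P \<phi>" and P: "module R (P d)"
  and eq: "!!w. w \<in> words W ==> wdeg w = d ==> \<psi> w = \<phi> w"
 shows "lin (Sy W d) (P d) (pres_lift R (P d) \<psi>)"
  and "w \<in> words W ==> wdeg w = d ==> pres_lift R (P d) \<psi> (sm W w) = \<phi> w"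
proof -
 let ?X = "words_of_deg W d"
 have \<psi>: "\<psi> \<in> ?X \<rightarrow> carrier (P d)"
  using symfun_closed[OF \<phi>] eq by (auto simp: words_of_deg_def)
 have eq': "w \<in> ?X ==> \<psi> w = \<phi> w" for w
  using eq by (simp add: words_of_deg_def)
 have rel: "free_ext R (P d) \<psi> r = \<zero>[P d]" if "r \<in> sym_rels R W d" for r
  using that unfolding sym_rels_def Let_def
 proof (elim UnE CollectE exE conjE; hypsubst)
  fix u v i x y assume a: "u @ (i, x) # v \<in> ?X" "u @ (i, y) # v \<in> ?X"
  then have X: "u @ (i, x \<oplus>[W i] y) # v \<in> ?X"
   by (auto simp: words_of_deg_def)
  show "free_ext R (P d) \<psi> (bv (u @ (i, x \<oplus>[W i] y) # v) \<ominus>[fr ?X]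
    (bv (u @ (i, x) # v) \<oplus>[fr ?X] bv (u @ (i, y) # v))) = \<zero>[P d]"
   by (rule free_ext_rel_add[OF P \<psi> X a])
    (unfold eq'[OF X] eq'[OF a(1)] eq'[OF a(2)], rule symfun_add[OF \<phi>], use a in \<open>auto simp: words_of_deg_def\<close>)
 next
  fix u v i x a assume a: "a \<in> carrier R" "u @ (i, x) # v \<in> ?X"
  then have X: "u @ (i, a \<odot>[W i] x) # v \<in> ?X"
   by (auto simp: words_of_deg_def)
  show "free_ext R (P d) \<psi> (bv (u @ (i, a \<odot>[W i] x) # v) \<ominus>[fr ?X]
    (a \<odot>[fr ?X] bv (u @ (i, x) # v))) = \<zero>[P d]"
   by (rule free_ext_rel_smult[OF P \<psi> X a(2,1)])
    (unfold eq'[OF X] eq'[OF a(2)], rule symfun_smult[OF \<phi>], use a in \<open>auto simp: words_of_deg_def\<close>)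
 next
  fix u v i x j y assume a: "u @ (i, x) # (j, y) # v \<in> ?X"
  then have X: "u @ (j, y) # (i, x) # v \<in> ?X"
   by (auto simp: words_of_deg_def)
  show "free_ext R (P d) \<psi> (bv (u @ (i, x) # (j, y) # v) \<ominus>[fr ?X]
    (ks (i * j) \<odot>[fr ?X] bv (u @ (j, y) # (i, x) # v))) = \<zero>[P d]"
   by (rule free_ext_rel_smult[OF P \<psi> a X ksign_closed])
    (unfold eq'[OF X] eq'[OF a], rule symfun_swap[OF \<phi>], use a in \<open>auto simp: words_of_deg_def\<close>)
 qed
 show "lin (Sy W d) (P d) (pres_lift R (P d) \<psi>)"
  unfolding Sym_def by (rule pres_lift[OF sym_rels_carrier P \<psi> rel])
 show "pres_lift R (P d) \<psi> (sm W w) = \<phi> w" if "w \<in> words W" "wdeg w = d"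
  using that pres_lift(2)[OF sym_rels_carrier P \<psi> rel, of w] eq
  by (auto simp: smon_def words_of_deg_def)
qed

lemma sym_ext:
 fixes P :: "('k, 'p) module"
 assumes "module R P" "lin (Sy W d) P h" "lin (Sy W d) P h'"
  and "!!w. w \<in> words W ==> wdeg w = d ==> h (sm W w) = h' (sm W w)"
  and "x \<in> carrier (Sy W d)"
 shows "h x = h' x"
proof (rule mlin_ext_pres[OF sym_rels_carrier assms(1) assms(2)[unfolded Sym_def] assms(3)[unfolded Sym_def] _
  assms(5)[unfolded Sym_def]])
 fix w assume "w \<in> words_of_deg W d"
 then have w: "w \<in> words W" "wdeg w = d"
  by (simp_all add: words_of_deg_def)
 from assms(4)[OF w] w(2)
 show "h (pres_gen R (words_of_deg W d) (sym_rels R W d) w) = h' (pres_gen R (words_of_deg W d) (sym_rels R W d) w)"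
  unfolding smon_def by (simp only:)
qed

lemma sym_induct [consumes 1, case_names zero step]:
 assumes "x \<in> carrier (Sy W d)" "Q \<zero>[Sy W d]"
  and "!!a w x. [|a \<in> carrier R; w \<in> words W; wdeg w = d; x \<in> carrier (Sy W d); Q x|] ==>
   Q (a \<odot>[Sy W d] sm W w \<oplus>[Sy W d] x)"
 shows "Q x"
proof (rule pres_induct[OF sym_rels_carrier, where Q = Q])
 show "x \<in> carrier (pres_mod R (words_of_deg W d) (sym_rels R W d))"
  using assms(1) by (simp add: Sym_def)
 show "Q \<zero>[pres_mod R (words_of_deg W d) (sym_rels R W d)]"
  using assms(2) by (simp add: Sym_def)
 show "Q (a \<odot>[pres_mod R (words_of_deg W d) (sym_rels R W d)]
    pres_gen R (words_of_deg W d) (sym_rels R W d) w \<oplus>[pres_mod R (words_of_deg W d) (sym_rels R W d)] y)"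
  if "a \<in> carrier R" "w \<in> words_of_deg W d" "y \<in> carrier (pres_mod R (words_of_deg W d) (sym_rels R W d))" "Q y"
  for a w y
  using assms(3)[of a w y] that by (auto simp: Sym_def smon_def words_of_deg_def)
qed

end

subsection \<open>Tensor products\<close>

context
 fixes A :: "('k, 'a) gmod" and B :: "('k, 'b) gmod"
 assumes A [simp]: "gr A" and B [simp]: "gr B"
begin

lemma tens_rels_carrier: "tens_rels R A B d \<subseteq> carrier (fr (tens_pairs A B d))"
 unfolding tens_rels_def Let_def
 by (auto intro!: m_minus m_add m_smult basis_vec_closed free_mod_module) (auto simp: tens_pairs_def)

lemma gm_tensor [simp]: "gr (tensor R A B)"
 by (rule gmI) (simp add: tensor_def pres_mod_module tens_rels_carrier)

lemma tens_closed:
 "[|x \<in> carrier (A i); y \<in> carrier (B j); d = i + j|] ==> tens R A B i x j y \<in> carrier (tensor R A B d)"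
 unfolding tens_def tensor_def by (simp, rule pres_gen_closed[OF tens_rels_carrier]) (simp add: tens_pairs_def)

lemma tens_rels_mem:
 "[|((i, x), (j, y)) \<in> tens_pairs A B d; ((i, x'), (j, y)) \<in> tens_pairs A B d|] ==>
  bv ((i, x \<oplus>[A i] x'), (j, y)) \<ominus>[fr (tens_pairs A B d)]
   (bv ((i, x), (j, y)) \<oplus>[fr (tens_pairs A B d)] bv ((i, x'), (j, y))) \<in> tens_rels R A B d"
 "[|((i, x), (j, y)) \<in> tens_pairs A B d; ((i, x), (j, y')) \<in> tens_pairs A B d|] ==>
  bv ((i, x), (j, y \<oplus>[B j] y')) \<ominus>[fr (tens_pairs A B d)]
   (bv ((i, x), (j, y)) \<oplus>[fr (tens_pairs A B d)] bv ((i, x), (j, y'))) \<in> tens_rels R A B d"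
 "[|a \<in> carrier R; ((i, x), (j, y)) \<in> tens_pairs A B d|] ==>
  bv ((i, a \<odot>[A i] x), (j, y)) \<ominus>[fr (tens_pairs A B d)]
   (a \<odot>[fr (tens_pairs A B d)] bv ((i, x), (j, y))) \<in> tens_rels R A B d"
 "[|a \<in> carrier R; ((i, x), (j, y)) \<in> tens_pairs A B d|] ==>
  bv ((i, x), (j, a \<odot>[B j] y)) \<ominus>[fr (tens_pairs A B d)]
   (a \<odot>[fr (tens_pairs A B d)] bv ((i, x), (j, y))) \<in> tens_rels R A B d"
 unfolding tens_rels_def Let_def
 subgoal by (rule UnI1, rule UnI1, rule UnI1, rule CollectI, intro exI conjI, rule refl)
 subgoal by (rule UnI1, rule UnI1, rule UnI2, rule CollectI, intro exI conjI, rule refl)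
 subgoal by (rule UnI1, rule UnI2, rule CollectI, intro exI conjI, rule refl)
 subgoal by (rule UnI2, rule CollectI, intro exI conjI, rule refl)
 done

lemma tens_mlin_left: "y \<in> carrier (B j) ==> d = i + j ==> lin (A i) (tensor R A B d) (%x. tens R A B i x j y)"
proof (rule mlinI)
 assume y: "y \<in> carrier (B j)" and d: "d = i + j"
 show "tens R A B i x j y \<in> carrier (tensor R A B d)" if "x \<in> carrier (A i)" for x
  using that y d by (rule tens_closed)
 show "tens R A B i (x \<oplus>[A i] x') j y = tens R A B i x j y \<oplus>[tensor R A B d] tens R A B i x' j y"
  if "x \<in> carrier (A i)" "x' \<in> carrier (A i)" for x x'
  unfolding tens_def tensor_def d by (rule pres_gen_rel_add[OF tens_rels_carrier tens_rels_mem(1)])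
   (use that y in \<open>auto simp: tens_pairs_def\<close>)
 show "tens R A B i (a \<odot>[A i] x) j y = a \<odot>[tensor R A B d] tens R A B i x j y"
  if "a \<in> carrier R" "x \<in> carrier (A i)" for a x
  unfolding tens_def tensor_def d by (rule pres_gen_rel_smult[OF tens_rels_carrier tens_rels_mem(3)])
   (use that y in \<open>auto simp: tens_pairs_def\<close>)
qed

lemma tens_mlin_right: "x \<in> carrier (A i) ==> d = i + j ==> lin (B j) (tensor R A B d) (%y. tens R A B i x j y)"
proof (rule mlinI)
 assume x: "x \<in> carrier (A i)" and d: "d = i + j"
 show "tens R A B i x j y \<in> carrier (tensor R A B d)" if "y \<in> carrier (B j)" for y
  using x that d by (rule tens_closed)
 show "tens R A B i x j (y \<oplus>[B j] y') = tens R A B i x j y \<oplus>[tensor R A B d] tens R A B i x j y'"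
  if "y \<in> carrier (B j)" "y' \<in> carrier (B j)" for y y'
  unfolding tens_def tensor_def d by (rule pres_gen_rel_add[OF tens_rels_carrier tens_rels_mem(2)])
   (use that x in \<open>auto simp: tens_pairs_def\<close>)
 show "tens R A B i x j (a \<odot>[B j] y) = a \<odot>[tensor R A B d] tens R A B i x j y"
  if "a \<in> carrier R" "y \<in> carrier (B j)" for a y
  unfolding tens_def tensor_def d by (rule pres_gen_rel_smult[OF tens_rels_carrier tens_rels_mem(4)])
   (use that x in \<open>auto simp: tens_pairs_def\<close>)
qed

lemma tens_lift:
 fixes P :: "('k, 'p) module"
 assumes h: "bilin R A B P d h" and P: "module R P"
 shows "lin (tensor R A B d) P (pres_lift R P (%((i, x), (j, y)). h i x j y))"
  and "[|x \<in> carrier (A i); y \<in> carrier (B j); i + j = d|] ==>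
   pres_lift R P (%((i, x), (j, y)). h i x j y) (tens R A B i x j y) = h i x j y"
proof -
 let ?X = "tens_pairs A B d" and ?\<phi> = "%((i, x), (j, y)). h i x j y"
 have l: "lin (A i) P (%x. h i x j y)" if "i + j = d" "y \<in> carrier (B j)" for i j y
  using h that by (auto simp: bilin_def)
 have r: "lin (B j) P (%y. h i x j y)" if "i + j = d" "x \<in> carrier (A i)" for i j x
  using h that by (auto simp: bilin_def)
 have \<phi>: "?\<phi> \<in> ?X \<rightarrow> carrier P"
  using l by (auto simp: tens_pairs_def mlin_def)
 have rel: "free_ext R P ?\<phi> r = \<zero>[P]" if "r \<in> tens_rels R A B d" for r
  using that unfolding tens_rels_def Let_def
 proof (elim UnE CollectE exE conjE; hypsubst)
  fix i x x' j y assume "((i, x), (j, y)) \<in> ?X" "((i, x'), (j, y)) \<in> ?X"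
  then show "free_ext R P ?\<phi> (bv ((i, x \<oplus>[A i] x'), (j, y)) \<ominus>[fr ?X]
    (bv ((i, x), (j, y)) \<oplus>[fr ?X] bv ((i, x'), (j, y)))) = \<zero>[P]"
   by (intro free_ext_rel_add[OF P \<phi>]) (auto simp: tens_pairs_def mlin_add[OF l])
 next
  fix i x j y y' assume "((i, x), (j, y)) \<in> ?X" "((i, x), (j, y')) \<in> ?X"
  then show "free_ext R P ?\<phi> (bv ((i, x), (j, y \<oplus>[B j] y')) \<ominus>[fr ?X]
    (bv ((i, x), (j, y)) \<oplus>[fr ?X] bv ((i, x), (j, y')))) = \<zero>[P]"
   by (intro free_ext_rel_add[OF P \<phi>]) (auto simp: tens_pairs_def mlin_add[OF r])
 next
  fix i x j y a assume "((i, x), (j, y)) \<in> ?X" "a \<in> carrier R"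
  then show "free_ext R P ?\<phi> (bv ((i, a \<odot>[A i] x), (j, y)) \<ominus>[fr ?X]
    (a \<odot>[fr ?X] bv ((i, x), (j, y)))) = \<zero>[P]"
   by (intro free_ext_rel_smult[OF P \<phi>]) (auto simp: tens_pairs_def mlin_smult[OF l])
 next
  fix i x j y a assume "((i, x), (j, y)) \<in> ?X" "a \<in> carrier R"
  then show "free_ext R P ?\<phi> (bv ((i, x), (j, a \<odot>[B j] y)) \<ominus>[fr ?X]
    (a \<odot>[fr ?X] bv ((i, x), (j, y)))) = \<zero>[P]"
   by (intro free_ext_rel_smult[OF P \<phi>]) (auto simp: tens_pairs_def mlin_smult[OF r])
 qed
 show "lin (tensor R A B d) P (pres_lift R P ?\<phi>)"
  unfolding tensor_def by (rule pres_lift[OF tens_rels_carrier P \<phi> rel])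
 show "pres_lift R P ?\<phi> (tens R A B i x j y) = h i x j y"
  if "x \<in> carrier (A i)" "y \<in> carrier (B j)" "i + j = d"
  using that pres_lift(2)[OF tens_rels_carrier P \<phi> rel, of "((i, x), (j, y))"]
  by (auto simp: tens_def tens_pairs_def)
qed

lemma tens_ext:
 fixes P :: "('k, 'p) module"
 assumes "module R P" "lin (tensor R A B d) P h" "lin (tensor R A B d) P h'"
  and "!!i x j y. [|x \<in> carrier (A i); y \<in> carrier (B j); i + j = d|] ==> h (tens R A B i x j y) = h' (tens R A B i x j y)"
  and "t \<in> carrier (tensor R A B d)"
 shows "h t = h' t"
proof (rule mlin_ext_pres[OF tens_rels_carrier assms(1) assms(2)[unfolded tensor_def] assms(3)[unfolded tensor_def] _
  assms(5)[unfolded tensor_def]])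
 fix p assume "p \<in> tens_pairs A B d"
 then obtain i x j y where p: "p = ((i, x), (j, y))" and xy: "x \<in> carrier (A i)" "y \<in> carrier (B j)" "i + j = d"
  by (auto simp: tens_pairs_def)
 from assms(4)[OF xy] xy(3)
 show "h (pres_gen R (tens_pairs A B d) (tens_rels R A B d) p) = h' (pres_gen R (tens_pairs A B d) (tens_rels R A B d) p)"
  unfolding tens_def p by (simp only:)
qed

end

lemma tens_map:
 fixes A :: "('k, 'a) gmod" and B :: "('k, 'b) gmod" and A' :: "('k, 'c) gmod" and B' :: "('k, 'd) gmod"
 assumes [simp]: "gr A" "gr B" "gr A'" "gr B'"
  and \<phi>: "gl R A A' p \<phi>" and \<psi>: "gl R B B' q \<psi>"
 shows "e = d + p + q ==> lin (tensor R A B d) (tensor R A' B' e) (tens_map R A' B' p \<phi> q \<psi> d)"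
  and "[|x \<in> carrier (A i); y \<in> carrier (B j); i + j = d; e = d + p + q|] ==>
   tens_map R A' B' p \<phi> q \<psi> d (tens R A B i x j y) =
   ks (q * i) \<odot>[tensor R A' B' e] tens R A' B' (i + p) (\<phi> i x) (j + q) (\<psi> j y)"
proof -
 let ?T = "tensor R A' B' (d + p + q)"
 have b: "bilin R A B ?T d (%i x j y. ks (q * i) \<odot>[?T] tens R A' B' (i + p) (\<phi> i x) (j + q) (\<psi> j y))"
  unfolding bilin_def
 proof (intro allI impI conjI ballI)
  fix i j y assume "i + j = d" "y \<in> carrier (B j)"
  then show "lin (A i) ?T (%x. ks (q * i) \<odot>[?T] tens R A' B' (i + p) (\<phi> i x) (j + q) (\<psi> j y))"
   by (intro mlin_scale mlin_comp[OF glD[OF \<phi> refl], where k = "%x. tens R A' B' (i + p) x (j + q) (\<psi> j y)"] tens_mlin_left gl_closed[OF \<psi>]) auto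
 next
  fix i j x assume "i + j = d" "x \<in> carrier (A i)"
  then show "lin (B j) ?T (%y. ks (q * i) \<odot>[?T] tens R A' B' (i + p) (\<phi> i x) (j + q) (\<psi> j y))"
   by (intro mlin_scale mlin_comp[OF glD[OF \<psi> refl], where k = "%y. tens R A' B' (i + p) (\<phi> i x) (j + q) y"] tens_mlin_right gl_closed[OF \<phi>]) auto
 qed
 show "e = d + p + q ==> lin (tensor R A B d) (tensor R A' B' e) (tens_map R A' B' p \<phi> q \<psi> d)"
  unfolding tens_map_def using tens_lift(1)[OF _ _ b] by simp
 show "[|x \<in> carrier (A i); y \<in> carrier (B j); i + j = d; e = d + p + q|] ==>
   tens_map R A' B' p \<phi> q \<psi> d (tens R A B i x j y) =
   ks (q * i) \<odot>[tensor R A' B' e] tens R A' B' (i + p) (\<phi> i x) (j + q) (\<psi> j y)"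
  unfolding tens_map_def using tens_lift(2)[OF _ _ b] by simp
qed

context
 fixes W :: "('k, 'w) gmod"
 assumes W [simp]: "gr W"
begin

lemma stens_closed: "a \<in> words W ==> b \<in> words W ==> d = wdeg a + wdeg b ==> stens R W a b \<in> carrier (ST W d)"
 unfolding stens_def by (auto intro!: tens_closed smon_closed)

lemma stens_bisym: "bisym R W W (ST W) (stens R W)"
 unfolding bisym_def stens_def
 by (auto intro!: symfun_mlin[OF smon_symfun, where h = "%d x. ten W d x (wdeg _) (sm W _)"]
   symfun_mlin[OF smon_symfun, where h = "%d x. ten W (wdeg _) (sm W _) d x"]
   tens_mlin_left tens_mlin_right smon_closed)

text \<open>By \<open>finsum_Sh\<close> the defining shuffle sum is \<open>ssum\<close> of the
  bisymmetric function \<open>stens\<close>, so it descends to S(W).\<close>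

lemma comult_mlin: "lin (Sy W d) (ST W d) (cmu W d)"
 and comult_smon: "w \<in> words W ==> d = wdeg w ==> cmu W d (sm W w) = ss (ST W d) w (stens R W)"
proof -
 have eq: "finsum (ST W d) (%(j, \<sigma>). let u = take j (permute_list \<sigma> w); v = drop j (permute_list \<sigma> w) in
    koszul R w \<sigma> \<odot>[ST W d] ten W (wdeg u) (sm W u) (wdeg v) (sm W v))
   (SIGMA j:{..length w}. Sh j (length w)) = ss (ST W (wdeg w)) w (stens R W)"
  if w: "w \<in> words W" "wdeg w = d" for w d
 proof -
  have "stens R W a b \<in> carrier (ST W d)" if "splits w a b" for a b
   using w splits_words[OF that, of W] splits_wdeg[OF that] by (intro stens_closed) auto
  from finsum_Sh[OF gm[OF gm_tensor[OF gm_Sym[OF W] gm_Sym[OF W]]], where w = w and G = "stens R W", OF this] w show ?thesis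
   by (simp add: Let_def stens_def)
 qed
 have P: "module R (ST W d)"
  by simp
 note lift = sym_lift[OF W ssum_symfun[OF W stens_bisym gm_tensor[OF gm_Sym[OF W] gm_Sym[OF W]]] P eq]
 show "lin (Sy W d) (ST W d) (cmu W d)"
  unfolding comult_def by (rule lift(1))
 show "w \<in> words W ==> d = wdeg w ==> cmu W d (sm W w) = ss (ST W d) w (stens R W)"
  unfolding comult_def using lift(2) by simp
qed

end

end

section \<open>Multiplication by monomials and the primitive elements\<close>

text \<open>Left multiplication by a monomial, lifted in the second factor only. The full product of
  S(W) is assembled from it in \<open>concat_lift\<close>.\<close>

definition wmul :: "'k ring => ('k, 'w) gmod => 'w word => int => ('k, 'w) sym => ('k, 'w) sym" where
 "wmul R W a d = pres_lift R (Sym R W (d + wdeg a)) (%b. smon R W (a @ b))"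

definition lpart :: "'k ring => ('k, 'w) gmod => nat => int => ('k, 'w) sym => ('k, 'w) sym" where
 "lpart R W n d = pres_lift R (Sym R W d) (%w. if length w = n then smon R W w else \<zero>[Sym R W d])"

context ground
begin

definition nsc :: "nat => 'k" where
 "nsc n = [n] \<cdot> \<one>"

lemma nsc_closed [simp]: "nsc n \<in> carrier R"
 by (simp add: nsc_def)

lemma nsc_add: "nsc (m + n) = nsc m \<oplus> nsc n"
 by (simp add: nsc_def add.nat_pow_mult)

lemma nsc_one [simp]: "nsc (Suc 0) = \<one>"
 by (simp add: nsc_def)

lemma nsc_unit: "n > 0 ==> nsc n \<in> Units R"
 unfolding nsc_def by (rule nat_unit)

lemma gl_id: "gl R A A 0 (%i y. y)"
 by (simp add: gl_def mlin_id)

context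
 fixes W :: "('k, 'w) gmod"
 assumes W [simp]: "gr W"
begin

lemma symfun_prefix:
 assumes a: "a \<in> words W"
 shows "symf W (%d. Sy W (d + wdeg a)) (%b. sm W (a @ b))"
 using a
proof (induction a)
 case Nil
 then show ?case by (simp add: smon_symfun)
next
 case (Cons x a)
 have "sm W (a @ x # b) \<in> carrier (Sy W (wdeg b + (fst x + wdeg a)))" if "b \<in> words W" for b
  using that Cons.prems by (intro smon_closed) auto
 have "symf W (%d. Sy W (wdeg (x # a) + d)) (%b. sm W ((x # a) @ b))"
  if "!!u. u \<in> words W ==> True"
 proof (rule symfunI)
  note ss = symfun_add[OF smon_symfun[OF W], of "(x # a) @ _"]
   symfun_smult[OF smon_symfun[OF W], of "(x # a) @ _"] symfun_swap[OF smon_symfun[OF W], of "(x # a) @ _"]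
  show "sm W ((x # a) @ w) \<in> carrier (Sy W (wdeg (x # a) + wdeg w))" if "w \<in> words W" for w
   using that Cons.prems by (intro smon_closed) auto
  show "sm W ((x # a) @ u @ (i, y \<oplus>[W i] z) # v) = sm W ((x # a) @ u @ (i, y) # v)
    \<oplus>[Sy W (wdeg (x # a) + (wdeg u + (i + wdeg v)))] sm W ((x # a) @ u @ (i, z) # v)"
   if "u \<in> words W" "v \<in> words W" "y \<in> carrier (W i)" "z \<in> carrier (W i)" for u v i y z
   using ss(1)[of u v y i z] that Cons.prems by (simp add: add.assoc)
  show "sm W ((x # a) @ u @ (i, k \<odot>[W i] y) # v) = k
    \<odot>[Sy W (wdeg (x # a) + (wdeg u + (i + wdeg v)))] sm W ((x # a) @ u @ (i, y) # v)"
   if "u \<in> words W" "v \<in> words W" "y \<in> carrier (W i)" "k \<in> carrier R" for u v i y k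
   using ss(2)[of u v y i k] that Cons.prems by (simp add: add.assoc)
  show "sm W ((x # a) @ u @ (i, y) # (j, z) # v) = ks (i * j)
    \<odot>[Sy W (wdeg (x # a) + (wdeg u + (i + (j + wdeg v))))] sm W ((x # a) @ u @ (j, z) # (i, y) # v)"
   if "u \<in> words W" "v \<in> words W" "y \<in> carrier (W i)" "z \<in> carrier (W j)" for u v i y j z
   using ss(3)[of u v y i z j] that Cons.prems by (simp add: add.assoc)
 qed
 then show ?case by (simp add: add.commute)
qed

lemma wmul_gl: "a \<in> words W ==> gl R (Sy W) (Sy W) (wdeg a) (wmul R W a)"
 and wmul_smon: "[|a \<in> words W; b \<in> words W; d = wdeg b|] ==> wmul R W a d (sm W b) = sm W (a @ b)"
proof -
 have P: "module R (Sy W (d + wdeg a))" for d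
  by simp
 show "gl R (Sy W) (Sy W) (wdeg a) (wmul R W a)" if a: "a \<in> words W"
  unfolding gl_def wmul_def
  using sym_lift(1)[OF W symfun_prefix[OF a], OF P refl] by blast
 show "wmul R W a d (sm W b) = sm W (a @ b)" if a: "a \<in> words W" and b: "b \<in> words W" "d = wdeg b"
  unfolding wmul_def
  by (rule sym_lift(2)[OF W symfun_prefix[OF a], OF P refl b(1) b(2)[symmetric]])
qed

lemma wmul_mlin: "a \<in> words W ==> e = d + wdeg a ==> lin (Sy W d) (Sy W e) (wmul R W a d)"
 by (rule glD[OF wmul_gl])

lemma wmul_closed: "[|a \<in> words W; y \<in> carrier (Sy W d); e = d + wdeg a|] ==> wmul R W a d y \<in> carrier (Sy W e)"
 by (rule mlin_closed[OF wmul_mlin])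

text \<open>Both sides of each relation are linear in \<open>y\<close>, so it suffices to take a
  monomial for \<open>y\<close>; there the relation is one between monomials.\<close>

lemma wmul_symfun:
 assumes y: "y \<in> carrier (Sy W d)"
 shows "symf W (%e. Sy W (d + e)) (%a. wmul R W a d y)"
proof (rule symfunI)
 show "wmul R W a d y \<in> carrier (Sy W (d + wdeg a))" if "a \<in> words W" for a
  using that y by (simp add: wmul_closed)
 show "wmul R W (u @ (i, x \<oplus>[W i] x') # v) d y =
   wmul R W (u @ (i, x) # v) d y \<oplus>[Sy W (d + (wdeg u + (i + wdeg v)))] wmul R W (u @ (i, x') # v) d y"
  if "u \<in> words W" "v \<in> words W" "x \<in> carrier (W i)" "x' \<in> carrier (W i)" for u v i x x'
 proof (rule sym_ext[OF W, where x = y and d = d and P = "Sy W (d + (wdeg u + (i + wdeg v)))"])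
  fix b assume b: "b \<in> words W" "wdeg b = d"
  have "sm W (u @ (i, x \<oplus>[W i] x') # v @ b) = sm W (u @ (i, x) # v @ b)
    \<oplus>[Sy W (d + (wdeg u + (i + wdeg v)))] sm W (u @ (i, x') # v @ b)"
   using that b by (intro symfun_add[OF smon_symfun[OF W]]) auto
  then show "wmul R W (u @ (i, x \<oplus>[W i] x') # v) d (sm W b) = wmul R W (u @ (i, x) # v) d (sm W b)
    \<oplus>[Sy W (d + (wdeg u + (i + wdeg v)))] wmul R W (u @ (i, x') # v) d (sm W b)"
   using that b by (simp add: wmul_smon)
 qed (use that y in \<open>auto intro!: wmul_mlin mlin_plus\<close>)
 show "wmul R W (u @ (i, k \<odot>[W i] x) # v) d y =
   k \<odot>[Sy W (d + (wdeg u + (i + wdeg v)))] wmul R W (u @ (i, x) # v) d y"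
  if "u \<in> words W" "v \<in> words W" "x \<in> carrier (W i)" "k \<in> carrier R" for u v i x k
 proof (rule sym_ext[OF W, where x = y and d = d and P = "Sy W (d + (wdeg u + (i + wdeg v)))"])
  fix b assume b: "b \<in> words W" "wdeg b = d"
  have "sm W (u @ (i, k \<odot>[W i] x) # v @ b) = k
    \<odot>[Sy W (d + (wdeg u + (i + wdeg v)))] sm W (u @ (i, x) # v @ b)"
   using that b by (intro symfun_smult[OF smon_symfun[OF W]]) auto
  then show "wmul R W (u @ (i, k \<odot>[W i] x) # v) d (sm W b) = k
    \<odot>[Sy W (d + (wdeg u + (i + wdeg v)))] wmul R W (u @ (i, x) # v) d (sm W b)"
   using that b by (simp add: wmul_smon)
 qed (use that y in \<open>auto intro!: wmul_mlin mlin_scale\<close>)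
 show "wmul R W (u @ (i, x) # (j, z) # v) d y =
   ks (i * j) \<odot>[Sy W (d + (wdeg u + (i + (j + wdeg v))))] wmul R W (u @ (j, z) # (i, x) # v) d y"
  if "u \<in> words W" "v \<in> words W" "x \<in> carrier (W i)" "z \<in> carrier (W j)" for u v i x j z
 proof (rule sym_ext[OF W, where x = y and d = d and P = "Sy W (d + (wdeg u + (i + (j + wdeg v))))"])
  fix b assume b: "b \<in> words W" "wdeg b = d"
  have "sm W (u @ (i, x) # (j, z) # v @ b) = ks (i * j)
    \<odot>[Sy W (d + (wdeg u + (i + (j + wdeg v))))] sm W (u @ (j, z) # (i, x) # v @ b)"
   using that b by (intro symfun_swap[OF smon_symfun[OF W]]) auto
  then show "wmul R W (u @ (i, x) # (j, z) # v) d (sm W b) = ks (i * j)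
    \<odot>[Sy W (d + (wdeg u + (i + (j + wdeg v))))] wmul R W (u @ (j, z) # (i, x) # v) d (sm W b)"
   using that b by (simp add: wmul_smon)
 qed (use that y in \<open>auto intro!: wmul_mlin mlin_scale\<close>)
qed

lemma wmul_wmul:
 assumes "a \<in> words W" "b \<in> words W" "y \<in> carrier (Sy W d)" "e = d + wdeg b"
 shows "wmul R W a e (wmul R W b d y) = wmul R W (a @ b) d y"
proof (rule sym_ext[OF W, where x = y and d = d and P = "Sy W (d + wdeg b + wdeg a)"])
 show "lin (Sy W d) (Sy W (d + wdeg b + wdeg a)) (%y. wmul R W a e (wmul R W b d y))"
  using assms by (intro mlin_comp[OF wmul_mlin wmul_mlin]) auto
 show "lin (Sy W d) (Sy W (d + wdeg b + wdeg a)) (wmul R W (a @ b) d)"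
  using assms by (intro wmul_mlin) auto
qed (use assms in \<open>auto simp: wmul_smon\<close>)

subsection \<open>The projection to the generators and the word length\<close>

lemma proj1_lift: "lin (Sy W d) (W d) (pr W d)"
 "w \<in> words W ==> wdeg w = d ==> pr W d (sm W w) = (if length w = 1 then snd (hd w) else \<zero>[W d])"
proof -
 have s: "symf W W (%w. if length w = 1 then snd (hd w) else \<zero>[W (wdeg w)])"
 proof (rule symfunI)
  show "(if length w = 1 then snd (hd w) else \<zero>[W (wdeg w)]) \<in> carrier (W (wdeg w))" if "w \<in> words W" for w
   using that by (cases w) auto
 qed (auto simp: add.left_commute split: if_splits)
 have P: "module R (W d)" by simp
 have eq: "(if length w = 1 then snd (hd w) else \<zero>[W d]) = (if length w = 1 then snd (hd w) else \<zero>[W (wdeg w)])"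
  if "w \<in> words W" "wdeg w = d" for w
  using that by simp
 note l = sym_lift[OF W s P eq]
 show "lin (Sy W d) (W d) (pr W d)"
  unfolding proj1_def by (rule l(1))
 show "w \<in> words W ==> wdeg w = d ==> pr W d (sm W w) = (if length w = 1 then snd (hd w) else \<zero>[W d])"
  unfolding proj1_def using l(2)[of w] by simp
qed

lemma proj1_letter [simp]: "x \<in> carrier (W i) ==> pr W i (sm W [(i, x)]) = x"
 by (simp add: proj1_lift)

lemma lpart_lift: "lin (Sy W d) (Sy W d) (lpart R W n d)"
 "w \<in> words W ==> wdeg w = d ==> lpart R W n d (sm W w) = (if length w = n then sm W w else \<zero>[Sy W d])"
proof -
 note sm = symfun_add[OF smon_symfun[OF W]] symfun_smult[OF smon_symfun[OF W]]
 have s: "symf W (Sy W) (%w. if length w = n then sm W w else \<zero>[Sy W (wdeg w)])"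
 proof (rule symfunI)
  show "(if length w = n then sm W w else \<zero>[Sy W (wdeg w)]) \<in> carrier (Sy W (wdeg w))" if "w \<in> words W" for w
   using that by (simp add: smon_closed)
  show "(if length (u @ (i, x) # (j, y) # v) = n then sm W (u @ (i, x) # (j, y) # v)
    else \<zero>[Sy W (wdeg (u @ (i, x) # (j, y) # v))]) = ks (i * j) \<odot>[Sy W (wdeg u + (i + (j + wdeg v)))]
    (if length (u @ (j, y) # (i, x) # v) = n then sm W (u @ (j, y) # (i, x) # v)
    else \<zero>[Sy W (wdeg (u @ (j, y) # (i, x) # v))])"
   if "u \<in> words W" "v \<in> words W" "x \<in> carrier (W i)" "y \<in> carrier (W j)" for u v i x j y
   using symfun_swap[OF smon_symfun[OF W] that refl] by (simp add: add.left_commute[of j])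
 qed (auto simp: sm)
 have P: "module R (Sy W d)" by simp
 have eq: "(if length w = n then sm W w else \<zero>[Sy W d]) = (if length w = n then sm W w else \<zero>[Sy W (wdeg w)])"
  if "w \<in> words W" "wdeg w = d" for w
  using that by simp
 note l = sym_lift[OF W s P eq]
 show "lin (Sy W d) (Sy W d) (lpart R W n d)"
  unfolding lpart_def by (rule l(1))
 show "w \<in> words W ==> wdeg w = d ==> lpart R W n d (sm W w) = (if length w = n then sm W w else \<zero>[Sy W d])"
  unfolding lpart_def using l(2)[of w] by simp
qed

lemma smon_letter_mlin: "lin (W d) (Sy W d) (%x. sm W [(d, x)])"
proof (rule mlinI)
 show "sm W [(d, x)] \<in> carrier (Sy W d)" if "x \<in> carrier (W d)" for x
  using that by (simp add: smon_closed)
 show "sm W [(d, x \<oplus>[W d] y)] = sm W [(d, x)] \<oplus>[Sy W d] sm W [(d, y)]"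
  if "x \<in> carrier (W d)" "y \<in> carrier (W d)" for x y
  using that by (intro symfun_add0[OF smon_symfun[OF W]]) auto
 show "sm W [(d, a \<odot>[W d] x)] = a \<odot>[Sy W d] sm W [(d, x)]"
  if "a \<in> carrier R" "x \<in> carrier (W d)" for a x
  using that by (intro symfun_smult0[OF smon_symfun[OF W]]) auto
qed

lemma lpart_1:
 assumes "x \<in> carrier (Sy W d)"
 shows "lpart R W 1 d x = sm W [(d, pr W d x)]"
proof (rule sym_ext[OF W, where x = x and d = d and P = "Sy W d"])
 show "lin (Sy W d) (Sy W d) (%x. sm W [(d, pr W d x)])"
  by (rule mlin_comp[OF proj1_lift(1) smon_letter_mlin])
 fix w assume w: "w \<in> words W" "wdeg w = d"
 have "sm W [(d, \<zero>[W d])] = \<zero>[Sy W d]"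
  by (rule mlin_zero[OF _ _ smon_letter_mlin]) auto
 moreover have "[(d, snd (hd w))] = w" if "length w = 1"
  using that w by (cases w) auto
 ultimately show "lpart R W 1 d (sm W w) = sm W [(d, pr W d (sm W w))]"
  using w by (simp add: lpart_lift(2) proj1_lift(2))
qed (use assms in \<open>auto intro: lpart_lift\<close>)

text \<open>An element is the sum of its parts of fixed word length, of which only finitely many
  matter.\<close>

lemma eq_zero_lpart:
 assumes x: "x \<in> carrier (Sy W d)" and z: "!!n. lpart R W n d x = \<zero>[Sy W d]"
 shows "x = \<zero>[Sy W d]"
proof -
 \<comment> \<open>The partial sums over word lengths become constant. In this form the claim
   survives adding a monomial, with the bound raised to its length plus one.\<close>
 have "\<exists>N. \<forall>M\<ge>N. finsum (Sy W d) (%n. lpart R W n d x) {..<M} = x"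
  using x
 proof (induction rule: sym_induct[OF W, consumes 1, case_names zero step])
  case zero
  have "lpart R W n d \<zero>[Sy W d] = \<zero>[Sy W d]" for n
   by (rule mlin_zero[OF _ _ lpart_lift(1)]) auto
  then show ?case by (simp add: m_finsum_zero)
 next
  case (step a w x)
  then obtain N where N: "!!M. M \<ge> N ==> finsum (Sy W d) (%n. lpart R W n d x) {..<M} = x" by blast
  have sw: "sm W w \<in> carrier (Sy W d)"
   using step by (simp add: smon_closed)
  note cl = mlin_closed[OF lpart_lift(1)]
  have "finsum (Sy W d) (%n. lpart R W n d (a \<odot>[Sy W d] sm W w \<oplus>[Sy W d] x)) {..<M} =
    a \<odot>[Sy W d] sm W w \<oplus>[Sy W d] x" if M: "M \<ge> max N (Suc (length w))" for M
  proof -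
   have "finsum (Sy W d) (%n. lpart R W n d (a \<odot>[Sy W d] sm W w \<oplus>[Sy W d] x)) {..<M} =
    finsum (Sy W d) (%n. a \<odot>[Sy W d] lpart R W n d (sm W w)) {..<M} \<oplus>[Sy W d]
    finsum (Sy W d) (%n. lpart R W n d x) {..<M}"
    using step(1,4) sw by (subst m_finsum_add[symmetric])
     (auto simp: mlin_add[OF lpart_lift(1)] mlin_smult[OF lpart_lift(1)] intro!: cl m_smult m_finsum_cong)
   also have "finsum (Sy W d) (%n. a \<odot>[Sy W d] lpart R W n d (sm W w)) {..<M} =
     finsum (Sy W d) (%n. a \<odot>[Sy W d] lpart R W n d (sm W w)) {length w}"
    using M step sw by (intro m_finsum_superset[symmetric]) (auto simp: lpart_lift(2))
   also have "... = a \<odot>[Sy W d] sm W w"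
    using step sw by (subst m_finsum_insert) (auto simp: lpart_lift(2))
   finally show ?thesis using N M by simp
  qed
  then show ?case by blast
 qed
 then obtain N where "finsum (Sy W d) (%n. lpart R W n d x) {..<N} = x" by blast
 then show ?thesis
  using z by (simp add: m_finsum_zero)
qed

subsection \<open>Primitive elements\<close>

text \<open>The multiplication of S(W) in total degree \<open>d\<close>, as a linear map on the
  tensor product; the last two properties are its unit laws.\<close>

lemma concat_lift:
 obtains mu where "lin (ST W d) (Sy W d) mu"
  and "!!a b. [|a \<in> words W; b \<in> words W; wdeg a + wdeg b = d|] ==> mu (stens R W a b) = sm W (a @ b)"
  and "!!x. x \<in> carrier (Sy W d) ==> mu (ten W d x 0 (sm W [])) = x"
  and "!!x. x \<in> carrier (Sy W d) ==> mu (ten W 0 (sm W []) d x) = x"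
proof -
 \<comment> \<open>The product of \<open>x\<close> and \<open>y\<close>: for fixed \<open>y\<close>
   the map \<open>wmul\<close> is lifted in its word argument. Linearity in \<open>y\<close> is then
   obtained by induction on \<open>x\<close>.\<close>
 define M where "M = (%i x j y. pres_lift R (Sy W (j + i)) (%a. wmul R W a j y) x)"
 have Ml: "lin (Sy W i) (Sy W (j + i)) (%x. M i x j y)"
  and Mv: "a \<in> words W ==> wdeg a = i ==> M i (sm W a) j y = wmul R W a j y"
  if y: "y \<in> carrier (Sy W j)" for i j y a
 proof -
  have P: "module R (Sy W (j + i))" by simp
  note l = sym_lift[OF W wmul_symfun[OF y], where d = i, OF P refl]
  show "lin (Sy W i) (Sy W (j + i)) (%x. M i x j y)"
   using l(1) by (simp add: M_def)
  show "a \<in> words W ==> wdeg a = i ==> M i (sm W a) j y = wmul R W a j y"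
   using l(2) by (simp add: M_def)
 qed
 have Mr: "lin (Sy W j) (Sy W (j + i)) (%y. M i x j y)" if x: "x \<in> carrier (Sy W i)" for i j x
  using x
 proof (induction rule: sym_induct[OF W, consumes 1, case_names zero step])
  case zero
  have "lin (Sy W j) (Sy W (j + i)) (%y. \<zero>[Sy W (j + i)])"
   by (rule mlin_zero_map) auto
  then show ?case
   by (rule mlin_cong) (simp_all add: mlin_zero[OF _ _ Ml])
 next
  case (step a w x)
  have "lin (Sy W j) (Sy W (j + i)) (%y. a \<odot>[Sy W (j + i)] wmul R W w j y \<oplus>[Sy W (j + i)] M i x j y)"
   using step by (intro mlin_plus mlin_scale wmul_mlin) auto
  then show ?case
   by (rule mlin_cong) (use step in \<open>auto simp: mlin_add[OF Ml] mlin_smult[OF Ml] Mv smon_closed\<close>)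
 qed
 have b: "bilin R (Sy W) (Sy W) (Sy W d) d M"
  unfolding bilin_def
 proof (intro allI impI conjI ballI)
  fix i j assume "i + j = d"
  then have d: "j + i = d" by simp
  show "lin (Sy W i) (Sy W d) (%x. M i x j y)" if "y \<in> carrier (Sy W j)" for y
   using Ml[OF that, of i] unfolding d .
  show "lin (Sy W j) (Sy W d) (%y. M i x j y)" if "x \<in> carrier (Sy W i)" for x
   using Mr[OF that, of j] unfolding d .
 qed
 define mu where "mu = pres_lift R (Sy W d) (%((i, x), (j, y)). M i x j y)"
 note ml = tens_lift[OF gm_Sym[OF W] gm_Sym[OF W] b gm[OF gm_Sym[OF W]], folded mu_def]
 have s0: "sm W [] \<in> carrier (Sy W 0)"
  by (simp add: smon_closed)
 show thesis
 proof (rule that)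
  show "lin (ST W d) (Sy W d) mu" by (rule ml(1))
  show "mu (stens R W a b) = sm W (a @ b)" if "a \<in> words W" "b \<in> words W" "wdeg a + wdeg b = d" for a b
   using that by (simp add: stens_def ml(2) smon_closed Mv wmul_smon)
  show "mu (ten W d x 0 (sm W [])) = x" if x: "x \<in> carrier (Sy W d)" for x
  proof -
   have "M d x 0 (sm W []) = x"
   proof (rule sym_ext[OF W, where d = d and P = "Sy W d" and x = x])
    show "lin (Sy W d) (Sy W d) (%x. M d x 0 (sm W []))"
     using Ml[OF s0, of d] by simp
   qed (use x s0 in \<open>auto simp: Mv wmul_smon mlin_id\<close>)
   then show ?thesis using x s0 by (simp add: ml(2))
  qed
  show "mu (ten W 0 (sm W []) d x) = x" if x: "x \<in> carrier (Sy W d)" for x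
  proof -
   have "wmul R W [] d x = x"
    by (rule sym_ext[OF W, where d = d and P = "Sy W d" and x = x])
     (use x in \<open>auto simp: wmul_smon mlin_id intro!: wmul_mlin\<close>)
   then show ?thesis using x s0 by (simp add: ml(2) Mv)
  qed
 qed
qed

text \<open>Each letter goes left or right, and sorting the concatenation back costs the same Koszul
  sign once more, so the signs cancel. Every letter contributes a factor 2.\<close>

lemma ssum_concat:
 assumes "w \<in> words W" "d = wdeg w"
 shows "ss (Sy W d) w (%a b. sm W (a @ b)) = nsc (2 ^ length w) \<odot>[Sy W d] sm W w"
 using assms
proof (induction w arbitrary: d)
 case Nil
 then show ?case by (simp add: smon_closed)
next
 case (Cons x w)
 have w: "w \<in> words W" and x: "[x] \<in> words W" and d: "d = wdeg w + wdeg [x]"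
  using Cons.prems by auto
 have cl: "sm W (a @ b) \<in> carrier (Sy W (wdeg w))" "sm W (x # a @ b) \<in> carrier (Sy W d)"
  "a \<in> words W" "b \<in> words W" "d = wdeg a + (fst x + wdeg b)" if "splits w a b" for a b
  using w x d splits_words[OF that, of W] splits_wdeg[OF that] by (auto intro!: smon_closed)
 have "wmul R W [x] (wdeg w) (ss (Sy W (wdeg w)) w (%a b. sm W (a @ b))) =
   ss (Sy W d) w (%a b. wmul R W [x] (wdeg w) (sm W (a @ b)))"
  using cl x d by (intro ssum_mlin wmul_mlin) auto
 also have "... = ss (Sy W d) w (%a b. sm W (x # a @ b))"
  using cl x by (intro ssum_cong refl) (simp add: wmul_smon splits_wdeg)
 finally have 1: "ss (Sy W d) w (%a b. sm W (x # a @ b)) =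
   nsc (2 ^ length w) \<odot>[Sy W d] sm W (x # w)"
  using w x d by (simp add: Cons.IH[OF w refl] mlin_smult[OF wmul_mlin[OF x refl]] wmul_smon smon_closed)
 have 2: "ss (Sy W d) w (%a b. ks (fst x * wdeg a) \<odot>[Sy W d] sm W (a @ x # b)) =
   ss (Sy W d) w (%a b. sm W (x # a @ b))"
 proof (intro ssum_cong refl)
  fix a b assume ab: "splits w a b"
  have "sm W (a @ x # b) = ks (fst x * wdeg a) \<odot>[Sy W d] sm W (x # a @ b)"
   using symfun_move[OF smon_symfun[OF W], of d x "[]" a b] cl[OF ab] x by simp
  then show "ks (fst x * wdeg a) \<odot>[Sy W d] sm W (a @ x # b) = sm W (x # a @ b)"
   using cl[OF ab] by (simp add: m_smult_smult)
 qed
 have "sm W (x # w) \<in> carrier (Sy W d)"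
  using w x d by (intro smon_closed) auto
 then show ?case
  using 2 by (simp add: 1 mult_2 nsc_add m_smult_addl)
qed

text \<open>Multiplication after comultiplication doubles a primitive element, and it multiplies the
  part of word length \<open>n\<close> by \<open>2 ^ n\<close>. Hence \<open>2 ^ n - 2\<close>
  annihilates that part. This settles all lengths except 1, and length 1 is the hypothesis
  \<open>p\<close>.\<close>

lemma primitive_zero:
 assumes x: "x \<in> carrier (Sy W d)"
  and prim: "cmu W d x = ten W d x 0 (sm W []) \<oplus>[ST W d]
   ten W 0 (sm W []) d x"
  and p: "pr W d x = \<zero>[W d]"
 shows "x = \<zero>[Sy W d]"
proof -
 obtain mu where mu: "lin (ST W d) (Sy W d) mu"
  and mu1: "!!a b. [|a \<in> words W; b \<in> words W; wdeg a + wdeg b = d|] ==> mu (stens R W a b) = sm W (a @ b)"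
  and mu2: "!!x. x \<in> carrier (Sy W d) ==> mu (ten W d x 0 (sm W [])) = x"
  and mu3: "!!x. x \<in> carrier (Sy W d) ==> mu (ten W 0 (sm W []) d x) = x"
  by (rule concat_lift[of d]) blast
 have s0: "sm W [] \<in> carrier (Sy W 0)"
  by (simp add: smon_closed)
 have E: "mu (cmu W d (sm W w)) = nsc (2 ^ length w) \<odot>[Sy W d] sm W w"
  if w: "w \<in> words W" "wdeg w = d" for w
 proof -
  have ab: "a \<in> words W" "b \<in> words W" "wdeg a + wdeg b = d" if "splits w a b" for a b
   using w splits_words[OF that, of W] splits_wdeg[OF that] by auto
  have "mu (cmu W d (sm W w)) = ss (Sy W d) w (%a b. mu (stens R W a b))"
   unfolding comult_smon[OF W w(1) w(2)[symmetric]]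
   by (rule ssum_mlin[OF _ _ mu]) (use ab in \<open>auto intro!: stens_closed\<close>)
  also have "... = ss (Sy W d) w (%a b. sm W (a @ b))"
   using ab mu1 by (intro ssum_cong refl) blast
  finally show ?thesis using ssum_concat w by simp
 qed
 \<comment> \<open>The part of length \<open>n\<close> of \<open>mu\<close> after the
   comultiplication, computed once on monomials and once from primitivity.\<close>
 have L: "nsc (2 ^ n) \<odot>[Sy W d] lpart R W n d x = nsc 2 \<odot>[Sy W d] lpart R W n d x" for n
 proof -
  have "lpart R W n d (mu (cmu W d x)) = nsc (2 ^ n) \<odot>[Sy W d] lpart R W n d x"
  proof (rule sym_ext[OF W, where d = d and P = "Sy W d" and x = x])
   show "lin (Sy W d) (Sy W d) (%x. lpart R W n d (mu (cmu W d x)))"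
    by (rule mlin_comp[OF mlin_comp[OF comult_mlin[OF W] mu] lpart_lift(1)])
   show "lin (Sy W d) (Sy W d) (%x. nsc (2 ^ n) \<odot>[Sy W d] lpart R W n d x)"
    by (intro mlin_scale lpart_lift(1)) auto
   fix w assume w: "w \<in> words W" "wdeg w = d"
   then show "lpart R W n d (mu (cmu W d (sm W w))) = nsc (2 ^ n) \<odot>[Sy W d] lpart R W n d (sm W w)"
    by (simp add: E mlin_smult[OF lpart_lift(1)] smon_closed lpart_lift(2))
  qed (use x in auto)
  moreover have "mu (cmu W d x) = x \<oplus>[Sy W d] x"
   unfolding prim using x s0 by (simp add: mlin_add[OF mu] tens_closed mu2 mu3)
  moreover have "nsc 2 = \<one> \<oplus> \<one>"
   using nsc_add[of 1 1] by (simp add: numeral_2_eq_2)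
  ultimately show ?thesis
   using x mlin_closed[OF lpart_lift(1) x] by (simp add: mlin_add[OF lpart_lift(1)] m_smult_addl)
 qed
 have "lpart R W n d x = \<zero>[Sy W d]" for n
 proof -
  let ?p = "lpart R W n d x"
  have p': "?p \<in> carrier (Sy W d)"
   by (rule mlin_closed[OF lpart_lift(1) x])
  have canc: "nsc (k + m) \<odot>[Sy W d] ?p = nsc m \<odot>[Sy W d] ?p ==> nsc k \<odot>[Sy W d] ?p = \<zero>[Sy W d]" for k m
  proof -
   assume eq: "nsc (k + m) \<odot>[Sy W d] ?p = nsc m \<odot>[Sy W d] ?p"
   have "nsc m \<odot>[Sy W d] ?p \<oplus>[Sy W d] nsc k \<odot>[Sy W d] ?p = nsc (m + k) \<odot>[Sy W d] ?p"
    using p' by (simp add: nsc_add m_smult_addl)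
   also have "... = nsc m \<odot>[Sy W d] ?p \<oplus>[Sy W d] \<zero>[Sy W d]"
    using eq p' by (simp add: add.commute)
   finally show "nsc k \<odot>[Sy W d] ?p = \<zero>[Sy W d]"
    using p' by (subst (asm) m_add_cancel) auto
  qed
  consider "n = 0" | "n = 1" | "n \<ge> 2" by linarith
  then show ?thesis
  proof cases
   \<comment> \<open>For \<open>n = 0\<close> the factors are 1 and 2, and their difference 1 can be
     cancelled.\<close>
   case 1
   then have "nsc (1 + 1) \<odot>[Sy W d] ?p = nsc 1 \<odot>[Sy W d] ?p"
    using L[of n] unfolding one_add_one by (simp only: power_0)
   from canc[OF this] show ?thesis using p' by simp
  next
   case 2
   have "?p = sm W [(d, \<zero>[W d])]"
    unfolding 2 lpart_1[OF x] p ..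
   also have "... = \<zero>[Sy W d]"
    by (rule mlin_zero[OF _ _ smon_letter_mlin]) auto
   finally show ?thesis .
  next
   \<comment> \<open>For \<open>n\<close> at least 2 the number \<open>2 ^ n - 2\<close> is positive
     and hence a unit.\<close>
   case 3
   have "(2::nat) ^ 2 \<le> 2 ^ n"
    by (rule power_increasing[OF 3]) simp
   moreover have "(2::nat) ^ 2 = 4" by simp
   ultimately have gt: "(2::nat) ^ n > 2" by linarith
   then have "(2::nat) ^ n - 2 + 2 = 2 ^ n" by linarith
   then have "nsc ((2 ^ n - 2) + 2) \<odot>[Sy W d] ?p = nsc 2 \<odot>[Sy W d] ?p"
    using L[of n] by (simp only:)
   from canc[OF this] have z: "nsc (2 ^ n - 2) \<odot>[Sy W d] ?p = \<zero>[Sy W d]" .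
   have "0 < (2::nat) ^ n - 2" using gt by linarith
   from nsc_unit[OF this] show ?thesis
    by (rule m_unit_cancel[OF gm[OF gm_Sym[OF W]] _ p' z])
  qed
 qed
 then show ?thesis
  by (rule eq_zero_lpart[OF x])
qed

end

end

text \<open>For \<open>F = smon\<close> this is the coderivation with components \<open>g\<close>.\<close>
definition conv :: "'k ring => ('k, 'v) gmod => int => ('w word => 'v) => ('w word => ('k, 'v) sym) => 'w word => ('k, 'v) sym" where
 "conv R V j g F w = ssum R (Sym R V (wdeg w + j)) w (%a b. wmul R V [(wdeg a + j, g a)] (wdeg b) (F b))"

lemma conv_cong [fundef_cong]:
 assumes "w = w'" "!!a. g a = g' a" "!!a b. splits w' a b ==> F b = F' b"
 shows "conv R V j g F w = conv R V j g' F' w'"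
 unfolding conv_def using assms by (auto intro!: ssum_cong)

text \<open>The coalgebra morphism with components \<open>f\<close>, expanded along the factor that contains the first letter.\<close>
function expF :: "'k ring => ('k, 'v) gmod => ('w word => 'v) => 'w word => ('k, 'v) sym" where
 "expF R V f [] = smon R V []"
| "expF R V f (x # w) = conv R V (fst x) (%a. f (x # a)) (%b. expF R V f b) w"
 by pat_completeness auto
termination
 by (relation "measure (%(R, V, f, w). length w)") (auto simp: splits_length)

definition mexp :: "'k ring => ('k, 'w) gmod => ('k, 'v) gmod => ('w word => 'v) => int => ('k, 'w) sym => ('k, 'v) sym" where
 "mexp R W V f = (%d. \<lambda>x\<in>carrier (Sym R W d). pres_lift R (Sym R V d) (expF R V f) x)"

section \<open>Uniqueness from components, and convolution\<close>

context ground
begin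

context
 fixes W :: "('k, 'w) gmod" and V :: "('k, 'v) gmod"
 assumes W [simp]: "gr W" and V [simp]: "gr V"
begin

text \<open>\<open>D\<close> stands for the difference of two morphisms \<open>F\<close> and
  \<open>G\<close>, with \<open>j = 0\<close>, or of two coderivations along \<open>F\<close>, with
  \<open>G = F\<close>. By induction on the length, all terms of the comultiplication in which
  \<open>D\<close> meets a shorter word vanish, so \<open>D w\<close> is primitive.\<close>

lemma word_uniqueness:
 assumes F: "!!w. w \<in> words W ==> F w \<in> carrier (Sy V (wdeg w))" "F [] = sm V []"
  and G: "!!w. w \<in> words W ==> G w \<in> carrier (Sy V (wdeg w))" "G [] = sm V []"
  and D: "!!w. w \<in> words W ==> D w \<in> carrier (Sy V (wdeg w + j))"
  and comult: "!!w. w \<in> words W ==> cmu V (wdeg w + j) (D w) = ss (ST V (wdeg w + j)) w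
    (%a b. ten V (wdeg a + j) (D a) (wdeg b) (F b) \<oplus>[ST V (wdeg w + j)]
     ks (j * wdeg a) \<odot>[ST V (wdeg w + j)] ten V (wdeg a) (G a) (wdeg b + j) (D b))"
  and p: "!!w. w \<in> words W ==> pr V (wdeg w + j) (D w) = \<zero>[V (wdeg w + j)]"
  and w: "w \<in> words W"
 shows "D w = \<zero>[Sy V (wdeg w + j)]"
 using w
proof (induction "length w" arbitrary: w rule: less_induct)
 case less
 let ?d = "wdeg w + j"
 let ?T = "ST V ?d"
 let ?t = "ten V"
 note sp = splitsD[OF _ less.prems]
 have cl: "?t (wdeg a + j) (D a) (wdeg b) (F b) \<in> carrier ?T" "?t (wdeg a) (G a) (wdeg b + j) (D b) \<in> carrier ?T"
  if "splits w a b" for a b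
  using sp[OF that] by (auto intro!: tens_closed F G D)
 have zl: "?t (wdeg a + j) (D a) (wdeg b) (F b) = \<zero>[?T]" if ab: "splits w a b" "b \<noteq> []" for a b
 proof -
  have 0: "D a = \<zero>[Sy V (wdeg a + j)]"
   using sp[OF ab(1)] ab splits_length_less(1)[OF ab] by (intro less.hyps) auto
  have "lin (Sy V (wdeg a + j)) ?T (%x. ?t (wdeg a + j) x (wdeg b) (F b))"
   using sp[OF ab(1)] by (intro tens_mlin_left F) auto
  from mlin_zero[OF _ _ this] show ?thesis
   by (simp add: 0)
 qed
 have zr: "?t (wdeg a) (G a) (wdeg b + j) (D b) = \<zero>[?T]" if ab: "splits w a b" "a \<noteq> []" for a b
 proof -
  have 0: "D b = \<zero>[Sy V (wdeg b + j)]"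
   using sp[OF ab(1)] ab splits_length_less(2)[OF ab] by (intro less.hyps) auto
  have "lin (Sy V (wdeg b + j)) ?T (%x. ?t (wdeg a) (G a) (wdeg b + j) x)"
   using sp[OF ab(1)] by (intro tens_mlin_right G) auto
  from mlin_zero[OF _ _ this] show ?thesis
   by (simp add: 0)
 qed
 have "ss ?T w (%a b. ?t (wdeg a + j) (D a) (wdeg b) (F b)) = ?t (wdeg w + j) (D w) (wdeg ([] :: 'w word)) (F [])"
  using cl(1)[of w "[]"] by (intro ssum_left zl) auto
 moreover have "ss ?T w (%a b. ks (j * wdeg a) \<odot>[?T] ?t (wdeg a) (G a) (wdeg b + j) (D b)) =
   ks (j * wdeg ([] :: 'w word)) \<odot>[?T] ?t (wdeg ([] :: 'w word)) (G []) (wdeg w + j) (D w)"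
  using cl(2)[of "[]" w] zr by (intro ssum_right) auto
 ultimately have "cmu V ?d (D w) = ?t ?d (D w) 0 (sm V []) \<oplus>[?T] ?t 0 (sm V []) ?d (D w)"
  using less.prems cl cl(2)[of "[]" w] F G by (simp add: comult ssum_add)
 then show ?case
  using less.prems by (intro primitive_zero[OF V D _ p]) auto
qed

lemma wmul_letter_mlin:
 assumes "y \<in> carrier (Sy V d)" "e = d + i"
 shows "lin (V i) (Sy V e) (%v. wmul R V [(i, v)] d y)"
 using assms symfun_add0[OF wmul_symfun[OF V assms(1)], of "[]"] symfun_smult0[OF wmul_symfun[OF V assms(1)], of "[]"]
 by (intro mlinI) (auto intro!: wmul_closed)

text \<open>A letter is primitive, so multiplying by it multiplies the comultiplication by
  \<open>x \<otimes> 1 + 1 \<otimes> x\<close>.\<close>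

lemma comult_wmul:
 assumes x: "snd x \<in> carrier (V (fst x))" and y: "y \<in> carrier (Sy V d)"
 shows "cmu V (d + fst x) (wmul R V [x] d y) =
  tmap V (fst x) (wmul R V [x]) 0 (%i y. y) d (cmu V d y) \<oplus>[ST V (d + fst x)]
  tmap V 0 (%i y. y) (fst x) (wmul R V [x]) d (cmu V d y)"
proof (rule sym_ext[OF V, where x = y and d = d and P = "ST V (d + fst x)"])
 have x': "[x] \<in> words V" using x by simp
 have gw: "gl R (Sy V) (Sy V) (fst x) (wmul R V [x])"
  using wmul_gl[OF V x'] by simp
 note tm1 = tens_map[OF gm_Sym[OF V] gm_Sym[OF V] gm_Sym[OF V] gm_Sym[OF V] gw gl_id]
 note tm2 = tens_map[OF gm_Sym[OF V] gm_Sym[OF V] gm_Sym[OF V] gm_Sym[OF V] gl_id gw]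
 show "lin (Sy V d) (ST V (d + fst x)) (%y. cmu V (d + fst x) (wmul R V [x] d y))"
  using x' by (intro mlin_comp[OF wmul_mlin comult_mlin]) auto
 show "lin (Sy V d) (ST V (d + fst x)) (%y.
   tmap V (fst x) (wmul R V [x]) 0 (%i y. y) d (cmu V d y) \<oplus>[ST V (d + fst x)]
   tmap V 0 (%i y. y) (fst x) (wmul R V [x]) d (cmu V d y))"
  by (intro mlin_plus mlin_comp[OF comult_mlin tm1(1)] mlin_comp[OF comult_mlin tm2(1)]) auto
 fix w assume w: "w \<in> words V" "wdeg w = d"
 let ?T = "ST V (d + fst x)"
 have sp: "a \<in> words V" "b \<in> words V" "wdeg a + wdeg b = d" if "splits w a b" for a b
  using w splits_words[OF that, of V] splits_wdeg[OF that] by auto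
 have cl: "ten V (wdeg a + fst x) (sm V (x # a)) (wdeg b) (sm V b) \<in> carrier ?T"
  if "splits w a b" for a b
  using sp[OF that] x' by (auto intro!: tens_closed smon_closed)
 have "cmu V (d + fst x) (wmul R V [x] d (sm V w)) = ss ?T (x # w) (stens R V)"
  using w x' by (simp add: wmul_smon comult_smon del: ssum.simps)
 also have "... = ss ?T w (%a b. stens R V (x # a) b) \<oplus>[?T] ss ?T w (%a b. ks (fst x * wdeg a) \<odot>[?T] stens R V a (x # b))"
  by simp
 also have "ss ?T w (%a b. stens R V (x # a) b) =
   tmap V (fst x) (wmul R V [x]) 0 (%i y. y) d (ss (ST V d) w (stens R V))"
 proof (subst ssum_mlin[OF _ _ tm1(1)])
  show "ss ?T w (%a b. stens R V (x # a) b) = ss ?T w (%a b.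
    tmap V (fst x) (wmul R V [x]) 0 (%i y. y) d (stens R V a b))"
  proof (intro ssum_cong refl)
   fix a b assume ab: "splits w a b"
   show "stens R V (x # a) b = tmap V (fst x) (wmul R V [x]) 0 (%i y. y) d (stens R V a b)"
    using sp[OF ab] x' cl[OF ab] unfolding stens_def
    by (subst tm1(2)[where e = "d + fst x"]) (simp_all add: smon_closed wmul_smon add.commute[of "fst x"])
  qed
 qed (use sp in \<open>auto intro!: stens_closed\<close>)
 also have "ss ?T w (%a b. ks (fst x * wdeg a) \<odot>[?T] stens R V a (x # b)) =
   tmap V 0 (%i y. y) (fst x) (wmul R V [x]) d (ss (ST V d) w (stens R V))"
 proof (subst ssum_mlin[OF _ _ tm2(1)])
  show "ss ?T w (%a b. ks (fst x * wdeg a) \<odot>[?T] stens R V a (x # b)) = ss ?T w (%a b.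
    tmap V 0 (%i y. y) (fst x) (wmul R V [x]) d (stens R V a b))"
  proof (intro ssum_cong refl)
   fix a b assume ab: "splits w a b"
   show "ks (fst x * wdeg a) \<odot>[?T] stens R V a (x # b) =
     tmap V 0 (%i y. y) (fst x) (wmul R V [x]) d (stens R V a b)"
    using sp[OF ab] x' unfolding stens_def
    by (subst tm2(2)[where e = "d + fst x"]) (simp_all add: smon_closed wmul_smon add.commute[of "fst x"])
  qed
 qed (use sp in \<open>auto intro!: stens_closed\<close>)
 finally show "cmu V (d + fst x) (wmul R V [x] d (sm V w)) =
  tmap V (fst x) (wmul R V [x]) 0 (%i y. y) d (cmu V d (sm V w)) \<oplus>[?T]
  tmap V 0 (%i y. y) (fst x) (wmul R V [x]) d (cmu V d (sm V w))"
  using w by (simp add: comult_smon)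
qed (use y in auto)

text \<open>The case of \<open>comult_wmul\<close> in which \<open>y\<close> is the value of a
  coalgebra morphism at \<open>b\<close>, whose comultiplication is known on the splittings of
  \<open>b\<close>.\<close>

lemma comult_wmul_ssum:
 assumes x: "snd x \<in> carrier (V i)" "i = fst x" and b: "b \<in> words W" and e: "e = wdeg b + i"
  and y: "y \<in> carrier (Sy V (wdeg b))" and F: "!!w. w \<in> words W ==> F w \<in> carrier (Sy V (wdeg w))"
  and c: "cmu V (wdeg b) y = ss (ST V (wdeg b)) b
   (%b1 b2. ten V (wdeg b1) (F b1) (wdeg b2) (F b2))"
 shows "cmu V e (wmul R V [x] (wdeg b) y) =
   ss (ST V e) b (%b1 b2. ten V (wdeg b1 + i) (wmul R V [x] (wdeg b1) (F b1)) (wdeg b2) (F b2))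
   \<oplus>[ST V e] ss (ST V e) b (%b1 b2. ks (i * wdeg b1) \<odot>[ST V e]
    ten V (wdeg b1) (F b1) (wdeg b2 + i) (wmul R V [x] (wdeg b2) (F b2)))"
proof -
 have x': "[x] \<in> words V" using x by simp
 have gw: "gl R (Sy V) (Sy V) i (wmul R V [x])"
  using wmul_gl[OF V x'] x by simp
 note tm1 = tens_map[OF gm_Sym[OF V] gm_Sym[OF V] gm_Sym[OF V] gm_Sym[OF V] gw gl_id]
 note tm2 = tens_map[OF gm_Sym[OF V] gm_Sym[OF V] gm_Sym[OF V] gm_Sym[OF V] gl_id gw]
 have sp: "b1 \<in> words W" "b2 \<in> words W" "wdeg b1 + wdeg b2 = wdeg b" if "splits b b1 b2" for b1 b2
  using b splits_words[OF that, of W] splits_wdeg[OF that] by auto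
 have cl: "ten V (wdeg b1) (F b1) (wdeg b2) (F b2) \<in> carrier (ST V (wdeg b))"
  "ten V (wdeg b1 + i) (wmul R V [x] (wdeg b1) (F b1)) (wdeg b2) (F b2) \<in> carrier (ST V e)"
  if "splits b b1 b2" for b1 b2
  using sp[OF that] e x x' by (auto intro!: tens_closed F wmul_closed)
 have 1: "tmap V i (wmul R V [x]) 0 (%i y. y) (wdeg b) (cmu V (wdeg b) y) =
   ss (ST V e) b (%b1 b2. ten V (wdeg b1 + i) (wmul R V [x] (wdeg b1) (F b1)) (wdeg b2) (F b2))"
  unfolding c
 proof (subst ssum_mlin[OF _ _ tm1(1)])
  show "ss (ST V e) b (%b1 b2. tmap V i (wmul R V [x]) 0 (%i y. y) (wdeg b)
    (ten V (wdeg b1) (F b1) (wdeg b2) (F b2))) =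
   ss (ST V e) b (%b1 b2. ten V (wdeg b1 + i) (wmul R V [x] (wdeg b1) (F b1)) (wdeg b2) (F b2))"
   using sp cl(2) e by (intro ssum_cong refl, subst tm1(2)[where e = e]) (auto intro!: F)
 qed (use cl e in auto)
 have 2: "tmap V 0 (%i y. y) i (wmul R V [x]) (wdeg b) (cmu V (wdeg b) y) =
   ss (ST V e) b (%b1 b2. ks (i * wdeg b1) \<odot>[ST V e]
    ten V (wdeg b1) (F b1) (wdeg b2 + i) (wmul R V [x] (wdeg b2) (F b2)))"
  unfolding c
 proof (subst ssum_mlin[OF _ _ tm2(1)])
  show "ss (ST V e) b (%b1 b2. tmap V 0 (%i y. y) i (wmul R V [x]) (wdeg b)
    (ten V (wdeg b1) (F b1) (wdeg b2) (F b2))) =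
   ss (ST V e) b (%b1 b2. ks (i * wdeg b1) \<odot>[ST V e]
    ten V (wdeg b1) (F b1) (wdeg b2 + i) (wmul R V [x] (wdeg b2) (F b2)))"
   using sp e by (intro ssum_cong refl, subst tm2(2)[where e = e]) (auto intro!: F)
 qed (use cl e in auto)
 show ?thesis
  using comult_wmul[OF x(1)[unfolded x(2)] y] unfolding x(2)[symmetric] e[symmetric] 1 2 .
qed

lemma conv_closed:
 assumes w: "w \<in> words W" and g: "!!a b. splits w a b ==> g a \<in> carrier (V (wdeg a + j))"
  and F: "!!a b. splits w a b ==> F b \<in> carrier (Sy V (wdeg b))" and e: "e = wdeg w + j"
 shows "conv R V j g F w \<in> carrier (Sy V e)"
 unfolding conv_def e using assms by (intro ssum_closed) (auto intro!: wmul_closed simp: splits_wdeg)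

text \<open>The convolution is a coderivation along \<open>F\<close>: the new letter
  \<open>g a\<close> enters the left or the right tensor factor, and the parts of \<open>w\<close>
  are regrouped accordingly.\<close>

lemma comult_conv:
 assumes w: "w \<in> words W" and g: "!!a. a \<in> words W ==> g a \<in> carrier (V (wdeg a + j))"
  and F: "!!a. a \<in> words W ==> F a \<in> carrier (Sy V (wdeg a))"
  and c: "!!a b. splits w a b ==> cmu V (wdeg b) (F b) = ss (ST V (wdeg b)) b
   (%b1 b2. ten V (wdeg b1) (F b1) (wdeg b2) (F b2))"
  and e: "e = wdeg w + j"
 shows "cmu V e (conv R V j g F w) =
  ss (ST V e) w (%a b. ten V (wdeg a + j) (conv R V j g F a) (wdeg b) (F b))
  \<oplus>[ST V e]
  ss (ST V e) w (%a b. ks (j * wdeg a) \<odot>[ST V e]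
   ten V (wdeg a) (F a) (wdeg b + j) (conv R V j g F b))"
proof -
 let ?T = "ST V e" and ?t = "ten V"
 define m where "m = (%a b. wmul R V [(wdeg a + j, g a)] (wdeg b) (F b))"
 \<comment> \<open>\<open>K1\<close> has the letter in the left factor, \<open>K2\<close> in the
   right factor, where it has passed \<open>F b1\<close>.\<close>
 define K1 where "K1 = (%a b1 b2. ?t (wdeg b1 + (wdeg a + j)) (m a b1) (wdeg b2) (F b2))"
 define K2 where "K2 = (%a b1 b2. ks ((wdeg a + j) * wdeg b1) \<odot>[?T] ?t (wdeg b1) (F b1) (wdeg b2 + (wdeg a + j)) (m a b2))"
 have m: "m a b \<in> carrier (Sy V (wdeg b + (wdeg a + j)))" if "a \<in> words W" "b \<in> words W" for a b
  unfolding m_def using that by (intro wmul_closed) (auto intro!: g F)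
 have sp: "a \<in> words W" "b \<in> words W" "e = wdeg b + (wdeg a + j)" if "splits w a b" for a b
  using w splits_words[OF that, of W] splits_wdeg[OF that] e by auto
 have m': "m a b \<in> carrier (Sy V (wdeg w + j))" if ab: "splits w a b" for a b
  using m[OF sp(1,2)[OF ab]] by (simp only: sp(3)[OF ab, symmetric, unfolded e])
 have sp3: "a \<in> words W" "b \<in> words W" "c \<in> words W" "e = wdeg a + wdeg b + wdeg c + j" if "splits3 w a b c" for a b c
  using w splits3_words[OF that, of W] splits3_wdeg[OF that] e by auto
 have K1: "K1 a b c \<in> carrier ?T" and K2: "K2 a b c \<in> carrier ?T" if "splits3 w a b c" for a b c
  unfolding K1_def K2_def using sp3[OF that] by (auto intro!: m_smult tens_closed m F)
 have K1s: "ss ?T b (K1 a) \<in> carrier ?T" and K2s: "ss ?T b (K2 a) \<in> carrier ?T" if "splits w a b" for a b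
  using that by (auto intro!: ssum_closed K1 K2 dest: splits3I)
 have "cmu V e (conv R V j g F w) = ss ?T w (%a b. cmu V e (m a b))"
  unfolding conv_def e m_def[symmetric]
  by (intro ssum_mlin comult_mlin m') auto
 also have "... = ss ?T w (%a b. ss ?T b (%b1 b2. K1 a b1 b2) \<oplus>[?T] ss ?T b (%b1 b2. K2 a b1 b2))"
 proof (intro ssum_cong refl)
  fix a b assume ab: "splits w a b"
  note s = sp[OF ab]
  show "cmu V e (m a b) = ss ?T b (%b1 b2. K1 a b1 b2) \<oplus>[?T] ss ?T b (%b1 b2. K2 a b1 b2)"
   unfolding m_def K1_def K2_def
   by (rule comult_wmul_ssum[where F = F]) (use s c[OF ab] in \<open>auto intro!: g F\<close>)
 qed
 also have "... = ss ?T w (%a b. ss ?T b (%b1 b2. K1 a b1 b2)) \<oplus>[?T] ss ?T w (%a b. ss ?T b (%b1 b2. K2 a b1 b2))"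
  using K1s K2s by (intro ssum_add) auto
 also have "ss ?T w (%a b. ss ?T b (%b1 b2. K1 a b1 b2)) = ss ?T w (%c b2. ss ?T c (%a b1. K1 a b1 b2))"
  by (rule ssum_coassoc[symmetric]) (auto intro: K1)
 also have "... = ss ?T w (%a b. ?t (wdeg a + j) (conv R V j g F a) (wdeg b) (F b))"
 proof (intro ssum_cong refl)
  fix c b assume cb: "splits w c b"
  note s = sp[OF cb]
  have s': "a \<in> words W" "b1 \<in> words W" "wdeg b1 + (wdeg a + j) = wdeg c + j" if "splits c a b1" for a b1
   using s splits_words[OF that, of W] splits_wdeg[OF that] by auto
  have ms: "m a b1 \<in> carrier (Sy V (wdeg c + j))" if "splits c a b1" for a b1
   using m[OF s'(1,2)[OF that]] by (simp only: s'(3)[OF that])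
  have "?t (wdeg c + j) (conv R V j g F c) (wdeg b) (F b) = ss ?T c (%a b1. ?t (wdeg c + j) (m a b1) (wdeg b) (F b))"
   unfolding conv_def m_def[symmetric]
   by (intro ssum_mlin[OF _ _ tens_mlin_left]) (use s s' ms in \<open>auto intro!: F\<close>)
  also have "... = ss ?T c (%a b1. K1 a b1 b)"
   unfolding K1_def by (intro ssum_cong refl) (simp add: s')
  finally show "ss ?T c (%a b1. K1 a b1 b) = ?t (wdeg c + j) (conv R V j g F c) (wdeg b) (F b)" by simp
 qed
 \<comment> \<open>Bringing \<open>b1\<close> in front of \<open>a\<close> costs their sign. It
   cancels against part of the sign in \<open>K2\<close> and leaves the sign of \<open>j\<close> and
   \<open>b1\<close>.\<close>
 also have "ss ?T w (%a b. ss ?T b (%b1 b2. K2 a b1 b2)) =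
   ss ?T w (%b1 c. ss ?T c (%a b2. ks (wdeg a * wdeg b1) \<odot>[?T] K2 a b1 b2))"
  by (rule ssum_exchange) (auto intro: K2)
 also have "... = ss ?T w (%a b. ks (j * wdeg a) \<odot>[?T] ?t (wdeg a) (F a) (wdeg b + j) (conv R V j g F b))"
 proof (intro ssum_cong refl)
  fix b1 c assume bc: "splits w b1 c"
  note s = sp[OF bc]
  have s': "a \<in> words W" "b2 \<in> words W" "wdeg b2 + (wdeg a + j) = wdeg c + j" if "splits c a b2" for a b2
   using s splits_words[OF that, of W] splits_wdeg[OF that] by auto
  have ms: "m a b2 \<in> carrier (Sy V (wdeg c + j))" if "splits c a b2" for a b2
   using m[OF s'(1,2)[OF that]] by (simp only: s'(3)[OF that])
  have cl: "?t (wdeg b1) (F b1) (wdeg c + j) (m a b2) \<in> carrier ?T" if "splits c a b2" for a b2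
   using s ms[OF that] by (intro tens_closed F) auto
  have "?t (wdeg b1) (F b1) (wdeg c + j) (conv R V j g F c) = ss ?T c (%a b2. ?t (wdeg b1) (F b1) (wdeg c + j) (m a b2))"
   unfolding conv_def m_def[symmetric]
   by (intro ssum_mlin[OF _ _ tens_mlin_right]) (use s s' ms in \<open>auto intro!: F\<close>)
  then have "ks (j * wdeg b1) \<odot>[?T] ?t (wdeg b1) (F b1) (wdeg c + j) (conv R V j g F c) =
   ss ?T c (%a b2. ks (j * wdeg b1) \<odot>[?T] ?t (wdeg b1) (F b1) (wdeg c + j) (m a b2))"
   using cl by (simp add: ssum_smult)
  also have "... = ss ?T c (%a b2. ks (wdeg a * wdeg b1) \<odot>[?T] K2 a b1 b2)"
  proof (intro ssum_cong refl)
   fix a b2 assume ab: "splits c a b2"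
   have "ks (wdeg a * wdeg b1) \<odot>[?T] K2 a b1 b2 =
     ks (wdeg a * wdeg b1 + (wdeg a + j) * wdeg b1) \<odot>[?T] ?t (wdeg b1) (F b1) (wdeg c + j) (m a b2)"
    unfolding K2_def s'(3)[OF ab] using cl[OF ab] by (intro m_ksign_ksign) auto
   also have "... = ks (j * wdeg b1) \<odot>[?T] ?t (wdeg b1) (F b1) (wdeg c + j) (m a b2)"
    by (intro ksmult_cong refl) auto
   finally show "ks (j * wdeg b1) \<odot>[?T] ?t (wdeg b1) (F b1) (wdeg c + j) (m a b2) =
     ks (wdeg a * wdeg b1) \<odot>[?T] K2 a b1 b2" by simp
  qed
  finally show "ss ?T c (%a b2. ks (wdeg a * wdeg b1) \<odot>[?T] K2 a b1 b2) =
    ks (j * wdeg b1) \<odot>[?T] ?t (wdeg b1) (F b1) (wdeg c + j) (conv R V j g F c)" by simp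
 qed
 finally show ?thesis .
qed

lemma conv_symfun:
 assumes g: "symf W (%d. V (d + j)) g" and F: "symf W (Sy V) F"
 shows "symf W (%d. Sy V (d + j)) (conv R V j g F)"
proof -
 have b: "bisym R W W (%d. Sy V (d + j)) (%a b. wmul R V [(wdeg a + j, g a)] (wdeg b) (F b))"
  unfolding bisym_def
 proof (intro conjI ballI)
  fix b assume b: "b \<in> words W"
  show "symf W (%d. Sy V (d + wdeg b + j)) (%a. wmul R V [(wdeg a + j, g a)] (wdeg b) (F b))"
   by (rule symfun_mlin[OF g, where h = "%d v. wmul R V [(d + j, v)] (wdeg b) (F b)"])
    (use b symfun_closed[OF F b refl] in \<open>auto intro!: wmul_letter_mlin\<close>)
 next
  fix a assume a: "a \<in> words W"
  show "symf W (%d. Sy V (wdeg a + d + j)) (%b. wmul R V [(wdeg a + j, g a)] (wdeg b) (F b))"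
   by (rule symfun_mlin[OF F, where h = "%d. wmul R V [(wdeg a + j, g a)] d"])
    (use a symfun_closed[OF g a refl] in \<open>auto intro!: wmul_mlin\<close>)
 qed
 have "symf W (%d. Sy V (d + j)) (%w. ss (Sy V (wdeg w + j)) w
   (%a b. wmul R V [(wdeg a + j, g a)] (wdeg b) (F b)))"
  by (rule ssum_symfun[OF W b]) simp
 then show ?thesis
  by (simp add: conv_def[abs_def])
qed

end

lemma ssum_minus:
 fixes P :: "('k, 'p) module"
 assumes P: "module R P" and "!!a b. splits w a b ==> G a b \<in> carrier P" "!!a b. splits w a b ==> H a b \<in> carrier P"
 shows "ss P w (%a b. G a b \<ominus>[P] H a b) = ss P w G \<ominus>[P] ss P w H"
proof -
 have "ss P w (%a b. G a b \<oplus>[P] (\<ominus> \<one>) \<odot>[P] H a b) = ss P w G \<oplus>[P] (\<ominus> \<one>) \<odot>[P] ss P w H"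
  using assms by (simp add: ssum_add ssum_smult)
 moreover have "ss P w (%a b. G a b \<ominus>[P] H a b) = ss P w (%a b. G a b \<oplus>[P] (\<ominus> \<one>) \<odot>[P] H a b)"
  using assms by (intro ssum_cong refl) (simp add: m_minus_eq neg_eq_smult)
 ultimately show ?thesis
  using assms by (simp add: m_minus_eq neg_eq_smult)
qed

context
 fixes W :: "('k, 'w) gmod" and V :: "('k, 'v) gmod"
 assumes W [simp]: "gr W" and V [simp]: "gr V"
begin

text \<open>The coderivation rule along \<open>F\<close> is linear in the coderivation, so the
  difference satisfies \<open>word_uniqueness\<close> with \<open>G = F\<close>.\<close>

lemma derivation_unique:
 assumes F: "!!w. w \<in> words W ==> F w \<in> carrier (Sy V (wdeg w))" "F [] = sm V []"
  and D1: "!!w. w \<in> words W ==> D1 w \<in> carrier (Sy V (wdeg w + j))"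
  and D2: "!!w. w \<in> words W ==> D2 w \<in> carrier (Sy V (wdeg w + j))"
  and c1: "!!w. w \<in> words W ==> cmu V (wdeg w + j) (D1 w) =
    ss (ST V (wdeg w + j)) w (%a b. ten V (wdeg a + j) (D1 a) (wdeg b) (F b)) \<oplus>[ST V (wdeg w + j)]
    ss (ST V (wdeg w + j)) w (%a b. ks (j * wdeg a) \<odot>[ST V (wdeg w + j)] ten V (wdeg a) (F a) (wdeg b + j) (D1 b))"
  and c2: "!!w. w \<in> words W ==> cmu V (wdeg w + j) (D2 w) =
    ss (ST V (wdeg w + j)) w (%a b. ten V (wdeg a + j) (D2 a) (wdeg b) (F b)) \<oplus>[ST V (wdeg w + j)]
    ss (ST V (wdeg w + j)) w (%a b. ks (j * wdeg a) \<odot>[ST V (wdeg w + j)] ten V (wdeg a) (F a) (wdeg b + j) (D2 b))"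
  and p: "!!w. w \<in> words W ==> pr V (wdeg w + j) (D1 w) = pr V (wdeg w + j) (D2 w)"
  and w: "w \<in> words W"
 shows "D1 w = D2 w"
proof -
 define D where "D = (%w. D1 w \<ominus>[Sy V (wdeg w + j)] D2 w)"
 have "D w = \<zero>[Sy V (wdeg w + j)]"
 proof (rule word_uniqueness[where F = F and G = F and D = D])
  fix w assume w: "w \<in> words W"
  show "D w \<in> carrier (Sy V (wdeg w + j))"
   using w D1 D2 by (simp add: D_def)
  show "pr V (wdeg w + j) (D w) = \<zero>[V (wdeg w + j)]"
   using w D1 D2 p[OF w] mlin_closed[OF proj1_lift(1)[OF V] D2[OF w]]
   by (simp add: D_def mlin_minus[OF _ _ proj1_lift(1)] m_minus_zero_iff)
  let ?T = "ST V (wdeg w + j)"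
  note sp = splitsD[OF _ w]
  have cl: "ten V (wdeg a + j) (Di a) (wdeg b) (F b) \<in> carrier ?T" "ten V (wdeg a) (F a) (wdeg b + j) (Di b) \<in> carrier ?T"
   if "splits w a b" "Di = D1 \<or> Di = D2" for a b Di
   using sp[OF that(1)] that(2) by (auto intro!: tens_closed F D1 D2)
  have eq: "ten V (wdeg a + j) (D a) (wdeg b) (F b) = ten V (wdeg a + j) (D1 a) (wdeg b) (F b) \<ominus>[?T] ten V (wdeg a + j) (D2 a) (wdeg b) (F b)"
   "ks (j * wdeg a) \<odot>[?T] ten V (wdeg a) (F a) (wdeg b + j) (D b) =
    ks (j * wdeg a) \<odot>[?T] ten V (wdeg a) (F a) (wdeg b + j) (D1 b) \<ominus>[?T]
    ks (j * wdeg a) \<odot>[?T] ten V (wdeg a) (F a) (wdeg b + j) (D2 b)"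
   if ab: "splits w a b" for a b
  proof -
   note s = sp[OF ab]
   have l: "lin (Sy V (wdeg a + j)) ?T (%x. ten V (wdeg a + j) x (wdeg b) (F b))"
    using s by (intro tens_mlin_left F) auto
   have "lin (Sy V (wdeg b + j)) ?T (%x. ten V (wdeg a) (F a) (wdeg b + j) x)"
    using s by (intro tens_mlin_right F) auto
   then have r: "lin (Sy V (wdeg b + j)) ?T (%x. ks (j * wdeg a) \<odot>[?T] ten V (wdeg a) (F a) (wdeg b + j) x)"
    by (intro mlin_scale) auto
   show "ten V (wdeg a + j) (D a) (wdeg b) (F b) = ten V (wdeg a + j) (D1 a) (wdeg b) (F b) \<ominus>[?T] ten V (wdeg a + j) (D2 a) (wdeg b) (F b)"
    using mlin_minus[OF _ _ l D1[OF s(1)] D2[OF s(1)]] by (simp add: D_def)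
   show "ks (j * wdeg a) \<odot>[?T] ten V (wdeg a) (F a) (wdeg b + j) (D b) =
     ks (j * wdeg a) \<odot>[?T] ten V (wdeg a) (F a) (wdeg b + j) (D1 b) \<ominus>[?T]
     ks (j * wdeg a) \<odot>[?T] ten V (wdeg a) (F a) (wdeg b + j) (D2 b)"
    using mlin_minus[OF _ _ r D1[OF s(2)] D2[OF s(2)]] by (simp add: D_def)
  qed
  have "ss ?T w (%a b. ten V (wdeg a + j) (D a) (wdeg b) (F b) \<oplus>[?T] ks (j * wdeg a) \<odot>[?T] ten V (wdeg a) (F a) (wdeg b + j) (D b)) =
   ss ?T w (%a b. ten V (wdeg a + j) (D a) (wdeg b) (F b)) \<oplus>[?T]
   ss ?T w (%a b. ks (j * wdeg a) \<odot>[?T] ten V (wdeg a) (F a) (wdeg b + j) (D b))"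
   by (intro ssum_add) (use cl eq in simp_all)
  also have "ss ?T w (%a b. ten V (wdeg a + j) (D a) (wdeg b) (F b)) =
   ss ?T w (%a b. ten V (wdeg a + j) (D1 a) (wdeg b) (F b)) \<ominus>[?T] ss ?T w (%a b. ten V (wdeg a + j) (D2 a) (wdeg b) (F b))"
   by (subst ssum_minus[symmetric]) (use cl eq in \<open>simp_all cong: ssum_cong\<close>)
  also have "ss ?T w (%a b. ks (j * wdeg a) \<odot>[?T] ten V (wdeg a) (F a) (wdeg b + j) (D b)) =
   ss ?T w (%a b. ks (j * wdeg a) \<odot>[?T] ten V (wdeg a) (F a) (wdeg b + j) (D1 b)) \<ominus>[?T]
   ss ?T w (%a b. ks (j * wdeg a) \<odot>[?T] ten V (wdeg a) (F a) (wdeg b + j) (D2 b))"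
   by (subst ssum_minus[symmetric]) (use cl eq in \<open>simp_all cong: ssum_cong\<close>)
  finally have X: "ss ?T w (%a b. ten V (wdeg a + j) (D a) (wdeg b) (F b) \<oplus>[?T]
    ks (j * wdeg a) \<odot>[?T] ten V (wdeg a) (F a) (wdeg b + j) (D b)) =
   (ss ?T w (%a b. ten V (wdeg a + j) (D1 a) (wdeg b) (F b)) \<ominus>[?T] ss ?T w (%a b. ten V (wdeg a + j) (D2 a) (wdeg b) (F b))) \<oplus>[?T]
   (ss ?T w (%a b. ks (j * wdeg a) \<odot>[?T] ten V (wdeg a) (F a) (wdeg b + j) (D1 b)) \<ominus>[?T]
   ss ?T w (%a b. ks (j * wdeg a) \<odot>[?T] ten V (wdeg a) (F a) (wdeg b + j) (D2 b)))" .
  have Dw: "D w = D1 w \<ominus>[Sy V (wdeg w + j)] D2 w"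
   by (simp add: D_def)
  have "cmu V (wdeg w + j) (D w) = cmu V (wdeg w + j) (D1 w) \<ominus>[?T] cmu V (wdeg w + j) (D2 w)"
   unfolding Dw by (rule mlin_minus[OF _ _ comult_mlin[OF V] D1[OF w] D2[OF w]]) auto
  then show "cmu V (wdeg w + j) (D w) = ss ?T w (%a b. ten V (wdeg a + j) (D a) (wdeg b) (F b) \<oplus>[?T]
    ks (j * wdeg a) \<odot>[?T] ten V (wdeg a) (F a) (wdeg b + j) (D b))"
   unfolding X using cl
   by (simp add: c1[OF w] c2[OF w] m_minus_eq m_neg_add madd_ac)
 qed (use W V F w in auto)
 then show ?thesis
  using D1[OF w] D2[OF w] by (simp add: D_def m_minus_zero_iff)
qed

lemma morphism_unique:
 assumes F: "!!w. w \<in> words W ==> F w \<in> carrier (Sy V (wdeg w))" "F [] = sm V []"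
  and G: "!!w. w \<in> words W ==> G w \<in> carrier (Sy V (wdeg w))" "G [] = sm V []"
  and c1: "!!w. w \<in> words W ==> cmu V (wdeg w) (F w) = ss (ST V (wdeg w)) w (%a b. ten V (wdeg a) (F a) (wdeg b) (F b))"
  and c2: "!!w. w \<in> words W ==> cmu V (wdeg w) (G w) = ss (ST V (wdeg w)) w (%a b. ten V (wdeg a) (G a) (wdeg b) (G b))"
  and p: "!!w. w \<in> words W ==> pr V (wdeg w) (F w) = pr V (wdeg w) (G w)"
  and w: "w \<in> words W"
 shows "F w = G w"
proof -
 define D where "D = (%w. F w \<ominus>[Sy V (wdeg w)] G w)"
 have "D w = \<zero>[Sy V (wdeg w + 0)]"
 proof (rule word_uniqueness[where F = F and G = G and D = D])
  fix w assume w: "w \<in> words W"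
  show "D w \<in> carrier (Sy V (wdeg w + 0))"
   using w F G by (simp add: D_def)
  show "pr V (wdeg w + 0) (D w) = \<zero>[V (wdeg w + 0)]"
   using w F G p[OF w] mlin_closed[OF proj1_lift(1)[OF V] G(1)[OF w]]
   by (simp add: D_def mlin_minus[OF _ _ proj1_lift(1)] m_minus_zero_iff)
  let ?T = "ST V (wdeg w)"
  note sp = splitsD[OF _ w]
  have cl: "ten V (wdeg a) (F a) (wdeg b) (F b) \<in> carrier ?T" "ten V (wdeg a) (G a) (wdeg b) (F b) \<in> carrier ?T"
   "ten V (wdeg a) (G a) (wdeg b) (G b) \<in> carrier ?T" if "splits w a b" for a b
   using sp[OF that] by (auto intro!: tens_closed F G)
  \<comment> \<open>The difference of \<open>F \<otimes> F\<close> and \<open>G \<otimes> G\<close>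
    is \<open>(F - G) \<otimes> F + G \<otimes> (F - G)\<close>; hence the two functions in
    \<open>word_uniqueness\<close>.\<close>
  have eq: "ten V (wdeg a) (D a) (wdeg b) (F b) \<oplus>[?T] ten V (wdeg a) (G a) (wdeg b) (D b) =
    ten V (wdeg a) (F a) (wdeg b) (F b) \<ominus>[?T] ten V (wdeg a) (G a) (wdeg b) (G b)"
   if ab: "splits w a b" for a b
  proof -
   note s = sp[OF ab]
   have l: "lin (Sy V (wdeg a)) ?T (%x. ten V (wdeg a) x (wdeg b) (F b))"
    using s by (intro tens_mlin_left F) auto
   have r: "lin (Sy V (wdeg b)) ?T (%x. ten V (wdeg a) (G a) (wdeg b) x)"
    using s by (intro tens_mlin_right G) auto
   have "ten V (wdeg a) (D a) (wdeg b) (F b) = ten V (wdeg a) (F a) (wdeg b) (F b) \<ominus>[?T] ten V (wdeg a) (G a) (wdeg b) (F b)"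
    using mlin_minus[OF _ _ l F(1)[OF s(1)] G(1)[OF s(1)]] by (simp add: D_def)
   moreover have "ten V (wdeg a) (G a) (wdeg b) (D b) = ten V (wdeg a) (G a) (wdeg b) (F b) \<ominus>[?T] ten V (wdeg a) (G a) (wdeg b) (G b)"
    using mlin_minus[OF _ _ r F(1)[OF s(2)] G(1)[OF s(2)]] by (simp add: D_def)
   ultimately show ?thesis
    using cl[OF ab]
    by (simp add: m_minus_eq madd_assoc) (simp add: madd_assoc[symmetric])
  qed
  have "ss ?T w (%a b. ten V (wdeg a) (D a) (wdeg b) (F b) \<oplus>[?T] ten V (wdeg a) (G a) (wdeg b) (D b)) =
   ss ?T w (%a b. ten V (wdeg a) (F a) (wdeg b) (F b) \<ominus>[?T] ten V (wdeg a) (G a) (wdeg b) (G b))"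
   by (intro ssum_cong refl eq)
  also have "... = cmu V (wdeg w) (F w \<ominus>[Sy V (wdeg w)] G w)"
   using cl F(1)[OF w] G(1)[OF w]
   by (simp add: mlin_minus[OF _ _ comult_mlin] c1[OF w] c2[OF w] ssum_minus)
  finally have e1: "cmu V (wdeg w) (D w) =
   ss ?T w (%a b. ten V (wdeg a) (D a) (wdeg b) (F b) \<oplus>[?T] ten V (wdeg a) (G a) (wdeg b) (D b))" by (simp add: D_def)
  have cl': "ten V (wdeg a) (G a) (wdeg b) (D b) \<in> carrier ?T" if "splits w a b" for a b
   using sp[OF that] by (auto intro!: tens_closed G simp: D_def F G)
  show "cmu V (wdeg w + 0) (D w) = ss (ST V (wdeg w + 0)) w (%a b. ten V (wdeg a + 0) (D a) (wdeg b) (F b)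
    \<oplus>[ST V (wdeg w + 0)] ks (0 * wdeg a) \<odot>[ST V (wdeg w + 0)] ten V (wdeg a) (G a) (wdeg b + 0) (D b))"
   unfolding add_0_right using e1 cl' by (simp cong: ssum_cong)
 qed (use W V F G w in auto)
 then show ?thesis
  using F(1)[OF w] G(1)[OF w] by (simp add: D_def m_minus_zero_iff)
qed

subsection \<open>Morphisms with prescribed components\<close>

lemma conv_add_left:
 assumes w: "w \<in> words W" and g: "!!a b. splits w a b ==> g1 a \<in> carrier (V (wdeg a + j))"
   "!!a b. splits w a b ==> g2 a \<in> carrier (V (wdeg a + j))"
  and F: "!!a b. splits w a b ==> F b \<in> carrier (Sy V (wdeg b))"
  and eq: "!!a b. splits w a b ==> g a = g1 a \<oplus>[V (wdeg a + j)] g2 a" and e: "e = wdeg w + j"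
 shows "conv R V j g F w = conv R V j g1 F w \<oplus>[Sy V e] conv R V j g2 F w"
proof -
 have m: "lin (V (wdeg a + j)) (Sy V e) (%v. wmul R V [(wdeg a + j, v)] (wdeg b) (F b))"
  if "splits w a b" for a b
  using F[OF that] splits_wdeg[OF that] e by (intro wmul_letter_mlin[OF V]) auto
 show ?thesis
  unfolding conv_def e[symmetric]
  by (subst ssum_add[symmetric])
   (use g m in \<open>auto simp: eq mlin_add[OF m] intro!: ssum_cong intro: mlin_closed[OF m]\<close>)
qed

lemma conv_smult_left:
 assumes w: "w \<in> words W" and g: "!!a b. splits w a b ==> g1 a \<in> carrier (V (wdeg a + j))"
  and F: "!!a b. splits w a b ==> F b \<in> carrier (Sy V (wdeg b))" and c: "c \<in> carrier R"
  and eq: "!!a b. splits w a b ==> g a = c \<odot>[V (wdeg a + j)] g1 a" and e: "e = wdeg w + j"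
 shows "conv R V j g F w = c \<odot>[Sy V e] conv R V j g1 F w"
proof -
 have m: "lin (V (wdeg a + j)) (Sy V e) (%v. wmul R V [(wdeg a + j, v)] (wdeg b) (F b))"
  if "splits w a b" for a b
  using F[OF that] splits_wdeg[OF that] e by (intro wmul_letter_mlin[OF V]) auto
 show ?thesis
  unfolding conv_def e[symmetric]
  by (subst ssum_smult)
   (use g m c in \<open>auto simp: eq mlin_smult[OF m] intro!: ssum_cong intro: mlin_closed[OF m]\<close>)
qed

context
 fixes f :: "'w word => 'v"
 assumes f: "symf W V f"
begin

abbreviation (input) "E \<equiv> expF R V f"

lemma f_Cons_closed: "[|snd x \<in> carrier (W (fst x)); a \<in> words W|] ==> f (x # a) \<in> carrier (V (wdeg a + fst x))"
 by (rule symfun_closed[OF f]) auto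

lemma expF_closed: "w \<in> words W ==> d = wdeg w ==> E w \<in> carrier (Sy V d)"
proof (induction "length w" arbitrary: w d rule: less_induct)
 case less
 show ?case
 proof (cases w)
  case Nil
  then show ?thesis using less.prems by (simp add: smon_closed)
 next
  case (Cons x v)
  have sp: "a \<in> words W" "b \<in> words W" "length b < length w" if "splits v a b" for a b
   using less.prems splits_words[OF that, of W] splits_length[OF that] Cons by auto
  have "conv R V (fst x) (%a. f (x # a)) E v \<in> carrier (Sy V (wdeg v + fst x))"
   using less.prems Cons sp
   by (intro conv_closed[OF W V _ _ less.hyps]) (auto intro!: f_Cons_closed)
  then show ?thesis using Cons less.prems by (simp add: add.commute)
 qed
qed

text \<open>The value at \<open>x # v\<close> is a convolution with values on shorter words. The two
  sums of \<open>comult_conv\<close> are the two branches of \<open>ssum\<close> for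
  \<open>x # v\<close>, with \<open>x\<close> on the left or on the right.\<close>

lemma comult_expF: "w \<in> words W ==>
 cmu V (wdeg w) (E w) = ss (ST V (wdeg w)) w (%a b. ten V (wdeg a) (E a) (wdeg b) (E b))"
proof (induction "length w" arbitrary: w rule: less_induct)
 case less
 show ?case
 proof (cases w)
  case Nil
  then show ?thesis by (simp add: comult_smon stens_def)
 next
  case (Cons x v)
  let ?T = "ST V (wdeg v + fst x)"
  have v: "v \<in> words W" and x: "snd x \<in> carrier (W (fst x))"
   using less.prems Cons by auto
  have sp: "b \<in> words W" "length b < length w" if "splits v a b" for a b
   using v splits_words[OF that, of W] splits_length[OF that] Cons by auto
  have "cmu V (wdeg v + fst x) (conv R V (fst x) (%a. f (x # a)) E v) =
   ss ?T v (%a b. ten V (wdeg a + fst x) (conv R V (fst x) (%a. f (x # a)) E a) (wdeg b) (E b)) \<oplus>[?T]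
   ss ?T v (%a b. ks (fst x * wdeg a) \<odot>[?T] ten V (wdeg a) (E a) (wdeg b + fst x) (conv R V (fst x) (%a. f (x # a)) E b))"
   by (rule comult_conv[OF W V v _ _ less.hyps]) (use sp x in \<open>auto intro!: f_Cons_closed expF_closed\<close>)
  then show ?thesis
   unfolding Cons by (simp add: add.commute[of "fst x"])
 qed
qed

text \<open>The recursion treats the first letter differently from the second. Expanding twice
  separates the terms with both letters in one factor, where \<open>f\<close> is symmetric, from
  those with two factors, which commute in S(V).\<close>

lemma expF_head_swap:
 assumes p: "snd p \<in> carrier (W (fst p))" and q: "snd q \<in> carrier (W (fst q))" and w: "w \<in> words W"
  and d: "d = fst p + fst q + wdeg w"
 shows "E (p # q # w) = ks (fst p * fst q) \<odot>[Sy V d] E (q # p # w)"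
proof -
 let ?S = "Sy V d"
 \<comment> \<open>\<open>A\<close> collects the terms with both letters in one factor,
   \<open>B\<close> those with one factor for each; \<open>L p a\<close> is the factor that contains
   \<open>p\<close>.\<close>
 define A where "A = (%p q. ss ?S w (%a b. wmul R V [(wdeg a + fst p + fst q, f (p # q # a))] (wdeg b) (E b)))"
 define L where "L = (%p a. (wdeg a + fst p, f (p # a)))"
 define K where "K = (%p q a c d. ks (fst q * wdeg a) \<odot>[?S] wmul R V [L p a, L q c] (wdeg d) (E d))"
 define B where "B = (%p q. ss ?S w (%a b. ss ?S b (%c d. K p q a c d)))"
 note sp = splitsD[OF _ w]
 have sp3: "a \<in> words W" "b \<in> words W" "c \<in> words W" "wdeg w = wdeg a + wdeg b + wdeg c" if "splits3 w a b c" for a b c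
  using w splits3_words[OF that, of W] splits3_wdeg[OF that] by auto
 have L: "snd (L p a) \<in> carrier (V (fst (L p a)))" "fst (L p a) = wdeg a + fst p"
  if "a \<in> words W" "snd p \<in> carrier (W (fst p))" for a p
  using that by (auto simp: L_def f_Cons_closed)
 have wK: "wmul R V [L p a, L q c] (wdeg e) (E e) \<in> carrier ?S"
  if "splits3 w a c e" "snd p \<in> carrier (W (fst p))" "snd q \<in> carrier (W (fst q))" "fst p + fst q + wdeg w = d" for a c e p q
  using sp3[OF that(1)] L that by (intro wmul_closed[OF V]) (auto intro!: expF_closed)
 have K: "K p q a c e \<in> carrier ?S"
  if "splits3 w a c e" "snd p \<in> carrier (W (fst p))" "snd q \<in> carrier (W (fst q))" "fst p + fst q + wdeg w = d" for a c e p q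
  unfolding K_def using wK[OF that] by simp
 have exp: "E (p # q # w) = A p q \<oplus>[?S] B p q"
  if p: "snd p \<in> carrier (W (fst p))" and q: "snd q \<in> carrier (W (fst q))" and d': "fst p + fst q + wdeg w = d" for p q
 proof -
  have d2: "wdeg (q # w) + fst p = d" using d' by simp
  have "E (p # q # w) = ss ?S w (%a b. wmul R V [(wdeg (q # a) + fst p, f (p # q # a))] (wdeg b) (E b)) \<oplus>[?S]
    ss ?S w (%a b. ks (fst q * wdeg a) \<odot>[?S] wmul R V [(wdeg a + fst p, f (p # a))] (wdeg (q # b)) (E (q # b)))"
   unfolding expF.simps(2)[of R V f p "q # w"] conv_def d2 by simp
  also have "ss ?S w (%a b. wmul R V [(wdeg (q # a) + fst p, f (p # q # a))] (wdeg b) (E b)) = A p q"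
   unfolding A_def by (intro ssum_cong refl) (simp add: algebra_simps)
  also have "ss ?S w (%a b. ks (fst q * wdeg a) \<odot>[?S] wmul R V [(wdeg a + fst p, f (p # a))] (wdeg (q # b)) (E (q # b))) = B p q"
   unfolding B_def
  proof (intro ssum_cong refl)
   fix a b assume ab: "splits w a b"
   note s = sp[OF ab]
   have s': "c \<in> words W" "e \<in> words W" "wdeg b = wdeg c + wdeg e" if "splits b c e" for c e
    using s splits_words[OF that, of W] splits_wdeg[OF that] by auto
   have Lp: "[L p a] \<in> words V" using L[OF s(1) p] by simp
   have Lq: "[L q c] \<in> words V" if "c \<in> words W" for c using L[OF that q] by simp
   have cl: "wmul R V [L q c] (wdeg e) (E e) \<in> carrier (Sy V (wdeg b + fst q))" if "splits b c e" for c e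
    using s'[OF that] q by (intro wmul_closed[OF V]) (auto intro!: expF_closed f_Cons_closed simp: L_def)
   have Eq: "E (q # b) = ss (Sy V (wdeg b + fst q)) b (%c e. wmul R V [L q c] (wdeg e) (E e))"
    by (simp add: conv_def L_def)
   have "wmul R V [L p a] (wdeg b + fst q) (E (q # b)) =
     ss ?S b (%c e. wmul R V [L p a] (wdeg b + fst q) (wmul R V [L q c] (wdeg e) (E e)))"
    unfolding Eq by (intro ssum_mlin wmul_mlin[OF V Lp]) (use cl s d' L(2)[OF s(1) p] in auto)
   also have "... = ss ?S b (%c e. wmul R V [L p a, L q c] (wdeg e) (E e))"
    by (intro ssum_cong refl, subst wmul_wmul[OF V Lp Lq])
     (use s' q in \<open>auto intro!: expF_closed f_Cons_closed simp: L_def\<close>)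
   finally have "ks (fst q * wdeg a) \<odot>[?S] wmul R V [L p a] (wdeg b + fst q) (E (q # b)) =
     ss ?S b (%c e. K p q a c e)"
    unfolding K_def using wK[OF splits3I(2)[OF ab]] p q d' by (simp add: ssum_smult)
   then show "ks (fst q * wdeg a) \<odot>[?S] wmul R V [(wdeg a + fst p, f (p # a))] (wdeg (q # b)) (E (q # b)) =
     ss ?S b (%c e. K p q a c e)"
    by (simp add: L_def add.commute)
  qed
  finally show ?thesis .
 qed
 have A: "A p q = ks (fst p * fst q) \<odot>[?S] A q p"
 proof -
  have m: "lin (V (wdeg a + fst p + fst q)) ?S (%v. wmul R V [(wdeg a + fst p + fst q, v)] (wdeg b) (E b))"
   if "splits w a b" for a b
   using sp[OF that] d by (intro wmul_letter_mlin[OF V]) (auto intro!: expF_closed)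
  have cl: "f (q # p # a) \<in> carrier (V (wdeg a + fst p + fst q))"
   and sw: "f (p # q # a) = ks (fst p * fst q) \<odot>[V (wdeg a + fst p + fst q)] f (q # p # a)" if "a \<in> words W" for a
  proof -
   show "f (q # p # a) \<in> carrier (V (wdeg a + fst p + fst q))"
    using that p q by (intro symfun_closed[OF f]) auto
   show "f (p # q # a) = ks (fst p * fst q) \<odot>[V (wdeg a + fst p + fst q)] f (q # p # a)"
    using symfun_swap0[OF f that p q, of "wdeg a + fst p + fst q"] by simp
  qed
  have "A p q = ss ?S w (%a b. ks (fst p * fst q) \<odot>[?S] wmul R V [(wdeg a + fst p + fst q, f (q # p # a))] (wdeg b) (E b))"
   unfolding A_def
  proof (intro ssum_cong refl)
   fix a b assume ab: "splits w a b"
   show "wmul R V [(wdeg a + fst p + fst q, f (p # q # a))] (wdeg b) (E b) =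
     ks (fst p * fst q) \<odot>[?S] wmul R V [(wdeg a + fst p + fst q, f (q # p # a))] (wdeg b) (E b)"
    unfolding sw[OF sp(1)[OF ab]] using cl[OF sp(1)[OF ab]] by (simp add: mlin_smult[OF m[OF ab]])
  qed
  also have "... = ks (fst p * fst q) \<odot>[?S] ss ?S w (%a b. wmul R V [(wdeg a + fst p + fst q, f (q # p # a))] (wdeg b) (E b))"
   using cl sp by (intro ssum_smult[symmetric]) (auto intro: mlin_closed[OF m])
  also have "ss ?S w (%a b. wmul R V [(wdeg a + fst p + fst q, f (q # p # a))] (wdeg b) (E b)) = A q p"
   by (simp add: A_def add.assoc add.commute[of "fst p"])
  finally show ?thesis .
 qed
 have B: "B p q = ks (fst p * fst q) \<odot>[?S] B q p"
 proof -
  have d1: "fst p + fst q + wdeg w = d" "fst q + fst p + wdeg w = d" using d by auto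
  \<comment> \<open>The two factors are interchanged by \<open>ssum_exchange\<close> on the words
    and by commutativity in S(V) on the letters; of all the signs that of \<open>p\<close> and
    \<open>q\<close> remains.\<close>
  have "B p q = ss ?S w (%c b. ss ?S b (%a e. ks (wdeg a * wdeg c) \<odot>[?S] K p q a c e))"
   unfolding B_def using K p q d1 by (intro ssum_exchange) auto
  also have "... = ss ?S w (%c b. ks (fst p * fst q) \<odot>[?S] ss ?S b (%a e. K q p c a e))"
  proof (intro ssum_cong refl)
   fix c b assume cb: "splits w c b"
   have "ss ?S b (%a e. ks (wdeg a * wdeg c) \<odot>[?S] K p q a c e) = ss ?S b (%a e. ks (fst p * fst q) \<odot>[?S] K q p c a e)"
   proof (intro ssum_cong refl)
    fix a e assume ae: "splits b a e"
    have s3: "splits3 w c a e" by (rule splits3I(2)[OF cb ae])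
    note s = sp3[OF s3]
    have y: "E e \<in> carrier (Sy V (wdeg e))" using s by (intro expF_closed) auto
    note La = L[OF s(2) p] and Lc = L[OF s(1) q]
    have dd: "wdeg e + (d - wdeg e) = d" by simp
    have fa: "f (p # a) \<in> carrier (V (wdeg a + fst p))" "f (q # c) \<in> carrier (V (wdeg c + fst q))"
     using s p q by (auto intro!: f_Cons_closed)
    have "wmul R V [(wdeg a + fst p, f (p # a)), (wdeg c + fst q, f (q # c))] (wdeg e) (E e) =
     ks ((wdeg a + fst p) * (wdeg c + fst q)) \<odot>[Sy V (wdeg e + (d - wdeg e))]
     wmul R V [(wdeg c + fst q, f (q # c)), (wdeg a + fst p, f (p # a))] (wdeg e) (E e)"
     by (rule symfun_swap0[OF wmul_symfun[OF V y] _ fa]) (use s d in simp_all)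
    then have "wmul R V [L p a, L q c] (wdeg e) (E e) =
      ks ((wdeg a + fst p) * (wdeg c + fst q)) \<odot>[?S] wmul R V [L q c, L p a] (wdeg e) (E e)"
     unfolding dd L_def .
    then show "ks (wdeg a * wdeg c) \<odot>[?S] K p q a c e = ks (fst p * fst q) \<odot>[?S] K q p c a e"
     unfolding K_def using wK[OF s3 q p d1(2)] La(2) Lc(2)
     by (simp add: m_ksign_ksign) (rule ksmult_cong, auto)
   qed
   also have "... = ks (fst p * fst q) \<odot>[?S] ss ?S b (%a e. K q p c a e)"
    using K[OF splits3I(2)[OF cb] q p d1(2)] by (intro ssum_smult[symmetric]) auto
   finally show "ss ?S b (%a e. ks (wdeg a * wdeg c) \<odot>[?S] K p q a c e) =
    ks (fst p * fst q) \<odot>[?S] ss ?S b (%a e. K q p c a e)" .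
  qed
  also have "... = ks (fst p * fst q) \<odot>[?S] B q p"
   unfolding B_def using K[OF splits3I(2) q p d1(2)] by (intro ssum_smult[symmetric]) auto
  finally show ?thesis .
 qed
 have cl: "A q p \<in> carrier ?S" "B q p \<in> carrier ?S"
 proof -
  show "A q p \<in> carrier ?S"
   unfolding A_def using sp p q d
   by (intro ssum_closed wmul_closed[OF V] expF_closed) (auto intro!: symfun_closed[OF f])
  show "B q p \<in> carrier ?S"
   unfolding B_def using p q d by (intro ssum_closed K[OF splits3I(2)]) auto
 qed
 show ?thesis
  using exp[of p q] exp[of q p] p q d A B cl by (simp add: m_smult_add)
qed

lemma expF_symfun: "symf W (Sy V) E"
proof -
 \<comment> \<open>By induction only the symmetry of \<open>E\<close> on shorter words is available,
   while \<open>conv_symfun\<close> wants a function that is symmetric on all words. Cutting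
   \<open>E\<close> off by zero beyond length \<open>n\<close> provides one.\<close>
 define T where "T = (%n w. if length w \<le> n then E w else \<zero>[Sy V (wdeg w)])"
 have T0: "T n w = \<zero>[Sy V (wdeg w)]" if "length w > n" for n w
  using that by (simp add: T_def)
 have TE: "T n w = E w" if "length w \<le> n" for n w
  using that by (simp add: T_def)
 have Tcl: "T n w \<in> carrier (Sy V d)" if "w \<in> words W" "d = wdeg w" for n w d
  using that by (simp add: T_def expF_closed)
 have T: "symf W (Sy V) (T n)" for n
 proof (induction n)
  case 0
  show ?case
   by (rule symfunI) (auto simp: Tcl T0 add.left_commute)
 next
  case (Suc n)
  \<comment> \<open>A change away from the head is seen through \<open>H z\<close>, which is
    symmetric by \<open>conv_symfun\<close>. A change at the head is treated by linearity of
    \<open>f\<close> in its first letter, and a swap there by \<open>expF_head_swap\<close>.\<close>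
  define H where "H = (%z. conv R V (fst z) (%a. f (z # a)) (T n))"
  have Hs: "symf W (%d. Sy V (d + fst z)) (H z)" if "snd z \<in> carrier (W (fst z))" for z
  proof -
   have "symf W (%d. V (d + fst z)) (%a. f (z # a))"
    using symfun_Cons[OF f that] by (simp add: add.commute)
   then show ?thesis
    unfolding H_def by (rule conv_symfun[OF W V _ Suc.IH])
  qed
  have TH: "T (Suc n) (z # t) = H z t" if "length t \<le> n" for z t
  proof -
   have "E (z # t) = H z t"
    unfolding H_def expF.simps(2)
    by (rule conv_cong[OF refl refl]) (use that in \<open>auto simp: T_def splits_length\<close>)
   then show ?thesis using that by (simp add: T_def)
  qed
  have C: "E b \<in> carrier (Sy V (wdeg b))" if "splits v a b" "v \<in> words W" for a b v
   using that by (intro expF_closed) (auto simp: splits_words)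
  show ?case
  proof (rule symfunI)
   show "T (Suc n) w \<in> carrier (Sy V (wdeg w))" if "w \<in> words W" for w
    using that by (simp add: Tcl)
  next
   fix u v i x y assume a: "u \<in> words W" "v \<in> words W" "x \<in> carrier (W i)" "y \<in> carrier (W i)"
   let ?d = "wdeg u + (i + wdeg v)"
   show "T (Suc n) (u @ (i, x \<oplus>[W i] y) # v) = T (Suc n) (u @ (i, x) # v) \<oplus>[Sy V ?d] T (Suc n) (u @ (i, y) # v)"
   proof (cases "length u + length v \<le> n")
    case False
    then show ?thesis by (simp add: T0)
   next
    case True
    show ?thesis
    proof (cases u)
     case Nil
     have "E ((i, x \<oplus>[W i] y) # v) = E ((i, x) # v) \<oplus>[Sy V (wdeg v + i)] E ((i, y) # v)"
      unfolding expF.simps(2) fst_conv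
      by (rule conv_add_left) (use a C f_Cons_closed[of "(i, x)"] f_Cons_closed[of "(i, y)"] in
       \<open>auto simp: splits_words intro!: symfun_add0[OF f]\<close>)
     then show ?thesis using Nil True by (simp add: TE add.commute)
    next
     case (Cons z t)
     have z: "snd z \<in> carrier (W (fst z))" and t: "t \<in> words W" using a Cons by auto
     have "H z (t @ (i, x \<oplus>[W i] y) # v) = H z (t @ (i, x) # v) \<oplus>[Sy V (wdeg t + (i + wdeg v) + fst z)] H z (t @ (i, y) # v)"
      by (rule symfun_add[OF Hs[OF z] t a(2-4) refl])
     then show ?thesis using Cons True by (simp add: TH algebra_simps)
    qed
   qed
  next
   fix u v i x c assume a: "u \<in> words W" "v \<in> words W" "x \<in> carrier (W i)" "c \<in> carrier R"
   let ?d = "wdeg u + (i + wdeg v)"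
   show "T (Suc n) (u @ (i, c \<odot>[W i] x) # v) = c \<odot>[Sy V ?d] T (Suc n) (u @ (i, x) # v)"
   proof (cases "length u + length v \<le> n")
    case False
    then show ?thesis using a by (simp add: T0)
   next
    case True
    show ?thesis
    proof (cases u)
     case Nil
     have "E ((i, c \<odot>[W i] x) # v) = c \<odot>[Sy V (wdeg v + i)] E ((i, x) # v)"
      unfolding expF.simps(2) fst_conv
      by (rule conv_smult_left) (use a C f_Cons_closed[of "(i, x)"] in
       \<open>auto simp: splits_words intro!: symfun_smult0[OF f]\<close>)
     then show ?thesis using Nil True by (simp add: TE add.commute)
    next
     case (Cons z t)
     have z: "snd z \<in> carrier (W (fst z))" and t: "t \<in> words W" using a Cons by auto
     have "H z (t @ (i, c \<odot>[W i] x) # v) = c \<odot>[Sy V (wdeg t + (i + wdeg v) + fst z)] H z (t @ (i, x) # v)"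
      by (rule symfun_smult[OF Hs[OF z] t a(2-4) refl])
     then show ?thesis using Cons True by (simp add: TH algebra_simps)
    qed
   qed
  next
   fix u v i x j y assume a: "u \<in> words W" "v \<in> words W" "x \<in> carrier (W i)" "y \<in> carrier (W j)"
   let ?d = "wdeg u + (i + (j + wdeg v))"
   show "T (Suc n) (u @ (i, x) # (j, y) # v) = ks (i * j) \<odot>[Sy V ?d] T (Suc n) (u @ (j, y) # (i, x) # v)"
   proof (cases "length u + length v < n")
    case False
    then show ?thesis by (simp add: T0 add.left_commute)
   next
    case True
    show ?thesis
    proof (cases u)
     case Nil
     have "E ((i, x) # (j, y) # v) = ks (i * j) \<odot>[Sy V ?d] E ((j, y) # (i, x) # v)"
      using expF_head_swap[of "(i, x)" "(j, y)" v ?d] a Nil by (simp add: add.assoc)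
     then show ?thesis using Nil True by (simp add: TE)
    next
     case (Cons z t)
     have z: "snd z \<in> carrier (W (fst z))" and t: "t \<in> words W" using a Cons by auto
     have "H z (t @ (i, x) # (j, y) # v) =
       ks (i * j) \<odot>[Sy V (wdeg t + (i + (j + wdeg v)) + fst z)] H z (t @ (j, y) # (i, x) # v)"
      by (rule symfun_swap[OF Hs[OF z] t a(2-4) refl])
     then show ?thesis using Cons True by (simp add: TH algebra_simps)
    qed
   qed
  qed
 qed
 show ?thesis
 proof (rule symfunI)
  show "E w \<in> carrier (Sy V (wdeg w))" if "w \<in> words W" for w
   using that by (simp add: expF_closed)
 next
  fix u v i x y assume a: "u \<in> words W" "v \<in> words W" "x \<in> carrier (W i)" "y \<in> carrier (W i)"
  show "E (u @ (i, x \<oplus>[W i] y) # v) = E (u @ (i, x) # v) \<oplus>[Sy V (wdeg u + (i + wdeg v))] E (u @ (i, y) # v)"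
   using symfun_add[OF T[of "length u + length v + 1"] a refl] by (simp add: TE)
 next
  fix u v i x c assume a: "u \<in> words W" "v \<in> words W" "x \<in> carrier (W i)" "c \<in> carrier R"
  show "E (u @ (i, c \<odot>[W i] x) # v) = c \<odot>[Sy V (wdeg u + (i + wdeg v))] E (u @ (i, x) # v)"
   using symfun_smult[OF T[of "length u + length v + 1"] a refl] by (simp add: TE)
 next
  fix u v i x j y assume a: "u \<in> words W" "v \<in> words W" "x \<in> carrier (W i)" "y \<in> carrier (W j)"
  show "E (u @ (i, x) # (j, y) # v) = ks (i * j) \<odot>[Sy V (wdeg u + (i + (j + wdeg v)))] E (u @ (j, y) # (i, x) # v)"
   using symfun_swap[OF T[of "length u + length v + 2"] a refl] by (simp add: TE)
 qed
qed

text \<open>For nonempty \<open>b\<close> every term of \<open>E b\<close> starts with a letter, so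
  its product with \<open>x\<close> has at least two letters and no linear part.\<close>

lemma proj1_wmul_expF:
 assumes x: "snd x \<in> carrier (V (fst x))" and b: "b \<in> words W" and e: "e = fst x + wdeg b"
 shows "pr V e (wmul R V [x] (wdeg b) (E b)) = (if b = [] then snd x else \<zero>[V e])"
proof (cases b)
 case Nil
 then show ?thesis using x e proj1_letter[OF V, of "snd x" "fst x"] by (simp add: wmul_smon)
next
 case (Cons y t)
 let ?g = "%a. (wdeg a + fst y, f (y # a))"
 have y: "snd y \<in> carrier (W (fst y))" and t: "t \<in> words W" using b Cons by auto
 have x': "[x] \<in> words V" using x by simp
 have sp: "c \<in> words W" "d \<in> words W" "wdeg t = wdeg c + wdeg d" "[?g c] \<in> words V" if "splits t c d" for c d
  using t y splits_words[OF that, of W] splits_wdeg[OF that] by (auto intro!: f_Cons_closed)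
 have m: "lin (Sy V (wdeg b)) (V e) (%z. pr V e (wmul R V [x] (wdeg b) z))"
  by (rule mlin_comp[OF wmul_mlin[OF V x'] proj1_lift(1)[OF V]]) (use e in simp)
 have z: "pr V e (wmul R V [x] (wdeg b) (wmul R V [?g c] (wdeg d) z)) = \<zero>[V e]"
  if cd: "splits t c d" and z: "z \<in> carrier (Sy V (wdeg d))" for c d z
 proof -
  note s = sp[OF cd]
  have xg: "[x] @ [?g c] \<in> words V" using x' s(4) by simp
  have "wmul R V [x] (wdeg b) (wmul R V [?g c] (wdeg d) z) = wmul R V ([x] @ [?g c]) (wdeg d) z"
   using Cons s z by (intro wmul_wmul[OF V x']) auto
  moreover have "pr V e (wmul R V ([x] @ [?g c]) (wdeg d) z) = \<zero>[V e]"
  proof (rule sym_ext[OF V, where d = "wdeg d" and P = "V e" and x = z])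
   show "lin (Sy V (wdeg d)) (V e) (%z. pr V e (wmul R V ([x] @ [?g c]) (wdeg d) z))"
    by (rule mlin_comp[OF wmul_mlin[OF V xg] proj1_lift(1)[OF V]]) (use e s Cons in simp)
   show "lin (Sy V (wdeg d)) (V e) (%z. \<zero>[V e])"
    by (rule mlin_zero_map) simp
   fix r assume r: "r \<in> words V" "wdeg r = wdeg d"
   show "pr V e (wmul R V ([x] @ [?g c]) (wdeg d) (sm V r)) = \<zero>[V e]"
    using r xg e s Cons by (subst wmul_smon[OF V xg]) (auto simp: proj1_lift(2))
  qed (use z in auto)
  ultimately show ?thesis by simp
 qed
 have cl: "wmul R V [?g c] (wdeg d) (E d) \<in> carrier (Sy V (wdeg b))" if "splits t c d" for c d
  using sp[OF that] Cons by (intro wmul_closed[OF V]) (auto intro!: expF_closed)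
 have "wdeg t + fst y = wdeg b" using Cons by simp
 moreover have "E b = conv R V (fst y) (%a. f (y # a)) E t"
  using Cons by simp
 ultimately have "E b = ss (Sy V (wdeg b)) t (%c d. wmul R V [?g c] (wdeg d) (E d))"
  unfolding conv_def by (simp only:)
 then have "pr V e (wmul R V [x] (wdeg b) (E b)) =
   ss (V e) t (%c d. pr V e (wmul R V [x] (wdeg b) (wmul R V [?g c] (wdeg d) (E d))))"
  using ssum_mlin[OF _ _ m, of t "%c d. wmul R V [?g c] (wdeg d) (E d)"] cl by simp
 also have "... = \<zero>[V e]"
  using sp by (intro ssum_zero z expF_closed) auto
 finally show ?thesis using Cons by simp
qed

text \<open>Only the term whose first factor takes the whole word is a single letter.\<close>

lemma proj1_expF:
 assumes w: "w \<in> words W" "w \<noteq> []"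
 shows "pr V (wdeg w) (E w) = f w"
proof -
 obtain x v where xv: "w = x # v" using w by (cases w) auto
 have x: "snd x \<in> carrier (W (fst x))" and v: "v \<in> words W" using w xv by auto
 have e: "wdeg v + fst x = wdeg w" using xv by simp
 have sp: "a \<in> words W" "b \<in> words W" "wdeg w = wdeg b + (wdeg a + fst x)" "[(wdeg a + fst x, f (x # a))] \<in> words V"
  if "splits v a b" for a b
  using v x xv splits_words[OF that, of W] splits_wdeg[OF that] by (auto intro!: f_Cons_closed)
 have "pr V (wdeg w) (E w) =
   pr V (wdeg w) (ss (Sy V (wdeg w)) v (%a b. wmul R V [(wdeg a + fst x, f (x # a))] (wdeg b) (E b)))"
  using e by (simp only: xv expF.simps(2) conv_def)
 also have "... = ss (V (wdeg w)) v (%a b. pr V (wdeg w) (wmul R V [(wdeg a + fst x, f (x # a))] (wdeg b) (E b)))"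
  by (rule ssum_mlin[OF _ _ proj1_lift(1)[OF V]])
   (use sp in \<open>auto intro!: wmul_closed[OF V] expF_closed\<close>)
 also have "... = ss (V (wdeg w)) v (%a b. if b = [] then f (x # a) else \<zero>[V (wdeg w)])"
  using sp by (intro ssum_cong refl, subst proj1_wmul_expF) auto
 also have "... = f w"
  using f_Cons_closed[OF x v] e xv by (subst ssum_left) auto
 finally show ?thesis .
qed

end

end

end

text \<open>The coderivation rule on monomials, in the form that \<open>derivation_unique\<close>
  takes for \<open>F = smon\<close>. It makes sense for a function of words before that function is
  known to come from S(W).\<close>

definition wder :: "'k ring => ('k, 'w) gmod => int => ('w word => ('k, 'w) sym) => bool" where
 "wder R W j D \<longleftrightarrow> (\<forall>w\<in>words W. D w \<in> carrier (Sym R W (wdeg w + j)) \<and>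
   comult R W (wdeg w + j) (D w) =
    ssum R (SymTens R W (wdeg w + j)) w (%a b. tens R (Sym R W) (Sym R W) (wdeg a + j) (D a) (wdeg b) (smon R W b))
    \<oplus>[SymTens R W (wdeg w + j)]
    ssum R (SymTens R W (wdeg w + j)) w (%a b. ksign R (j * wdeg a) \<odot>[SymTens R W (wdeg w + j)]
     tens R (Sym R W) (Sym R W) (wdeg a) (smon R W a) (wdeg b + j) (D b)))"

context ground
begin

lemma tens_map_comult:
 fixes A' :: "('k, 'c) gmod" and B' :: "('k, 'd) gmod" and W :: "('k, 'w) gmod"
 assumes W [simp]: "gr W" and A' [simp]: "gr A'" and B' [simp]: "gr B'"
  and \<phi>: "gl R (Sy W) A' p \<phi>" and \<psi>: "gl R (Sy W) B' q \<psi>" and w: "w \<in> words W" "d = wdeg w" and e: "e = d + p + q"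
 shows "tens_map R A' B' p \<phi> q \<psi> d (cmu W d (sm W w)) = ss (tensor R A' B' e) w
  (%a b. ks (q * wdeg a) \<odot>[tensor R A' B' e]
   tens R A' B' (wdeg a + p) (\<phi> (wdeg a) (sm W a)) (wdeg b + q) (\<psi> (wdeg b) (sm W b)))"
proof -
 note tm = tens_map[OF gm_Sym[OF W] gm_Sym[OF W] A' B' \<phi> \<psi>]
 have sp: "a \<in> words W" "b \<in> words W" "wdeg a + wdeg b = d" if "splits w a b" for a b
  using w splits_words[OF that, of W] splits_wdeg[OF that] by auto
 have "tens_map R A' B' p \<phi> q \<psi> d (cmu W d (sm W w)) =
   ss (tensor R A' B' e) w (%a b. tens_map R A' B' p \<phi> q \<psi> d (stens R W a b))"
  unfolding comult_smon[OF W w] by (rule ssum_mlin[OF _ _ tm(1)[OF e]]) (use sp in \<open>auto intro!: stens_closed\<close>)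
 also have "... = ss (tensor R A' B' e) w (%a b. ks (q * wdeg a) \<odot>[tensor R A' B' e]
   tens R A' B' (wdeg a + p) (\<phi> (wdeg a) (sm W a)) (wdeg b + q) (\<psi> (wdeg b) (sm W b)))"
 proof (intro ssum_cong refl)
  fix a b assume ab: "splits w a b"
  show "tens_map R A' B' p \<phi> q \<psi> d (stens R W a b) = ks (q * wdeg a) \<odot>[tensor R A' B' e]
   tens R A' B' (wdeg a + p) (\<phi> (wdeg a) (sm W a)) (wdeg b + q) (\<psi> (wdeg b) (sm W b))"
   unfolding stens_def by (rule tm(2)[OF _ _ _ e]) (use sp[OF ab] in \<open>auto intro!: smon_closed\<close>)
 qed
 finally show ?thesis .
qed

subsection \<open>Composition and linearity of tensor products of maps\<close>

context
 fixes W :: "('k, 'w) gmod" and V :: "('k, 'v) gmod"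
 assumes W [simp]: "gr W" and V [simp]: "gr V"
begin

lemma tens_map_Sym:
 assumes "gl R (Sy W) (Sy V) p \<phi>" "gl R (Sy W) (Sy V) q \<psi>" "e = d + p + q"
 shows "lin (ST W d) (ST V e) (tmap V p \<phi> q \<psi> d)"
  and "[|x \<in> carrier (Sy W i); y \<in> carrier (Sy W j); i + j = d|] ==>
   tmap V p \<phi> q \<psi> d (ten W i x j y) =
   ks (q * i) \<odot>[ST V e] ten V (i + p) (\<phi> i x) (j + q) (\<psi> j y)"
 using tens_map[OF gm_Sym[OF W] gm_Sym[OF W] gm_Sym[OF V] gm_Sym[OF V] assms(1,2)] assms(3) by auto

lemma tens_map_Sym_closed:
 "[|gl R (Sy W) (Sy V) p \<phi>; gl R (Sy W) (Sy V) q \<psi>; e = d + p + q; t \<in> carrier (ST W d)|] ==>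
  tmap V p \<phi> q \<psi> d t \<in> carrier (ST V e)"
 by (rule mlin_closed[OF tens_map_Sym(1)])

text \<open>Both tensor positions are treated together, since the coderivation rule contains
  \<open>D \<otimes> 1\<close> as well as \<open>1 \<otimes> D\<close>.\<close>

lemma tens_map_lincomb:
 assumes \<phi>: "gl R (Sy W) (Sy V) p \<phi>" "gl R (Sy W) (Sy V) p \<phi>1" "gl R (Sy W) (Sy V) p \<phi>2"
  and \<psi>: "gl R (Sy W) (Sy V) q \<psi>" and ab: "a \<in> carrier R" "b \<in> carrier R"
  and eq: "!!i x. x \<in> carrier (Sy W i) ==> \<phi> i x = a \<odot>[Sy V (i + p)] \<phi>1 i x \<oplus>[Sy V (i + p)] b \<odot>[Sy V (i + p)] \<phi>2 i x"
  and t: "t \<in> carrier (ST W d)" and e: "e = d + p + q"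
 shows "tmap V p \<phi> q \<psi> d t =
   a \<odot>[ST V e] tmap V p \<phi>1 q \<psi> d t \<oplus>[ST V e]
   b \<odot>[ST V e] tmap V p \<phi>2 q \<psi> d t" (is ?L)
  and "tmap V q \<psi> p \<phi> d t =
   a \<odot>[ST V e] tmap V q \<psi> p \<phi>1 d t \<oplus>[ST V e]
   b \<odot>[ST V e] tmap V q \<psi> p \<phi>2 d t" (is ?R)
proof -
 have e': "e = d + q + p" using e by simp
 note l = tens_map_Sym(1)[OF _ \<psi> e] and r = tens_map_Sym(1)[OF \<psi> _ e']
 note ms = mlin_plus[OF _ mlin_scale[OF _ _ ab(1)] mlin_scale[OF _ _ ab(2)]]
 note g = gl_closed[OF \<phi>(2) _ refl] gl_closed[OF \<phi>(3) _ refl] gl_closed[OF \<psi> _ refl]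
 show ?L
 proof (rule tens_ext[OF gm_Sym[OF W] gm_Sym[OF W] _ l[OF \<phi>(1)] ms[OF _ _ l[OF \<phi>(2)] _ l[OF \<phi>(3)]] _ t])
  fix i x j y assume *: "x \<in> carrier (Sy W i)" "y \<in> carrier (Sy W j)" "i + j = d"
  let ?t = "%x. ten V (i + p) x (j + q) (\<psi> j y)"
  have m: "lin (Sy V (i + p)) (ST V e) ?t"
   using * e g by (intro tens_mlin_left) auto
  show "tmap V p \<phi> q \<psi> d (ten W i x j y) =
   a \<odot>[ST V e] tmap V p \<phi>1 q \<psi> d (ten W i x j y) \<oplus>[ST V e]
   b \<odot>[ST V e] tmap V p \<phi>2 q \<psi> d (ten W i x j y)"
   unfolding tens_map_Sym(2)[OF \<phi>(1) \<psi> e *] tens_map_Sym(2)[OF \<phi>(2) \<psi> e *] tens_map_Sym(2)[OF \<phi>(3) \<psi> e *] eq[OF *(1)]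
   using g(1,2)[OF *(1)] ab mlin_closed[OF m]
   by (simp add: mlin_add[OF m] mlin_smult[OF m] m_smult_add m_smult_smult m_comm)
 qed simp_all
 show ?R
 proof (rule tens_ext[OF gm_Sym[OF W] gm_Sym[OF W] _ r[OF \<phi>(1)] ms[OF _ _ r[OF \<phi>(2)] _ r[OF \<phi>(3)]] _ t])
  fix i x j y assume *: "x \<in> carrier (Sy W i)" "y \<in> carrier (Sy W j)" "i + j = d"
  let ?t = "%y. ten V (i + q) (\<psi> i x) (j + p) y"
  have m: "lin (Sy V (j + p)) (ST V e) ?t"
   using * e g by (intro tens_mlin_right) auto
  show "tmap V q \<psi> p \<phi> d (ten W i x j y) =
   a \<odot>[ST V e] tmap V q \<psi> p \<phi>1 d (ten W i x j y) \<oplus>[ST V e]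
   b \<odot>[ST V e] tmap V q \<psi> p \<phi>2 d (ten W i x j y)"
   unfolding tens_map_Sym(2)[OF \<psi> \<phi>(1) e' *] tens_map_Sym(2)[OF \<psi> \<phi>(2) e' *] tens_map_Sym(2)[OF \<psi> \<phi>(3) e' *] eq[OF *(2)]
   using g(1,2)[OF *(2)] ab mlin_closed[OF m]
   by (simp add: mlin_add[OF m] mlin_smult[OF m] m_smult_add m_smult_smult m_comm)
 qed simp_all
qed

text \<open>The sign is that of the second outer map passing the first inner one.\<close>

lemma tens_map_comp:
 fixes U :: "('k, 'u) gmod"
 assumes U [simp]: "gr U"
  and \<phi>: "gl R (Sy W) (Sy V) p \<phi>" and \<psi>: "gl R (Sy W) (Sy V) q \<psi>"
  and \<phi>': "gl R (Sy V) (Sy U) p' \<phi>'" and \<psi>': "gl R (Sy V) (Sy U) q' \<psi>'"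
  and \<phi>'': "gl R (Sy W) (Sy U) p'' \<phi>''" and \<psi>'': "gl R (Sy W) (Sy U) q'' \<psi>''"
  and pq: "p'' = p + p'" "q'' = q + q'"
  and eq: "!!i x. x \<in> carrier (Sy W i) ==> \<phi>'' i x = \<phi>' (i + p) (\<phi> i x)"
   "!!i x. x \<in> carrier (Sy W i) ==> \<psi>'' i x = \<psi>' (i + q) (\<psi> i x)"
  and t: "t \<in> carrier (ST W d)" and e: "e = d + p + q" and f: "f = e + p' + q'"
 shows "tmap U p' \<phi>' q' \<psi>' e (tmap V p \<phi> q \<psi> d t) =
  ks (q' * p) \<odot>[ST U f] tmap U p'' \<phi>'' q'' \<psi>'' d t"
proof -
 note A = tens_map_Sym[OF \<phi> \<psi> e]
 note B = ground.tens_map_Sym[OF ground_axioms V U \<phi>' \<psi>' f]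
 have f': "f = d + p'' + q''" using e f pq by simp
 note C = ground.tens_map_Sym[OF ground_axioms W U \<phi>'' \<psi>'' f']
 show ?thesis
 proof (rule tens_ext[OF gm_Sym[OF W] gm_Sym[OF W] _ mlin_comp[OF A(1) B(1)] mlin_scale[OF _ C(1) ksign_closed] _ t])
  fix i x j y assume *: "x \<in> carrier (Sy W i)" "y \<in> carrier (Sy W j)" "i + j = d"
  note c = gl_closed[OF \<phi> *(1) refl] gl_closed[OF \<psi> *(2) refl]
  have ij: "i + p + (j + q) = e" using *(3) e by simp
  have T: "ten V (i + p) (\<phi> i x) (j + q) (\<psi> j y) \<in> carrier (ST V e)"
   using c ij by (intro tens_closed) auto
  have S: "ten U (i + p'') (\<phi>'' i x) (j + q'') (\<psi>'' j y) \<in> carrier (ST U f)"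
   using gl_closed[OF \<phi>'' *(1) refl] gl_closed[OF \<psi>'' *(2) refl] *(3) f' by (intro tens_closed) auto
  have ip: "i + p + p' = i + p''" "j + q + q' = j + q''" using pq by simp_all
  show "tmap U p' \<phi>' q' \<psi>' e (tmap V p \<phi> q \<psi> d (ten W i x j y)) =
   ks (q' * p) \<odot>[ST U f] tmap U p'' \<phi>'' q'' \<psi>'' d (ten W i x j y)"
   unfolding A(2)[OF *] mlin_smult[OF B(1) ksign_closed T] B(2)[OF c ij] C(2)[OF *] ip eq(1)[OF *(1), symmetric] eq(2)[OF *(2), symmetric]
    m_ksign_ksign[OF gm[OF gm_tensor[OF gm_Sym[OF U] gm_Sym[OF U]]] S]
   by (rule ksmult_cong) (auto simp: pq algebra_simps)
 qed simp_all
qed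

end

subsection \<open>Morphisms\<close>

context
 fixes W :: "('k, 'w) gmod" and V :: "('k, 'v) gmod"
 assumes W [simp]: "gr W" and V [simp]: "gr V"
begin

lemma smf_D:
 assumes F: "F \<in> smf W V"
 shows smf_gl: "gl R (Sy W) (Sy V) 0 F"
  and smf_one: "F 0 (sm W []) = sm V []"
  and smf_comult: "w \<in> words W ==> d = wdeg w ==> cmu V d (F d (sm W w)) =
   ss (ST V d) w (%a b. ten V
    (wdeg a) (F (wdeg a) (sm W a)) (wdeg b) (F (wdeg b) (sm W b)))"
proof -
 show g: "gl R (Sy W) (Sy V) 0 F" and "F 0 (sm W []) = sm V []"
  using F by (auto simp: smf_morphisms_def graded_maps_iff)
 show "cmu V d (F d (sm W w)) = ss (ST V d) w (%a b. ten V
    (wdeg a) (F (wdeg a) (sm W a)) (wdeg b) (F (wdeg b) (sm W b)))" if w: "w \<in> words W" "d = wdeg w"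
 proof -
  have "cmu V d (F d (sm W w)) = tmap V 0 F 0 F d (cmu W d (sm W w))"
   using F w by (simp add: smf_morphisms_def smon_closed)
  also have "... = ss (ST V d) w (%a b. ks (0 * wdeg a) \<odot>[ST V d] ten V
    (wdeg a + 0) (F (wdeg a) (sm W a)) (wdeg b + 0) (F (wdeg b) (sm W b)))"
   by (rule tens_map_comult[OF W gm_Sym[OF V] gm_Sym[OF V] g g w]) simp
  also have "... = ss (ST V d) w (%a b. ten V
    (wdeg a) (F (wdeg a) (sm W a)) (wdeg b) (F (wdeg b) (sm W b)))"
  proof (intro ssum_cong refl)
   fix a b assume ab: "splits w a b"
   have "ten V (wdeg a) (F (wdeg a) (sm W a)) (wdeg b) (F (wdeg b) (sm W b)) \<in> carrier (ST V d)"
    using w splits_words[OF ab, of W] splits_wdeg[OF ab] by (auto intro!: tens_closed gl_closed[OF g] smon_closed)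
   then show "ks (0 * wdeg a) \<odot>[ST V d] ten V
    (wdeg a + 0) (F (wdeg a) (sm W a)) (wdeg b + 0) (F (wdeg b) (sm W b)) = ten V
    (wdeg a) (F (wdeg a) (sm W a)) (wdeg b) (F (wdeg b) (sm W b))" by simp
  qed
  finally show ?thesis .
 qed
qed

lemma smf_ext: "F \<in> smf W V ==> F d \<in> extensional (carrier (Sy W d))"
 by (auto simp: smf_morphisms_def graded_maps_iff)

lemma smf_closed: "F \<in> smf W V ==> x \<in> carrier (Sy W d) ==> F d x \<in> carrier (Sy V d)"
 using gl_closed[OF smf_gl] by fastforce

lemma smf_mlin: "F \<in> smf W V ==> lin (Sy W d) (Sy V d) (F d)"
 using glD[OF smf_gl] by fastforce

lemma smfI:
 assumes ext: "!!d. F d \<in> extensional (carrier (Sy W d))" and g: "gl R (Sy W) (Sy V) 0 F"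
  and one: "F 0 (sm W []) = sm V []"
  and c: "!!w. w \<in> words W ==> cmu V (wdeg w) (F (wdeg w) (sm W w)) =
   ss (ST V (wdeg w)) w (%a b. ten V
    (wdeg a) (F (wdeg a) (sm W a)) (wdeg b) (F (wdeg b) (sm W b)))"
 shows "F \<in> smf W V"
proof -
 have "cmu V d (F d x) = tmap V 0 F 0 F d (cmu W d x)"
  if x: "x \<in> carrier (Sy W d)" for d x
 proof (rule sym_ext[OF W, where d = d and P = "ST V d" and x = x])
  show "lin (Sy W d) (ST V d) (%x. cmu V d (F d x))"
   by (rule mlin_comp[OF glD[OF g] comult_mlin[OF V]]) simp
  show "lin (Sy W d) (ST V d) (%x. tmap V 0 F 0 F d (cmu W d x))"
   by (rule mlin_comp[OF comult_mlin[OF W] tens_map(1)[OF _ _ _ _ g g]]) auto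
  fix w assume w: "w \<in> words W" "wdeg w = d"
  show "cmu V d (F d (sm W w)) = tmap V 0 F 0 F d (cmu W d (sm W w))"
   unfolding w(2)[symmetric] c[OF w(1)]
  proof (subst tens_map_comult[OF W gm_Sym[OF V] gm_Sym[OF V] g g w(1) refl, of "wdeg w"])
   show "ss (ST V (wdeg w)) w (%a b. ten V
    (wdeg a) (F (wdeg a) (sm W a)) (wdeg b) (F (wdeg b) (sm W b))) =
    ss (ST V (wdeg w)) w (%a b. ks (0 * wdeg a) \<odot>[ST V (wdeg w)] ten V
    (wdeg a + 0) (F (wdeg a) (sm W a)) (wdeg b + 0) (F (wdeg b) (sm W b)))"
   proof (intro ssum_cong refl)
    fix a b assume ab: "splits w a b"
    have "ten V (wdeg a) (F (wdeg a) (sm W a)) (wdeg b) (F (wdeg b) (sm W b)) \<in> carrier (ST V (wdeg w))"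
     using w splits_words[OF ab, of W] splits_wdeg[OF ab] by (auto intro!: tens_closed gl_closed[OF g] smon_closed)
    then show "ten V (wdeg a) (F (wdeg a) (sm W a)) (wdeg b) (F (wdeg b) (sm W b)) =
     ks (0 * wdeg a) \<odot>[ST V (wdeg w)] ten V
     (wdeg a + 0) (F (wdeg a) (sm W a)) (wdeg b + 0) (F (wdeg b) (sm W b))" by simp
   qed
  qed simp
 qed (use x in auto)
 then show ?thesis
  using ext g one by (simp add: smf_morphisms_def graded_maps_iff)
qed

lemma component_mlin_symfun:
 assumes g: "gl R (Sy W) (Sy V) j D"
 shows "symf W (%d. V (d + j)) (cpt W V j D)"
 unfolding component_def[abs_def]
 by (rule symfun_mlin[OF smon_symfun[OF W], where h = "%d x. pr V (d + j) (D d x)"])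
  (auto intro: mlin_comp[OF glD[OF g refl] proj1_lift(1)[OF V]])

lemma smf_component_symfun: "F \<in> smf W V ==> symf W V (cpt W V 0 F)"
 using component_mlin_symfun[OF smf_gl] by fastforce

lemma smf_eqI:
 assumes F: "F \<in> smf W V" and G: "G \<in> smf W V"
  and eq: "!!w. w \<in> words W ==> w \<noteq> [] ==> cpt W V 0 F w = cpt W V 0 G w"
 shows "F = G"
proof -
 have w: "F (wdeg w) (sm W w) = G (wdeg w) (sm W w)" if w: "w \<in> words W" for w
 proof (rule morphism_unique[OF W V, where F = "%w. F (wdeg w) (sm W w)" and G = "%w. G (wdeg w) (sm W w)"])
  show "pr V (wdeg w) (F (wdeg w) (sm W w)) = pr V (wdeg w) (G (wdeg w) (sm W w))" if "w \<in> words W" for w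
  proof (cases "w = []")
   case True
   then show ?thesis by (simp add: smf_one[OF F] smf_one[OF G])
  next
   case False
   then show ?thesis using eq[OF that] by (simp add: component_def)
  qed
 qed (use w smf_one[OF F] smf_one[OF G] smf_comult[OF F] smf_comult[OF G] in
  \<open>auto intro!: smf_closed[OF F] smf_closed[OF G] smon_closed\<close>)
 have "F d x = G d x" for d x
 proof (cases "x \<in> carrier (Sy W d)")
  case True
  show ?thesis
   by (rule sym_ext[OF W _ smf_mlin[OF F] smf_mlin[OF G] _ True]) (use w in auto)
 next
  case False
  then show ?thesis using smf_ext[OF F, of d] smf_ext[OF G, of d] by (simp add: extensional_def)
 qed
 then show ?thesis by blast
qed

lemma mexp_smf:
 assumes f: "symf W V f"
 shows "mexp R W V f \<in> smf W V"
  and mexp_smon: "w \<in> words W ==> d = wdeg w ==> mexp R W V f d (sm W w) = expF R V f w"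
  and component_mexp: "w \<in> words W ==> w \<noteq> [] ==> cpt W V 0 (mexp R W V f) w = f w"
proof -
 have P: "module R (Sy V d)" for d by simp
 note l = sym_lift[OF W expF_symfun[OF W V f] P refl]
 have v: "mexp R W V f d (sm W w) = expF R V f w" if "w \<in> words W" "d = wdeg w" for d w
  using l(2)[OF that(1), of d] that by (simp add: mexp_def smon_closed)
 have g: "gl R (Sy W) (Sy V) 0 (mexp R W V f)"
  unfolding gl_def mexp_def using mlin_cong[OF l(1)] by simp
 show "mexp R W V f \<in> smf W V"
 proof (rule smfI)
  show "mexp R W V f d \<in> extensional (carrier (Sy W d))" for d
   by (simp add: mexp_def)
  show "mexp R W V f 0 (sm W []) = sm V []"
   by (simp add: v)
  fix w assume w: "w \<in> words W"
  have "ss (ST V (wdeg w)) w (%a b. ten V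
    (wdeg a) (mexp R W V f (wdeg a) (sm W a)) (wdeg b) (mexp R W V f (wdeg b) (sm W b))) =
   ss (ST V (wdeg w)) w (%a b. ten V
    (wdeg a) (expF R V f a) (wdeg b) (expF R V f b))"
  proof (intro ssum_cong refl)
   fix a b assume "splits w a b"
   then have "a \<in> words W" "b \<in> words W" using w by (auto simp: splits_words)
   then show "ten V
    (wdeg a) (mexp R W V f (wdeg a) (sm W a)) (wdeg b) (mexp R W V f (wdeg b) (sm W b)) =
    ten V (wdeg a) (expF R V f a) (wdeg b) (expF R V f b)"
    by (simp add: v)
  qed
  then show "cmu V (wdeg w) (mexp R W V f (wdeg w) (sm W w)) =
   ss (ST V (wdeg w)) w (%a b. ten V
    (wdeg a) (mexp R W V f (wdeg a) (sm W a)) (wdeg b) (mexp R W V f (wdeg b) (sm W b)))"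
   using w by (simp add: v comult_expF[OF W V f])
 qed (rule g)
 show "w \<in> words W ==> d = wdeg w ==> mexp R W V f d (sm W w) = expF R V f w"
  by (rule v)
 show "w \<in> words W ==> w \<noteq> [] ==> cpt W V 0 (mexp R W V f) w = f w"
  by (simp add: component_def v proj1_expF[OF W V f])
qed

lemma smf_eq_mexp:
 assumes F: "F \<in> smf W V"
 shows "F = mexp R W V (cpt W V 0 F)"
 by (rule smf_eqI[OF F mexp_smf(1)[OF smf_component_symfun[OF F]]])
  (simp add: component_mexp[OF smf_component_symfun[OF F]])

lemma component_closed: "gl R (Sy W) (Sy V) j D ==> w \<in> words W ==> d = wdeg w + j ==> cpt W V j D w \<in> carrier (V d)"
 using symfun_closed[OF component_mlin_symfun] by fastforce

definition strict_comp :: "(int => 'w => 'v) => 'w word => 'v" where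
 "strict_comp \<phi> w = (if length w = 1 then \<phi> (fst (hd w)) (snd (hd w)) else \<zero>[V (wdeg w)])"

lemma strict_comp_symfun:
 assumes \<phi>: "!!i. lin (W i) (V i) (\<phi> i)"
 shows "symf W V (strict_comp \<phi>)"
proof (rule symfunI)
 show "strict_comp \<phi> w \<in> carrier (V (wdeg w))" if "w \<in> words W" for w
  using that mlin_closed[OF \<phi>] by (cases w) (auto simp: strict_comp_def)
qed (auto simp: strict_comp_def mlin_add[OF \<phi>] mlin_smult[OF \<phi>] add.left_commute)

text \<open>The components vanish on longer words, so in each step of the recursion only the factor
  consisting of the first letter alone survives.\<close>

lemma expF_strict:
 assumes \<phi>: "!!i. lin (W i) (V i) (\<phi> i)" and w: "w \<in> words W"
 shows "expF R V (strict_comp \<phi>) w = sm V (map (%(i, y). (i, \<phi> i y)) w)"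
 using w
proof (induction w)
 case Nil
 then show ?case by simp
next
 case (Cons x w)
 let ?m = "map (%(i, y). (i, \<phi> i y))"
 note f = strict_comp_symfun[OF \<phi>]
 have mw: "?m u \<in> words V" "wdeg (?m u) = wdeg u" if "u \<in> words W" for u
  using that by (induction u) (auto simp: mlin_closed[OF \<phi>] split: prod.splits)
 have w: "w \<in> words W" and x: "snd x \<in> carrier (W (fst x))" using Cons.prems by auto
 note sp = splitsD[OF _ w]
 have z: "wmul R V [(wdeg a + fst x, strict_comp \<phi> (x # a))] (wdeg b) (expF R V (strict_comp \<phi>) b) = \<zero>[Sy V (wdeg w + fst x)]"
  if ab: "splits w a b" "a \<noteq> []" for a b
 proof -
  have y: "expF R V (strict_comp \<phi>) b \<in> carrier (Sy V (wdeg b))"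
   using sp[OF ab(1)] by (intro expF_closed[OF W V f]) auto
  have e: "wdeg w + fst x = wdeg b + (wdeg a + fst x)" using sp[OF ab(1)] by simp
  have "strict_comp \<phi> (x # a) = \<zero>[V (wdeg a + fst x)]"
   using ab(2) by (simp add: strict_comp_def add.commute)
  then show ?thesis
   using mlin_zero[OF _ _ wmul_letter_mlin[OF W V y e]] by simp
 qed
 have s1: "strict_comp \<phi> [x] = \<phi> (fst x) (snd x)"
  by (simp add: strict_comp_def)
 have "ss (Sy V (wdeg w + fst x)) w (%a b. wmul R V [(wdeg a + fst x, strict_comp \<phi> (x # a))] (wdeg b) (expF R V (strict_comp \<phi>) b)) =
   wmul R V [(wdeg ([] :: 'w word) + fst x, strict_comp \<phi> [x])] (wdeg w) (expF R V (strict_comp \<phi>) w)"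
 proof (rule ssum_right)
  show "wmul R V [(wdeg ([] :: 'w word) + fst x, strict_comp \<phi> [x])] (wdeg w) (expF R V (strict_comp \<phi>) w) \<in>
    carrier (Sy V (wdeg w + fst x))"
   using x mw[OF w] by (intro wmul_closed[OF V]) (simp_all add: s1 Cons.IH[OF w] mlin_closed[OF \<phi>] smon_closed)
 qed (use z in auto)
 then have "expF R V (strict_comp \<phi>) (x # w) =
   wmul R V [(fst x, \<phi> (fst x) (snd x))] (wdeg w) (sm V (?m w))"
  by (simp add: conv_def s1 Cons.IH[OF w])
 also have "... = sm V (?m (x # w))"
  using mw[OF w] x by (simp add: wmul_smon mlin_closed[OF \<phi>] split_beta)
 finally show ?case .
qed

text \<open>Applying \<open>\<phi>\<close> letterwise is the exponential of
  \<open>strict_comp \<phi>\<close>, so being a coalgebra morphism is inherited from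
  \<open>mexp_smf\<close>.\<close>

lemma strict_smf:
 assumes \<phi>: "!!i. lin (W i) (V i) (\<phi> i)"
 shows strict_smf1: "strict_morphism R W V \<phi> \<in> smf W V"
  and strict_smon: "w \<in> words W ==> d = wdeg w ==> strict_morphism R W V \<phi> d (sm W w) = sm V (map (%(i, y). (i, \<phi> i y)) w)"
  and proj1_strict: "x \<in> carrier (Sy W d) ==> pr V d (strict_morphism R W V \<phi> d x) = \<phi> d (pr W d x)"
proof -
 note f = strict_comp_symfun[OF \<phi>]
 have P: "module R (Sy V d)" for d by simp
 have eq: "sm V (map (%(i, y). (i, \<phi> i y)) w) = expF R V (strict_comp \<phi>) w" if "w \<in> words W" "wdeg w = d" for w d
  using expF_strict[OF \<phi> that(1)] by simp
 note l = sym_lift[OF W expF_symfun[OF W V f] P eq]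
 have m: "strict_morphism R W V \<phi> d x = mexp R W V (strict_comp \<phi>) d x" if x: "x \<in> carrier (Sy W d)" for d x
  unfolding strict_morphism_def mexp_def restrict_apply'[OF x]
  by (rule sym_ext[OF W P l(1) sym_lift(1)[OF W expF_symfun[OF W V f] P refl] _ x])
   (use l(2) sym_lift(2)[OF W expF_symfun[OF W V f] P refl] in \<open>simp_all\<close>)
 have "strict_morphism R W V \<phi> d x = mexp R W V (strict_comp \<phi>) d x" for d x
  using m[of x d] by (cases "x \<in> carrier (Sy W d)") (auto simp: strict_morphism_def mexp_def)
 then have eq': "strict_morphism R W V \<phi> = mexp R W V (strict_comp \<phi>)" by blast
 show s: "strict_morphism R W V \<phi> \<in> smf W V"
  unfolding eq' by (rule mexp_smf(1)[OF f])
 show v: "w \<in> words W ==> d = wdeg w ==> strict_morphism R W V \<phi> d (sm W w) = sm V (map (%(i, y). (i, \<phi> i y)) w)" for w d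
  unfolding eq' by (simp add: mexp_smon[OF f] expF_strict[OF \<phi>])
 have mw: "map (%(i, y). (i, \<phi> i y)) u \<in> words V \<and> wdeg (map (%(i, y). (i, \<phi> i y)) u) = wdeg u" if "u \<in> words W" for u
  using that by (induction u) (auto simp: mlin_closed[OF \<phi>] split: prod.splits)
 show "pr V d (strict_morphism R W V \<phi> d x) = \<phi> d (pr W d x)" if x: "x \<in> carrier (Sy W d)"
 proof (rule sym_ext[OF W, where d = d and P = "V d" and x = x])
  show "lin (Sy W d) (V d) (%x. pr V d (strict_morphism R W V \<phi> d x))"
   by (rule mlin_comp[OF smf_mlin[OF s] proj1_lift(1)[OF V]])
  show "lin (Sy W d) (V d) (%x. \<phi> d (pr W d x))"
   by (rule mlin_comp[OF proj1_lift(1)[OF W] \<phi>])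
  fix w assume w: "w \<in> words W" "wdeg w = d"
  have "\<phi> d \<zero>[W d] = \<zero>[V d]" by (rule mlin_zero[OF _ _ \<phi>]) auto
  then show "pr V d (strict_morphism R W V \<phi> d (sm W w)) = \<phi> d (pr W d (sm W w))"
   using w mw[OF w(1)] by (cases w) (auto simp: v proj1_lift(2))
 qed (use x in auto)
qed

end

lemma smf_comp:
 fixes W :: "('k, 'w) gmod" and V :: "('k, 'v) gmod" and U :: "('k, 'u) gmod"
 assumes W [simp]: "gr W" and V [simp]: "gr V" and U [simp]: "gr U"
  and F: "F \<in> smf W V" and G: "G \<in> smf V U"
 shows "gcomp (Sy W) G F \<in> smf W U"
proof -
 let ?H = "gcomp (Sy W) G F"
 have v: "?H d x = G d (F d x)" if "x \<in> carrier (Sy W d)" for d x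
  using that by (simp add: gcomp_def)
 have "lin (Sy W d) (Sy U d) (?H d)" for d
  by (rule mlin_cong[OF mlin_comp[OF smf_mlin[OF W V F] smf_mlin[OF V U G]]]) (auto simp: v)
 then have g: "gl R (Sy W) (Sy U) 0 ?H" by (simp add: gl_def)
 note gF = smf_gl[OF W V F] and gG = smf_gl[OF V U G]
 have "cmu U d (?H d x) = tmap U 0 ?H 0 ?H d (cmu W d x)"
  if x: "x \<in> carrier (Sy W d)" for d x
 proof -
  have c: "cmu W d x \<in> carrier (ST W d)" by (rule mlin_closed[OF comult_mlin[OF W] x])
  have "cmu U d (?H d x) = tmap U 0 G 0 G d (tmap V 0 F 0 F d (cmu W d x))"
   using F G x smf_closed[OF W V F x] by (simp add: smf_morphisms_def v)
  also have "... = ks (0 * 0) \<odot>[ST U d] tmap U 0 ?H 0 ?H d (cmu W d x)"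
   by (rule tens_map_comp[OF W V U gF gF gG gG g g _ _ _ _ c]) (simp_all add: v)
  also have "... = tmap U 0 ?H 0 ?H d (cmu W d x)"
   using tens_map_Sym_closed[OF W U g g _ c, of d] by simp
  finally show ?thesis .
 qed
 moreover have "?H 0 (sm W []) = sm U []"
  using v[OF smon_closed[OF W, of "[]" 0]] by (simp add: smf_one[OF W V F] smf_one[OF V U G])
 ultimately show ?thesis
  using g by (auto simp: smf_morphisms_def graded_maps_iff gcomp_def)
qed

subsection \<open>Coderivations\<close>

context
 fixes W :: "('k, 'w) gmod"
 assumes W [simp]: "gr W"
begin

lemma coder_tens_maps:
 assumes g: "gl R (Sy W) (Sy W) j D" and w: "w \<in> words W" "d = wdeg w"
 shows "tmap W j D 0 (%i y. y) d (cmu W d (sm W w)) =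
   ss (ST W (d + j)) w (%a b. ten W (wdeg a + j) (D (wdeg a) (sm W a)) (wdeg b) (sm W b))"
  and "tmap W 0 (%i y. y) j D d (cmu W d (sm W w)) =
   ss (ST W (d + j)) w (%a b. ks (j * wdeg a) \<odot>[ST W (d + j)] ten W (wdeg a) (sm W a) (wdeg b + j) (D (wdeg b) (sm W b)))"
proof -
 have sp: "a \<in> words W" "b \<in> words W" "wdeg a + wdeg b = d" if "splits w a b" for a b
  using w splits_words[OF that, of W] splits_wdeg[OF that] by auto
 have cl: "ten W (wdeg a + j) (D (wdeg a) (sm W a)) (wdeg b) (sm W b) \<in> carrier (ST W (d + j))"
  if "splits w a b" for a b
  using sp[OF that] by (auto intro!: tens_closed gl_closed[OF g] smon_closed)
 show "tmap W j D 0 (%i y. y) d (cmu W d (sm W w)) =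
   ss (ST W (d + j)) w (%a b. ten W (wdeg a + j) (D (wdeg a) (sm W a)) (wdeg b) (sm W b))"
  by (subst tens_map_comult[OF W gm_Sym[OF W] gm_Sym[OF W] g gl_id w, of "d + j"])
   (use cl in \<open>simp_all cong: ssum_cong\<close>)
 show "tmap W 0 (%i y. y) j D d (cmu W d (sm W w)) =
   ss (ST W (d + j)) w (%a b. ks (j * wdeg a) \<odot>[ST W (d + j)] ten W (wdeg a) (sm W a) (wdeg b + j) (D (wdeg b) (sm W b)))"
  by (subst tens_map_comult[OF W gm_Sym[OF W] gm_Sym[OF W] gl_id g w, of "d + j"]) simp_all
qed

lemma coder_D:
 assumes D: "D \<in> coder W j"
 shows coder_gl: "gl R (Sy W) (Sy W) j D"
  and coder_ext: "D d \<in> extensional (carrier (Sy W d))"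
  and coder_wder: "wder R W j (%w. D (wdeg w) (sm W w))"
proof -
 show g: "gl R (Sy W) (Sy W) j D" and "D d \<in> extensional (carrier (Sy W d))"
  using D by (auto simp: coderivations_def graded_maps_iff)
 show "wder R W j (%w. D (wdeg w) (sm W w))"
  unfolding wder_def
 proof (intro ballI conjI)
  fix w assume w: "w \<in> words W"
  then have s: "sm W w \<in> carrier (Sy W (wdeg w))" by (simp add: smon_closed)
  show "D (wdeg w) (sm W w) \<in> carrier (Sy W (wdeg w + j))"
   using s by (intro gl_closed[OF g]) auto
  show "cmu W (wdeg w + j) (D (wdeg w) (sm W w)) =
    ss (ST W (wdeg w + j)) w (%a b. ten W (wdeg a + j) (D (wdeg a) (sm W a)) (wdeg b) (sm W b)) \<oplus>[ST W (wdeg w + j)]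
    ss (ST W (wdeg w + j)) w (%a b. ks (j * wdeg a) \<odot>[ST W (wdeg w + j)] ten W (wdeg a) (sm W a) (wdeg b + j) (D (wdeg b) (sm W b)))"
   using D s coder_tens_maps[OF g w refl] by (simp add: coderivations_def)
 qed
qed

lemma coderI:
 assumes ext: "!!d. D d \<in> extensional (carrier (Sy W d))" and g: "gl R (Sy W) (Sy W) j D"
  and wd: "wder R W j (%w. D (wdeg w) (sm W w))"
 shows "D \<in> coder W j"
proof -
 let ?R = "%d x. tmap W j D 0 (%i y. y) d (cmu W d x) \<oplus>[ST W (d + j)]
     tmap W 0 (%i y. y) j D d (cmu W d x)"
 have "cmu W (d + j) (D d x) = ?R d x" if x: "x \<in> carrier (Sy W d)" for d x
 proof (rule sym_ext[OF W, where d = d and P = "ST W (d + j)" and x = x])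
  show "lin (Sy W d) (ST W (d + j)) (%x. cmu W (d + j) (D d x))"
   by (rule mlin_comp[OF glD[OF g refl] comult_mlin[OF W]])
  show "lin (Sy W d) (ST W (d + j)) (?R d)"
   by (intro mlin_plus mlin_comp[OF comult_mlin[OF W] tens_map(1)[OF _ _ _ _ g gl_id]]
    mlin_comp[OF comult_mlin[OF W] tens_map(1)[OF _ _ _ _ gl_id g]]) auto
  fix w assume w: "w \<in> words W" "wdeg w = d"
  show "cmu W (d + j) (D d (sm W w)) = ?R d (sm W w)"
   using wd w coder_tens_maps[OF g w(1) w(2)[symmetric]] by (auto simp: wder_def)
 qed (use x in auto)
 then show ?thesis
  using ext g by (simp add: coderivations_def graded_maps_iff)
qed

lemma coder_closed: "D \<in> coder W j ==> x \<in> carrier (Sy W d) ==> e = d + j ==> D d x \<in> carrier (Sy W e)"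
 by (rule gl_closed[OF coder_gl])

lemma coder_mlin: "D \<in> coder W j ==> e = d + j ==> lin (Sy W d) (Sy W e) (D d)"
 by (rule glD[OF coder_gl])

lemma coder_component_symfun: "D \<in> coder W j ==> symf W (%d. W (d + j)) (cpt W W j D)"
 by (rule component_mlin_symfun[OF W W coder_gl])

lemma coder_component_closed: "D \<in> coder W j ==> w \<in> words W ==> d = wdeg w + j ==> cpt W W j D w \<in> carrier (W d)"
 by (rule component_closed[OF W W coder_gl])

lemma coder_word_eqI:
 assumes "!!w. w \<in> words W ==> D (wdeg w) (sm W w) = D' (wdeg w) (sm W w)"
  and "gl R (Sy W) (Sy W) j D" "gl R (Sy W) (Sy W) j D'"
  and "!!d. D d \<in> extensional (carrier (Sy W d))" "!!d. D' d \<in> extensional (carrier (Sy W d))"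
 shows "D = D'"
proof -
 have "D d x = D' d x" for d x
 proof (cases "x \<in> carrier (Sy W d)")
  case True
  show ?thesis
   by (rule sym_ext[OF W _ glD[OF assms(2) refl] glD[OF assms(3) refl] _ True]) (use assms(1) in auto)
 next
  case False
  then show ?thesis using assms(4,5)[of d] by (simp add: extensional_def)
 qed
 then show ?thesis by blast
qed

lemma coder_eqI:
 assumes D: "D \<in> coder W j" and D': "D' \<in> coder W j"
  and eq: "!!w. w \<in> words W ==> cpt W W j D w = cpt W W j D' w"
 shows "D = D'"
proof (rule coder_word_eqI)
 fix w assume w: "w \<in> words W"
 show "D (wdeg w) (sm W w) = D' (wdeg w) (sm W w)"
  by (rule derivation_unique[OF W W, where F = "sm W" and ?D1.0 = "%w. D (wdeg w) (sm W w)"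
    and ?D2.0 = "%w. D' (wdeg w) (sm W w)" and j = j])
   (use w coder_wder[OF D] coder_wder[OF D'] eq in \<open>simp_all add: wder_def component_def smon_closed\<close>)
qed (use coder_gl[OF D] coder_gl[OF D'] coder_ext[OF D] coder_ext[OF D'] in auto)

lemma smon_wmul: "[|x \<in> carrier (W i); b \<in> words W|] ==> wmul R W [(i, x)] (wdeg b) (sm W b) = sm W ((i, x) # b)"
 by (simp add: wmul_smon)

text \<open>By \<open>finsum_Sh\<close> the defining shuffle sum is \<open>conv\<close> of
  \<open>q\<close> with \<open>smon\<close>, and \<open>comult_conv\<close> gives the coderivation
  rule. A single letter arises only if \<open>q\<close> takes the whole word, which gives the
  components.\<close>

lemma vfield_of_lemmas:
 assumes q: "symf W (%d. W (d + j)) q"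
 shows vfield_of_coder: "vfield_of R W j q \<in> coder W j"
  and vfield_of_smon: "w \<in> words W ==> d = wdeg w ==> vfield_of R W j q d (sm W w) =
   ss (Sy W (d + j)) w (%a b. sm W ((wdeg a + j, q a) # b))"
  and component_vfield_of: "w \<in> words W ==> cpt W W j (vfield_of R W j q) w = q w"
proof -
 have qc: "q a \<in> carrier (W (wdeg a + j))" if "a \<in> words W" for a
  using symfun_closed[OF q that refl] .
 have sp: "a \<in> words W" "b \<in> words W" "wdeg w = wdeg a + wdeg b" if "splits w a b" "w \<in> words W" for a b w
  using that splits_words[OF that(1), of W] splits_wdeg[OF that(1)] by auto
 have cl: "sm W ((wdeg a + j, q a) # b) \<in> carrier (Sy W (wdeg w + j))" if "splits w a b" "w \<in> words W" for a b w
  using sp[OF that] by (intro smon_closed) (auto intro!: qc)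
 have cv: "conv R W j q (sm W) w = ss (Sy W (wdeg w + j)) w (%a b. sm W ((wdeg a + j, q a) # b))"
  if "w \<in> words W" for w
  unfolding conv_def using sp[OF _ that] by (intro ssum_cong refl smon_wmul qc) auto
 have eq: "finsum (Sy W (d + j)) (%(l, \<sigma>). let u = take l (permute_list \<sigma> w); v = drop l (permute_list \<sigma> w) in
     koszul R w \<sigma> \<odot>[Sy W (d + j)] sm W ((wdeg u + j, q u) # v)) (SIGMA l:{..length w}. Sh l (length w)) =
    conv R W j q (sm W) w" if w: "w \<in> words W" "wdeg w = d" for w d
  using finsum_Sh[of "Sy W (d + j)" w "%a b. sm W ((wdeg a + j, q a) # b)"] cl[OF _ w(1)] w
  by (simp add: Let_def cv)
 have P: "module R (Sy W (d + j))" for d by simp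
 note cs = conv_symfun[OF W W q smon_symfun[OF W]]
 note l = sym_lift[OF W cs P eq]
 have v: "vfield_of R W j q d (sm W w) = conv R W j q (sm W) w" if "w \<in> words W" "d = wdeg w" for d w
  using l(2)[OF _ _ that(1) that(2)[symmetric]] that by (simp add: vfield_of_def smon_closed)
 show sm: "w \<in> words W ==> d = wdeg w ==> vfield_of R W j q d (sm W w) =
   ss (Sy W (d + j)) w (%a b. sm W ((wdeg a + j, q a) # b))" for w d
  by (simp add: v cv)
 have "wder R W j (conv R W j q (sm W))"
  unfolding wder_def
 proof (intro ballI conjI)
  fix w assume w: "w \<in> words W"
  show "conv R W j q (sm W) w \<in> carrier (Sy W (wdeg w + j))"
   using symfun_closed[OF cs w refl] .
  show "cmu W (wdeg w + j) (conv R W j q (sm W) w) =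
    ss (ST W (wdeg w + j)) w (%a b. ten W (wdeg a + j) (conv R W j q (sm W) a) (wdeg b) (sm W b)) \<oplus>[ST W (wdeg w + j)]
    ss (ST W (wdeg w + j)) w (%a b. ks (j * wdeg a) \<odot>[ST W (wdeg w + j)]
     ten W (wdeg a) (sm W a) (wdeg b + j) (conv R W j q (sm W) b))"
   by (rule comult_conv[OF W W w _ _ _ refl])
    (use sp[OF _ w] in \<open>auto intro!: qc smon_closed simp: comult_smon stens_def[abs_def]\<close>)
 qed
 moreover have "wder R W j (%w. vfield_of R W j q (wdeg w) (sm W w)) = wder R W j (conv R W j q (sm W))"
  unfolding wder_def by (intro ball_cong refl arg_cong2[where f = "(\<and>)"] arg_cong2[where f = "(=)"] arg_cong2[where f = "add _"] ssum_cong)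
   (auto simp: v splits_words)
 moreover have "gl R (Sy W) (Sy W) j (vfield_of R W j q)"
  unfolding gl_def vfield_of_def using mlin_cong[OF l(1)] by simp
 ultimately show "vfield_of R W j q \<in> coder W j"
  by (intro coderI) (auto simp: vfield_of_def)
 show "cpt W W j (vfield_of R W j q) w = q w" if w: "w \<in> words W"
 proof -
  have "cpt W W j (vfield_of R W j q) w = pr W (wdeg w + j)
    (ss (Sy W (wdeg w + j)) w (%a b. sm W ((wdeg a + j, q a) # b)))"
   using w by (simp add: component_def sm)
  also have "... = ss (W (wdeg w + j)) w (%a b. pr W (wdeg w + j) (sm W ((wdeg a + j, q a) # b)))"
   by (rule ssum_mlin[OF _ _ proj1_lift(1)[OF W]]) (use cl w in auto)
  also have "... = ss (W (wdeg w + j)) w (%a b. if b = [] then q a else \<zero>[W (wdeg w + j)])"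
   using sp[OF _ w] qc by (intro ssum_cong refl) (simp add: proj1_lift(2))
  also have "... = q w"
   using qc[OF w] by (subst ssum_left) auto
  finally show ?thesis .
 qed
qed

text \<open>A coderivation equals the vectorfield built from its components, since both have the
  same projections to the generators.\<close>

lemma coder_smon:
 assumes D: "D \<in> coder W j" and w: "w \<in> words W" "d = wdeg w"
 shows "D d (sm W w) = ss (Sy W (d + j)) w (%a b. sm W ((wdeg a + j, cpt W W j D a) # b))"
proof -
 note q = coder_component_symfun[OF D]
 have "D = vfield_of R W j (cpt W W j D)"
  by (rule coder_eqI[OF D vfield_of_coder[OF q]]) (simp add: component_vfield_of[OF q])
 then show ?thesis
  using vfield_of_smon[OF q w] by simp
qed

end

lemma symfun_zero: "gr P ==> symf W P (%w. \<zero>[P (wdeg w)])"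
 by (rule symfunI) (auto simp: add.left_commute)

context
 fixes W :: "('k, 'w) gmod"
 assumes W [simp]: "gr W"
begin

lemma coder_comult:
 "D \<in> coder W j ==> x \<in> carrier (Sy W d) ==> e = d + j ==> cmu W e (D d x) =
  tmap W j D 0 (%i y. y) d (cmu W d x) \<oplus>[ST W e] tmap W 0 (%i y. y) j D d (cmu W d x)"
 by (simp add: coderivations_def)

text \<open>One statement for sums, multiples and the zero map, by specialising the
  coefficients.\<close>

lemma coder_lincomb:
 assumes D1: "D1 \<in> coder W j" and D2: "D2 \<in> coder W j" and ab: "a \<in> carrier R" "b \<in> carrier R"
  and ext: "!!d. D d \<in> extensional (carrier (Sy W d))"
  and eq: "!!d x. x \<in> carrier (Sy W d) ==> D d x = a \<odot>[Sy W (d + j)] D1 d x \<oplus>[Sy W (d + j)] b \<odot>[Sy W (d + j)] D2 d x"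
 shows "D \<in> coder W j"
proof -
 have "lin (Sy W d) (Sy W (d + j)) (D d)" for d
  by (rule mlin_cong[OF mlin_plus[OF _ mlin_scale[OF _ coder_mlin[OF W D1 refl] ab(1)] mlin_scale[OF _ coder_mlin[OF W D2 refl] ab(2)]]])
   (simp_all add: eq)
 then have g: "gl R (Sy W) (Sy W) j D" by (simp add: gl_def)
 note g1 = coder_gl[OF W D1] and g2 = coder_gl[OF W D2]
 have "cmu W (d + j) (D d x) = tmap W j D 0 (%i y. y) d (cmu W d x) \<oplus>[ST W (d + j)] tmap W 0 (%i y. y) j D d (cmu W d x)"
  if x: "x \<in> carrier (Sy W d)" for d x
 proof -
  have c: "cmu W d x \<in> carrier (ST W d)" by (rule mlin_closed[OF comult_mlin[OF W] x])
  have e: "d + j = d + j + 0" "d + j = d + 0 + j" by simp_all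
  note l = tens_map_lincomb[OF W W g g1 g2 gl_id ab _ c e(1)]
  note cl = tens_map_Sym_closed[OF W W g1 gl_id e(1) c] tens_map_Sym_closed[OF W W g2 gl_id e(1) c]
   tens_map_Sym_closed[OF W W gl_id g1 e(2) c] tens_map_Sym_closed[OF W W gl_id g2 e(2) c]
  note xc = coder_closed[OF W D1 x refl] coder_closed[OF W D2 x refl]
  have *: "cmu W (d + j) (D d x) = a \<odot>[ST W (d + j)] cmu W (d + j) (D1 d x) \<oplus>[ST W (d + j)]
    b \<odot>[ST W (d + j)] cmu W (d + j) (D2 d x)"
   using xc ab by (simp add: eq[OF x] mlin_add[OF comult_mlin[OF W]] mlin_smult[OF comult_mlin[OF W]])
  show ?thesis
   unfolding * coder_comult[OF D1 x refl] coder_comult[OF D2 x refl]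
   by (subst l(1), erule eq, subst l(2), erule eq) (use cl ab in \<open>simp add: m_smult_add madd_ac\<close>)
 qed
 then show ?thesis
  using g ext by (auto simp: coderivations_def graded_maps_iff)
qed

subsection \<open>The module of coderivations\<close>

lemma Coder_carrier [simp]: "carrier (Coder R W j) = coder W j"
 by (simp add: Coder_def)

lemma Coder_apply:
 "x \<in> carrier (Sy W d) ==> (s \<oplus>[Coder R W j] t) d x = s d x \<oplus>[Sy W (d + j)] t d x"
 "x \<in> carrier (Sy W d) ==> (a \<odot>[Coder R W j] s) d x = a \<odot>[Sy W (d + j)] s d x"
 "x \<in> carrier (Sy W d) ==> \<zero>[Coder R W j] d x = \<zero>[Sy W (d + j)]"
 by (simp_all add: Coder_def)

lemma Coder_extensional:
 "(s \<oplus>[Coder R W j] t) d \<in> extensional (carrier (Sy W d))"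
 "(a \<odot>[Coder R W j] s) d \<in> extensional (carrier (Sy W d))"
 "\<zero>[Coder R W j] d \<in> extensional (carrier (Sy W d))"
 by (simp_all add: Coder_def)

lemma coder_fun_eqI:
 assumes "!!d. s d \<in> extensional (carrier (Sy W d))" "!!d. t d \<in> extensional (carrier (Sy W d))"
  and "!!d x. x \<in> carrier (Sy W d) ==> s d x = t d x"
 shows "s = t"
proof -
 have "s d = t d" for d
  by (rule extensionalityI[OF assms(1,2)]) (rule assms(3))
 then show ?thesis by blast
qed

lemma coder_add_closed: "s \<in> coder W j ==> t \<in> coder W j ==> s \<oplus>[Coder R W j] t \<in> coder W j"
 by (rule coder_lincomb[of s j t \<one> \<one>, OF _ _ _ _ Coder_extensional(1)]) (auto simp: Coder_apply coder_closed)

lemma coder_smult_closed: "s \<in> coder W j ==> a \<in> carrier R ==> a \<odot>[Coder R W j] s \<in> coder W j"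
 by (rule coder_lincomb[of s j s a \<zero>, OF _ _ _ _ Coder_extensional(2)]) (auto simp: Coder_apply coder_closed)

lemma coder_zero_closed: "\<zero>[Coder R W j] \<in> coder W j"
proof -
 \<comment> \<open>The vectorfield with zero components supplies some coderivation; multiplied by
   zero it gives the zero map.\<close>
 have "symf W (%d. W (d + j)) (%w. \<zero>[W (wdeg w + j)])"
  by (rule symfun_zero) (rule gmI, simp)
 note D = vfield_of_coder[OF W this]
 show ?thesis
  by (rule coder_lincomb[OF D D zero_closed zero_closed Coder_extensional(3)]) (simp add: Coder_apply coder_closed[OF W D])
qed

lemma gm_Coder [simp]: "gr (Coder R W)"
proof (rule gmI)
 fix j
 note c = coder_closed[OF W _ _ refl]
 note e = coder_fun_eqI[OF Coder_extensional(1) Coder_extensional(1)]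
 show "module R (Coder R W j)"
 proof (rule moduleI)
  show "abelian_group (Coder R W j)"
  proof (rule abelian_groupI)
   fix s assume s: "s \<in> carrier (Coder R W j)"
   show "\<zero>[Coder R W j] \<oplus>[Coder R W j] s = s"
    using s by (intro coder_fun_eqI[OF Coder_extensional(1) coder_ext[OF W]]) (auto simp: Coder_apply c)
   have "(\<ominus> \<one>) \<odot>[Coder R W j] s \<in> carrier (Coder R W j)"
    using s by (simp add: coder_smult_closed)
   moreover have "(\<ominus> \<one>) \<odot>[Coder R W j] s \<oplus>[Coder R W j] s = \<zero>[Coder R W j]"
    using s by (intro coder_fun_eqI[OF Coder_extensional(1,3)]) (auto simp: Coder_apply m_neg_smult c)
   ultimately show "\<exists>t\<in>carrier (Coder R W j). t \<oplus>[Coder R W j] s = \<zero>[Coder R W j]"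
    by blast
   fix t assume t: "t \<in> carrier (Coder R W j)"
   show "s \<oplus>[Coder R W j] t \<in> carrier (Coder R W j)"
    using s t by (simp add: coder_add_closed)
   show "s \<oplus>[Coder R W j] t = t \<oplus>[Coder R W j] s"
    using s t by (intro e) (auto simp: Coder_apply madd_comm c)
   fix r assume r: "r \<in> carrier (Coder R W j)"
   show "s \<oplus>[Coder R W j] t \<oplus>[Coder R W j] r = s \<oplus>[Coder R W j] (t \<oplus>[Coder R W j] r)"
    using s t r by (intro e) (auto simp: Coder_apply madd_assoc c)
  qed (simp add: coder_zero_closed)
  fix a s assume a: "a \<in> carrier R" and s: "s \<in> carrier (Coder R W j)"
  show "a \<odot>[Coder R W j] s \<in> carrier (Coder R W j)"
   using a s by (simp add: coder_smult_closed)
  show "(a \<oplus> b) \<odot>[Coder R W j] s = a \<odot>[Coder R W j] s \<oplus>[Coder R W j] b \<odot>[Coder R W j] s" if "b \<in> carrier R" for b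
   using a s that by (intro coder_fun_eqI[OF Coder_extensional(2,1)]) (auto simp: Coder_apply m_smult_addl c)
  show "a \<odot>[Coder R W j] (s \<oplus>[Coder R W j] t) = a \<odot>[Coder R W j] s \<oplus>[Coder R W j] a \<odot>[Coder R W j] t"
   if "t \<in> carrier (Coder R W j)" for t
   using a s that by (intro coder_fun_eqI[OF Coder_extensional(2,1)]) (auto simp: Coder_apply m_smult_add c)
  show "(a \<otimes> b) \<odot>[Coder R W j] s = a \<odot>[Coder R W j] (b \<odot>[Coder R W j] s)" if "b \<in> carrier R" for b
   using a s that by (intro coder_fun_eqI[OF Coder_extensional(2,2)]) (auto simp: Coder_apply m_smult_smult c)
 next
  show "\<one> \<odot>[Coder R W j] s = s" if "s \<in> carrier (Coder R W j)" for s
   using that by (intro coder_fun_eqI[OF Coder_extensional(2) coder_ext[OF W]]) (auto simp: Coder_apply c)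
 qed (rule is_cring)
qed

lemma coder_eval_mlin: "x \<in> carrier (Sy W d) ==> e = d + j ==> lin (Coder R W j) (Sy W e) (%s. s d x)"
 by (rule mlinI) (auto simp: Coder_apply coder_closed)

lemma coder_component_mlin: "w \<in> words W ==> e = wdeg w + j ==> lin (Coder R W j) (W e) (%s. cpt W W j s w)"
 unfolding component_def
 by (hypsubst, rule mlin_comp[OF coder_eval_mlin[OF _ refl] proj1_lift(1)[OF W]]) (simp add: smon_closed)

subsection \<open>The bracket of coderivations\<close>

text \<open>Applying the coderivation rule twice gives four terms: the composite on either factor,
  and two mixed terms, one of them with the sign of \<open>s\<close> passing
  \<open>t\<close>.\<close>

lemma comult_coder_coder:
 assumes s: "s \<in> coder W i" and t: "t \<in> coder W j" and st: "gl R (Sy W) (Sy W) k st"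
  and k: "k = i + j" and eq: "!!d x. x \<in> carrier (Sy W d) ==> st d x = s (d + j) (t d x)"
  and x: "x \<in> carrier (Sy W d)" and e: "e = d + k" and c: "c = cmu W d x"
 shows "cmu W e (st d x) =
   (tmap W k st 0 (%i y. y) d c \<oplus>[ST W e] tmap W i s j t d c) \<oplus>[ST W e]
   (ks (i * j) \<odot>[ST W e] tmap W j t i s d c \<oplus>[ST W e] tmap W 0 (%i y. y) k st d c)"
proof -
 note gs = coder_gl[OF W s] and gt = coder_gl[OF W t]
 have cc: "c \<in> carrier (ST W d)" unfolding c by (rule mlin_closed[OF comult_mlin[OF W] x])
 have f: "e = d + j + i" using e k by simp
 note tx = coder_closed[OF W t x refl]
 have e1: "d + j = d + j + 0" "d + j = d + 0 + j" and e2: "e = d + j + i + 0" "e = d + j + 0 + i"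
  and e3: "e = d + k + 0" "e = d + 0 + k" "e = d + i + j" "e = d + j + i"
  using e k by simp_all
 let ?a = "tmap W j t 0 (%i y. y) d c" and ?b = "tmap W 0 (%i y. y) j t d c"
 have ab: "?a \<in> carrier (ST W (d + j))" "?b \<in> carrier (ST W (d + j))"
  by (rule tens_map_Sym_closed[OF W W gt gl_id e1(1) cc], rule tens_map_Sym_closed[OF W W gl_id gt e1(2) cc])
 note m = tens_map_Sym(1)[OF W W gs gl_id e2(1)] tens_map_Sym(1)[OF W W gl_id gs e2(2)]
 have 1: "tmap W i s 0 (%i y. y) (d + j) ?a = ks (0 * j) \<odot>[ST W e] tmap W k st 0 (%i y. y) d c"
  by (rule tens_map_comp[OF W W W gt gl_id gs gl_id st gl_id _ _ _ _ cc]) (use k e eq in auto)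
 have 2: "tmap W i s 0 (%i y. y) (d + j) ?b = ks (0 * 0) \<odot>[ST W e] tmap W i s j t d c"
  by (rule tens_map_comp[OF W W W gl_id gt gs gl_id gs gt _ _ _ _ cc]) (use k e in auto)
 have 3: "tmap W 0 (%i y. y) i s (d + j) ?a = ks (i * j) \<odot>[ST W e] tmap W j t i s d c"
  by (rule tens_map_comp[OF W W W gt gl_id gl_id gs gt gs _ _ _ _ cc]) (use k e in auto)
 have 4: "tmap W 0 (%i y. y) i s (d + j) ?b = ks (i * 0) \<odot>[ST W e] tmap W 0 (%i y. y) k st d c"
  by (rule tens_map_comp[OF W W W gl_id gt gl_id gs gl_id st _ _ _ _ cc]) (use k e eq in auto)
 note cl = tens_map_Sym_closed[OF W W st gl_id e3(1) cc] tens_map_Sym_closed[OF W W gl_id st e3(2) cc]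
  tens_map_Sym_closed[OF W W gs gt e3(3) cc]
 have "cmu W e (st d x) = tmap W i s 0 (%i y. y) (d + j) (?a \<oplus>[ST W (d + j)] ?b) \<oplus>[ST W e]
   tmap W 0 (%i y. y) i s (d + j) (?a \<oplus>[ST W (d + j)] ?b)"
  unfolding eq[OF x] coder_comult[OF s tx f] coder_comult[OF t x refl] c ..
 then show ?thesis
  unfolding mlin_add[OF m(1) ab] mlin_add[OF m(2) ab] 1 2 3 4 using cl by simp
qed

lemma coder_comp_gl:
 assumes s: "s \<in> coder W i" and t: "t \<in> coder W j" and k: "k = i + j"
 shows "gl R (Sy W) (Sy W) k (%d x. s (d + j) (t d x))"
 unfolding gl_def k
 by (intro allI mlin_comp[OF coder_mlin[OF W t refl] coder_mlin[OF W s]]) simp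

text \<open>A composite of coderivations fails the coderivation rule by the mixed terms of
  \<open>comult_coder_coder\<close>; in the graded commutator these cancel.\<close>

lemma bracket_closed:
 assumes s: "s \<in> coder W i" and t: "t \<in> coder W j" and k: "k = i + j"
 shows "bracket R W i j s t \<in> coder W k"
proof -
 let ?b = "bracket R W i j s t" and ?\<kappa> = "\<ominus> ks (i * j)"
 let ?st = "%d x. s (d + j) (t d x)" and ?ts = "%d x. t (d + i) (s d x)"
 have k': "k = j + i" using k by simp
 note g1 = coder_comp_gl[OF s t k] and g2 = coder_comp_gl[OF t s k']
 have eq: "?b d x = \<one> \<odot>[Sy W (d + k)] ?st d x \<oplus>[Sy W (d + k)] ?\<kappa> \<odot>[Sy W (d + k)] ?ts d x" if x: "x \<in> carrier (Sy W d)" for d x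
  using x k gl_closed[OF g1 x refl] gl_closed[OF g2 x refl] by (simp add: bracket_def m_minus_eq m_neg_smult)
 have "lin (Sy W d) (Sy W (d + k)) (?b d)" for d
  by (rule mlin_cong[OF mlin_plus[OF _ mlin_scale[OF _ glD[OF g1 refl] one_closed] mlin_scale[OF _ glD[OF g2 refl]]]]) (simp_all add: eq)
 then have g: "gl R (Sy W) (Sy W) k ?b" by (simp add: gl_def)
 have "cmu W (d + k) (?b d x) = tmap W k ?b 0 (%i y. y) d (cmu W d x) \<oplus>[ST W (d + k)] tmap W 0 (%i y. y) k ?b d (cmu W d x)"
  if x: "x \<in> carrier (Sy W d)" for d x
 proof -
  let ?T = "ST W (d + k)"
  define c where "c = cmu W d x"
  have cc: "c \<in> carrier (ST W d)" unfolding c_def by (rule mlin_closed[OF comult_mlin[OF W] x])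
  have e: "d + k = d + k + 0" "d + k = d + 0 + k" "d + k = d + i + j" "d + k = d + j + i" using k by simp_all
  have K: "?\<kappa> \<in> carrier R" by simp
  note l = tens_map_lincomb[OF W W g g1 g2 gl_id one_closed K _ cc e(1)]
  note gs = coder_gl[OF W s] and gt = coder_gl[OF W t]
  define p1 p2 u v q1 q2 where d: "p1 = tmap W k ?st 0 (%i y. y) d c" "p2 = tmap W k ?ts 0 (%i y. y) d c" "u = tmap W i s j t d c" "v = tmap W j t i s d c"
   "q1 = tmap W 0 (%i y. y) k ?st d c" "q2 = tmap W 0 (%i y. y) k ?ts d c"
  have cl: "p1 \<in> carrier ?T" "p2 \<in> carrier ?T" "u \<in> carrier ?T" "v \<in> carrier ?T" "q1 \<in> carrier ?T" "q2 \<in> carrier ?T"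
   unfolding d
   by (rule tens_map_Sym_closed[OF W W g1 gl_id e(1) cc] tens_map_Sym_closed[OF W W g2 gl_id e(1) cc]
    tens_map_Sym_closed[OF W W gs gt e(3) cc] tens_map_Sym_closed[OF W W gt gs e(4) cc]
    tens_map_Sym_closed[OF W W gl_id g1 e(2) cc] tens_map_Sym_closed[OF W W gl_id g2 e(2) cc])+
  have 1: "cmu W (d + k) (?st d x) = (p1 \<oplus>[?T] u) \<oplus>[?T] (ks (i * j) \<odot>[?T] v \<oplus>[?T] q1)"
   unfolding d by (rule comult_coder_coder[OF s t g1 k refl x refl c_def])
  have 2: "cmu W (d + k) (?ts d x) = (p2 \<oplus>[?T] v) \<oplus>[?T] (ks (j * i) \<odot>[?T] u \<oplus>[?T] q2)"
   unfolding d by (rule comult_coder_coder[OF t s g2 k' refl x refl c_def])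
  have T: "module R ?T" by simp
  have "cmu W (d + k) (?b d x) = cmu W (d + k) (?st d x) \<oplus>[?T] ?\<kappa> \<odot>[?T] cmu W (d + k) (?ts d x)"
   unfolding eq[OF x] using gl_closed[OF g1 x refl] gl_closed[OF g2 x refl] K
   by (simp add: mlin_add[OF comult_mlin[OF W]] mlin_smult[OF comult_mlin[OF W]])
  \<comment> \<open>\<open>u\<close> and \<open>v\<close> are the mixed terms. Each comes from both
    composites, with opposite signs.\<close>
  also have "... = (p1 \<oplus>[?T] ?\<kappa> \<odot>[?T] p2) \<oplus>[?T] (q1 \<oplus>[?T] ?\<kappa> \<odot>[?T] q2) \<oplus>[?T]
    ((u \<oplus>[?T] \<ominus>[?T] u) \<oplus>[?T] (ks (i * j) \<odot>[?T] v \<oplus>[?T] \<ominus>[?T] (ks (i * j) \<odot>[?T] v)))"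
   unfolding 1 2 using cl T
   by (simp add: m_smult_add m_smult_smult m_neg_smult m_smult_neg l_minus madd_ac mult.commute[of j i] del: m_r_neg m_l_neg)
  also have "... = (p1 \<oplus>[?T] ?\<kappa> \<odot>[?T] p2) \<oplus>[?T] (q1 \<oplus>[?T] ?\<kappa> \<odot>[?T] q2)"
   using cl T K by simp
  finally have *: "cmu W (d + k) (?b d x) = (p1 \<oplus>[?T] ?\<kappa> \<odot>[?T] p2) \<oplus>[?T] (q1 \<oplus>[?T] ?\<kappa> \<odot>[?T] q2)" .
  show ?thesis
   unfolding c_def[symmetric]
   by (subst l(1), erule eq, subst l(2), erule eq) (use * cl T in \<open>simp add: d[symmetric]\<close>)
 qed
 then show ?thesis
  using g by (auto simp: coderivations_def graded_maps_iff bracket_def)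
qed

text \<open>For odd \<open>Q\<close> the sign in the commutator turns the difference into a sum of
  two equal terms.\<close>

lemma bracket_self:
 assumes Q: "Q \<in> coder W 1" and x: "x \<in> carrier (Sy W d)"
 shows "bracket R W 1 1 Q Q d x = Q (d + 1) (Q d x) \<oplus>[Sy W (d + 2)] Q (d + 1) (Q d x)"
proof -
 have "Q (d + 1) (Q d x) \<in> carrier (Sy W (d + 2))"
  using x by (intro coder_closed[OF W Q]) auto
 then show ?thesis using x by (simp add: bracket_def m_minus_eq ksign_odd m_neg_smult)
qed

lemma double_zero:
 fixes P :: "('k, 'p) module"
 assumes P: "module R P" and x: "x \<in> carrier P"
 shows "x \<oplus>[P] x = \<zero>[P] \<longleftrightarrow> x = \<zero>[P]"
proof
 assume eq: "x \<oplus>[P] x = \<zero>[P]"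
 have "nsc (Suc 0 + Suc 0) \<odot>[P] x = x \<oplus>[P] x"
  unfolding nsc_add using P x by (simp add: m_smult_addl)
 then show "x = \<zero>[P]"
  using m_unit_cancel[OF P nsc_unit[of "Suc 0 + Suc 0"] x] eq by simp
qed (use assms in simp)

text \<open>The square of \<open>Q\<close> is half its bracket, as 2 is a unit, and the bracket is a
  coderivation. So the equation can be tested after projection to the generators.\<close>

lemma dg_structure_iff:
 assumes Q: "Q \<in> coder W 1"
 shows "dg_structure R W Q \<longleftrightarrow> (\<forall>w\<in>words W. pr W (wdeg w + 2) (Q (wdeg w + 1) (Q (wdeg w) (sm W w))) = \<zero>[W (wdeg w + 2)])"
  (is "_ \<longleftrightarrow> ?R")
  and dg_structure_sq: "dg_structure R W Q ==> x \<in> carrier (Sy W d) ==> Q (d + 1) (Q d x) = \<zero>[Sy W (d + 2)]"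
proof -
 have QQ: "Q (d + 1) (Q d x) \<in> carrier (Sy W (d + 2))" if "x \<in> carrier (Sy W d)" for d x
  using that by (intro coder_closed[OF W Q]) auto
 have z: "Q (d + 1) (Q d x) = \<zero>[Sy W (d + 2)]" if dg: "dg_structure R W Q" and x: "x \<in> carrier (Sy W d)" for d x
 proof -
  have "bracket R W 1 1 Q Q d x = \<zero>[Sy W (d + 2)]"
   using dg x by (simp add: dg_structure_def Coder_apply)
  then show ?thesis
   unfolding bracket_self[OF Q x] using double_zero[OF _ QQ[OF x]] by simp
 qed
 show "dg_structure R W Q ==> x \<in> carrier (Sy W d) ==> Q (d + 1) (Q d x) = \<zero>[Sy W (d + 2)]"
  by (rule z)
 have B: "bracket R W 1 1 Q Q \<in> coder W 2"
  by (rule bracket_closed[OF Q Q]) simp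
 show "dg_structure R W Q \<longleftrightarrow> ?R"
 proof
  assume "dg_structure R W Q"
  then show ?R
   using mlin_zero[OF _ _ proj1_lift(1)[OF W]] by (auto simp: z smon_closed)
 next
  assume r: ?R
  have "bracket R W 1 1 Q Q = \<zero>[Coder R W 2]"
  proof (rule coder_eqI[OF W B coder_zero_closed])
   fix w assume w: "w \<in> words W"
   have s: "sm W w \<in> carrier (Sy W (wdeg w))" using w by (simp add: smon_closed)
   have "cpt W W 2 \<zero>[Coder R W 2] w = \<zero>[W (wdeg w + 2)]"
    using s mlin_zero[OF _ _ proj1_lift(1)[OF W]] by (simp add: component_def Coder_apply)
   moreover have "cpt W W 2 (bracket R W 1 1 Q Q) w = \<zero>[W (wdeg w + 2)]"
    using r w QQ[OF s] unfolding component_def bracket_self[OF Q s] by (simp add: mlin_add[OF proj1_lift(1)])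
   ultimately show "cpt W W 2 (bracket R W 1 1 Q Q) w = cpt W W 2 \<zero>[Coder R W 2] w" by simp
  qed
  then show "dg_structure R W Q" using Q by (simp add: dg_structure_def)
 qed
qed

end

subsection \<open>Morphisms commuting with coderivations\<close>

text \<open>Both \<open>F\<close> after \<open>Q\<close> and \<open>P\<close> after \<open>F\<close>
  are coderivations along \<open>F\<close>, so \<open>derivation_unique\<close> reduces their
  equality to the projections.\<close>

lemma dg_commute:
 fixes W :: "('k, 'w) gmod" and V :: "('k, 'v) gmod"
 assumes W [simp]: "gr W" and V [simp]: "gr V"
  and F: "F \<in> smf W V" and Q: "Q \<in> coder W j" and P: "P \<in> coder V j"
  and eq: "!!w. w \<in> words W ==> pr V (wdeg w + j) (F (wdeg w + j) (Q (wdeg w) (sm W w))) =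
   pr V (wdeg w + j) (P (wdeg w) (F (wdeg w) (sm W w)))"
  and x: "x \<in> carrier (Sy W d)"
 shows "F (d + j) (Q d x) = P d (F d x)"
proof -
 let ?T = "ST V" and ?t = "ten V" and ?m = "tmap V"
 let ?G = "%d x. F (d + j) (Q d x)" and ?H = "%d x. P d (F d x)"
 note gF = smf_gl[OF W V F] and gP = coder_gl[OF V P] and gQ = coder_gl[OF W Q]
 have gG: "gl R (Sy W) (Sy V) j ?G"
  unfolding gl_def by (intro allI mlin_comp[OF coder_mlin[OF W Q refl] smf_mlin[OF W V F]])
 have gH: "gl R (Sy W) (Sy V) j ?H"
  unfolding gl_def by (intro allI mlin_comp[OF smf_mlin[OF W V F] coder_mlin[OF V P refl]])
 have one: "ks 0 \<odot>[?T e] ?m p \<phi> r \<psi> d c = ?m p \<phi> r \<psi> d c"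
  if "gl R (Sy W) (Sy V) p \<phi>" "gl R (Sy W) (Sy V) r \<psi>" "e = d + p + r" "c \<in> carrier (ST W d)" for p \<phi> r \<psi> d e c
  using tens_map_Sym_closed[OF W V that] by simp
 have G: "cmu V (d + j) (?G d x) = ?m j ?G 0 F d (cmu W d x) \<oplus>[?T (d + j)] ?m 0 F j ?G d (cmu W d x)"
  and H: "cmu V (d + j) (?H d x) = ?m j ?H 0 F d (cmu W d x) \<oplus>[?T (d + j)] ?m 0 F j ?H d (cmu W d x)"
  if x: "x \<in> carrier (Sy W d)" for d x
 proof -
  have e: "d + j = d + j + 0" "d + j = d + 0 + j" "d + j = d + j + 0 + 0" by simp_all
  define c where "c = cmu W d x"
  have c: "c \<in> carrier (ST W d)" unfolding c_def by (rule mlin_closed[OF comult_mlin[OF W] x])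
  let ?a = "tmap W j Q 0 (%i y. y) d c" and ?b = "tmap W 0 (%i y. y) j Q d c"
  have ab: "?a \<in> carrier (ST W (d + j))" "?b \<in> carrier (ST W (d + j))"
   by (rule tens_map_Sym_closed[OF W W gQ gl_id e(1) c], rule tens_map_Sym_closed[OF W W gl_id gQ e(2) c])
  have "cmu V (d + j) (?G d x) = ?m 0 F 0 F (d + j) (?a \<oplus>[ST W (d + j)] ?b)"
   using F coder_closed[OF W Q x refl] coder_comult[OF W Q x refl] by (simp add: smf_morphisms_def c_def)
  also have "... = ?m 0 F 0 F (d + j) ?a \<oplus>[?T (d + j)] ?m 0 F 0 F (d + j) ?b"
   by (rule mlin_add[OF tens_map_Sym(1)[OF W V gF gF e(3)] ab])
  also have "?m 0 F 0 F (d + j) ?a = ks (0 * j) \<odot>[?T (d + j)] ?m j ?G 0 F d c"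
   by (rule tens_map_comp[OF W W V gQ gl_id gF gF gG gF _ _ _ _ c]) simp_all
  also have "?m 0 F 0 F (d + j) ?b = ks (0 * 0) \<odot>[?T (d + j)] ?m 0 F j ?G d c"
   by (rule tens_map_comp[OF W W V gl_id gQ gF gF gF gG _ _ _ _ c]) simp_all
  finally show "cmu V (d + j) (?G d x) = ?m j ?G 0 F d (cmu W d x) \<oplus>[?T (d + j)] ?m 0 F j ?G d (cmu W d x)"
   unfolding c_def[symmetric] mult_zero_left mult_zero_right one[OF gG gF e(1) c] one[OF gF gG e(2) c] .
  have "cmu V (d + j) (?H d x) = ?m j P 0 (%i y. y) d (?m 0 F 0 F d c) \<oplus>[?T (d + j)] ?m 0 (%i y. y) j P d (?m 0 F 0 F d c)"
   using F x coder_comult[OF V P smf_closed[OF W V F x] refl] by (simp add: smf_morphisms_def c_def)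
  also have "?m j P 0 (%i y. y) d (?m 0 F 0 F d c) = ks (0 * 0) \<odot>[?T (d + j)] ?m j ?H 0 F d c"
   by (rule tens_map_comp[OF W V V gF gF gP gl_id gH gF _ _ _ _ c]) simp_all
  also have "?m 0 (%i y. y) j P d (?m 0 F 0 F d c) = ks (j * 0) \<odot>[?T (d + j)] ?m 0 F j ?H d c"
   by (rule tens_map_comp[OF W V V gF gF gl_id gP gF gH _ _ _ _ c]) simp_all
  finally show "cmu V (d + j) (?H d x) = ?m j ?H 0 F d (cmu W d x) \<oplus>[?T (d + j)] ?m 0 F j ?H d (cmu W d x)"
   unfolding c_def[symmetric] mult_zero_left mult_zero_right one[OF gH gF e(1) c] one[OF gF gH e(2) c] .
 qed
 have s: "?m j D 0 F (wdeg w) (cmu W (wdeg w) (sm W w)) = ss (?T (wdeg w + j)) w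
   (%a b. ?t (wdeg a + j) (D (wdeg a) (sm W a)) (wdeg b) (F (wdeg b) (sm W b)))"
  "?m 0 F j D (wdeg w) (cmu W (wdeg w) (sm W w)) = ss (?T (wdeg w + j)) w
   (%a b. ks (j * wdeg a) \<odot>[?T (wdeg w + j)] ?t (wdeg a) (F (wdeg a) (sm W a)) (wdeg b + j) (D (wdeg b) (sm W b)))"
  if D: "gl R (Sy W) (Sy V) j D" and w: "w \<in> words W" for D w
 proof -
  have cl: "?t (wdeg a + j) (D (wdeg a) (sm W a)) (wdeg b) (F (wdeg b) (sm W b)) \<in> carrier (?T (wdeg w + j))"
   if "splits w a b" for a b
   using w splits_words[OF that, of W] splits_wdeg[OF that]
   by (auto intro!: tens_closed gl_closed[OF D] smf_closed[OF W V F] smon_closed)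
  show "?m j D 0 F (wdeg w) (cmu W (wdeg w) (sm W w)) = ss (?T (wdeg w + j)) w
   (%a b. ?t (wdeg a + j) (D (wdeg a) (sm W a)) (wdeg b) (F (wdeg b) (sm W b)))"
   by (subst tens_map_comult[OF W gm_Sym[OF V] gm_Sym[OF V] D gF w refl, of "wdeg w + j"], simp, intro ssum_cong refl) (simp add: cl)
  show "?m 0 F j D (wdeg w) (cmu W (wdeg w) (sm W w)) = ss (?T (wdeg w + j)) w
   (%a b. ks (j * wdeg a) \<odot>[?T (wdeg w + j)] ?t (wdeg a) (F (wdeg a) (sm W a)) (wdeg b + j) (D (wdeg b) (sm W b)))"
   using tens_map_comult[OF W gm_Sym[OF V] gm_Sym[OF V] gF D w refl, of "wdeg w + j"] by simp
 qed
 have "?G (wdeg w) (sm W w) = ?H (wdeg w) (sm W w)" if w: "w \<in> words W" for w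
  by (rule derivation_unique[OF W V, where F = "%w. F (wdeg w) (sm W w)" and ?D1.0 = "%w. ?G (wdeg w) (sm W w)"
    and ?D2.0 = "%w. ?H (wdeg w) (sm W w)" and j = j])
   (use w smf_one[OF W V F] smon_closed[OF W] gl_closed[OF gG] gl_closed[OF gH] smf_closed[OF W V F] G H s[OF gG] s[OF gH] eq in simp_all)
 then show ?thesis
  using x by (intro sym_ext[OF W _ glD[OF gG refl] glD[OF gH refl] _ x]) auto
qed

end

section \<open>Words in a direct sum and the product of supermanifolds\<close>

definition lmap :: "(int => 'w => 'v) => 'w word => 'v word" where
 "lmap h = map (%(i, y). (i, h i y))"

lemma lmap_simps [simp]:
 "lmap h [] = []" "lmap h (x # w) = (fst x, h (fst x) (snd x)) # lmap h w"
 "lmap h (u @ v) = lmap h u @ lmap h v" "lmap h w = [] \<longleftrightarrow> w = []" "length (lmap h w) = length w"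
 "wdeg (lmap h w) = wdeg w" "lmap g (lmap h w) = lmap (%i y. g i (h i y)) w" "lmap (%i y. y) w = w"
 by (induction w) (auto simp: lmap_def split_beta)

lemma lmap_words: "w \<in> words W ==> (!!i y. y \<in> carrier (W i) ==> h i y \<in> carrier (V i)) ==> lmap h w \<in> words V"
 by (induction w) auto

lemma ssum_lmap: "ssum R P (lmap h w) G = ssum R P w (%a b. G (lmap h a) (lmap h b))"
 unfolding lmap_def by (rule ssum_map) (simp add: split_beta)

abbreviation fst_word :: "('a \<times> 'b) word => 'a word" where
 "fst_word \<equiv> lmap (%i. fst)"

abbreviation snd_word :: "('a \<times> 'b) word => 'b word" where
 "snd_word \<equiv> lmap (%i. snd)"

abbreviation inl_word :: "('k, 'b) gmod => 'a word => ('a \<times> 'b) word" where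
 "inl_word M \<equiv> lmap (%i b. (b, \<zero>[M i]))"

abbreviation inr_word :: "('k, 'a) gmod => 'b word => ('a \<times> 'b) word" where
 "inr_word B \<equiv> lmap (%i m. (\<zero>[B i], m))"

abbreviation zero_word :: "('k, 'b) gmod => 'a word => 'b word" where
 "zero_word M \<equiv> lmap (%i b. \<zero>[M i])"

lemma gcomp_eq_iff:
 "gcomp A p F = gcomp A q G \<longleftrightarrow> (\<forall>d. \<forall>x\<in>carrier (A d). p d (F d x) = q d (G d x))"
 unfolding gcomp_def fun_eq_iff restrict_def by metis

lemma gcomp_eq_left_iff:
 assumes "!!d. G d \<in> extensional (carrier (A d))"
 shows "gcomp A p F = G \<longleftrightarrow> (\<forall>d. \<forall>x\<in>carrier (A d). p d (F d x) = G d x)"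
 using extensional_arb[OF assms] unfolding gcomp_def fun_eq_iff restrict_def by metis

lemma dsum_simps [simp]:
 "carrier (dsum A B i) = carrier (A i) \<times> carrier (B i)" "\<zero>[dsum A B i] = (\<zero>[A i], \<zero>[B i])"
 "x \<oplus>[dsum A B i] y = (fst x \<oplus>[A i] fst y, snd x \<oplus>[B i] snd y)"
 "a \<odot>[dsum A B i] x = (a \<odot>[A i] fst x, a \<odot>[B i] snd x)"
 by (simp_all add: dsum_def)

lemma dsum_words_proj [simp]:
 "w \<in> words (dsum B M) ==> fst_word w \<in> words B" "w \<in> words (dsum B M) ==> snd_word w \<in> words M"
 by (auto intro: lmap_words)

context ground
begin

lemma symfun_lmap:
 fixes W :: "('k, 'w) gmod" and V :: "('k, 'v) gmod"
 assumes \<phi>: "symf V P \<phi>" and h: "!!i. lin (W i) (V i) (h i)"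
 shows "symf W P (%w. \<phi> (lmap h w))"
proof (rule symfunI)
 note w = lmap_words[OF _ mlin_closed[OF h]] and c = mlin_closed[OF h]
 show "\<phi> (lmap h w) \<in> carrier (P (wdeg w))" if "w \<in> words W" for w
  using that by (intro symfun_closed[OF \<phi>]) (auto intro: w)
 fix u v :: "'w word" and i j :: int and x y :: 'w and a
 assume "u \<in> words W" "v \<in> words W" "x \<in> carrier (W i)"
 then have [simp]: "lmap h u \<in> words V" "lmap h v \<in> words V" "h i x \<in> carrier (V i)" by (auto intro: w c)
 show "\<phi> (lmap h (u @ (i, x \<oplus>[W i] y) # v)) = \<phi> (lmap h (u @ (i, x) # v)) \<oplus>[P (wdeg u + (i + wdeg v))] \<phi> (lmap h (u @ (i, y) # v))"
  if "y \<in> carrier (W i)"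
  using that \<open>x \<in> carrier (W i)\<close> symfun_add[OF \<phi>, of "lmap h u" "lmap h v" "h i x" i "h i y"] by (simp add: mlin_add[OF h] c)
 show "\<phi> (lmap h (u @ (i, a \<odot>[W i] x) # v)) = a \<odot>[P (wdeg u + (i + wdeg v))] \<phi> (lmap h (u @ (i, x) # v))"
  if "a \<in> carrier R"
  using that \<open>x \<in> carrier (W i)\<close> symfun_smult[OF \<phi>, of "lmap h u" "lmap h v" "h i x" i a] by (simp add: mlin_smult[OF h])
 show "\<phi> (lmap h (u @ (i, x) # (j, y) # v)) = ks (i * j) \<odot>[P (wdeg u + (i + (j + wdeg v)))] \<phi> (lmap h (u @ (j, y) # (i, x) # v))"
  if "y \<in> carrier (W j)"
  using that symfun_swap[OF \<phi>, of "lmap h u" "lmap h v" "h i x" i "h j y" j] by (simp add: c)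
qed

text \<open>A single zero letter annihilates the value by linearity, and a nonempty zero word
  contains one.\<close>

lemma symfun_zero_word:
 fixes W :: "('k, 'w) gmod" and w :: "'v word"
 assumes W: "gr W" and \<phi>: "symf W P \<phi>" and P: "module R (P d)" and w: "w \<noteq> []" and v: "u \<in> words W" "v \<in> words W"
  and d: "d = wdeg u + (wdeg w + wdeg v)"
 shows "\<phi> (u @ zero_word W w @ v) = \<zero>[P d]"
proof -
 obtain x w' where x: "w = x # w'" using w by (cases w) auto
 have "zero_word W w' @ v \<in> words W"
  using v W by (induction w') auto
 then show ?thesis
  using symfun_zero_letter[OF \<phi> W P, of u "zero_word W w' @ v" "fst x"] v d x by simp
qed

lemma zero_word_words [simp]: "gr W ==> zero_word W w \<in> words W"
 by (induction w) auto

context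
 fixes B :: "('k, 'b) gmod" and M :: "('k, 'm) gmod"
 assumes B [simp]: "gr B" and M [simp]: "gr M"
begin

lemma gm_dsum [simp]: "gr (dsum B M)"
proof (rule gmI)
 fix i
 have BM [simp]: "module R (B i)" "module R (M i)" by simp_all
 show "module R (dsum B M i)"
 proof (rule moduleI)
  show "abelian_group (dsum B M i)"
  proof (rule abelian_groupI)
   fix x assume "x \<in> carrier (dsum B M i)"
   then have "(\<ominus>[B i] fst x, \<ominus>[M i] snd x) \<in> carrier (dsum B M i)"
    "(\<ominus>[B i] fst x, \<ominus>[M i] snd x) \<oplus>[dsum B M i] x = \<zero>[dsum B M i]"
    using BM m_l_neg[OF BM(1)] m_l_neg[OF BM(2)] by auto
   then show "\<exists>y\<in>carrier (dsum B M i). y \<oplus>[dsum B M i] x = \<zero>[dsum B M i]" by blast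
  qed (auto simp: madd_ac)
 qed (auto simp: is_cring m_smult_add m_smult_addl m_smult_smult)
qed

lemma dsum_mlin:
 "lin (dsum B M i) (B i) fst" "lin (dsum B M i) (M i) snd"
 "lin (B i) (dsum B M i) (%b. (b, \<zero>[M i]))" "lin (M i) (dsum B M i) (%m. (\<zero>[B i], m))"
 by (rule mlinI; force)+

lemma dsum_words [simp]:
 "bs \<in> words B ==> inl_word M bs \<in> words (dsum B M)" "ms \<in> words M ==> inr_word B ms \<in> words (dsum B M)"
 by (auto intro: lmap_words)

text \<open>Letters of \<open>B \<times> M\<close> split into two summands, and those from \<open>B\<close> can be moved to the front.\<close>
lemma symfun_dsum_eqI:
 assumes \<phi>: "symf (dsum B M) P \<phi>" and \<psi>: "symf (dsum B M) P \<psi>" and P: "gr P"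
  and eq: "!!bs ms. bs \<in> words B ==> ms \<in> words M ==> \<phi> (inl_word M bs @ inr_word B ms) = \<psi> (inl_word M bs @ inr_word B ms)"
  and w: "w \<in> words (dsum B M)"
 shows "\<phi> w = \<psi> w"
proof -
 \<comment> \<open>Generalised to an already sorted prefix, into which each step of the induction
   moves one letter of \<open>w\<close>.\<close>
 have "\<phi> (inl_word M bs @ inr_word B ms @ w) = \<psi> (inl_word M bs @ inr_word B ms @ w)"
  if "bs \<in> words B" "ms \<in> words M" for bs ms
  using w that
 proof (induction w arbitrary: bs ms)
  case Nil
  then show ?case using eq by simp
 next
  case (Cons x w)
  obtain i b m where x: "x = (i, (b, m))" by (cases x) auto
  have b: "b \<in> carrier (B i)" "m \<in> carrier (M i)" "w \<in> words (dsum B M)" using Cons.prems x by auto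
  let ?u = "inl_word M bs @ inr_word B ms"
  have m: "(b, m) = (b, \<zero>[M i]) \<oplus>[dsum B M i] (\<zero>[B i], m)" using b by simp
  let ?d = "wdeg ?u + (i + wdeg w)"
  have u: "?u \<in> words (dsum B M)" using Cons.prems by simp
  have split: "\<chi> (?u @ x # w) = \<chi> (?u @ (i, (b, \<zero>[M i])) # w) \<oplus>[P ?d] \<chi> (?u @ (i, (\<zero>[B i], m)) # w)"
   if "symf (dsum B M) P \<chi>" for \<chi>
   unfolding x m by (rule symfun_add[OF that u]) (use b in auto)
  have move: "\<chi> (?u @ (i, (b, \<zero>[M i])) # w) =
    ks (i * wdeg ms) \<odot>[P ?d] \<chi> (inl_word M (bs @ [(i, b)]) @ inr_word B ms @ w)"
   if \<chi>: "symf (dsum B M) P \<chi>" for \<chi>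
   using symfun_move[OF \<chi>, of ?d "(i, (b, \<zero>[M i]))" "inl_word M bs" "inr_word B ms" w] P b Cons.prems
   by simp
  have "\<phi> (inl_word M (bs @ [(i, b)]) @ inr_word B ms @ w) = \<psi> (inl_word M (bs @ [(i, b)]) @ inr_word B ms @ w)"
   by (rule Cons.IH) (use b Cons.prems in auto)
  moreover have "\<phi> (inl_word M bs @ inr_word B (ms @ [(i, m)]) @ w) = \<psi> (inl_word M bs @ inr_word B (ms @ [(i, m)]) @ w)"
   by (rule Cons.IH) (use b Cons.prems in auto)
  ultimately have "\<phi> (?u @ x # w) = \<psi> (?u @ x # w)"
   unfolding split[OF \<phi>] split[OF \<psi>] move[OF \<phi>] move[OF \<psi>] by simp
  then show ?case by simp
 qed
 from this[of "[]" "[]"] show ?thesis by simp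
qed

text \<open>The degree change \<open>c\<close> lets the lemma serve for morphisms and for
  vectorfields of degree 1.\<close>

lemma symfun_pair:
 fixes W :: "('k, 'w) gmod"
 assumes f: "symf W (%d. B (c d)) f" and g: "symf W (%d. M (c d)) g"
 shows "symf W (%d. dsum B M (c d)) (%w. (f w, g w))"
proof (rule symfunI)
 fix u v i x assume uvx: "u \<in> words W" "v \<in> words W" "x \<in> carrier (W i)"
 show "(f (u @ (i, x \<oplus>[W i] y) # v), g (u @ (i, x \<oplus>[W i] y) # v)) = (f (u @ (i, x) # v), g (u @ (i, x) # v))
   \<oplus>[dsum B M (c (wdeg u + (i + wdeg v)))] (f (u @ (i, y) # v), g (u @ (i, y) # v))" if "y \<in> carrier (W i)" for y
  using symfun_add[OF f uvx that refl] symfun_add[OF g uvx that refl] by simp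
 show "(f (u @ (i, a \<odot>[W i] x) # v), g (u @ (i, a \<odot>[W i] x) # v)) =
   a \<odot>[dsum B M (c (wdeg u + (i + wdeg v)))] (f (u @ (i, x) # v), g (u @ (i, x) # v))" if "a \<in> carrier R" for a
  using symfun_smult[OF f uvx that refl] symfun_smult[OF g uvx that refl] by simp
 show "(f (u @ (i, x) # (j, y) # v), g (u @ (i, x) # (j, y) # v)) = ks (i * j)
   \<odot>[dsum B M (c (wdeg u + (i + (j + wdeg v))))] (f (u @ (j, y) # (i, x) # v), g (u @ (j, y) # (i, x) # v))"
  if "y \<in> carrier (W j)" for j y
  unfolding dsum_simps fst_conv snd_conv prod.inject
  using symfun_swap[OF f uvx that refl] symfun_swap[OF g uvx that refl] by (rule conjI)
qed (use symfun_closed[OF f _ refl] symfun_closed[OF g _ refl] in simp)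

lemma prB_smf: "prB R B M \<in> smf (dsum B M) B"
 and prB_smon: "w \<in> words (dsum B M) ==> d = wdeg w ==> prB R B M d (sm (dsum B M) w) = sm B (fst_word w)"
 and proj1_prB: "x \<in> carrier (Sy (dsum B M) d) ==> pr B d (prB R B M d x) = fst (pr (dsum B M) d x)"
 using strict_smf[OF gm_dsum B dsum_mlin(1)] by (simp_all add: prB_def lmap_def)

lemma prM_smf: "prM R B M \<in> smf (dsum B M) M"
 and prM_smon: "w \<in> words (dsum B M) ==> d = wdeg w ==> prM R B M d (sm (dsum B M) w) = sm M (snd_word w)"
 and proj1_prM: "x \<in> carrier (Sy (dsum B M) d) ==> pr M d (prM R B M d x) = snd (pr (dsum B M) d x)"
 using strict_smf[OF gm_dsum M dsum_mlin(2)] by (simp_all add: prM_def lmap_def)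

lemma inM_smf: "inM R B M \<in> smf M (dsum B M)"
 and inM_smon: "w \<in> words M ==> d = wdeg w ==> inM R B M d (sm M w) = sm (dsum B M) (inr_word B w)"
 using strict_smf(1,2)[OF M gm_dsum dsum_mlin(4)] by (simp_all add: inM_def lmap_def)

lemma prM_inM: "x \<in> carrier (Sy M d) ==> prM R B M d (inM R B M d x) = x"
 by (rule sym_ext[OF M _ mlin_comp[OF smf_mlin[OF M gm_dsum inM_smf] smf_mlin[OF gm_dsum M prM_smf]] mlin_id])
  (auto simp: inM_smon prM_smon)

lemma prB_inM: "w \<in> words M ==> d = wdeg w ==>
  prB R B M d (inM R B M d (sm M w)) = (if w = [] then sm B [] else \<zero>[Sy B d])"
 using symfun_zero_word[OF B smon_symfun[OF B], of d w "[]" "[]"] by (simp add: inM_smon prB_smon)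

context
 fixes T :: "('k, 't) gmod"
 assumes T [simp]: "gr T"
begin

lemma pair_smf_eqI:
 assumes F: "F \<in> smf T (dsum B M)" and G: "G \<in> smf T (dsum B M)"
  and B_eq: "!!d x. x \<in> carrier (Sy T d) ==> prB R B M d (F d x) = prB R B M d (G d x)"
  and M_eq: "!!d x. x \<in> carrier (Sy T d) ==> prM R B M d (F d x) = prM R B M d (G d x)"
 shows "F = G"
proof (rule smf_eqI[OF T gm_dsum F G])
 fix w assume w: "w \<in> words T"
 let ?x = "sm T w"
 have x: "?x \<in> carrier (Sy T (wdeg w))" using w by (simp add: smon_closed)
 note c = smf_closed[OF T gm_dsum F x] smf_closed[OF T gm_dsum G x]
 show "cpt T (dsum B M) 0 F w = cpt T (dsum B M) 0 G w"
  unfolding component_def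
  using B_eq[OF x] M_eq[OF x] proj1_prB[OF c(1)] proj1_prB[OF c(2)] proj1_prM[OF c(1)] proj1_prM[OF c(2)]
  by (simp add: prod_eq_iff)
qed

text \<open>Existence in the universal property of the product; uniqueness is
  \<open>pair_smf_eqI\<close>. The components of \<open>k\<close> are the pairs of the components of
  \<open>g\<close> and \<open>h\<close>.\<close>

lemma pair_smf:
 assumes g: "g \<in> smf T B" and h: "h \<in> smf T M"
 obtains k where "k \<in> smf T (dsum B M)"
  "gcomp (Sy T) (prB R B M) k = g" "gcomp (Sy T) (prM R B M) k = h"
proof -
 let ?c = "%w. (cpt T B 0 g w, cpt T M 0 h w)"
 have "symf T (dsum B M) ?c"
  by (rule symfun_pair[where c = "%d. d", OF smf_component_symfun[OF T B g] smf_component_symfun[OF T M h]])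
 define k' where "k' = mexp R T (dsum B M) ?c"
 note k = mexp_smf[OF T gm_dsum \<open>symf T (dsum B M) ?c\<close>, folded k'_def]
 have p: "pr (dsum B M) (wdeg w) (k' (wdeg w) (sm T w)) = ?c w" if "w \<in> words T" "w \<noteq> []" for w
  using k(3)[OF that] by (simp add: component_def)
 have c: "k' (wdeg w) (sm T w) \<in> carrier (Sy (dsum B M) (wdeg w))" if "w \<in> words T" for w
  by (rule smf_closed[OF T gm_dsum k(1)]) (simp add: smon_closed that)
 have "gcomp (Sy T) (prB R B M) k' = g"
  by (rule smf_eqI[OF T B smf_comp[OF T gm_dsum B k(1) prB_smf] g])
   (simp add: component_def gcomp_def smon_closed proj1_prB c p)
 moreover have "gcomp (Sy T) (prM R B M) k' = h"
  by (rule smf_eqI[OF T M smf_comp[OF T gm_dsum M k(1) prM_smf] h])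
   (simp add: component_def gcomp_def smon_closed proj1_prM c p)
 ultimately show thesis by (rule that[OF k(1)])
qed

end

end
end

text \<open>The functional with value \<open>(\<psi>(b\<^sub>1 \<dots> b\<^sub>n))\<^sub>k(m\<^sub>1, \<dots>, m\<^sub>k)\<close> on \<open>b\<^sub>1 \<dots> b\<^sub>n m\<^sub>1 \<dots> m\<^sub>k\<close>.\<close>
definition fam :: "'k ring => ('k, 'm) gmod => ('b word => ('k, 'm) vfield) => ('b \<times> 'm) word => 'm" where
 "fam R M \<psi> w = ssum R (M (wdeg w + 1)) w
   (%a b. component R M M (wdeg a + 1) (\<psi> (fst_word a)) (snd_word b))"

text \<open>With the vectorfield of M as \<open>q\<close>, this turns the family of a deformation,
  which is zero at the empty word, into the family of the total vectorfield.\<close>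

definition aug :: "'a => ('w word => 'a) => 'w word => 'a" where
 "aug q \<phi> w = (if w = [] then q else \<phi> w)"

lemma aug_simps [simp]: "aug q \<phi> [] = q" "w \<noteq> [] ==> aug q \<phi> w = \<phi> w" "aug q (aug q' \<phi>) = aug q \<phi>"
 by (auto simp: aug_def)

lemma component_eq: "wdeg w = d ==> e = d + j ==> component R W V j D w = proj1 R V e (D d (smon R W w))"
 by (simp add: component_def)

section \<open>Families of coderivations and vectorfields on the product\<close>

context ground
begin

lemma symfun_aug:
 fixes W :: "('k, 'w) gmod"
 assumes \<phi>: "symf W P \<phi>" and q: "q \<in> carrier (P 0)"
 shows "symf W P (aug q \<phi>)"
proof (rule symfunI)
 show "aug q \<phi> w \<in> carrier (P (wdeg w))" if "w \<in> words W" for w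
  using symfun_closed[OF \<phi> that refl] q by (simp add: aug_def)
 fix u v i x assume uvx: "u \<in> words W" "v \<in> words W" "x \<in> carrier (W i)"
 show "aug q \<phi> (u @ (i, x \<oplus>[W i] y) # v) = aug q \<phi> (u @ (i, x) # v) \<oplus>[P (wdeg u + (i + wdeg v))] aug q \<phi> (u @ (i, y) # v)"
  if "y \<in> carrier (W i)" for y
  using symfun_add[OF \<phi> uvx that refl] by simp
 show "aug q \<phi> (u @ (i, a \<odot>[W i] x) # v) = a \<odot>[P (wdeg u + (i + wdeg v))] aug q \<phi> (u @ (i, x) # v)"
  if "a \<in> carrier R" for a
  using symfun_smult[OF \<phi> uvx that refl] by simp
 show "aug q \<phi> (u @ (i, x) # (j, y) # v) = ks (i * j) \<odot>[P (wdeg u + (i + (j + wdeg v)))] aug q \<phi> (u @ (j, y) # (i, x) # v)"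
  if "y \<in> carrier (W j)" for j y
  unfolding aug_def using symfun_swap[OF \<phi> uvx that refl] by (simp only: append_is_Nil_conv list.distinct simp_thms if_False)
qed

context
 fixes M :: "('k, 'm) gmod"
 assumes M [simp]: "gr M"
begin

lemma gm_Umod [simp]: "gr (Umod R M)"
 by (rule gmI) (simp add: Umod_def shift_def)

lemma Umod_simps [simp]: "carrier (Umod R M i) = coder M (i + 1)"
 by (simp add: Umod_def shift_def)

lemma Umod_component_mlin:
 "w \<in> words M ==> e = wdeg w + (i + 1) ==> lin (Umod R M i) (M e) (%s. cpt M M (i + 1) s w)"
 using coder_component_mlin[OF M] by (simp add: Umod_def shift_def)

context
 fixes B :: "('k, 'b) gmod" and \<psi> :: "'b word => ('k, 'm) vfield"
 assumes B [simp]: "gr B" and \<psi>: "symf B (Umod R M) \<psi>"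
begin

lemma fam_coder: "bs \<in> words B ==> \<psi> bs \<in> coder M (wdeg bs + 1)"
 using symfun_closed[OF \<psi> _ refl] by simp

lemma fam_component_closed:
 "bs \<in> words B ==> ms \<in> words M ==> d = wdeg bs + wdeg ms + 1 ==> cpt M M (wdeg bs + 1) (\<psi> bs) ms \<in> carrier (M d)"
 using coder_component_closed[OF M fam_coder, of bs ms d] by simp

lemma fam_bisym:
 "bisym R (dsum B M) (dsum B M) (%d. M (d + 1)) (%a b. cpt M M (wdeg a + 1) (\<psi> (fst_word a)) (snd_word b))"
 unfolding bisym_def
proof (intro conjI ballI)
 fix b assume b: "b \<in> words (dsum B M)"
 show "symf (dsum B M) (%d. M (d + wdeg b + 1)) (%a. cpt M M (wdeg a + 1) (\<psi> (fst_word a)) (snd_word b))"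
  by (rule symfun_mlin[OF symfun_lmap[OF \<psi> dsum_mlin(1)[OF B M]], where h = "%d s. cpt M M (d + 1) s (snd_word b)"])
   (use b in \<open>auto intro!: Umod_component_mlin\<close>)
next
 fix a assume a: "a \<in> words (dsum B M)"
 have "symf M (%d. M (d + (wdeg (fst_word a) + 1))) (cpt M M (wdeg (fst_word a) + 1) (\<psi> (fst_word a)))"
  by (rule coder_component_symfun[OF M fam_coder]) (use a in simp)
 then have "symf M (%d. M (wdeg a + d + 1)) (cpt M M (wdeg a + 1) (\<psi> (fst_word a)))"
  by (simp add: algebra_simps)
 then show "symf (dsum B M) (%d. M (wdeg a + d + 1)) (%b. cpt M M (wdeg a + 1) (\<psi> (fst_word a)) (snd_word b))"
  by (rule symfun_lmap[OF _ dsum_mlin(2)[OF B M]])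
qed

lemma fam_symfun: "symf (dsum B M) (%d. M (d + 1)) (fam R M \<psi>)"
 using ssum_symfun[OF gm_dsum[OF B M] fam_bisym] gm_shift[OF M, of 1]
 by (simp add: fam_def[abs_def] add.commute)

lemma component_zero_letter:
 assumes "ms \<in> words M" "bs \<in> words B" "d = i + wdeg bs + wdeg ms + 1" "e = i + wdeg bs + 1"
 shows "cpt M M e (\<psi> ((i, \<zero>[B i]) # bs)) ms = \<zero>[M d]"
proof -
 have "\<psi> ((i, \<zero>[B i]) # bs) = \<zero>[Umod R M (i + wdeg bs)]"
  using symfun_zero_letter[OF \<psi> B, of "i + wdeg bs" "[]" bs i] assms by simp
 moreover have "cpt M M (i + wdeg bs + 1) \<zero>[Umod R M (i + wdeg bs)] ms = \<zero>[M d]"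
  by (rule mlin_zero[OF _ _ Umod_component_mlin]) (use assms in auto)
 ultimately show ?thesis using assms by simp
qed

text \<open>Letters from B have zero M-part and letters from M have zero B-part, so only the
  splitting into \<open>bs\<close> and \<open>ms\<close> contributes, and it carries no
  sign.\<close>

lemma fam_sorted:
 assumes bs: "bs \<in> words B" and ms: "ms \<in> words M"
 shows "fam R M \<psi> (inl_word M bs @ inr_word B ms) = cpt M M (wdeg bs + 1) (\<psi> bs) ms"
proof -
 let ?N = "wdeg bs + wdeg ms + 1"
 let ?G = "%a b. cpt M M (wdeg a + 1) (\<psi> (fst_word a)) (snd_word b)"
 let ?c = "%a (a' :: 'm word) (b :: 'b word) b'. cpt M M (wdeg a + wdeg a' + 1) (\<psi> (a @ zero_word B a')) (zero_word M b @ b')"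
 note sp = splitsD[OF _ bs]
 note sp' = splitsD[OF _ ms]
 have cl: "?c a a' b b' \<in> carrier (M ?N)" if "splits bs a b" "splits ms a' b'" for a b a' b'
  using sp[OF that(1)] sp'[OF that(2)] fam_component_closed[of "a @ zero_word B a'" "zero_word M b @ b'" ?N] B M
  by (simp add: algebra_simps)
 have z: "?c a a' b b' = \<zero>[M ?N]" if s: "splits bs a b" "splits ms a' b'" and ne: "b \<noteq> [] \<or> a' \<noteq> []" for a b a' b'
 proof (cases "b = []")
  case False
  have "symf M (%d. M (d + (wdeg (a @ zero_word B a') + 1))) (cpt M M (wdeg (a @ zero_word B a') + 1) (\<psi> (a @ zero_word B a')))"
   by (rule coder_component_symfun[OF M fam_coder]) (use sp[OF s(1)] B M in simp)
  from symfun_zero_word[OF M this _ False, where u = "[]" and v = b', OF _ _ _ refl] show ?thesis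
   using sp[OF s(1)] sp'[OF s(2)] by (simp add: algebra_simps)
 next
  case True
  have "\<psi> (a @ zero_word B a' @ []) = \<zero>[Umod R M (wdeg a + (wdeg a' + wdeg ([] :: 'b word)))]"
   by (rule symfun_zero_word[OF B \<psi>]) (use ne True sp[OF s(1)] in auto)
  moreover have "cpt M M (wdeg a + wdeg a' + 1) \<zero>[Umod R M (wdeg a + wdeg a')] (zero_word M b @ b') = \<zero>[M ?N]"
   by (rule mlin_zero[OF _ _ Umod_component_mlin]) (use sp[OF s(1)] sp'[OF s(2)] B M in auto)
  ultimately show ?thesis by simp
 qed
 have G: "?G (inl_word M a @ inr_word B a') (inl_word M b @ inr_word B b') = ?c a a' b b'" for a a' b b'
  by simp
 have cl': "?G (a @ a') (b @ b') \<in> carrier (M ?N)" if "splits (inl_word M bs) a b" "splits (inr_word B ms) a' b'" for a b a' b'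
 proof -
  have "a \<in> words (dsum B M)" "b \<in> words (dsum B M)" "a' \<in> words (dsum B M)" "b' \<in> words (dsum B M)"
   using splits_words[OF that(1), of "dsum B M"] splits_words[OF that(2), of "dsum B M"] bs ms B M by auto
  then show ?thesis
   using bisym_closed[OF fam_bisym, of "a @ a'" "b @ b'" "wdeg bs + wdeg ms"] splits_wdeg[OF that(1)] splits_wdeg[OF that(2)] by (simp add: algebra_simps)
 qed
 have "fam R M \<psi> (inl_word M bs @ inr_word B ms) =
   ss (M ?N) bs (%a b. ss (M ?N) ms (%a' b'. ks (wdeg b * wdeg a') \<odot>[M ?N] ?c a a' b b'))"
  using ssum_append[where G = ?G and P = "M ?N" and u = "inl_word M bs" and v = "inr_word B ms", OF _ cl'] by (simp add: fam_def ssum_lmap)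
 also have "... = ss (M ?N) bs (%a b. ?c a [] b ms)"
 proof (intro ssum_cong refl)
  fix a b assume ab: "splits bs a b"
  show "ss (M ?N) ms (%a' b'. ks (wdeg b * wdeg a') \<odot>[M ?N] ?c a a' b b') = ?c a [] b ms"
   by (subst ssum_right) (use z[OF ab] cl[OF ab splits_self(2)] in auto)
 qed
 also have "... = ?c bs [] [] ms"
  by (rule ssum_left) (use z[OF _ splits_self(2)] cl[OF splits_self] in auto)
 finally show ?thesis by simp
qed

text \<open>The first letter will be the value of a vectorfield and has both parts. Its B-part joins
  the argument of the family; its M-part is moved behind \<open>bs\<close>, with a sign, and joins
  the word in M.\<close>

lemma fam_letter:
 assumes x: "x \<in> carrier (B i)" and y: "y \<in> carrier (M i)" and bs: "bs \<in> words B" and ms: "ms \<in> words M"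
  and d: "d = i + wdeg bs + wdeg ms + 1"
 shows "fam R M \<psi> ((i, (x, y)) # inl_word M bs @ inr_word B ms) =
   cpt M M (i + wdeg bs + 1) (\<psi> ((i, x) # bs)) ms \<oplus>[M d]
   ks (i * wdeg bs) \<odot>[M d] cpt M M (wdeg bs + 1) (\<psi> bs) ((i, y) # ms)"
proof -
 let ?w = "inl_word M bs @ inr_word B ms"
 have w: "?w \<in> words (dsum B M)" using bs ms B M by simp
 have d': "i + (wdeg bs + wdeg ms) + 1 = d" using d by simp
 have "fam R M \<psi> ((i, (x, y)) # ?w) = fam R M \<psi> ((i, (x, \<zero>[M i]) \<oplus>[dsum B M i] (\<zero>[B i], y)) # ?w)"
  using x y by simp
 also have "... = fam R M \<psi> ((i, (x, \<zero>[M i])) # ?w) \<oplus>[M d] fam R M \<psi> ((i, (\<zero>[B i], y)) # ?w)"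
  using symfun_add0[OF fam_symfun w, of "(x, \<zero>[M i])" i "(\<zero>[B i], y)" "i + (wdeg bs + wdeg ms)"] x y d' by simp
 also have "fam R M \<psi> ((i, (x, \<zero>[M i])) # ?w) = cpt M M (i + wdeg bs + 1) (\<psi> ((i, x) # bs)) ms"
  using fam_sorted[of "(i, x) # bs" ms] x bs ms by simp
 also have "fam R M \<psi> ((i, (\<zero>[B i], y)) # ?w) = ks (i * wdeg bs) \<odot>[M d] fam R M \<psi> (inl_word M bs @ (i, (\<zero>[B i], y)) # inr_word B ms)"
 proof -
  let ?v = "inl_word M bs @ (i, (\<zero>[B i], y)) # inr_word B ms"
  have v: "?v \<in> words (dsum B M)" using bs ms y B M by simp
  have c: "fam R M \<psi> ((i, (\<zero>[B i], y)) # ?w) \<in> carrier (M d)"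
   using symfun_closed[OF fam_symfun, of "(i, (\<zero>[B i], y)) # ?w" "i + (wdeg bs + wdeg ms)"] w y d' by simp
  have "fam R M \<psi> ([] @ inl_word M bs @ (i, (\<zero>[B i], y)) # inr_word B ms) =
   ks (fst (i, (\<zero>[B i], y)) * wdeg (inl_word M bs)) \<odot>[M (i + (wdeg bs + wdeg ms) + 1)] fam R M \<psi> ([] @ (i, (\<zero>[B i], y)) # ?w)"
   by (rule symfun_move[OF fam_symfun]) (use bs ms y B M in auto)
  then show ?thesis using c by (simp add: d' m_ksign_ksign ksign_even)
 qed
 also have "fam R M \<psi> (inl_word M bs @ (i, (\<zero>[B i], y)) # inr_word B ms) = cpt M M (wdeg bs + 1) (\<psi> bs) ((i, y) # ms)"
  using fam_sorted[of bs "(i, y) # ms"] y bs ms by simp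
 finally show ?thesis .
qed

text \<open>The value of \<open>D\<close> becomes one letter that is fed into \<open>Q\<close>. Its
  B-part enters the family through \<open>D'\<close>; its M-part produces the composite of the
  coderivations \<open>\<psi> b\<close> and \<open>\<chi> a\<close>. The degree \<open>j\<close> is
  1 for the square of a vectorfield and 2 where \<open>D\<close> is itself a bracket.\<close>

lemma fam_vfield_comp:
 assumes D: "D \<in> coder (dsum B M) j" and D': "D' \<in> coder B j"
  and fst_D: "!!w. w \<in> words (dsum B M) ==> fst (cpt (dsum B M) (dsum B M) j D w) = cpt B B j D' (fst_word w)"
  and \<chi>: "!!bs. bs \<in> words B ==> \<chi> bs \<in> coder M (wdeg bs + j)"
  and snd_D: "!!bs ms. bs \<in> words B ==> ms \<in> words M ==>
    snd (cpt (dsum B M) (dsum B M) j D (inl_word M bs @ inr_word B ms)) = cpt M M (wdeg bs + j) (\<chi> bs) ms"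
  and Q: "Q \<in> coder (dsum B M) 1"
  and snd_Q: "!!w. w \<in> words (dsum B M) ==> snd (cpt (dsum B M) (dsum B M) 1 Q w) = fam R M \<psi> w"
  and bs: "bs \<in> words B" and ms: "ms \<in> words M" and d: "d = wdeg bs + wdeg ms" and n: "n = d + j + 1"
 shows "snd (pr (dsum B M) n (Q (d + j) (D d (sm (dsum B M) (inl_word M bs @ inr_word B ms))))) =
  ss (M n) bs (%a b. cpt M M (wdeg a + j + wdeg b + 1) (\<psi> ((wdeg a + j, cpt B B j D' a) # b)) ms \<oplus>[M n]
   ks ((wdeg a + j) * wdeg b) \<odot>[M n] pr M n (\<psi> b (wdeg ms + (wdeg a + j)) (\<chi> a (wdeg ms) (sm M ms))))"
proof -
 let ?X = "dsum B M"
 let ?w = "inl_word M bs @ inr_word B ms"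
 let ?c = "cpt ?X ?X j D"
 have X [simp]: "gr ?X" by simp
 have w: "?w \<in> words ?X" "wdeg ?w = d" using bs ms d B M by simp_all
 note sp = splitsD[OF _ bs]
 note sp' = splitsD[OF _ ms]
 have cD: "?c a \<in> carrier (?X (wdeg a + j))" if "a \<in> words ?X" for a
  by (rule coder_component_closed[OF X D that refl])
 have h: "lin (Sy ?X (d + j)) (M n) (%x. snd (pr ?X n (Q (d + j) x)))"
  by (rule mlin_comp[OF mlin_comp[OF coder_mlin[OF X Q] proj1_lift(1)[OF X]] dsum_mlin(2)[OF B M]]) (simp add: n)
 have hw: "snd (pr ?X n (Q (d + j) (sm ?X v))) = fam R M \<psi> v" if "v \<in> words ?X" "wdeg v = d + j" for v
  using snd_Q[OF that(1)] that(2) by (simp add: component_def n)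
 have fc: "fam R M \<psi> v \<in> carrier (M n)" if "v \<in> words ?X" "wdeg v = d + j" for v
  using symfun_closed[OF fam_symfun that(1) refl] that(2) by (simp add: n)
 have "snd (pr ?X n (Q (d + j) (D d (sm ?X ?w)))) =
   snd (pr ?X n (Q (d + j) (ss (Sy ?X (d + j)) ?w (%a b. sm ?X ((wdeg a + j, ?c a) # b)))))"
  using coder_smon[OF X D w(1) w(2)[symmetric]] by simp
 also have "... = ss (M n) ?w (%a b. snd (pr ?X n (Q (d + j) (sm ?X ((wdeg a + j, ?c a) # b)))))"
 proof (rule ssum_mlin[OF _ _ h])
  fix a b assume "splits ?w a b"
  then show "sm ?X ((wdeg a + j, ?c a) # b) \<in> carrier (Sy ?X (d + j))"
   using w splits_words[of ?w a b ?X] splits_wdeg[of ?w a b] cD by (intro smon_closed[OF X]) auto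
 qed auto
 also have "... = ss (M n) ?w (%a b. fam R M \<psi> ((wdeg a + j, ?c a) # b))"
 proof (intro ssum_cong refl hw)
  fix a b assume "splits ?w a b"
  then show "(wdeg a + j, ?c a) # b \<in> words ?X" "wdeg ((wdeg a + j, ?c a) # b) = d + j"
   using w splits_words[of ?w a b ?X] splits_wdeg[of ?w a b] cD by auto
 qed
 also have "... = ss (M n) bs (%a b. ss (M n) ms (%a' b'. ks (wdeg b * wdeg a') \<odot>[M n]
   fam R M \<psi> ((wdeg a + wdeg a' + j, ?c (inl_word M a @ inr_word B a')) # inl_word M b @ inr_word B b')))"
 proof (subst ssum_append)
  fix a b a' b' assume s: "splits (inl_word M bs) a b" "splits (inr_word B ms) a' b'"
  show "fam R M \<psi> ((wdeg (a @ a') + j, ?c (a @ a')) # b @ b') \<in> carrier (M n)"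
  proof (rule fc)
   have "a \<in> words ?X" "b \<in> words ?X" "a' \<in> words ?X" "b' \<in> words ?X"
    using splits_words[OF s(1), of ?X] splits_words[OF s(2), of ?X] bs ms B M by auto
   then show "(wdeg (a @ a') + j, ?c (a @ a')) # b @ b' \<in> words ?X" using cD[of "a @ a'"] by simp
   show "wdeg ((wdeg (a @ a') + j, ?c (a @ a')) # b @ b') = d + j"
    using splits_wdeg[OF s(1)] splits_wdeg[OF s(2)] d by simp
  qed
 qed (simp_all add: ssum_lmap)
 also have "... = ss (M n) bs (%a b. cpt M M (wdeg a + j + wdeg b + 1) (\<psi> ((wdeg a + j, cpt B B j D' a) # b)) ms \<oplus>[M n]
   ks ((wdeg a + j) * wdeg b) \<odot>[M n] pr M n (\<psi> b (wdeg ms + (wdeg a + j)) (\<chi> a (wdeg ms) (sm M ms))))"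
 proof (intro ssum_cong refl)
  fix a b assume ab: "splits bs a b"
  note ab' = sp[OF ab]
  let ?e = "%a' :: 'm word. wdeg a + wdeg a' + j"
  let ?x = "%a' :: 'm word. cpt B B j D' (a @ zero_word B a')" and ?y = "cpt M M (wdeg a + j) (\<chi> a)"
  let ?P = "%a' b'. cpt M M (?e a' + wdeg b + 1) (\<psi> ((?e a', ?x a') # b)) b'"
  let ?S = "%a' b'. cpt M M (wdeg b + 1) (\<psi> b) ((wdeg a' + (wdeg a + j), ?y a') # b')"
  have xc: "?x a' \<in> carrier (B (?e a'))" for a'
   by (rule coder_component_closed[OF B D']) (use ab' B in auto)
  have yc: "?y a' \<in> carrier (M (wdeg a' + (wdeg a + j)))" if "a' \<in> words M" for a'
   by (rule coder_component_closed[OF M \<chi>[OF ab'(1)] that refl])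
  have xy: "?c (inl_word M a @ inr_word B a') = (?x a', ?y a')" if "a' \<in> words M" for a'
   using fst_D[of "inl_word M a @ inr_word B a'"] snd_D[OF ab'(1) that] ab' that B M by (simp add: prod_eq_iff)
  have Pc: "?P a' b' \<in> carrier (M n)" if "splits ms a' b'" for a' b'
   using coder_component_closed[OF M fam_coder, of "(?e a', ?x a') # b" b' n] xc[of a'] ab' sp'[OF that] d n by simp
  have Sc: "?S a' b' \<in> carrier (M n)" if "splits ms a' b'" for a' b'
   using coder_component_closed[OF M fam_coder, of b "(wdeg a' + (wdeg a + j), ?y a') # b'" n] yc[of a'] ab' sp'[OF that] d n by simp
  have "ss (M n) ms (%a' b'. ks (wdeg b * wdeg a') \<odot>[M n]
    fam R M \<psi> ((?e a', ?c (inl_word M a @ inr_word B a')) # inl_word M b @ inr_word B b')) =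
   ss (M n) ms (%a' b'. ks (wdeg b * wdeg a') \<odot>[M n] ?P a' b' \<oplus>[M n] ks ((wdeg a + j) * wdeg b) \<odot>[M n] ?S a' b')"
  proof (intro ssum_cong refl)
   fix a' b' assume s: "splits ms a' b'"
   note s' = sp'[OF s]
   have e: "wdeg a' + (wdeg a + j) = ?e a'" by simp
   have "fam R M \<psi> ((?e a', ?c (inl_word M a @ inr_word B a')) # inl_word M b @ inr_word B b') =
    ?P a' b' \<oplus>[M n] ks (?e a' * wdeg b) \<odot>[M n] ?S a' b'"
    unfolding xy[OF s'(1)] e
    by (rule fam_letter) (use xc yc[OF s'(1)] s' ab' d n e in simp_all)
   moreover have "ks (wdeg b * wdeg a') \<odot>[M n] (ks (?e a' * wdeg b) \<odot>[M n] ?S a' b') =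
    ks ((wdeg a + j) * wdeg b) \<odot>[M n] ?S a' b'"
    by (subst m_ksign_ksign, simp, rule Sc[OF s], rule ksmult_cong) (auto simp: algebra_simps)
   ultimately show "ks (wdeg b * wdeg a') \<odot>[M n]
    fam R M \<psi> ((?e a', ?c (inl_word M a @ inr_word B a')) # inl_word M b @ inr_word B b') =
    ks (wdeg b * wdeg a') \<odot>[M n] ?P a' b' \<oplus>[M n] ks ((wdeg a + j) * wdeg b) \<odot>[M n] ?S a' b'"
    using Pc[OF s] Sc[OF s] by (simp add: m_smult_add)
  qed
  also have "... = ss (M n) ms (%a' b'. ks (wdeg b * wdeg a') \<odot>[M n] ?P a' b') \<oplus>[M n]
    ks ((wdeg a + j) * wdeg b) \<odot>[M n] ss (M n) ms ?S"
   using Pc Sc by (subst ssum_add) (auto simp: ssum_smult)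
  \<comment> \<open>Letters from M have zero B-part, so \<open>D'\<close> contributes only if no
    letter of \<open>ms\<close> goes to \<open>a'\<close>.\<close>
  also have "ss (M n) ms (%a' b'. ks (wdeg b * wdeg a') \<odot>[M n] ?P a' b') = ?P [] ms"
  proof (subst ssum_right)
   fix a' b' assume s: "splits ms a' b'" and ne: "a' \<noteq> []"
   have "?x a' = \<zero>[B (?e a')]"
    using symfun_zero_word[OF B coder_component_symfun[OF B D'] _ ne ab'(1), of "?e a' - j" "[]"] B by simp
   then have "?P a' b' = \<zero>[M n]"
    using component_zero_letter[of b' b n "?e a'"] sp'[OF s] ab' d n by simp
   then show "ks (wdeg b * wdeg a') \<odot>[M n] ?P a' b' = \<zero>[M n]" by simp
  qed (use Pc[OF splits_self(2)] in auto)
  \<comment> \<open>By \<open>coder_smon\<close> the sum over the splittings of \<open>ms\<close> is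
    \<open>\<chi> a\<close> on the monomial of \<open>ms\<close>, followed by
    \<open>\<psi> b\<close>.\<close>
  also have "ss (M n) ms ?S = pr M n (\<psi> b (wdeg ms + (wdeg a + j)) (\<chi> a (wdeg ms) (sm M ms)))"
  proof -
   let ?f = "wdeg ms + (wdeg a + j)"
   have Nb: "n = ?f + (wdeg b + 1)" using ab' d n by simp
   have hb: "lin (Sy M ?f) (M n) (%x. pr M n (\<psi> b ?f x))"
    by (rule mlin_comp[OF coder_mlin[OF M fam_coder[OF ab'(2)] Nb] proj1_lift(1)[OF M]])
   have "pr M n (\<psi> b ?f (\<chi> a (wdeg ms) (sm M ms))) =
    pr M n (\<psi> b ?f (ss (Sy M ?f) ms (%a' b'. sm M ((wdeg a' + (wdeg a + j), ?y a') # b'))))"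
    by (simp only: coder_smon[OF M \<chi>[OF ab'(1)] ms refl])
   also have "... = ss (M n) ms (%a' b'. pr M n (\<psi> b ?f (sm M ((wdeg a' + (wdeg a + j), ?y a') # b'))))"
    by (rule ssum_mlin[OF _ _ hb]) (use sp' yc in \<open>auto intro!: smon_closed\<close>)
   also have "... = ss (M n) ms ?S"
   proof (intro ssum_cong refl)
    fix a' b' assume s: "splits ms a' b'"
    have e: "wdeg ((wdeg a' + (wdeg a + j), ?y a') # b') = ?f" "?f + (wdeg b + 1) = n"
     using sp'[OF s] Nb by simp_all
    show "pr M n (\<psi> b ?f (sm M ((wdeg a' + (wdeg a + j), ?y a') # b'))) = ?S a' b'"
     by (rule component_eq[OF e(1) e(2)[symmetric], symmetric])
   qed
   finally show ?thesis ..
  qed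
  finally show "ss (M n) ms (%a' b'. ks (wdeg b * wdeg a') \<odot>[M n]
    fam R M \<psi> ((?e a', ?c (inl_word M a @ inr_word B a')) # inl_word M b @ inr_word B b')) =
   cpt M M (wdeg a + j + wdeg b + 1) (\<psi> ((wdeg a + j, cpt B B j D' a) # b)) ms \<oplus>[M n]
   ks ((wdeg a + j) * wdeg b) \<odot>[M n] pr M n (\<psi> b (wdeg ms + (wdeg a + j)) (\<chi> a (wdeg ms) (sm M ms)))"
   by simp
 qed
 finally show ?thesis .
qed

end

end
end

section \<open>The canonical family\<close>

text \<open>The components of the identity of U, read as a family of coderivations indexed by words
  in U.\<close>

definition can_fam :: "'k ring => ('k, 'm) gmod => ('k, 'm) vfield word => ('k, 'm) vfield" where
 "can_fam R M w = proj1 R (Umod R M) (wdeg w) (smon R (Umod R M) w)"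

text \<open>The linear map \<open>S(U) \<rightarrow> U\<close> that is \<open>q\<close> on \<open>1\<close>, the identity on \<open>U\<close> and zero on products.\<close>
definition brk :: "'k ring => ('k, 'm) gmod => ('k, 'm) vfield => int => ('k, ('k, 'm) vfield) sym => ('k, 'm) vfield" where
 "brk R M q d = pres_lift R (Umod R M d) (aug q (can_fam R M))"

context ground
begin

context
 fixes M :: "('k, 'm) gmod"
 assumes M [simp]: "gr M"
begin

lemma can_fam_symfun: "symf (Umod R M) (Umod R M) (can_fam R M)"
 unfolding can_fam_def[abs_def]
 by (rule symfun_mlin[OF smon_symfun proj1_lift(1)]) simp_all

lemma can_fam_letter [simp]: "u \<in> coder M (i + 1) ==> can_fam R M [(i, u)] = u"
 by (simp add: can_fam_def)

context
 fixes q :: "('k, 'm) vfield"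
 assumes q [simp]: "q \<in> coder M 1"
begin

lemma brk_mlin: "lin (Sy (Umod R M) d) (Umod R M d) (brk R M q d)"
 and brk_smon: "w \<in> words (Umod R M) ==> wdeg w = d ==> brk R M q d (sm (Umod R M) w) = aug q (can_fam R M) w"
proof -
 note l = sym_lift[OF gm_Umod[OF M] symfun_aug[OF can_fam_symfun, of q]]
 show "lin (Sy (Umod R M) d) (Umod R M d) (brk R M q d)"
  unfolding brk_def by (rule l(1)) simp_all
 show "w \<in> words (Umod R M) ==> wdeg w = d ==> brk R M q d (sm (Umod R M) w) = aug q (can_fam R M) w"
  unfolding brk_def by (rule l(2)) simp_all
qed

text \<open>A product with a letter has no constant term, and \<open>brk\<close> differs from the
  projection to U only on constants.\<close>

lemma brk_wmul:
 assumes u: "u \<in> coder M (i + 1)" and y: "y \<in> carrier (Sy (Umod R M) d)" and e: "e = d + i"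
 shows "brk R M q e (wmul R (Umod R M) [(i, u)] d y) = pr (Umod R M) e (wmul R (Umod R M) [(i, u)] d y)"
proof -
 have U [simp]: "gr (Umod R M)" by simp
 have w: "lin (Sy (Umod R M) d) (Sy (Umod R M) e) (wmul R (Umod R M) [(i, u)] d)"
  using u e by (intro wmul_mlin[OF U]) auto
 show ?thesis
  by (rule sym_ext[OF U _ mlin_comp[OF w brk_mlin] mlin_comp[OF w proj1_lift(1)[OF U]] _ y])
   (use u e in \<open>auto simp: wmul_smon[OF U] brk_smon can_fam_def add.commute\<close>)
qed

text \<open>On a nonempty word the value of \<open>f\<close> is a sum of products with at least one
  letter, where \<open>brk\<close> is the projection. On the empty word the value is 1, and
  \<open>brk\<close> gives \<open>q\<close>.\<close>

lemma brk_smf: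
 fixes B :: "('k, 'b) gmod"
 assumes B [simp]: "gr B" and f: "f \<in> smf B (Umod R M)" and a: "a \<in> words B" "d = wdeg a"
 shows "brk R M q d (f d (sm B a)) = aug q (cpt B (Umod R M) 0 f) a"
proof (cases a)
 case Nil
 then show ?thesis using a brk_smon[of "[]" 0] by (simp add: smf_one[OF B gm_Umod[OF M] f])
next
 case (Cons x w)
 have U [simp]: "gr (Umod R M)" by simp
 let ?c = "cpt B (Umod R M) 0 f"
 note c = smf_component_symfun[OF B U f]
 have x: "snd x \<in> carrier (B (fst x))" "w \<in> words B" "d = wdeg w + fst x" using a Cons by auto
 note sp = splitsD[OF _ x(2)]
 let ?t = "%v b. wmul R (Umod R M) [(wdeg v + fst x, ?c (x # v))] (wdeg b) (expF R (Umod R M) ?c b)"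
 have cc: "?c (x # v) \<in> coder M (wdeg v + fst x + 1)" if "v \<in> words B" for v
  using f_Cons_closed[OF B U c x(1) that] by simp
 have E: "expF R (Umod R M) ?c b \<in> carrier (Sy (Umod R M) (wdeg b))" if "b \<in> words B" for b
  by (rule expF_closed[OF B U c that refl])
 have "f d (sm B a) = expF R (Umod R M) ?c a"
  using mexp_smon[OF B U c a] smf_eq_mexp[OF B U f] by simp
 then have v: "f d (sm B a) = ss (Sy (Umod R M) d) w ?t"
  using Cons x(3) by (simp add: conv_def)
 have tc: "?t v b \<in> carrier (Sy (Umod R M) d)" if "splits w v b" for v b
  by (rule wmul_closed[OF U _ E]) (use sp[OF that] cc x in auto)
 have "brk R M q d (f d (sm B a)) = ss (Umod R M d) w (%v b. brk R M q d (?t v b))"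
  unfolding v by (rule ssum_mlin[OF _ _ brk_mlin tc]) auto
 also have "... = ss (Umod R M d) w (%v b. pr (Umod R M) d (?t v b))"
  by (intro ssum_cong refl brk_wmul) (use sp cc E x in auto)
 also have "... = pr (Umod R M) d (f d (sm B a))"
  unfolding v by (rule ssum_mlin[OF _ _ proj1_lift(1)[OF U] tc, symmetric]) auto
 finally show ?thesis
  using Cons a by (simp add: component_def)
qed

text \<open>The M-part of \<open>Q\<close> factors as the comultiplication, the two projections, and
  the evaluation of a coderivation on an element of S(M). As \<open>F\<close> respects
  comultiplications and its projections are known, the evaluation can be carried out on the
  splittings of \<open>w\<close>.\<close>

lemma fam_smf:
 fixes B :: "('k, 'b) gmod"
 assumes B [simp]: "gr B" and f: "f \<in> smf B (Umod R M)"
  and F: "F \<in> smf (dsum B M) (dsum (Umod R M) M)"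
  and FU: "!!d x. x \<in> carrier (Sy (dsum B M) d) ==> prB R (Umod R M) M d (F d x) = f d (prB R B M d x)"
  and FM: "!!d x. x \<in> carrier (Sy (dsum B M) d) ==> prM R (Umod R M) M d (F d x) = prM R B M d x"
  and Q: "Q \<in> coder (dsum (Umod R M) M) 1"
  and snd_Q: "!!w. w \<in> words (dsum (Umod R M) M) ==>
   snd (cpt (dsum (Umod R M) M) (dsum (Umod R M) M) 1 Q w) = fam R M (aug q (can_fam R M)) w"
  and w: "w \<in> words (dsum B M)" "d = wdeg w"
 shows "snd (pr (dsum (Umod R M) M) (d + 1) (Q d (F d (sm (dsum B M) w)))) =
  fam R M (aug q (cpt B (Umod R M) 0 f)) w"
proof -
 have U [simp]: "gr (Umod R M)" by simp
 let ?U = "Umod R M" and ?X = "dsum (Umod R M) M"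
 let ?T = "tensor R (Sy ?U) (Sy M) d" and ?t = "tens R (Sy ?U) (Sy M)"
 have X [simp]: "gr ?X" and W [simp]: "gr (dsum B M)" by simp_all
 \<comment> \<open>Evaluation: \<open>brk\<close> turns an element of S(U) into a coderivation,
   which is applied to an element of S(M) and projected to M.\<close>
 let ?h = "%i x j y. pr M (d + 1) (brk R M q i x j y)"
 have "bilin R (Sy ?U) (Sy M) (M (d + 1)) d ?h"
  unfolding bilin_def
 proof (intro allI impI conjI ballI)
  fix i j assume ij: "i + j = d"
  show "lin (Sy ?U i) (M (d + 1)) (%x. ?h i x j y)" if y: "y \<in> carrier (Sy M j)" for y
  proof -
   have "lin (Umod R M i) (Sy M (d + 1)) (%s. s j y)"
    using coder_eval_mlin[OF M y, of "d + 1" "i + 1"] ij by (simp add: Umod_def shift_def)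
   from mlin_comp[OF mlin_comp[OF brk_mlin this] proj1_lift(1)[OF M]] show ?thesis .
  qed
  show "lin (Sy M j) (M (d + 1)) (%y. ?h i x j y)" if x: "x \<in> carrier (Sy ?U i)" for x
   by (rule mlin_comp[OF coder_mlin[OF M, of _ "i + 1"] proj1_lift(1)[OF M]])
    (use mlin_closed[OF brk_mlin x] ij in auto)
 qed
 note L = tens_lift[OF gm_Sym[OF U] gm_Sym[OF M] this gm[OF M]]
 define L' where "L' = pres_lift R (M (d + 1)) (%((i, x), (j, y)). ?h i x j y)"
 note L1 = L(1)[folded L'_def] and L2 = L(2)[folded L'_def]
 let ?p = "tens_map R (Sy ?U) (Sy M) 0 (prB R ?U M) 0 (prM R ?U M) d"
 note gU = smf_gl[OF X U prB_smf[OF U M]] and gM = smf_gl[OF X M prM_smf[OF U M]]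
 note p = tens_map[OF gm_Sym[OF X] gm_Sym[OF X] gm_Sym[OF U] gm_Sym[OF M] gU gM]
 have pm: "lin (ST ?X d) ?T ?p" by (rule p(1)) simp
 have pt: "?p (ten ?X i x j y) = ?t i (prB R ?U M i x) j (prM R ?U M j y)"
  if "x \<in> carrier (Sy ?X i)" "y \<in> carrier (Sy ?X j)" "i + j = d" for i j x y
 proof -
  have "?t i (prB R ?U M i x) j (prM R ?U M j y) \<in> carrier ?T"
   using that gl_closed[OF gU] gl_closed[OF gM] by (intro tens_closed) auto
  then show ?thesis using p(2)[OF that, of d] by simp
 qed
 \<comment> \<open>Stated for a general \<open>G\<close>, because it serves twice: for the
   monomials, which identifies the M-part of \<open>Q\<close>, and for the values of
   \<open>F\<close>.\<close>
 have main: "L' (?p (ss (ST ?X d) v (%a b. ten ?X (wdeg a) (G a) (wdeg b) (G b)))) =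
   ss (M (d + 1)) v (%a b. ?h (wdeg a) (prB R ?U M (wdeg a) (G a)) (wdeg b) (prM R ?U M (wdeg b) (G b)))"
  if v: "wdeg v = d" and G: "!!a b. splits v a b ==> G a \<in> carrier (Sy ?X (wdeg a)) \<and> G b \<in> carrier (Sy ?X (wdeg b))"
  for v :: "'v word" and G
 proof -
  have "L' (?p (ss (ST ?X d) v (%a b. ten ?X (wdeg a) (G a) (wdeg b) (G b)))) =
   ss (M (d + 1)) v (%a b. L' (?p (ten ?X (wdeg a) (G a) (wdeg b) (G b))))"
   by (rule ssum_mlin[OF _ _ mlin_comp[OF pm L1]])
    (use G v in \<open>auto simp: splits_wdeg intro!: tens_closed\<close>)
  also have "... = ss (M (d + 1)) v (%a b. ?h (wdeg a) (prB R ?U M (wdeg a) (G a)) (wdeg b) (prM R ?U M (wdeg b) (G b)))"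
  proof (intro ssum_cong refl)
   fix a b assume ab: "splits v a b"
   have e: "wdeg a + wdeg b = d" using splits_wdeg[OF ab] v by simp
   show "L' (?p (ten ?X (wdeg a) (G a) (wdeg b) (G b))) =
     ?h (wdeg a) (prB R ?U M (wdeg a) (G a)) (wdeg b) (prM R ?U M (wdeg b) (G b))"
    using pt[OF _ _ e] L2[OF _ _ e] G[OF ab] gl_closed[OF gU _ refl] gl_closed[OF gM _ refl] by simp
  qed
  finally show ?thesis .
 qed
 have val: "snd (pr ?X (d + 1) (Q d y)) = L' (?p (cmu ?X d y))" if y: "y \<in> carrier (Sy ?X d)" for y
 proof (rule sym_ext[OF X _ _ _ _ y])
  show "lin (Sy ?X d) (M (d + 1)) (%y. snd (pr ?X (d + 1) (Q d y)))"
   by (rule mlin_comp[OF mlin_comp[OF coder_mlin[OF X Q refl] proj1_lift(1)[OF X]] dsum_mlin(2)[OF U M]])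
  show "lin (Sy ?X d) (M (d + 1)) (%y. L' (?p (cmu ?X d y)))"
   by (rule mlin_comp[OF mlin_comp[OF comult_mlin[OF X] pm] L1])
  fix v assume v: "v \<in> words ?X" "wdeg v = d"
  note sp = splitsD[OF _ v(1)]
  have "L' (?p (cmu ?X d (sm ?X v))) =
   L' (?p (ss (ST ?X d) v (%a b. ten ?X (wdeg a) (sm ?X a) (wdeg b) (sm ?X b))))"
   using comult_smon[OF X v(1) v(2)[symmetric]] by (simp add: stens_def[abs_def])
  also have "... = ss (M (d + 1)) v (%a b. ?h (wdeg a) (prB R ?U M (wdeg a) (sm ?X a)) (wdeg b) (prM R ?U M (wdeg b) (sm ?X b)))"
   by (rule main[OF v(2)]) (use sp in \<open>auto intro!: smon_closed\<close>)
  also have "... = fam R M (aug q (can_fam R M)) v"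
   unfolding fam_def v(2)
  proof (intro ssum_cong refl)
   fix a b assume ab: "splits v a b"
   show "?h (wdeg a) (prB R ?U M (wdeg a) (sm ?X a)) (wdeg b) (prM R ?U M (wdeg b) (sm ?X b)) =
    cpt M M (wdeg a + 1) (aug q (can_fam R M) (fst_word a)) (snd_word b)"
    using sp[OF ab] v by (simp add: prB_smon[OF U M] prM_smon[OF U M] brk_smon component_def algebra_simps)
  qed
  also have "... = snd (pr ?X (d + 1) (Q d (sm ?X v)))"
   using snd_Q[OF v(1)] v(2) by (simp add: component_def)
  finally show "snd (pr ?X (d + 1) (Q d (sm ?X v))) = L' (?p (cmu ?X d (sm ?X v)))" ..
 qed simp
 have sp: "a \<in> words (dsum B M)" "b \<in> words (dsum B M)" "wdeg w = wdeg a + wdeg b" if "splits w a b" for a b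
  using that w by (auto simp: splits_words splits_wdeg)
 have Fw: "F d (sm (dsum B M) w) \<in> carrier (Sy ?X d)"
  using w by (intro smf_closed[OF W X F] smon_closed) auto
 have "snd (pr ?X (d + 1) (Q d (F d (sm (dsum B M) w)))) =
   L' (?p (ss (ST ?X d) w (%a b. ten ?X (wdeg a) (F (wdeg a) (sm (dsum B M) a))
    (wdeg b) (F (wdeg b) (sm (dsum B M) b)))))"
  unfolding val[OF Fw] smf_comult[OF W X F w] ..
 also have "... = ss (M (d + 1)) w (%a b. ?h (wdeg a) (prB R ?U M (wdeg a) (F (wdeg a) (sm (dsum B M) a)))
    (wdeg b) (prM R ?U M (wdeg b) (F (wdeg b) (sm (dsum B M) b))))"
  by (rule main[OF w(2)[symmetric]]) (use sp in \<open>auto intro!: smf_closed[OF W X F] smon_closed\<close>)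
 also have "... = fam R M (aug q (cpt B ?U 0 f)) w"
  unfolding fam_def w(2)[symmetric]
 proof (intro ssum_cong refl)
  fix a b assume ab: "splits w a b"
  have "prB R ?U M (wdeg a) (F (wdeg a) (sm (dsum B M) a)) = f (wdeg a) (sm B (fst_word a))"
   using sp[OF ab] by (simp add: FU smon_closed prB_smon[OF B M])
  moreover have "prM R ?U M (wdeg b) (F (wdeg b) (sm (dsum B M) b)) = sm M (snd_word b)"
   using sp[OF ab] by (simp add: FM smon_closed prM_smon[OF B M])
  ultimately show "?h (wdeg a) (prB R ?U M (wdeg a) (F (wdeg a) (sm (dsum B M) a)))
    (wdeg b) (prM R ?U M (wdeg b) (F (wdeg b) (sm (dsum B M) b))) =
   cpt M M (wdeg a + 1) (aug q (cpt B ?U 0 f) (fst_word a)) (snd_word b)"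
   using sp[OF ab] w brk_smf[OF B f, of "fst_word a" "wdeg a"] by (simp add: component_def[of R M M] algebra_simps)
 qed
 finally show ?thesis .
qed

end

end

section \<open>The vectorfield on U and its components\<close>

text \<open>The shape of \<open>QU_comp\<close>: components on one and two letters only. For longer
  words both sides of every relation are zero.\<close>

lemma symfun_upto2:
 fixes W :: "('k, 'w) gmod"
 assumes P: "!!d. module R (P d)"
  and h1: "!!i. lin (W i) (P i) (h1 i)"
  and l: "!!i j y. y \<in> carrier (W j) ==> lin (W i) (P (i + j)) (%x. h2 i x j y)"
  and r: "!!i j x. x \<in> carrier (W i) ==> lin (W j) (P (i + j)) (%y. h2 i x j y)"
  and swap: "!!i j x y. x \<in> carrier (W i) ==> y \<in> carrier (W j) ==> h2 i x j y = ks (i * j) \<odot>[P (i + j)] h2 j y i x"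
 shows "symf W P (%w. case w of [(i, x)] => h1 i x | [(i, x), (j, y)] => h2 i x j y | _ => \<zero>[P (wdeg w)])"
  (is "symf W P ?\<phi>")
proof -
 define \<phi> where "\<phi> = ?\<phi>"
 note [simp] = P mlin_closed[OF h1] mlin_closed[OF l]
 have v0: "\<phi> [] = \<zero>[P 0]" and v1: "\<phi> [p] = h1 (fst p) (snd p)" and v2: "\<phi> [p, p'] = h2 (fst p) (snd p) (fst p') (snd p')" for p p'
  by (simp_all add: \<phi>_def split: prod.splits)
 have v3: "\<phi> w = \<zero>[P (wdeg w)]" if "length w > 2" for w
  using that by (cases w; cases "tl w"; cases "tl (tl w)") (auto simp: \<phi>_def)
 have "symf W P \<phi>"
 proof (rule symfunI)
 show "\<phi> w \<in> carrier (P (wdeg w))" if w: "w \<in> words W" for w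
 proof -
  consider "w = []" | p where "w = [p]" | p p' where "w = [p, p']" | "length w > 2"
   by (cases w; cases "tl w"; cases "tl (tl w)") auto
  then show ?thesis
   using w by cases (simp_all add: v0 v1 v2 v3)
 qed
 fix u v :: "'w word" and i and x assume uvx: "u \<in> words W" "v \<in> words W" "x \<in> carrier (W i)"
 consider "u = []" "v = []" | p where "u = [p]" "v = []" | p where "u = []" "v = [p]" | "length u + length v > 1"
  by (cases u; cases v; cases "tl u"; cases "tl v") auto
 note uv = this
 show "\<phi> (u @ (i, x \<oplus>[W i] y) # v) = \<phi> (u @ (i, x) # v) \<oplus>[P (wdeg u + (i + wdeg v))] \<phi> (u @ (i, y) # v)"
  if y: "y \<in> carrier (W i)" for y
  using uv
 proof cases
  case 1 then show ?thesis using mlin_add[OF h1 uvx(3) y] by (simp add: v1)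
 next
  case (2 p) then show ?thesis using mlin_add[OF r uvx(3) y, of "snd p" "fst p"] uvx by (simp add: v2)
 next
  case (3 p) then show ?thesis using mlin_add[OF l uvx(3) y, of "snd p" "fst p"] uvx by (simp add: v2)
 next
  case 4 then show ?thesis using uvx by (simp add: v3)
 qed
 show "\<phi> (u @ (i, a \<odot>[W i] x) # v) = a \<odot>[P (wdeg u + (i + wdeg v))] \<phi> (u @ (i, x) # v)"
  if a: "a \<in> carrier R" for a
  using uv
 proof cases
  case 1 then show ?thesis using mlin_smult[OF h1 a uvx(3)] by (simp add: v1)
 next
  case (2 p) then show ?thesis using mlin_smult[OF r a uvx(3), of "snd p" "fst p"] uvx by (simp add: v2)
 next
  case (3 p) then show ?thesis using mlin_smult[OF l a uvx(3), of "snd p" "fst p"] uvx by (simp add: v2)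
 next
  case 4 then show ?thesis using uvx a by (simp add: v3)
 qed
 show "\<phi> (u @ (i, x) # (j, y) # v) = ks (i * j) \<odot>[P (wdeg u + (i + (j + wdeg v)))] \<phi> (u @ (j, y) # (i, x) # v)"
  if y: "y \<in> carrier (W j)" for j y
 proof (cases "u = [] \<and> v = []")
  case True
  then show ?thesis using swap[OF uvx(3) y] by (simp add: v2)
 next
  case False
  then have "length (u @ (i, x) # (j, y) # v) > 2" "length (u @ (j, y) # (i, x) # v) > 2"
   by (cases u; auto)+
  from v3[OF this(1)] v3[OF this(2)] show ?thesis by (simp add: add.left_commute)
 qed
qed
 then show ?thesis unfolding \<phi>_def .
qed

context
 fixes M :: "('k, 'm) gmod"
 assumes M [simp]: "gr M"
begin

lemma bracket_apply:
 assumes s: "s \<in> coder M i" and t: "t \<in> coder M j" and x: "x \<in> carrier (Sy M d)" and e: "e = d + (i + j)"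
 shows "bracket R M i j s t d x = s (d + j) (t d x) \<oplus>[Sy M e] (\<ominus> ks (i * j)) \<odot>[Sy M e] t (d + i) (s d x)"
proof -
 have "t (d + i) (s d x) \<in> carrier (Sy M (d + (i + j)))"
  using x by (intro coder_closed[OF M t] coder_closed[OF M s]) auto
 then show ?thesis using x e by (simp add: bracket_def m_minus_eq m_neg_smult)
qed

lemma bracket_ext: "bracket R M i j s t d \<in> extensional (carrier (Sy M d))"
 by (simp add: bracket_def)

lemma coder_comp_closed:
 "[|s \<in> coder M i; t \<in> coder M j; x \<in> carrier (Sy M d); e = d + (i + j)|] ==>
  s (d + j) (t d x) \<in> carrier (Sy M e)"
 by (rule coder_closed[OF M _ coder_closed[OF M _ _ refl]]) auto

lemma bracket_mlin_left:
 assumes t: "t \<in> coder M j" and k: "k = i + j"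
 shows "lin (Coder R M i) (Coder R M k) (%s. bracket R M i j s t)"
 unfolding k
proof (rule mlinI)
 fix s s' a assume "s \<in> carrier (Coder R M i)"
 then have s: "s \<in> coder M i" using M by simp
 show "bracket R M i j s t \<in> carrier (Coder R M (i + j))"
  using bracket_closed[OF M s t refl] M by simp
 show "bracket R M i j (s \<oplus>[Coder R M i] s') t = bracket R M i j s t \<oplus>[Coder R M (i + j)] bracket R M i j s' t"
  if "s' \<in> carrier (Coder R M i)"
 proof (rule coder_fun_eqI[OF M bracket_ext Coder_extensional(1)[OF M]])
  have s': "s' \<in> coder M i" using that M by simp
  fix d x assume x: "x \<in> carrier (Sy M d)"
  have tx: "t d x \<in> carrier (Sy M (d + j))" by (rule coder_closed[OF M t x refl])
  have e: "d + j + i = d + (i + j)" by simp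
  note c = coder_comp_closed[OF t s x, of "d + (i + j)"] coder_comp_closed[OF t s' x, of "d + (i + j)"]
   coder_comp_closed[OF s t x refl] coder_comp_closed[OF s' t x refl]
  show "bracket R M i j (s \<oplus>[Coder R M i] s') t d x = (bracket R M i j s t \<oplus>[Coder R M (i + j)] bracket R M i j s' t) d x"
   using c mlin_add[OF coder_mlin[OF M t refl] coder_closed[OF M s x refl] coder_closed[OF M s' x refl]]
   by (simp add: bracket_apply[OF coder_add_closed[OF M s s'] t x refl] bracket_apply[OF s t x refl] bracket_apply[OF s' t x refl]
    Coder_apply[OF M x] Coder_apply[OF M tx] e add.assoc add.commute[of j i] m_smult_add madd_ac)
 qed
 show "bracket R M i j (a \<odot>[Coder R M i] s) t = a \<odot>[Coder R M (i + j)] bracket R M i j s t" if a: "a \<in> carrier R"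
 proof (rule coder_fun_eqI[OF M bracket_ext Coder_extensional(2)[OF M]])
  fix d x assume x: "x \<in> carrier (Sy M d)"
  have tx: "t d x \<in> carrier (Sy M (d + j))" by (rule coder_closed[OF M t x refl])
  have e: "d + j + i = d + (i + j)" by simp
  note c = coder_comp_closed[OF t s x, of "d + (i + j)"] coder_comp_closed[OF s t x refl]
  show "bracket R M i j (a \<odot>[Coder R M i] s) t d x = (a \<odot>[Coder R M (i + j)] bracket R M i j s t) d x"
   using c a mlin_smult[OF coder_mlin[OF M t refl] a coder_closed[OF M s x refl]]
   by (simp add: bracket_apply[OF coder_smult_closed[OF M s a] t x refl] bracket_apply[OF s t x refl]
    Coder_apply[OF M x] Coder_apply[OF M tx] e add.assoc add.commute[of j i] m_smult_add m_smult_smult m_comm)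
 qed
qed

lemma bracket_swap:
 assumes s: "s \<in> coder M i" and t: "t \<in> coder M j" and k: "k = i + j"
 shows "bracket R M j i t s = (\<ominus> ks (i * j)) \<odot>[Coder R M k] bracket R M i j s t"
proof (rule coder_fun_eqI[OF M bracket_ext Coder_extensional(2)[OF M]])
 fix d x assume x: "x \<in> carrier (Sy M d)"
 have e: "d + k = d + (i + j)" "d + k = d + (j + i)" using k by simp_all
 note c = coder_comp_closed[OF t s x e(2)] coder_comp_closed[OF s t x e(1)]
 have sg: "\<ominus> ks (j * i) = \<ominus> ks (i * j)" "(\<ominus> ks (i * j)) \<otimes> (\<ominus> ks (i * j)) = \<one>"
  by (simp_all add: mult.commute l_minus r_minus)
 show "bracket R M j i t s d x = ((\<ominus> ks (i * j)) \<odot>[Coder R M k] bracket R M i j s t) d x"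
  using c by (simp add: bracket_apply[OF s t x e(1)] bracket_apply[OF t s x e(2)] Coder_apply[OF M x]
   m_smult_add m_smult_smult sg madd_comm)
qed

text \<open>Graded antisymmetry reduces the claim to linearity in the first argument.\<close>

lemma bracket_mlin_right:
 assumes s: "s \<in> coder M i" and k: "k = i + j"
 shows "lin (Coder R M j) (Coder R M k) (%t. bracket R M i j s t)"
proof (rule mlin_cong)
 show "lin (Coder R M j) (Coder R M k) (%t. (\<ominus> ks (j * i)) \<odot>[Coder R M k] bracket R M j i t s)"
  by (rule mlin_scale[OF _ bracket_mlin_left[OF s]]) (use k M in auto)
qed (use bracket_swap[OF _ s, of _ j k] k M in auto)

context
 fixes q :: "('k, 'm) vfield"
 assumes q [simp]: "q \<in> coder M 1"
begin

lemma Ldiff_mlin: "k = i + 1 ==> lin (Coder R M i) (Coder R M k) (Ldiff R M q i)"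
 unfolding Ldiff_def using bracket_mlin_left[OF q, of k i] M by (auto intro: mlin_scale)

text \<open>The shift by one degree, together with the sign \<open>ks i\<close>, turns the graded
  antisymmetric bracket into a graded symmetric map.\<close>

lemma QU_comp_symfun: "symf (Umod R M) (%d. Umod R M (d + 1)) (QU_comp R M q)"
proof -
 have U: "Umod R M i = Coder R M (i + 1)" for i by (simp add: Umod_def shift_def)
 have Uk: "module R (Coder R M i)" for i using M by simp
 let ?h2 = "%i u j v. \<ominus>[Coder R M (i + j + 2)] (ks i \<odot>[Coder R M (i + j + 2)] bracket R M (i + 1) (j + 1) u v)"
 have "symf (Umod R M) (%d. Umod R M (d + 1))
   (%w. case w of [(i, x)] => Ldiff R M q (i + 1) x | [(i, x), (j, y)] => ?h2 i x j y | _ => \<zero>[Umod R M (wdeg w + 1)])"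
 proof (rule symfun_upto2)
  show "lin (Umod R M i) (Umod R M (i + 1)) (Ldiff R M q (i + 1))" for i
   unfolding U by (rule Ldiff_mlin) simp
  have n: "\<ominus>[Coder R M k] (a \<odot>[Coder R M k] x) = (\<ominus> a) \<odot>[Coder R M k] x" if "a \<in> carrier R" "x \<in> coder M k" for a x k
   using that M m_neg_smult[OF Uk] by simp
  have h2: "?h2 i u j v = (\<ominus> ks i) \<odot>[Coder R M (i + j + 2)] bracket R M (i + 1) (j + 1) u v"
   if "u \<in> coder M (i + 1)" "v \<in> coder M (j + 1)" for i j u v
   by (rule n) (use bracket_closed[OF M that, of "i + j + 2"] in auto)
  fix i j x
  show "lin (Umod R M i) (Umod R M (i + j + 1)) (%u. ?h2 i u j v)" if v: "v \<in> carrier (Umod R M j)" for v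
   unfolding U by (rule mlin_cong[OF mlin_scale[OF _ bracket_mlin_left]], rule Uk)
    (use h2 v M in \<open>auto simp: Uk add.assoc\<close>)
  show "lin (Umod R M j) (Umod R M (i + j + 1)) (%v. ?h2 i x j v)" if x: "x \<in> carrier (Umod R M i)"
   unfolding U by (rule mlin_cong[OF mlin_scale[OF _ bracket_mlin_right]], rule Uk)
    (use h2 x M in \<open>auto simp: Uk add.assoc\<close>)
  show "?h2 i x j v = ks (i * j) \<odot>[Umod R M (i + j + 1)] ?h2 j v i x"
   if "x \<in> carrier (Umod R M i)" "v \<in> carrier (Umod R M j)" for v
  proof -
   have x: "x \<in> coder M (i + 1)" and v: "v \<in> coder M (j + 1)" using that M by simp_all
   have k: "i + j + 2 = i + 1 + (j + 1)" "j + i + 2 = i + j + 2" "i + j + 1 + 1 = i + j + 2" by simp_all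
   have b: "bracket R M (i + 1) (j + 1) x v \<in> carrier (Coder R M (i + j + 2))" using bracket_closed[OF M x v k(1)] M by simp
   \<comment> \<open>Modulo 2 the exponents add up to \<open>i + 1\<close>, which is the sign in
     front of the bracket.\<close>
   have "ks (i * j) \<otimes> (\<ominus> ks j \<otimes> \<ominus> ks ((i + 1) * (j + 1))) = ks (i * j + (j + (i + 1) * (j + 1)))"
    by (simp add: l_minus r_minus ksign_add)
   also have "... = \<ominus> ks i"
   proof -
    have "ks (i * j + (j + (i + 1) * (j + 1))) = ks (i + 1)" by (rule ksign_cong) (auto simp: algebra_simps)
    then show ?thesis by (simp add: ksign_add ksign_odd r_minus)
   qed
   finally have sg: "ks (i * j) \<otimes> (\<ominus> ks j \<otimes> \<ominus> ks ((i + 1) * (j + 1))) = \<ominus> ks i" .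
   have s: "a \<odot>[Coder R M (i + j + 2)] (b \<odot>[Coder R M (i + j + 2)] (c \<odot>[Coder R M (i + j + 2)] bracket R M (i + 1) (j + 1) x v)) =
     (a \<otimes> (b \<otimes> c)) \<odot>[Coder R M (i + j + 2)] bracket R M (i + 1) (j + 1) x v"
    if "a \<in> carrier R" "b \<in> carrier R" "c \<in> carrier R" for a b c
    using b that by (simp add: m_smult_smult Uk)
   show ?thesis
    unfolding U k(3) h2[OF x v] h2[OF v x] unfolding k(2) bracket_swap[OF x v k(1)]
    by (subst s) (simp_all only: sg ksign_closed a_inv_closed)
  qed
 qed (simp add: U Uk)
 note s = this
 have U': "Coder R M (i + j + 2) = Umod R M (i + j + 1)" for i j by (simp add: U add.assoc)
 show ?thesis
  using s unfolding QU_comp_def[abs_def] U' .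
qed

lemma QU_coder: "QU R M q \<in> coder (Umod R M) 1"
 and component_QU: "w \<in> words (Umod R M) ==> cpt (Umod R M) (Umod R M) 1 (QU R M q) w = QU_comp R M q w"
 unfolding QU_def using vfield_of_coder[OF gm_Umod[OF M] QU_comp_symfun] component_vfield_of[OF gm_Umod[OF M] QU_comp_symfun]
 by blast+

lemma component_bracket:
 assumes s: "s \<in> coder M i" and t: "t \<in> coder M j" and w: "w \<in> words M" and k: "k = i + j" and e: "e = wdeg w + k"
 shows "cpt M M k (bracket R M i j s t) w =
   pr M e (s (wdeg w + j) (t (wdeg w) (sm M w))) \<oplus>[M e]
   (\<ominus> ks (i * j)) \<odot>[M e] pr M e (t (wdeg w + i) (s (wdeg w) (sm M w)))"
proof -
 have x: "sm M w \<in> carrier (Sy M (wdeg w))" using w M by (simp add: smon_closed)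
 have e': "e = wdeg w + (i + j)" "e = wdeg w + (j + i)" using k e by simp_all
 note c = coder_comp_closed[OF s t x e'(1)] coder_comp_closed[OF t s x e'(2)]
 show ?thesis
  unfolding component_eq[OF refl e] bracket_apply[OF s t x e'(1)]
  using c mlin_add[OF proj1_lift(1)[OF M]] mlin_smult[OF proj1_lift(1)[OF M]] M by simp
qed

text \<open>The right side is the formula of \<open>component_QU2\<close> for \<open>j = 0\<close>
  and \<open>v = q\<close>. So the differential behaves like the quadratic component with the
  vectorfield of M inserted, which is why that vectorfield can be treated as the value of a family
  at the empty word.\<close>

lemma component_Ldiff:
 assumes s: "s \<in> coder M (i + 1)" and w: "w \<in> words M" and e: "e = wdeg w + (i + 2)"
 shows "cpt M M (i + 2) (Ldiff R M q (i + 1) s) w = \<ominus>[M e]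
  (ks i \<odot>[M e] pr M e (s (wdeg w + 1) (q (wdeg w) (sm M w))) \<oplus>[M e]
   pr M e (q (wdeg w + (i + 1)) (s (wdeg w) (sm M w))))" (is "_ = \<ominus>[M e] (_ \<odot>[M e] ?A \<oplus>[M e] ?B)")
proof -
 have k: "i + 2 = i + 1 + 1" by simp
 have x: "sm M w \<in> carrier (Sy M (wdeg w))" using w M by (simp add: smon_closed)
 have c: "?A \<in> carrier (M e)" "?B \<in> carrier (M e)"
  using coder_comp_closed[OF s q x, of e] coder_comp_closed[OF q s x, of e] e M
  by (auto intro!: mlin_closed[OF proj1_lift(1)])
 have "cpt M M (i + 2) (Ldiff R M q (i + 1) s) w =
  ks (i + 1) \<odot>[M e] cpt M M (i + 2) (bracket R M (i + 1) 1 s q) w"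
  unfolding Ldiff_def
  using mlin_smult[OF coder_component_mlin[OF M w e]] bracket_closed[OF M s q k] M by (simp add: add.assoc)
 also have "... = ks (i + 1) \<odot>[M e] (?A \<oplus>[M e] (\<ominus> ks (i + 1)) \<odot>[M e] ?B)"
  using component_bracket[OF s q w k e] by simp
 also have "... = \<ominus>[M e] (ks i \<odot>[M e] ?A \<oplus>[M e] ?B)"
 proof -
  have "ks (i + 1) = \<ominus> ks i" by (simp add: ksign_add ksign_odd r_minus)
  then show ?thesis
   using c M by (simp add: m_smult_add m_smult_smult l_minus r_minus m_neg_add m_neg_smult)
 qed
 finally show ?thesis .
qed

lemma component_QU2:
 assumes u: "u \<in> coder M (i + 1)" and v: "v \<in> coder M (j + 1)" and w: "w \<in> words M"
  and k: "k = i + j + 2" and e: "e = wdeg w + k"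
 shows "cpt M M k (QU_comp R M q [(i, u), (j, v)]) w = \<ominus>[M e]
  (ks i \<odot>[M e] pr M e (u (wdeg w + (j + 1)) (v (wdeg w) (sm M w))) \<oplus>[M e]
   ks ((i + 1) * j) \<odot>[M e] pr M e (v (wdeg w + (i + 1)) (u (wdeg w) (sm M w))))"
   (is "_ = \<ominus>[M e] (_ \<odot>[M e] ?A \<oplus>[M e] _ \<odot>[M e] ?B)")
proof -
 have k': "k = i + 1 + (j + 1)" using k by simp
 have x: "sm M w \<in> carrier (Sy M (wdeg w))" using w M by (simp add: smon_closed)
 have c: "?A \<in> carrier (M e)" "?B \<in> carrier (M e)"
  using coder_comp_closed[OF u v x, of e] coder_comp_closed[OF v u x, of e] e k M
  by (auto intro!: mlin_closed[OF proj1_lift(1)])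
 have U: "Umod R M (i + j + 1) = Coder R M k" using k by (simp add: Umod_def shift_def add.assoc)
 let ?b = "bracket R M (i + 1) (j + 1) u v"
 have b: "?b \<in> carrier (Coder R M k)" using bracket_closed[OF M u v k'] M by simp
 have "cpt M M k (QU_comp R M q [(i, u), (j, v)]) w = cpt M M k ((\<ominus> ks i) \<odot>[Coder R M k] ?b) w"
  using b gm[OF gm_Coder[OF M], of k] by (simp add: QU_comp_def U m_neg_smult)
 also have "... = (\<ominus> ks i) \<odot>[M e] cpt M M k ?b w"
  using mlin_smult[OF coder_component_mlin[OF M w e] _ b] by simp
 also have "... = (\<ominus> ks i) \<odot>[M e] (?A \<oplus>[M e] (\<ominus> ks ((i + 1) * (j + 1))) \<odot>[M e] ?B)"
  using component_bracket[OF u v w k' e] by simp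
 also have "... = \<ominus>[M e] (ks i \<odot>[M e] ?A \<oplus>[M e] ks ((i + 1) * j) \<odot>[M e] ?B)"
 proof -
  have "ks ((i + 1) * j) = ks ((i + (i + 1) * (j + 1)) + 1)" by (rule ksign_cong) (auto simp: algebra_simps)
  then have "ks ((i + 1) * j) = \<ominus> (ks i \<otimes> ks ((i + 1) * (j + 1)))"
   by (simp only: ksign_add) (simp add: ksign_odd r_minus)
  then show ?thesis
   using c M by (simp add: m_smult_add m_smult_smult l_minus r_minus m_neg_add m_neg_smult m_smult_neg)
 qed
 finally show ?thesis .
qed

end

end

section \<open>The vectorfield on U composed with a coalgebra morphism\<close>

context
 fixes M :: "('k, 'm) gmod" and q :: "('k, 'm) vfield"
 assumes M [simp]: "gr M" and q [simp]: "q \<in> coder M 1"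
begin

lemma mlin_neg_map: "module R P ==> lin P P (%x. \<ominus>[P] x)"
 by (rule mlinI) (auto simp: m_neg_add m_smult_neg)

lemma proj1_QU_mlin:
 "e = d + 1 ==> lin (Sy (Umod R M) d) (Umod R M e) (%y. pr (Umod R M) e (QU R M q d y))"
 using mlin_comp[OF coder_mlin[OF gm_Umod[OF M] QU_coder[OF M q] refl] proj1_lift(1)[OF gm_Umod[OF M]]] by simp

lemma proj1_QU_smon:
 "w \<in> words (Umod R M) ==> d = wdeg w ==> e = d + 1 ==>
  pr (Umod R M) e (QU R M q d (sm (Umod R M) w)) = QU_comp R M q w"
 using component_QU[OF M q, of w] by (simp add: component_def)

text \<open>Products with three letters consist of words of length at least three, where
  \<open>QU_comp\<close> vanishes.\<close>

lemma proj1_QU_wmul3: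
 assumes a: "a \<in> words (Umod R M)" "length a = 3" and z: "z \<in> carrier (Sy (Umod R M) d)"
  and f: "f = d + wdeg a" and e: "e = f + 1"
 shows "pr (Umod R M) e (QU R M q f (wmul R (Umod R M) a d z)) = \<zero>[Umod R M e]"
proof -
 have U [simp]: "gr (Umod R M)" by simp
 obtain p1 p2 p3 where a': "a = [p1, p2, p3]"
  using a(2) by (auto simp: numeral_3_eq_3 length_Suc_conv)
 show ?thesis
 proof (rule sym_ext[OF U _ _ mlin_zero_map _ z])
  show "lin (Sy (Umod R M) d) (Umod R M e) (%y. pr (Umod R M) e (QU R M q f (wmul R (Umod R M) a d y)))"
   by (rule mlin_comp[OF wmul_mlin[OF U a(1) f] proj1_QU_mlin[OF e]])
  fix w assume w: "w \<in> words (Umod R M)" "wdeg w = d"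
  have "pr (Umod R M) e (QU R M q f (wmul R (Umod R M) a d (sm (Umod R M) w))) = QU_comp R M q (a @ w)"
   using w a f e proj1_QU_smon[of "a @ w" f e] by (simp add: wmul_smon[OF U])
  also have "... = \<zero>[Umod R M e]"
   using w f e unfolding a' by (cases p1; cases p2; cases p3) (simp add: QU_comp_def ac_simps)
  finally show "pr (Umod R M) e (QU R M q f (wmul R (Umod R M) a d (sm (Umod R M) w))) = \<zero>[Umod R M e]" .
 qed simp_all
qed

context
 fixes B :: "('k, 'b) gmod" and \<phi> :: "'b word => ('k, 'm) vfield"
 assumes B [simp]: "gr B" and \<phi>: "symf B (Umod R M) \<phi>"
begin

lemma phi_Cons_coder: "snd x \<in> carrier (B (fst x)) ==> a \<in> words B ==> \<phi> (x # a) \<in> coder M (wdeg a + fst x + 1)"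
 using f_Cons_closed[OF B gm_Umod[OF M] \<phi>] by simp

text \<open>After multiplication by the letter \<open>u\<close> only terms of the exponential with
  at most one factor reach a component of \<open>QU\<close>: the constant term if \<open>b\<close>
  is empty, and the single factor \<open>\<phi> b\<close> otherwise.\<close>

lemma proj1_QU_wmul_expF:
 assumes u: "u \<in> coder M (i + 1)" and b: "b \<in> words B" and f: "f = wdeg b + i" and e: "e = f + 1"
 shows "pr (Umod R M) e (QU R M q f (wmul R (Umod R M) [(i, u)] (wdeg b) (expF R (Umod R M) \<phi> b))) =
  QU_comp R M q ((i, u) # (if b = [] then [] else [(wdeg b, \<phi> b)]))"
proof (cases b)
 case Nil
 then show ?thesis using u f proj1_QU_smon[of "[(i, u)]" f e] e wmul_smon[OF gm_Umod[OF M], of "[(i, u)]" "[]" 0] by simp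
next
 case (Cons y b')
 let ?U = "Umod R M"
 have U [simp]: "gr ?U" by simp
 let ?E = "expF R ?U \<phi>"
 have y: "snd y \<in> carrier (B (fst y))" "b' \<in> words B" "wdeg b = wdeg b' + fst y" using b Cons by auto
 have uw: "[(i, u)] \<in> words ?U" using u by simp
 note sp = splitsD[OF _ y(2)]
 let ?v = "%c. [(wdeg c + fst y, \<phi> (y # c))]"
 have vw: "?v c \<in> words ?U" if "c \<in> words B" for c using phi_Cons_coder[OF y(1) that] by simp
 note Ec = expF_closed[OF B U \<phi>]
 let ?h = "%z. pr ?U e (QU R M q f (wmul R ?U [(i, u)] (wdeg b) z))"
 have h: "lin (Sy ?U (wdeg b)) (?U e) ?h"
  by (rule mlin_comp[OF wmul_mlin[OF U uw] proj1_QU_mlin[OF e]]) (simp add: f)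
 have t: "wmul R ?U (?v c) (wdeg d) (?E d) \<in> carrier (Sy ?U (wdeg b))" if "splits b' c d" for c d
  by (rule wmul_closed[OF U vw Ec]) (use sp[OF that] y in auto)
 have z: "?h (wmul R ?U (?v c) (wdeg d) (?E d)) = \<zero>[?U e]" if s: "splits b' c d" and d: "d \<noteq> []" for c d
 proof -
  obtain x d' where d': "d = x # d'" using d by (cases d) auto
  have x: "snd x \<in> carrier (B (fst x))" "d' \<in> words B" "wdeg d = wdeg d' + fst x" using sp(2)[OF s] d' by auto
  have sp': "a \<in> words B" "a' \<in> words B" "wdeg d' = wdeg a + wdeg a'" if "splits d' a a'" for a a'
   using that x by (auto simp: splits_words splits_wdeg)
  let ?t = "%a. [(wdeg a + fst x, \<phi> (x # a))]"
  have tw: "?t a \<in> words ?U" if "a \<in> words B" for a using phi_Cons_coder[OF x(1) that] by simp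
  have hv: "lin (Sy ?U (wdeg d)) (?U e) (%z. ?h (wmul R ?U (?v c) (wdeg d) z))"
   by (rule mlin_comp[OF wmul_mlin[OF U vw] h]) (use sp[OF s] y in auto)
  have "?E d = ss (Sy ?U (wdeg d)) d' (%a a'. wmul R ?U (?t a) (wdeg a') (?E a'))"
   unfolding x(3) unfolding d' by (simp add: conv_def)
  then have "?h (wmul R ?U (?v c) (wdeg d) (?E d)) =
    ?h (wmul R ?U (?v c) (wdeg d) (ss (Sy ?U (wdeg d)) d' (%a a'. wmul R ?U (?t a) (wdeg a') (?E a'))))"
   by simp
  also have "... = ss (?U e) d' (%a a'. ?h (wmul R ?U (?v c) (wdeg d) (wmul R ?U (?t a) (wdeg a') (?E a'))))"
   by (rule ssum_mlin[OF _ _ hv]) (use sp' x tw in \<open>auto intro!: wmul_closed[OF U] Ec\<close>)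
  also have "... = \<zero>[?U e]"
  proof (rule ssum_zero)
   fix a a' assume aa: "splits d' a a'"
   note a = sp'[OF aa]
   have "wmul R ?U [(i, u)] (wdeg b) (wmul R ?U (?v c) (wdeg d) (wmul R ?U (?t a) (wdeg a') (?E a'))) =
     wmul R ?U ([(i, u)] @ ?v c @ ?t a) (wdeg a') (?E a')"
    using wmul_wmul[OF U vw[OF sp(1)[OF s]] tw[OF a(1)] Ec[OF a(2) refl], of "wdeg d"]
     wmul_wmul[OF U uw _ Ec[OF a(2) refl], of "?v c @ ?t a" "wdeg b"] vw[OF sp(1)[OF s]] tw[OF a(1)] x y sp(3)[OF s] a(3)
    by simp
   then show "?h (wmul R ?U (?v c) (wdeg d) (wmul R ?U (?t a) (wdeg a') (?E a'))) = \<zero>[?U e]"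
    using proj1_QU_wmul3[of "[(i, u)] @ ?v c @ ?t a" "?E a'" "wdeg a'" f e] uw vw[OF sp(1)[OF s]] tw[OF a(1)]
     Ec[OF a(2) refl] f e x y sp(3)[OF s] a(3) by simp
  qed simp
  finally show ?thesis .
 qed
 have "?E b = ss (Sy ?U (wdeg b)) b' (%c d. wmul R ?U (?v c) (wdeg d) (?E d))"
  unfolding y(3) unfolding Cons by (simp add: conv_def)
 then have "?h (?E b) = ?h (ss (Sy ?U (wdeg b)) b' (%c d. wmul R ?U (?v c) (wdeg d) (?E d)))"
  by simp
 also have "... = ss (?U e) b' (%c d. ?h (wmul R ?U (?v c) (wdeg d) (?E d)))"
  by (rule ssum_mlin[OF _ _ h t]) simp_all
 also have "... = ?h (wmul R ?U (?v b') (wdeg ([] :: 'b word)) (?E []))"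
  by (rule ssum_left) (use z mlin_closed[OF h t[OF splits_self(1)]] in auto)
 also have "... = ?h (sm ?U [(wdeg b, \<phi> b)])"
  using wmul_smon[OF U vw[OF y(2)], of "[]" 0] y(3) Cons by (simp add: add.commute)
 also have "... = QU_comp R M q [(i, u), (wdeg b, \<phi> b)]"
  using wmul_smon[OF U uw, of "[(wdeg b, \<phi> b)]" "wdeg b"] vw[OF y(2)] y(3) Cons u f
   proj1_QU_smon[of "[(i, u), (wdeg b, \<phi> b)]" f e] e by (simp add: add.commute)
 finally show ?thesis using Cons by simp
qed

text \<open>Projection to U picks the component of the morphism at each word produced by
  \<open>Q\<close>. These words are nonempty, so \<open>aug q\<close> may be inserted; this matches
  the first summand in \<open>fam_vfield_comp\<close>.\<close>

lemma component_mexp_vfield: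
 assumes Q: "Q \<in> coder B 1" and bs: "bs \<in> words B" and ms: "ms \<in> words M" and n: "n = wdeg bs + wdeg ms + 2"
 shows "cpt M M (wdeg bs + 2) (pr (Umod R M) (wdeg bs + 1) (mexp R B (Umod R M) \<phi> (wdeg bs + 1) (Q (wdeg bs) (sm B bs)))) ms =
  ss (M n) bs (%a b. cpt M M (wdeg a + 1 + wdeg b + 1) (aug q \<phi> ((wdeg a + 1, cpt B B 1 Q a) # b)) ms)"
proof -
 let ?U = "Umod R M" and ?F = "mexp R B (Umod R M) \<phi>" and ?e = "wdeg bs + 1"
 have U [simp]: "gr ?U" by simp
 note sp = splitsD[OF _ bs]
 let ?l = "%a. (wdeg a + 1, cpt B B 1 Q a)"
 have lw: "?l a # b \<in> words B" if "a \<in> words B" "b \<in> words B" for a b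
  using that coder_component_closed[OF B Q that(1) refl] by simp
 have h: "lin (Sy B ?e) (M n) (%x. cpt M M (wdeg bs + 2) (pr ?U ?e (?F ?e x)) ms)"
 proof (rule mlin_comp[OF mlin_comp[OF smf_mlin[OF B U mexp_smf(1)[OF B U \<phi>]] proj1_lift(1)[OF U]]])
  have e: "wdeg bs + 2 = ?e + 1" by simp
  show "lin (?U ?e) (M n) (%s. cpt M M (wdeg bs + 2) s ms)"
   unfolding e by (rule Umod_component_mlin[OF M ms]) (simp add: n)
 qed
 have "cpt M M (wdeg bs + 2) (pr ?U ?e (?F ?e (Q (wdeg bs) (sm B bs)))) ms =
   ss (M n) bs (%a b. cpt M M (wdeg bs + 2) (pr ?U ?e (?F ?e (sm B (?l a # b)))) ms)"
  unfolding coder_smon[OF B Q bs refl]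
  by (rule ssum_mlin[OF _ _ h]) (use sp coder_component_closed[OF B Q _ refl] in \<open>auto intro!: smon_closed[OF B]\<close>)
 also have "... = ss (M n) bs (%a b. cpt M M (wdeg a + 1 + wdeg b + 1) (aug q \<phi> (?l a # b)) ms)"
 proof (intro ssum_cong refl)
  fix a b assume ab: "splits bs a b"
  have "pr ?U ?e (?F ?e (sm B (?l a # b))) = \<phi> (?l a # b)"
   using component_mexp[OF B U \<phi> lw[OF sp(1,2)[OF ab]]] sp(3)[OF ab]
   by (simp add: component_eq[of "?l a # b" ?e ?e 0])
  then show "cpt M M (wdeg bs + 2) (pr ?U ?e (?F ?e (sm B (?l a # b)))) ms =
    cpt M M (wdeg a + 1 + wdeg b + 1) (aug q \<phi> (?l a # b)) ms"
   using sp(3)[OF ab] by (simp add: ac_simps)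
 qed
 finally show ?thesis .
qed

text \<open>The sum runs over all splittings of \<open>bs\<close> into two parts. One part contains
  the first letter and is the factor singled out by the exponential; the two terms of a bracket are
  the two orders of the parts. An empty part stands for \<open>q\<close>, which accounts for the
  differential.\<close>

lemma component_QU_mexp:
 assumes dg: "dg_structure R M q" and bs: "bs \<in> words B" and ms: "ms \<in> words M" and n: "n = wdeg bs + wdeg ms + 2"
 shows "cpt M M (wdeg bs + 2) (pr (Umod R M) (wdeg bs + 1) (QU R M q (wdeg bs) (mexp R B (Umod R M) \<phi> (wdeg bs) (sm B bs)))) ms =
  \<ominus>[M n] ss (M n) bs (%a b. ks ((wdeg a + 1) * wdeg b) \<odot>[M n]
   pr M n (aug q \<phi> b (wdeg ms + (wdeg a + 1)) (aug q \<phi> a (wdeg ms) (sm M ms))))"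
proof -
 let ?U = "Umod R M" and ?F = "mexp R B (Umod R M) \<phi>" and ?E = "expF R (Umod R M) \<phi>"
 have U [simp]: "gr ?U" by simp
 let ?C = "%a b. pr M n (aug q \<phi> b (wdeg ms + (wdeg a + 1)) (aug q \<phi> a (wdeg ms) (sm M ms)))"
 have x: "sm M ms \<in> carrier (Sy M (wdeg ms))" using ms M by (simp add: smon_closed)
 have ac: "aug q \<phi> a \<in> coder M (wdeg a + 1)" if "a \<in> words B" for a
  by (rule fam_coder[OF M B symfun_aug[OF \<phi>]]) (use that in auto)
 have Cc: "?C a b \<in> carrier (M n)" if "splits bs a b" for a b
 proof -
  have ab: "a \<in> words B" "b \<in> words B" "wdeg bs = wdeg a + wdeg b"
   using that bs by (auto simp: splits_words splits_wdeg)
  show ?thesis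
   by (rule mlin_closed[OF proj1_lift(1)[OF M]], rule coder_comp_closed[OF M ac ac x]) (use ab n in auto)
 qed
 show ?thesis
 proof (cases bs)
  case Nil
  \<comment> \<open>At the empty word the left side vanishes because \<open>QU\<close> has no
    constant component; the right side is the square of \<open>q\<close>, which is zero by
    \<open>dg\<close>.\<close>
  have "?F 0 (sm B []) = sm ?U []" by (rule smf_one[OF B U mexp_smf(1)[OF B U \<phi>]])
  moreover have "pr ?U 1 (QU R M q 0 (sm ?U [])) = \<zero>[?U 1]"
   using proj1_QU_smon[of "[]" 0 1] by (simp add: QU_comp_def)
  moreover have "cpt M M 2 \<zero>[?U 1] ms = \<zero>[M n]"
   using mlin_zero[OF gm[OF U] gm[OF M] Umod_component_mlin[OF M ms, of n 1]] n Nil by simp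
  moreover have "q (wdeg ms + 1) (q (wdeg ms) (sm M ms)) = \<zero>[Sy M n]"
   using dg_structure_sq[OF M q dg x] n Nil by simp
  moreover have "pr M n \<zero>[Sy M n] = \<zero>[M n]"
   by (rule mlin_zero[OF _ _ proj1_lift(1)[OF M]]) simp_all
  ultimately show ?thesis using Nil M by simp
 next
  case (Cons p w)
  have p: "snd p \<in> carrier (B (fst p))" "w \<in> words B" "wdeg bs = wdeg w + fst p" using bs Cons by auto
  note sp = splitsD[OF _ p(2)]
  have C1: "?C (p # a) b \<in> carrier (M n)" "?C b (p # a) \<in> carrier (M n)" "?C a (p # b) \<in> carrier (M n)" "?C (p # b) a \<in> carrier (M n)"
   if "splits w a b" for a b
  proof -
   have s: "splits bs (p # a) b" "splits bs a (p # b)" using that Cons by simp_all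
   show "?C (p # a) b \<in> carrier (M n)" "?C b (p # a) \<in> carrier (M n)" "?C a (p # b) \<in> carrier (M n)" "?C (p # b) a \<in> carrier (M n)"
    using Cc[OF s(1)] Cc[OF splits_comm[OF s(1)]] Cc[OF s(2)] Cc[OF splits_comm[OF s(2)]] .
  qed
  let ?t = "%a b. wmul R ?U [(wdeg a + fst p, \<phi> (p # a))] (wdeg b) (?E b)"
  let ?h = "%y. cpt M M (wdeg bs + 2) (pr ?U (wdeg bs + 1) (QU R M q (wdeg bs) y)) ms"
  have e2: "wdeg bs + 2 = wdeg bs + 1 + 1" by simp
  have h: "lin (Sy ?U (wdeg bs)) (M n) ?h"
   unfolding e2 by (rule mlin_comp[OF proj1_QU_mlin[OF refl] Umod_component_mlin[OF M ms]]) (simp add: n)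
  have "?F (wdeg bs) (sm B bs) = ss (Sy ?U (wdeg bs)) w ?t"
   unfolding mexp_smon[OF B U \<phi> bs refl] unfolding p(3) unfolding Cons by (simp add: conv_def)
  then have "?h (?F (wdeg bs) (sm B bs)) = ?h (ss (Sy ?U (wdeg bs)) w ?t)" by simp
  also have "... = ss (M n) w (%a b. ?h (?t a b))"
   by (rule ssum_mlin[OF _ _ h])
    (use sp p phi_Cons_coder[OF p(1)] in \<open>auto intro!: wmul_closed[OF U] expF_closed[OF B U \<phi>]\<close>)
  \<comment> \<open>The factor with \<open>p # a\<close> is given. If the rest \<open>b\<close> is
    empty, the terms come from the differential, where \<open>q = aug q \<phi> []\<close>; otherwise
    they come from the bracket with \<open>\<phi> b\<close>.\<close>
  also have "... = ss (M n) w (%a b. \<ominus>[M n] (ks (wdeg a + fst p) \<odot>[M n] ?C b (p # a) \<oplus>[M n]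
    ks ((wdeg a + fst p + 1) * wdeg b) \<odot>[M n] ?C (p # a) b))"
  proof (intro ssum_cong refl)
   fix a b assume ab: "splits w a b"
   note ab' = sp[OF ab]
   let ?i = "wdeg a + fst p"
   have u: "\<phi> (p # a) \<in> coder M (?i + 1)" by (rule phi_Cons_coder[OF p(1) ab'(1)])
   have v: "pr ?U (wdeg bs + 1) (QU R M q (wdeg bs) (?t a b)) =
    QU_comp R M q ((?i, \<phi> (p # a)) # (if b = [] then [] else [(wdeg b, \<phi> b)]))"
    by (rule proj1_QU_wmul_expF[OF u ab'(2)]) (use p ab' in auto)
   show "?h (?t a b) = \<ominus>[M n] (ks ?i \<odot>[M n] ?C b (p # a) \<oplus>[M n]
    ks ((?i + 1) * wdeg b) \<odot>[M n] ?C (p # a) b)"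
   proof (cases "b = []")
    case True
    have e: "wdeg bs + 2 = ?i + 2" "n = wdeg ms + (?i + 2)" using True p ab' n by simp_all
    have "?C (p # a) b \<in> carrier (M n)" by (rule C1(1)[OF ab])
    then show ?thesis
     unfolding v using component_Ldiff[OF M q u ms e(2)] True e(1) M by (simp add: QU_comp_def ac_simps)
   next
    case False
    have b: "\<phi> b \<in> coder M (wdeg b + 1)" using ac[OF ab'(2)] False by simp
    have e: "wdeg bs + 2 = ?i + wdeg b + 2" "n = wdeg ms + (wdeg bs + 2)" using p ab' n by simp_all
    show ?thesis
     unfolding v using component_QU2[OF M q u b ms e] False by (simp add: add.commute[of "fst p" "wdeg a"])
   qed
  qed
  also have "... = \<ominus>[M n] ss (M n) w (%a b. ks (wdeg a + fst p) \<odot>[M n] ?C b (p # a) \<oplus>[M n]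
    ks ((wdeg a + fst p + 1) * wdeg b) \<odot>[M n] ?C (p # a) b)"
   by (rule ssum_mlin[OF _ _ mlin_neg_map, symmetric]) (use C1 M in auto)
  also have "ss (M n) w (%a b. ks (wdeg a + fst p) \<odot>[M n] ?C b (p # a) \<oplus>[M n]
    ks ((wdeg a + fst p + 1) * wdeg b) \<odot>[M n] ?C (p # a) b) =
   ss (M n) bs (%a b. ks ((wdeg a + 1) * wdeg b) \<odot>[M n] ?C a b)"
  proof -
   let ?H = "%a b. ks ((wdeg a + 1) * wdeg b) \<odot>[M n] ?C a b"
   \<comment> \<open>In this branch \<open>p\<close> lies in the second part. Interchanging the
     names of the parts gives the term with \<open>b\<close> first and \<open>p # a\<close>
     second.\<close>
   have "ss (M n) w (%a b. ks (fst p * wdeg a) \<odot>[M n] ?H a (p # b)) =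
    ss (M n) w (%a b. ks (wdeg a * wdeg b) \<odot>[M n] (ks (fst p * wdeg b) \<odot>[M n] ?H b (p # a)))"
    by (rule ssum_cocomm) (use C1 M in auto)
   also have "... = ss (M n) w (%a b. ks (wdeg a + fst p) \<odot>[M n] ?C b (p # a))"
   proof (intro ssum_cong refl)
    fix a b assume ab: "splits w a b"
    have "ks (wdeg a * wdeg b) \<odot>[M n] (ks (fst p * wdeg b) \<odot>[M n] ?H b (p # a)) =
     ks (wdeg a * wdeg b + (fst p * wdeg b + (wdeg b + 1) * wdeg (p # a))) \<odot>[M n] ?C b (p # a)"
     using C1[OF ab] M by (simp only: m_ksign_ksign gm ksign_closed m_smult)
    also have "... = ks (wdeg a + fst p) \<odot>[M n] ?C b (p # a)"
     by (rule ksmult_cong) (auto simp: algebra_simps)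
    finally show "ks (wdeg a * wdeg b) \<odot>[M n] (ks (fst p * wdeg b) \<odot>[M n] ?H b (p # a)) =
     ks (wdeg a + fst p) \<odot>[M n] ?C b (p # a)" .
   qed
   finally have "ss (M n) bs ?H = ss (M n) w (%a b. ?H (p # a) b) \<oplus>[M n]
     ss (M n) w (%a b. ks (wdeg a + fst p) \<odot>[M n] ?C b (p # a))"
    unfolding Cons ssum.simps by (simp only:)
   also have "... = ss (M n) w (%a b. ?H (p # a) b \<oplus>[M n] ks (wdeg a + fst p) \<odot>[M n] ?C b (p # a))"
    by (rule ssum_add[symmetric]) (use C1 M in auto)
   also have "... = ss (M n) w (%a b. ks (wdeg a + fst p) \<odot>[M n] ?C b (p # a) \<oplus>[M n]
     ks ((wdeg a + fst p + 1) * wdeg b) \<odot>[M n] ?C (p # a) b)"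
   proof (intro ssum_cong refl)
    fix a b assume ab: "splits w a b"
    have "?H (p # a) b = ks ((wdeg a + fst p + 1) * wdeg b) \<odot>[M n] ?C (p # a) b"
     by (rule ksmult_cong) (auto simp: algebra_simps)
    then show "?H (p # a) b \<oplus>[M n] ks (wdeg a + fst p) \<odot>[M n] ?C b (p # a) =
     ks (wdeg a + fst p) \<odot>[M n] ?C b (p # a) \<oplus>[M n] ks ((wdeg a + fst p + 1) * wdeg b) \<odot>[M n] ?C (p # a) b"
     using madd_comm[OF gm[OF M]] C1[OF ab] M by simp
   qed
   finally show ?thesis ..
  qed
  finally show ?thesis .
 qed
qed

end
end

end

section \<open>Vectorfields on B x M described by families\<close>

text \<open>The zero B-part is condition (iii) of a deformation; the value zero at the empty word
  expresses that the vectorfield vanishes on the fibre over the distinguished point.\<close>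

definition fam_rel :: "'k ring => ('k, 'm) gmod => ('k, 'b) gmod => ('k, 'b \<times> 'm) vfield => ('b word => ('k, 'm) vfield) => bool" where
 "fam_rel R M B Q \<phi> \<longleftrightarrow> symfun R B (Umod R M) \<phi> \<and> \<phi> [] = \<zero>[Umod R M 0] \<and> Q \<in> coderivations R (dsum B M) 1 \<and>
   (\<forall>w\<in>words (dsum B M). component R (dsum B M) (dsum B M) 1 Q w = (\<zero>[B (wdeg w + 1)], fam R M \<phi> w))"

context ground
begin

lemma symfun_sandwich:
 fixes W :: "('k, 'w) gmod"
 assumes c: "symf W P c" and uv: "u \<in> words W" "v \<in> words W"
 shows "symf W (%d. P (wdeg u + d + wdeg v)) (%w. c (u @ w @ v))"
proof (rule symfunI)
 show "c (u @ w @ v) \<in> carrier (P (wdeg u + wdeg w + wdeg v))" if "w \<in> words W" for w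
  by (rule symfun_closed[OF c]) (use that uv in auto)
 fix u' v' :: "'w word" and i and x assume *: "u' \<in> words W" "v' \<in> words W" "x \<in> carrier (W i)"
 have uv': "u @ u' \<in> words W" "v' @ v \<in> words W" using * uv by auto
 let ?d = "wdeg u + (wdeg u' + (i + wdeg v')) + wdeg v"
 show "c (u @ (u' @ (i, x \<oplus>[W i] y) # v') @ v) = c (u @ (u' @ (i, x) # v') @ v) \<oplus>[P ?d] c (u @ (u' @ (i, y) # v') @ v)"
  if "y \<in> carrier (W i)" for y
  using symfun_add[OF c uv' *(3) that, of ?d] by simp
 show "c (u @ (u' @ (i, a \<odot>[W i] x) # v') @ v) = a \<odot>[P ?d] c (u @ (u' @ (i, x) # v') @ v)"
  if "a \<in> carrier R" for a
  using symfun_smult[OF c uv' *(3) that, of ?d] by simp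
 show "c (u @ (u' @ (i, x) # (j, y) # v') @ v) =
   ks (i * j) \<odot>[P (wdeg u + (wdeg u' + (i + (j + wdeg v'))) + wdeg v)] c (u @ (u' @ (j, y) # (i, x) # v') @ v)"
  if "y \<in> carrier (W j)" for j y
  using symfun_swap[OF c uv' *(3) that, of "wdeg u + (wdeg u' + (i + (j + wdeg v'))) + wdeg v"] by simp
qed

context
 fixes M :: "('k, 'm) gmod"
 assumes M [simp]: "gr M"
begin

text \<open>Elements of U are coderivations and are compared by their components, so symmetry in
  \<open>bs\<close> of each component suffices.\<close>

lemma symfun_UmodI:
 fixes B :: "('k, 'b) gmod"
 assumes \<phi>: "!!bs. bs \<in> words B ==> \<phi> bs \<in> coder M (wdeg bs + 1)" and B: "gr B"
  and c: "!!ms. ms \<in> words M ==> symf B (%d. M (d + wdeg ms + 1)) (%bs. cpt M M (wdeg bs + 1) (\<phi> bs) ms)"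
 shows "symf B (Umod R M) \<phi>"
proof (rule symfunI)
 show "\<phi> bs \<in> carrier (Umod R M (wdeg bs))" if "bs \<in> words B" for bs
  using \<phi>[OF that] by simp
 have eqI: "s = t" if "s \<in> carrier (Umod R M d)" "t \<in> carrier (Umod R M d)"
  and "!!ms. ms \<in> words M ==> cpt M M (d + 1) s ms = cpt M M (d + 1) t ms" for s t d
  by (rule coder_eqI[OF M, of _ "d + 1"]) (use that in auto)
 fix u v i x assume *: "u \<in> words B" "v \<in> words B" "x \<in> carrier (B i)"
 let ?d = "wdeg u + (i + wdeg v)"
 have cl: "\<phi> (u @ (i, y) # v) \<in> carrier (Umod R M ?d)" if "y \<in> carrier (B i)" for y
  using \<phi>[of "u @ (i, y) # v"] * that by simp
 note h = Umod_component_mlin[OF M]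
 note mU = gm[OF gm_Umod[OF M]]
 have e: "?d + wdeg ms + 1 = wdeg ms + (?d + 1)" for ms :: "'m word" by simp
 show "\<phi> (u @ (i, x \<oplus>[B i] y) # v) = \<phi> (u @ (i, x) # v) \<oplus>[Umod R M ?d] \<phi> (u @ (i, y) # v)" if y: "y \<in> carrier (B i)" for y
 proof (rule eqI[OF cl m_add[OF mU cl[OF *(3)] cl[OF y]]])
  show "x \<oplus>[B i] y \<in> carrier (B i)" using B *(3) y by simp
  fix ms assume ms: "ms \<in> words M"
  have "cpt M M (?d + 1) (\<phi> (u @ (i, x) # v) \<oplus>[Umod R M ?d] \<phi> (u @ (i, y) # v)) ms =
    cpt M M (?d + 1) (\<phi> (u @ (i, x) # v)) ms \<oplus>[M (?d + wdeg ms + 1)] cpt M M (?d + 1) (\<phi> (u @ (i, y) # v)) ms"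
   by (rule mlin_add[OF h[OF ms e] cl[OF *(3)] cl[OF y]])
  then show "cpt M M (?d + 1) (\<phi> (u @ (i, x \<oplus>[B i] y) # v)) ms =
    cpt M M (?d + 1) (\<phi> (u @ (i, x) # v) \<oplus>[Umod R M ?d] \<phi> (u @ (i, y) # v)) ms"
   using symfun_add[OF c[OF ms] *(1,2,3) y refl] by simp
 qed
 show "\<phi> (u @ (i, a \<odot>[B i] x) # v) = a \<odot>[Umod R M ?d] \<phi> (u @ (i, x) # v)" if a: "a \<in> carrier R" for a
 proof (rule eqI[OF cl m_smult[OF mU a cl[OF *(3)]]])
  show "a \<odot>[B i] x \<in> carrier (B i)" using B *(3) a by simp
  fix ms assume ms: "ms \<in> words M"
  have "cpt M M (?d + 1) (a \<odot>[Umod R M ?d] \<phi> (u @ (i, x) # v)) ms =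
    a \<odot>[M (?d + wdeg ms + 1)] cpt M M (?d + 1) (\<phi> (u @ (i, x) # v)) ms"
   by (rule mlin_smult[OF h[OF ms e] a cl[OF *(3)]])
  then show "cpt M M (?d + 1) (\<phi> (u @ (i, a \<odot>[B i] x) # v)) ms =
    cpt M M (?d + 1) (a \<odot>[Umod R M ?d] \<phi> (u @ (i, x) # v)) ms"
   using symfun_smult[OF c[OF ms] *(1,2,3) a refl] by simp
 qed
 show "\<phi> (u @ (i, x) # (j, y) # v) = ks (i * j) \<odot>[Umod R M (wdeg u + (i + (j + wdeg v)))] \<phi> (u @ (j, y) # (i, x) # v)"
  if y: "y \<in> carrier (B j)" for j y
 proof -
  let ?d = "wdeg u + (i + (j + wdeg v))"
  have cl1: "\<phi> (u @ (i, x) # (j, y) # v) \<in> carrier (Umod R M ?d)"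
   using \<phi>[of "u @ (i, x) # (j, y) # v"] * y by simp
  have cl2: "\<phi> (u @ (j, y) # (i, x) # v) \<in> carrier (Umod R M ?d)"
   using \<phi>[of "u @ (j, y) # (i, x) # v"] * y by (simp add: add.left_commute)
  show ?thesis
  proof (rule eqI[OF cl1 m_smult[OF mU ksign_closed cl2]])
   fix ms assume ms: "ms \<in> words M"
   have e': "?d + wdeg ms + 1 = wdeg ms + (?d + 1)" by simp
   have "cpt M M (?d + 1) (ks (i * j) \<odot>[Umod R M ?d] \<phi> (u @ (j, y) # (i, x) # v)) ms =
     ks (i * j) \<odot>[M (?d + wdeg ms + 1)] cpt M M (?d + 1) (\<phi> (u @ (j, y) # (i, x) # v)) ms"
    by (rule mlin_smult[OF h[OF ms e'] ksign_closed cl2])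
   moreover have "wdeg (u @ (i, x) # (j, y) # v) = ?d" "wdeg (u @ (j, y) # (i, x) # v) = ?d" by simp_all
   ultimately show "cpt M M (?d + 1) (\<phi> (u @ (i, x) # (j, y) # v)) ms =
    cpt M M (?d + 1) (ks (i * j) \<odot>[Umod R M ?d] \<phi> (u @ (j, y) # (i, x) # v)) ms"
    using symfun_swap[OF c[OF ms] *(1,2,3) y refl] by (simp only:)
  qed
 qed
qed

context
 fixes B :: "('k, 'b) gmod"
 assumes B [simp]: "gr B"
begin

lemma fam_relI:
 assumes \<phi>: "symf B (Umod R M) \<phi>" and \<phi>0: "\<phi> [] = \<zero>[Umod R M 0]"
  and eq: "!!w. w \<in> words (dsum B M) ==> c w = (\<zero>[B (wdeg w + 1)], fam R M \<phi> w)"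
 shows "fam_rel R M B (vfield_of R (dsum B M) 1 c) \<phi>"
proof -
 have z: "symf (dsum B M) (%d. B (d + 1)) (%w. \<zero>[B (wdeg w + 1)])"
  by (rule symfun_zero) (rule gmI, simp)
 have s: "symf (dsum B M) (%d. dsum B M (d + 1)) c"
  by (rule symfun_cong[OF symfun_pair[OF B M z fam_symfun[OF M B \<phi>]] eq]) simp_all
 show ?thesis
  unfolding fam_rel_def
  using \<phi> \<phi>0 vfield_of_coder[OF gm_dsum[OF B M] s] component_vfield_of[OF gm_dsum[OF B M] s] eq by simp
qed

lemma prB_dg:
 assumes QB: "QB \<in> coder B 1" and Qt: "Qt \<in> coder (dsum B M) 1"
  and comp: "!!w. w \<in> words (dsum B M) ==> fst (cpt (dsum B M) (dsum B M) 1 Qt w) = cpt B B 1 QB (fst_word w)"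
  and x: "x \<in> carrier (Sy (dsum B M) d)"
 shows "prB R B M (d + 1) (Qt d x) = QB d (prB R B M d x)"
proof (rule dg_commute[OF gm_dsum[OF B M] B prB_smf[OF B M] Qt QB _ x])
 fix w assume w: "w \<in> words (dsum B M)"
 have "Qt (wdeg w) (sm (dsum B M) w) \<in> carrier (Sy (dsum B M) (wdeg w + 1))"
  using w by (intro coder_closed[OF gm_dsum[OF B M] Qt _ refl] smon_closed) auto
 then show "pr B (wdeg w + 1) (prB R B M (wdeg w + 1) (Qt (wdeg w) (sm (dsum B M) w))) =
  pr B (wdeg w + 1) (QB (wdeg w) (prB R B M (wdeg w) (sm (dsum B M) w)))"
  using comp[OF w] w by (simp add: proj1_prB component_def prB_smon)
qed

context
 fixes q :: "('k, 'm) vfield" and QB :: "('k, 'b) vfield"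
 assumes q [simp]: "q \<in> coder M 1" and QB [simp]: "QB \<in> coder B 1"
begin

lemma vfB_coder: "vfB R B M QB \<in> coder (dsum B M) 1"
 and component_vfB: "w \<in> words (dsum B M) ==>
  cpt (dsum B M) (dsum B M) 1 (vfB R B M QB) w = (cpt B B 1 QB (fst_word w), \<zero>[M (wdeg w + 1)])"
proof -
 have "symf (dsum B M) (%d. M (d + 1)) (%w. \<zero>[M (wdeg w + 1)])"
  by (rule symfun_zero) (rule gmI, simp)
 note s = symfun_pair[OF B M symfun_lmap[OF coder_component_symfun[OF B QB] dsum_mlin(1)[OF B M]] this]
 have eq: "vfB R B M QB = vfield_of R (dsum B M) 1 (%w. (cpt B B 1 QB (fst_word w), \<zero>[M (wdeg w + 1)]))"
  by (simp add: vfB_def lmap_def)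
 show "vfB R B M QB \<in> coder (dsum B M) 1"
  unfolding eq by (rule vfield_of_coder[OF gm_dsum[OF B M] s])
 show "w \<in> words (dsum B M) ==>
  cpt (dsum B M) (dsum B M) 1 (vfB R B M QB) w = (cpt B B 1 QB (fst_word w), \<zero>[M (wdeg w + 1)])"
  unfolding eq by (rule component_vfield_of[OF gm_dsum[OF B M] s])
qed

lemma vfM_coder: "vfM R B M q \<in> coder (dsum B M) 1"
 and component_vfM: "w \<in> words (dsum B M) ==>
  cpt (dsum B M) (dsum B M) 1 (vfM R B M q) w = (\<zero>[B (wdeg w + 1)], cpt M M 1 q (snd_word w))"
proof -
 have "symf (dsum B M) (%d. B (d + 1)) (%w. \<zero>[B (wdeg w + 1)])"
  by (rule symfun_zero) (rule gmI, simp)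
 note s = symfun_pair[OF B M this symfun_lmap[OF coder_component_symfun[OF M q] dsum_mlin(2)[OF B M]]]
 have eq: "vfM R B M q = vfield_of R (dsum B M) 1 (%w. (\<zero>[B (wdeg w + 1)], cpt M M 1 q (snd_word w)))"
  by (simp add: vfM_def lmap_def)
 show "vfM R B M q \<in> coder (dsum B M) 1"
  unfolding eq by (rule vfield_of_coder[OF gm_dsum[OF B M] s])
 show "w \<in> words (dsum B M) ==>
  cpt (dsum B M) (dsum B M) 1 (vfM R B M q) w = (\<zero>[B (wdeg w + 1)], cpt M M 1 q (snd_word w))"
  unfolding eq by (rule component_vfield_of[OF gm_dsum[OF B M] s])
qed

lemma total_vf_coder: "Q \<in> coder (dsum B M) 1 ==> total_vf R M q B QB Q \<in> coder (dsum B M) 1"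
 unfolding total_vf_def
 by (intro coder_add_closed[OF gm_dsum[OF B M]] vfB_coder vfM_coder)

lemma component_total_vf:
 assumes Q: "Q \<in> coder (dsum B M) 1" and w: "w \<in> words (dsum B M)"
 shows "cpt (dsum B M) (dsum B M) 1 (total_vf R M q B QB Q) w =
  (cpt B B 1 QB (fst_word w) \<oplus>[B (wdeg w + 1)] fst (cpt (dsum B M) (dsum B M) 1 Q w),
   cpt M M 1 q (snd_word w) \<oplus>[M (wdeg w + 1)] snd (cpt (dsum B M) (dsum B M) 1 Q w))"
proof -
 let ?X = "dsum B M"
 have X [simp]: "gr ?X" by simp
 note h = mlin_add[OF coder_component_mlin[OF X w refl]]
 have c: "vfM R B M q \<in> carrier (Coder R ?X 1)" "vfB R B M QB \<in> carrier (Coder R ?X 1)" "Q \<in> carrier (Coder R ?X 1)"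
  using vfM_coder vfB_coder Q X by simp_all
 have "cpt B B 1 QB (fst_word w) \<in> carrier (B (wdeg w + 1))"
  by (rule coder_component_closed[OF B QB]) (use w in auto)
 moreover have "cpt M M 1 q (snd_word w) \<in> carrier (M (wdeg w + 1))"
  by (rule coder_component_closed[OF M q]) (use w in auto)
 ultimately show ?thesis
  unfolding total_vf_def h[OF m_add[OF gm[OF gm_Coder[OF X]] c(1,2)] c(3)] h[OF c(1,2)] component_vfB[OF w] component_vfM[OF w]
  by simp
qed

text \<open>It suffices to look at sorted words. If a letter comes from B, the vectorfield of M sees
  a zero letter and vanishes; if none does, the family is at the empty word and contributes zero, so
  the value there is that of \<open>q\<close>.\<close>

lemma component_total_fam:
 assumes r: "fam_rel R M B Q \<phi>" and w: "w \<in> words (dsum B M)"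
 shows "cpt (dsum B M) (dsum B M) 1 (total_vf R M q B QB Q) w =
  (cpt B B 1 QB (fst_word w), fam R M (aug q \<phi>) w)"
proof -
 have \<phi>: "symf B (Umod R M) \<phi>" and \<phi>0: "\<phi> [] = \<zero>[Umod R M 0]" and Q: "Q \<in> coder (dsum B M) 1"
  using r by (auto simp: fam_rel_def)
 have a\<phi>: "symf B (Umod R M) (aug q \<phi>)" by (rule symfun_aug[OF \<phi>]) simp
 note fs = fam_symfun[OF M B \<phi>]
 note qs = symfun_lmap[OF coder_component_symfun[OF M q] dsum_mlin(2)[OF B M]]
 have "cpt M M 1 q (snd_word w) \<oplus>[M (wdeg w + 1)] fam R M \<phi> w = fam R M (aug q \<phi>) w"
 proof (rule symfun_dsum_eqI[OF B M _ fam_symfun[OF M B a\<phi>] _ _ w])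
  show "symf (dsum B M) (%d. M (d + 1)) (%w. cpt M M 1 q (snd_word w) \<oplus>[M (wdeg w + 1)] fam R M \<phi> w)"
   by (rule symfun_plus[OF qs fs]) simp
  show "gr (%d. M (d + 1))" by (rule gmI) simp
  fix bs ms assume bs: "bs \<in> words B" and ms: "ms \<in> words M"
  let ?w = "inl_word M bs @ inr_word B ms"
  have fc: "cpt M M (wdeg bs + 1) (\<phi> bs) ms \<in> carrier (M (wdeg ?w + 1))"
   by (rule fam_component_closed[OF M B \<phi> bs ms]) simp
  show "cpt M M 1 q (snd_word ?w) \<oplus>[M (wdeg ?w + 1)] fam R M \<phi> ?w = fam R M (aug q \<phi>) ?w"
  proof (cases "bs = []")
   case True
   have "cpt M M 1 \<zero>[Umod R M 0] ms = \<zero>[M (wdeg ms + 1)]"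
    using mlin_zero[OF gm[OF gm_Umod[OF M]] gm[OF M] Umod_component_mlin[OF M ms, of "wdeg ms + 1" 0]] by simp
   moreover have "cpt M M 1 q ms \<in> carrier (M (wdeg ms + 1))"
    by (rule coder_component_closed[OF M q ms]) simp
   ultimately show ?thesis
    using True \<phi>0 ms fam_sorted[OF M B \<phi> bs ms] fam_sorted[OF M B a\<phi> bs ms] M by simp
  next
   case False
   have "cpt M M 1 q ([] @ zero_word M bs @ ms) = \<zero>[M (wdeg bs + wdeg ms + 1)]"
    by (rule symfun_zero_word[OF M coder_component_symfun[OF M q] _ False]) (use ms M in auto)
   then show ?thesis
    using False fam_sorted[OF M B \<phi> bs ms] fam_sorted[OF M B a\<phi> bs ms] fc M by simp
  qed
 qed
 moreover have "cpt B B 1 QB (fst_word w) \<in> carrier (B (wdeg w + 1))"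
  by (rule coder_component_closed[OF B QB]) (use w in auto)
 ultimately show ?thesis
  using component_total_vf[OF Q w] r w B by (simp add: fam_rel_def)
qed

text \<open>Neither \<open>QB\<close> nor \<open>QU\<close> is assumed to square to zero. The lemma
  is therefore available for B = U, where it yields the M-part of the square before the structure
  equation on U is known.\<close>

lemma mc_iff:
 assumes dg: "dg_structure R M q" and \<phi>: "symf B (Umod R M) \<phi>" and Qt: "Qt \<in> coder (dsum B M) 1"
  and comp: "!!w. w \<in> words (dsum B M) ==>
   cpt (dsum B M) (dsum B M) 1 Qt w = (cpt B B 1 QB (fst_word w), fam R M (aug q \<phi>) w)"
 shows "(\<forall>w\<in>words (dsum B M). snd (pr (dsum B M) (wdeg w + 2) (Qt (wdeg w + 1) (Qt (wdeg w) (sm (dsum B M) w)))) =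
   \<zero>[M (wdeg w + 2)]) \<longleftrightarrow>
  (\<forall>d. \<forall>x\<in>carrier (Sy B d). mexp R B (Umod R M) \<phi> (d + 1) (QB d x) = QU R M q d (mexp R B (Umod R M) \<phi> d x))"
  (is "?L \<longleftrightarrow> ?R")
proof -
 let ?X = "dsum B M" and ?U = "Umod R M" and ?F = "mexp R B (Umod R M) \<phi>"
 have X [simp]: "gr ?X" and U [simp]: "gr ?U" by simp_all
 have a\<phi>: "symf B ?U (aug q \<phi>)" by (rule symfun_aug[OF \<phi>]) simp
 note F = mexp_smf(1)[OF B U \<phi>]
 define l where "l = (%bs. pr ?U (wdeg bs + 1) (?F (wdeg bs + 1) (QB (wdeg bs) (sm B bs))))"
 define r where "r = (%bs. pr ?U (wdeg bs + 1) (QU R M q (wdeg bs) (?F (wdeg bs) (sm B bs))))"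
 have l: "l bs \<in> coder M (wdeg bs + 2)" if "bs \<in> words B" for bs
  using mlin_closed[OF proj1_lift(1)[OF U] smf_closed[OF B U F coder_closed[OF B QB smon_closed[OF B that refl] refl]]]
  by (simp add: l_def add.assoc)
 have r: "r bs \<in> coder M (wdeg bs + 2)" if "bs \<in> words B" for bs
  using mlin_closed[OF proj1_lift(1)[OF U] coder_closed[OF U QU_coder[OF M q] smf_closed[OF B U F smon_closed[OF B that refl]] refl]]
  by (simp add: r_def add.assoc)
 \<comment> \<open>\<open>?A\<close> is what the B-part of the first application contributes to the
   square, \<open>?C\<close> what its M-part contributes. For the morphism, the side with
   \<open>QB\<close> is the sum over \<open>?A\<close> and the side with \<open>QU\<close> is minus
   the sum over \<open>?C\<close>.\<close>
 have key: "snd (pr ?X (wdeg bs + wdeg ms + 2) (Qt (wdeg bs + wdeg ms + 1) (Qt (wdeg bs + wdeg ms) (sm ?X (inl_word M bs @ inr_word B ms))))) = \<zero>[M (wdeg bs + wdeg ms + 2)]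
  \<longleftrightarrow> cpt M M (wdeg bs + 2) (l bs) ms = cpt M M (wdeg bs + 2) (r bs) ms"
  if bs: "bs \<in> words B" and ms: "ms \<in> words M" for bs ms
 proof -
  define n where "n = wdeg bs + wdeg ms + 2"
  have n': "n = wdeg bs + wdeg ms + 1 + 1" by (simp add: n_def)
  let ?A = "%a b. cpt M M (wdeg a + 1 + wdeg b + 1) (aug q \<phi> ((wdeg a + 1, cpt B B 1 QB a) # b)) ms"
  let ?C = "%a b. ks ((wdeg a + 1) * wdeg b) \<odot>[M n]
   pr M n (aug q \<phi> b (wdeg ms + (wdeg a + 1)) (aug q \<phi> a (wdeg ms) (sm M ms)))"
  note sp = splitsD[OF _ bs]
  note ac = fam_coder[OF M B a\<phi>]
  have Ac: "?A a b \<in> carrier (M n)" if "splits bs a b" for a b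
   using fam_component_closed[OF M B a\<phi> _ ms, of "(wdeg a + 1, cpt B B 1 QB a) # b" n]
    coder_component_closed[OF B QB sp(1)[OF that] refl] sp[OF that] by (simp add: n_def)
  have Cc: "?C a b \<in> carrier (M n)" if "splits bs a b" for a b
   by (rule m_smult[OF gm[OF M] ksign_closed], rule mlin_closed[OF proj1_lift(1)[OF M]],
    rule coder_comp_closed[OF M ac ac smon_closed[OF M ms refl]]) (use sp[OF that] n_def in auto)
  have "snd (pr ?X n (Qt (wdeg bs + wdeg ms + 1) (Qt (wdeg bs + wdeg ms) (sm ?X (inl_word M bs @ inr_word B ms))))) =
   ss (M n) bs (%a b. ?A a b \<oplus>[M n] ?C a b)"
   by (rule fam_vfield_comp[OF M B a\<phi> Qt QB _ ac _ Qt _ bs ms refl n'])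
    (use comp fam_sorted[OF M B a\<phi>] M B in auto)
  also have "... = ss (M n) bs ?A \<oplus>[M n] ss (M n) bs ?C"
   by (rule ssum_add) (use Ac Cc in auto)
  finally have v: "snd (pr ?X n (Qt (wdeg bs + wdeg ms + 1) (Qt (wdeg bs + wdeg ms) (sm ?X (inl_word M bs @ inr_word B ms))))) =
   ss (M n) bs ?A \<oplus>[M n] ss (M n) bs ?C" .
  have lv: "cpt M M (wdeg bs + 2) (l bs) ms = ss (M n) bs ?A"
   unfolding l_def by (rule component_mexp_vfield[OF M q B \<phi> QB bs ms n_def])
  have rv: "cpt M M (wdeg bs + 2) (r bs) ms = \<ominus>[M n] ss (M n) bs ?C"
   unfolding r_def by (rule component_QU_mexp[OF M q B \<phi> dg bs ms n_def])
  have S: "ss (M n) bs ?A \<in> carrier (M n)" "ss (M n) bs ?C \<in> carrier (M n)"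
   using Ac Cc by (auto intro!: ssum_closed)
  have "ss (M n) bs ?A \<oplus>[M n] ss (M n) bs ?C = \<zero>[M n] \<longleftrightarrow> ss (M n) bs ?A = \<ominus>[M n] ss (M n) bs ?C"
   using m_minus_zero_iff[OF gm[OF M] S(1) m_neg[OF gm[OF M] S(2)]] S M by (simp add: m_minus_eq)
  then show ?thesis unfolding n_def[symmetric] v lv rv .
 qed
 have lr: "l bs = r bs \<longleftrightarrow> (\<forall>ms\<in>words M. cpt M M (wdeg bs + 2) (l bs) ms = cpt M M (wdeg bs + 2) (r bs) ms)"
  if "bs \<in> words B" for bs
  using coder_eqI[OF M l[OF that] r[OF that]] by auto
 have R_iff: "?R \<longleftrightarrow> (\<forall>bs\<in>words B. l bs = r bs)"
 proof
  assume ?R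
  then show "\<forall>bs\<in>words B. l bs = r bs" by (auto simp: l_def r_def smon_closed)
 next
  assume "\<forall>bs\<in>words B. l bs = r bs"
  then show ?R
   using dg_commute[OF B U F QB QU_coder[OF M q]] by (auto simp: l_def r_def)
 qed
 show ?thesis
  unfolding R_iff
 proof
  assume L: ?L
  show "\<forall>bs\<in>words B. l bs = r bs"
  proof
   fix bs assume bs: "bs \<in> words B"
   show "l bs = r bs"
    unfolding lr[OF bs]
   proof
    fix ms assume ms: "ms \<in> words M"
    have "inl_word M bs @ inr_word B ms \<in> words ?X" using bs ms M B by simp
    from L[rule_format, OF this] key[OF bs ms]
    show "cpt M M (wdeg bs + 2) (l bs) ms = cpt M M (wdeg bs + 2) (r bs) ms" by simp
   qed
  qed
 next
  assume lr': "\<forall>bs\<in>words B. l bs = r bs"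
  \<comment> \<open>As a symmetric function of the word, the M-part of the square is determined by
    its values on sorted words.\<close>
  let ?h = "%d x. snd (pr ?X (d + 2) (Qt (d + 1) (Qt d x)))"
  have h: "lin (Sy ?X d) (M (d + 2)) (?h d)" for d
   by (rule mlin_comp[OF mlin_comp[OF mlin_comp[OF coder_mlin[OF X Qt refl] coder_mlin[OF X Qt]] proj1_lift(1)[OF X]] dsum_mlin(2)[OF B M]]) simp
  have P: "gr (%d. M (d + 2))" by (rule gmI) simp
  show ?L
  proof
   fix w assume w: "w \<in> words ?X"
   show "?h (wdeg w) (sm ?X w) = \<zero>[M (wdeg w + 2)]"
   proof (rule symfun_dsum_eqI[OF B M symfun_mlin[OF smon_symfun[OF X] h gm[OF gm_Sym[OF X]] X] symfun_zero[OF P] P _ w])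
    fix bs ms assume bs: "bs \<in> words B" and ms: "ms \<in> words M"
    show "?h (wdeg (inl_word M bs @ inr_word B ms)) (sm ?X (inl_word M bs @ inr_word B ms)) =
      \<zero>[M (wdeg (inl_word M bs @ inr_word B ms) + 2)]"
     using key[OF bs ms] lr' bs by simp
   qed
  qed
 qed
qed

end

end

end

end

section \<open>The canonical vectorfield and the structure equation on U\<close>

lemma splits_nth: "p < length w ==> splits w [w ! p] (take p w @ drop (Suc p) w)"
 using arg_cong[OF id_take_nth_drop, of p w mset] by (simp add: splits_def)

context ground
begin

text \<open>A function that needs exactly one letter on the left leaves one splitting for each
  position; the sign is that of moving the letter to the front, as in
  \<open>Qcan_comp\<close>.\<close>

lemma ssum_letters:
 fixes P :: "('k, 'p) module"
 assumes P: "module R P" and "!!a b. splits w a b ==> G a b \<in> carrier P" "!!a b. splits w a b ==> length a \<noteq> 1 ==> G a b = \<zero>[P]"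
 shows "ss P w G = finsum P (%p. ks (fst (w ! p) * wdeg (take p w)) \<odot>[P] G [w ! p] (take p w @ drop (Suc p) w)) {..<length w}"
 using assms(2,3)
proof (induction w arbitrary: G)
 case Nil
 then show ?case using P by (simp add: lessThan_0)
next
 case (Cons x w)
 let ?G = "%a b. ks (fst x * wdeg a) \<odot>[P] G a (x # b)"
 let ?T = "%p. ks (fst ((x # w) ! p) * wdeg (take p (x # w))) \<odot>[P] G [(x # w) ! p] (take p (x # w) @ drop (Suc p) (x # w))"
 have c: "G [w ! p] (x # take p w @ drop (Suc p) w) \<in> carrier P" if "p < length w" for p
  by (rule Cons.prems(1)) (use splits_nth[OF that] in simp)
 have c0: "G [x] w \<in> carrier P" by (rule Cons.prems(1)) simp
 have Tc: "?T p \<in> carrier P" if "p < length (x # w)" for p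
  using that c c0 P by (cases p) auto
 have 1: "ss P w (%a b. G (x # a) b) = G [x] w"
  by (rule ssum_right) (use Cons.prems c0 P in auto)
 have z: "?G a b = \<zero>[P]" if "splits w a b" "length a \<noteq> 1" for a b
  using Cons.prems(2)[of a "x # b"] that P by simp
 have 2: "ss P w ?G = finsum P (%p. ?T (Suc p)) {..<length w}"
 proof (subst Cons.IH)
  show "finsum P (%p. ks (fst (w ! p) * wdeg (take p w)) \<odot>[P] ?G [w ! p] (take p w @ drop (Suc p) w)) {..<length w} =
   finsum P (%p. ?T (Suc p)) {..<length w}"
  proof (rule m_finsum_cong[OF P refl])
   fix p assume p: "p \<in> {..<length w}"
   then have cp: "G [w ! p] (x # take p w @ drop (Suc p) w) \<in> carrier P" using c by simp
   have e: "fst (w ! p) * wdeg (take p w) + fst x * wdeg [w ! p] = fst ((x # w) ! Suc p) * wdeg (take (Suc p) (x # w))"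
    by (simp add: algebra_simps)
   show "ks (fst (w ! p) * wdeg (take p w)) \<odot>[P] ?G [w ! p] (take p w @ drop (Suc p) w) = ?T (Suc p)"
    unfolding m_ksign_ksign[OF P cp] e by simp
   show "?T (Suc p) \<in> carrier P" by (rule Tc) (use p in simp)
  qed
 qed (use Cons.prems(1) z P in auto)
 have "finsum P ?T {..<length (x # w)} = finsum P ?T (insert 0 (Suc ` {..<length w}))"
  by (simp only: length_Cons lessThan_Suc_eq_insert_0)
 also have "... = ?T 0 \<oplus>[P] finsum P ?T (Suc ` {..<length w})"
  by (rule m_finsum_insert[OF P]) (use Tc in auto)
 also have "finsum P ?T (Suc ` {..<length w}) = finsum P (%p. ?T (Suc p)) {..<length w}"
 proof (rule m_finsum_reindex[OF P])
  show "?T (Suc p) \<in> carrier P" if "p \<in> {..<length w}" for p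
   by (rule Tc) (use that in simp)
 qed simp
 also have "?T 0 = G [x] w" using c0 P by simp
 finally show ?case by (simp add: 1 2)
qed

text \<open>The identity is a strict morphism, and its components are the projection to the
  generators.\<close>

lemma mexp_proj1:
 fixes W :: "('k, 'w) gmod"
 assumes W [simp]: "gr W" and x: "x \<in> carrier (Sy W d)"
 shows "mexp R W W (%w. pr W (wdeg w) (sm W w)) d x = x"
proof -
 let ?f = "%w. pr W (wdeg w) (sm W w)" and ?i = "strict_morphism R W W (%i y. y)"
 have f: "symf W W ?f"
  by (rule symfun_mlin[OF smon_symfun proj1_lift(1)]) simp_all
 note i = strict_smf[OF W W mlin_id]
 have v: "?i d (sm W w) = sm W w" if "w \<in> words W" "wdeg w = d" for w d
  using i(2)[OF that(1) that(2)[symmetric]] by (simp add: case_prod_eta[of Pair, simplified])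
 have "mexp R W W ?f = ?i"
 proof (rule smf_eqI[OF W W mexp_smf(1)[OF W W f] i(1)])
  fix w assume w: "w \<in> words W" "w \<noteq> []"
  show "cpt W W 0 (mexp R W W ?f) w = cpt W W 0 ?i w"
   unfolding component_mexp[OF W W f w] by (simp add: component_def v w)
 qed
 moreover have "?i d x = x"
  by (rule sym_ext[OF W _ smf_mlin[OF W W i(1)] mlin_id _ x]) (use v in auto)
 ultimately show ?thesis by simp
qed

context
 fixes M :: "('k, 'm) gmod" and q :: "('k, 'm) vfield"
 assumes M [simp]: "gr M" and dg: "dg_structure R M q"
begin

lemma q_coder [simp]: "q \<in> coder M 1"
 using dg by (simp add: dg_structure_def)

lemma zero_Umod_component: "ms \<in> words M ==> d = wdeg ms + (i + 1) ==> k = i + 1 ==> cpt M M k \<zero>[Umod R M i] ms = \<zero>[M d]"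
 using mlin_zero[OF gm[OF gm_Umod[OF M]] gm[OF M] Umod_component_mlin[OF M]] by blast

text \<open>\<open>can_fam\<close> vanishes unless the word has exactly one letter, so the
  functional of the family becomes a sum over positions by \<open>ssum_letters\<close>.\<close>

lemma fam_rel_Qcan: "fam_rel R M (Umod R M) (Qcan R M) (can_fam R M)"
 unfolding Qcan_def
proof (rule fam_relI[OF M gm_Umod[OF M] can_fam_symfun[OF M]])
 let ?U = "Umod R M"
 have U [simp]: "gr ?U" by simp
 show "can_fam R M [] = \<zero>[?U 0]"
  using proj1_lift(2)[OF U, of "[]" 0] by (simp add: can_fam_def)
 fix w assume w: "w \<in> words (dsum ?U M)"
 let ?G = "%a b. cpt M M (wdeg a + 1) (can_fam R M (fst_word a)) (snd_word b)"
 have "fam R M (can_fam R M) w = finsum (M (wdeg w + 1))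
   (%p. ks (fst (w ! p) * wdeg (take p w)) \<odot>[M (wdeg w + 1)] ?G [w ! p] (take p w @ drop (Suc p) w)) {..<length w}"
  unfolding fam_def
 proof (rule ssum_letters)
  fix a b assume s: "splits w a b"
  then have ab: "a \<in> words (dsum ?U M)" "b \<in> words (dsum ?U M)" "wdeg w = wdeg a + wdeg b"
   using w by (auto simp: splits_words splits_wdeg)
  show "?G a b \<in> carrier (M (wdeg w + 1))"
   using fam_component_closed[OF M U can_fam_symfun[OF M], of "fst_word a" "snd_word b"] ab by simp
  show "?G a b = \<zero>[M (wdeg w + 1)]" if "length a \<noteq> 1"
  proof -
   have "can_fam R M (fst_word a) = \<zero>[?U (wdeg a)]"
    using proj1_lift(2)[OF U, of "fst_word a" "wdeg a"] ab that by (simp add: can_fam_def)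
   then show ?thesis using zero_Umod_component[of "snd_word b" "wdeg w + 1" "wdeg a"] ab by simp
  qed
 qed simp
 also have "... = snd (Qcan_comp R M w)"
  unfolding Qcan_comp_def snd_conv
 proof (rule m_finsum_cong[OF gm[OF M] refl])
  fix p assume p: "p \<in> {..<length w}"
  then have wp: "snd (w ! p) \<in> carrier (dsum ?U M (fst (w ! p)))"
   using w nth_mem[of p w] by (auto simp: words_def case_prod_unfold simp del: dsum_simps)
  then have u: "fst (snd (w ! p)) \<in> coder M (fst (w ! p) + 1)" using M by (simp add: mem_Times_iff)
  show "ks (fst (w ! p) * wdeg (take p w)) \<odot>[M (wdeg w + 1)] ?G [w ! p] (take p w @ drop (Suc p) w) =
    ks (fst (w ! p) * wdeg (take p w)) \<odot>[M (wdeg w + 1)]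
     cpt M M (fst (w ! p) + 1) (fst (snd (w ! p))) (map (%(i, x). (i, snd x)) (take p w @ drop (Suc p) w))"
   using can_fam_letter[OF M u] by (simp add: lmap_def split_beta)
  have s: "splits w [w ! p] (take p w @ drop (Suc p) w)" by (rule splits_nth) (use p in simp)
  have *: "take p w @ drop (Suc p) w \<in> words (dsum ?U M)" "wdeg w = fst (w ! p) + wdeg (take p w @ drop (Suc p) w)"
   using w splits_words[OF s, of "dsum ?U M"] splits_wdeg[OF s] by simp_all
  have "cpt M M (fst (w ! p) + 1) (fst (snd (w ! p))) (snd_word (take p w @ drop (Suc p) w)) \<in> carrier (M (wdeg w + 1))"
   by (rule coder_component_closed[OF M u dsum_words_proj(2)[OF *(1)]]) (use *(2) in simp)
  then show "ks (fst (w ! p) * wdeg (take p w)) \<odot>[M (wdeg w + 1)]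
     cpt M M (fst (w ! p) + 1) (fst (snd (w ! p))) (map (%(i, x). (i, snd x)) (take p w @ drop (Suc p) w)) \<in> carrier (M (wdeg w + 1))"
   using M by (simp add: lmap_def)
 qed
 finally show "Qcan_comp R M w = (\<zero>[?U (wdeg w + 1)], fam R M (can_fam R M) w)"
  by (simp add: Qcan_comp_def)
qed

text \<open>Let \<open>Q\<close> be the total vectorfield on U x M and \<open>D\<close> its bracket.
  By \<open>mc_iff\<close> the M-part of \<open>D\<close> vanishes; its U-part is \<open>D'\<close>,
  the bracket of \<open>QU\<close>. The M-part of \<open>Q\<close> after \<open>D\<close> on
  \<open>bs\<close> and \<open>ms\<close> is, by \<open>fam_vfield_comp\<close>, the coderivation
  given by the component of \<open>D'\<close> at \<open>bs\<close>, taken at \<open>ms\<close>. It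
  is also twice the M-part of the cube of \<open>Q\<close>, which is zero.\<close>

lemma QU_dg: "dg_structure R (Umod R M) (QU R M q)"
proof -
 let ?U = "Umod R M" and ?X = "dsum (Umod R M) M"
 have U [simp]: "gr ?U" by simp
 have X [simp]: "gr ?X" by simp
 let ?P = "QU R M q"
 have P: "?P \<in> coder ?U 1" by (rule QU_coder[OF M q_coder])
 let ?c = "can_fam R M"
 note c = can_fam_symfun[OF M]
 have ac: "symf ?U ?U (aug q ?c)" by (rule symfun_aug[OF c]) simp
 define Q where "Q = total_vf R M q ?U ?P (Qcan R M)"
 have Q: "Q \<in> coder ?X 1"
  unfolding Q_def by (rule total_vf_coder[OF M U q_coder P]) (use fam_rel_Qcan in \<open>simp add: fam_rel_def\<close>)
 have comp: "cpt ?X ?X 1 Q w = (cpt ?U ?U 1 ?P (fst_word w), fam R M (aug q ?c) w)" if "w \<in> words ?X" for w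
  unfolding Q_def by (rule component_total_fam[OF M U q_coder P fam_rel_Qcan that])
 have id: "mexp R ?U ?U ?c d x = x" if "x \<in> carrier (Sy ?U d)" for d x
  using mexp_proj1[OF U that] by (simp add: can_fam_def[abs_def])
 have "\<forall>d. \<forall>x\<in>carrier (Sy ?U d). mexp R ?U ?U ?c (d + 1) (?P d x) = ?P d (mexp R ?U ?U ?c d x)"
  using coder_closed[OF U P _ refl] by (simp add: id)
 then have sq: "\<forall>w\<in>words ?X. snd (pr ?X (wdeg w + 2) (Q (wdeg w + 1) (Q (wdeg w) (sm ?X w)))) = \<zero>[M (wdeg w + 2)]"
  using mc_iff[OF M U q_coder P dg c Q comp] by blast
 have QQ: "Q (d + 1) (Q d x) \<in> carrier (Sy ?X (d + 2))" if "x \<in> carrier (Sy ?X d)" for d x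
  using coder_closed[OF X Q coder_closed[OF X Q that refl], of "d + 2"] by simp
 have sq': "snd (pr ?X (d + 2) (Q (d + 1) (Q d x))) = \<zero>[M (d + 2)]" if x: "x \<in> carrier (Sy ?X d)" for d x
 proof (rule sym_ext[OF X _ _ mlin_zero_map _ x])
  show "lin (Sy ?X d) (M (d + 2)) (%x. snd (pr ?X (d + 2) (Q (d + 1) (Q d x))))"
   by (rule mlin_comp[OF mlin_comp[OF mlin_comp[OF coder_mlin[OF X Q refl] coder_mlin[OF X Q]] proj1_lift(1)[OF X]] dsum_mlin(2)[OF U M]]) simp
 qed (use sq M in auto)
 have pB: "prB R ?U M (d + 1) (Q d x) = ?P d (prB R ?U M d x)" if "x \<in> carrier (Sy ?X d)" for d x
  by (rule prB_dg[OF M U P Q _ that]) (simp add: comp)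
 define D where "D = bracket R ?X 1 1 Q Q"
 define D' where "D' = bracket R ?U 1 1 ?P ?P"
 have D: "D \<in> coder ?X 2" and D': "D' \<in> coder ?U 2"
  unfolding D_def D'_def using bracket_closed[OF X Q Q] bracket_closed[OF U P P] by auto
 have Dx: "D d x = Q (d + 1) (Q d x) \<oplus>[Sy ?X (d + 2)] Q (d + 1) (Q d x)" if "x \<in> carrier (Sy ?X d)" for d x
  unfolding D_def by (rule bracket_self[OF X Q that])
 have D'x: "D' d x = ?P (d + 1) (?P d x) \<oplus>[Sy ?U (d + 2)] ?P (d + 1) (?P d x)" if "x \<in> carrier (Sy ?U d)" for d x
  unfolding D'_def by (rule bracket_self[OF U P that])
 have pQQ: "prB R ?U M (d + 2) (Q (d + 1) (Q d x)) = ?P (d + 1) (?P d (prB R ?U M d x))" if x: "x \<in> carrier (Sy ?X d)" for d x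
  using pB[OF coder_closed[OF X Q x refl]] pB[OF x] by (simp add: add.assoc)
 have Dcomp: "cpt ?X ?X 2 D w = (cpt ?U ?U 2 D' (fst_word w), \<zero>[M (wdeg w + 2)])" if w: "w \<in> words ?X" for w
 proof -
  have x: "sm ?X w \<in> carrier (Sy ?X (wdeg w))" using w by (simp add: smon_closed)
  let ?y = "Q (wdeg w + 1) (Q (wdeg w) (sm ?X w))"
  note y = QQ[OF x]
  have Dy: "D (wdeg w) (sm ?X w) \<in> carrier (Sy ?X (wdeg w + 2))" by (rule coder_closed[OF X D x refl])
  have "fst (cpt ?X ?X 2 D w) = pr ?U (wdeg w + 2) (prB R ?U M (wdeg w + 2) (D (wdeg w) (sm ?X w)))"
   using proj1_prB[OF U M Dy] by (simp add: component_def)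
  also have "prB R ?U M (wdeg w + 2) (D (wdeg w) (sm ?X w)) = D' (wdeg w) (prB R ?U M (wdeg w) (sm ?X w))"
   unfolding Dx[OF x] D'x[OF smf_closed[OF X U prB_smf[OF U M] x]] mlin_add[OF smf_mlin[OF X U prB_smf[OF U M]] y y] pQQ[OF x] ..
  also have "prB R ?U M (wdeg w) (sm ?X w) = sm ?U (fst_word w)"
   by (rule prB_smon[OF U M w refl])
  finally have 1: "fst (cpt ?X ?X 2 D w) = cpt ?U ?U 2 D' (fst_word w)"
   by (simp add: component_def)
  have "snd (cpt ?X ?X 2 D w) = snd (pr ?X (wdeg w + 2) ?y \<oplus>[?X (wdeg w + 2)] pr ?X (wdeg w + 2) ?y)"
   unfolding component_def Dx[OF x] mlin_add[OF proj1_lift(1)[OF X] y y] ..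
  also have "... = \<zero>[M (wdeg w + 2)]" using sq'[OF x] M by simp
  finally show ?thesis using 1 by (simp add: prod_eq_iff)
 qed
 have zero: "cpt ?U ?U 2 D' bs = \<zero>[?U (wdeg bs + 2)]" if bs: "bs \<in> words ?U" for bs
 proof (rule coder_eqI[OF M])
  show "cpt ?U ?U 2 D' bs \<in> coder M (wdeg bs + 3)"
   using coder_component_closed[OF U D' bs refl] by (simp add: add.assoc)
  show "\<zero>[?U (wdeg bs + 2)] \<in> coder M (wdeg bs + 3)"
   using m_zero[OF gm[OF U, of "wdeg bs + 2"]] by (simp add: add.assoc)
  fix ms assume ms: "ms \<in> words M"
  define n where "n = wdeg bs + wdeg ms + 2 + 1"
  let ?w = "inl_word M bs @ inr_word ?U ms"
  \<comment> \<open>\<open>D\<close> has no M-part, so the coderivations to be used in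
    \<open>fam_vfield_comp\<close> are zero.\<close>
  let ?\<chi> = "%bs :: ('k, 'm) vfield word. \<zero>[Coder R M (wdeg bs + 2)]"
  have w: "?w \<in> words ?X" using bs ms U M by simp
  have x: "sm ?X ?w \<in> carrier (Sy ?X (wdeg bs + wdeg ms))" using w by (simp add: smon_closed)
  note sp = splitsD[OF _ bs]
  have \<chi>c: "?\<chi> a \<in> coder M (wdeg a + 2)" for a
   by (rule coder_zero_closed[OF M])
  let ?A = "%a b. cpt M M (wdeg a + 2 + wdeg b + 1) (aug q ?c ((wdeg a + 2, cpt ?U ?U 2 D' a) # b)) ms"
  let ?C = "%a b. ks ((wdeg a + 2) * wdeg b) \<odot>[M n]
   pr M n (aug q ?c b (wdeg ms + (wdeg a + 2)) (?\<chi> a (wdeg ms) (sm M ms)))"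
  have Ac: "?A a b \<in> carrier (M n)" if "splits bs a b" for a b
   using fam_component_closed[OF M U ac _ ms, of "(wdeg a + 2, cpt ?U ?U 2 D' a) # b" n]
    coder_component_closed[OF U D' sp(1)[OF that] refl] sp[OF that] by (simp add: n_def)
  \<comment> \<open>With a further letter in \<open>b\<close> the canonical family meets a word of
    length at least two and vanishes; only the value of \<open>D'\<close> on all of
    \<open>bs\<close> is left.\<close>
  have A0: "?A a b = \<zero>[M n]" if s: "splits bs a b" and b: "b \<noteq> []" for a b
  proof -
   have k: "wdeg a + 2 + wdeg b = wdeg bs + 2" using sp[OF s] by simp
   have l: "cpt ?U ?U 2 D' a \<in> carrier (?U (wdeg a + 2))" by (rule coder_component_closed[OF U D' sp(1)[OF s] refl])
   have "aug q ?c ((wdeg a + 2, cpt ?U ?U 2 D' a) # b) = \<zero>[?U (wdeg a + 2 + wdeg b)]"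
    using proj1_lift(2)[OF U, of "(wdeg a + 2, cpt ?U ?U 2 D' a) # b" "wdeg a + 2 + wdeg b"] l sp(1,2)[OF s] b
    by (simp add: can_fam_def)
   moreover have "cpt M M (wdeg bs + 2 + 1) \<zero>[?U (wdeg bs + 2)] ms = \<zero>[M n]"
    by (rule zero_Umod_component[OF ms]) (simp_all add: n_def)
   ultimately show ?thesis unfolding k by simp
  qed
  have C0: "?C a b = \<zero>[M n]" if s: "splits bs a b" for a b
  proof -
   let ?b = "aug q ?c b"
   have b: "?b \<in> coder M (wdeg b + 1)" by (rule fam_coder[OF M U ac sp(2)[OF s]])
   have e: "n = wdeg ms + (wdeg a + 2) + (wdeg b + 1)" using sp[OF s] by (simp add: n_def)
   have "?\<chi> a (wdeg ms) (sm M ms) = \<zero>[Sy M (wdeg ms + (wdeg a + 2))]"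
    using ms by (simp add: Coder_apply(3)[OF M] smon_closed)
   moreover have "?b (wdeg ms + (wdeg a + 2)) \<zero>[Sy M (wdeg ms + (wdeg a + 2))] = \<zero>[Sy M n]"
    by (rule mlin_zero[OF gm[OF gm_Sym[OF M]] gm[OF gm_Sym[OF M]] coder_mlin[OF M b e]])
   moreover have "pr M n \<zero>[Sy M n] = \<zero>[M n]"
    by (rule mlin_zero[OF gm[OF gm_Sym[OF M]] gm[OF M] proj1_lift(1)[OF M]])
   ultimately show ?thesis using M by simp
  qed
  have "snd (pr ?X n (Q (wdeg bs + wdeg ms + 2) (D (wdeg bs + wdeg ms) (sm ?X ?w)))) =
    ss (M n) bs (%a b. ?A a b \<oplus>[M n] ?C a b)"
  proof (rule fam_vfield_comp[OF M U ac D D' _ \<chi>c _ Q _ bs ms refl n_def])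
   fix bs :: "('k, 'm) vfield word" and ms :: "'m word" assume *: "bs \<in> words ?U" "ms \<in> words M"
   have w: "inl_word M bs @ inr_word ?U ms \<in> words ?X" using * U M by simp
   have "cpt M M (wdeg bs + 2) (?\<chi> bs) ms = \<zero>[M (wdeg bs + wdeg ms + 2)]"
    by (rule mlin_zero[OF gm[OF gm_Coder[OF M]] gm[OF M] coder_component_mlin[OF M *(2)]]) simp
   then show "snd (cpt ?X ?X 2 D (inl_word M bs @ inr_word ?U ms)) = cpt M M (wdeg bs + 2) (?\<chi> bs) ms"
    unfolding Dcomp[OF w] by simp
  next
   fix w assume w: "w \<in> words ?X"
   show "fst (cpt ?X ?X 2 D w) = cpt ?U ?U 2 D' (fst_word w)" unfolding Dcomp[OF w] by simp
   show "snd (cpt ?X ?X 1 Q w) = fam R M (aug q ?c) w" unfolding comp[OF w] by simp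
  qed
  also have "... = ss (M n) bs ?A"
   by (intro ssum_cong refl) (use Ac C0 M in simp)
  also have "... = ?A bs []"
   by (rule ssum_left) (use A0 Ac[OF splits_self(1)] in auto)
  also have "?A bs [] = cpt M M (wdeg bs + 3) (cpt ?U ?U 2 D' bs) ms"
   using can_fam_letter[OF M, of "cpt ?U ?U 2 D' bs" "wdeg bs + 2"] coder_component_closed[OF U D' bs refl] by (simp add: add.commute)
  finally have v: "cpt M M (wdeg bs + 3) (cpt ?U ?U 2 D' bs) ms =
   snd (pr ?X n (Q (wdeg bs + wdeg ms + 2) (D (wdeg bs + wdeg ms) (sm ?X ?w))))" ..
  let ?d = "wdeg bs + wdeg ms"
  \<comment> \<open>The cube of \<open>Q\<close>, read as its square applied to \<open>Q\<close> of
    the monomial, so that \<open>sq'\<close> applies.\<close>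
  let ?y = "Q (?d + 2) (Q (?d + 1) (Q ?d (sm ?X ?w)))"
  have Q1: "Q ?d (sm ?X ?w) \<in> carrier (Sy ?X (?d + 1))" by (rule coder_closed[OF X Q x refl])
  have n: "n = ?d + 1 + 2" "?d + 2 = ?d + 1 + 1" by (simp_all add: n_def)
  have y: "?y \<in> carrier (Sy ?X n)" using QQ[OF Q1] by (simp only: n)
  have "Q (?d + 2) (D ?d (sm ?X ?w)) = ?y \<oplus>[Sy ?X n] ?y"
   unfolding Dx[OF x] by (rule mlin_add[OF coder_mlin[OF X Q] QQ[OF x] QQ[OF x]]) (simp add: n_def)
  then have "snd (pr ?X n (Q (?d + 2) (D ?d (sm ?X ?w)))) = snd (pr ?X n ?y) \<oplus>[M n] snd (pr ?X n ?y)"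
   using mlin_add[OF proj1_lift(1)[OF X] y y] by simp
  also have "snd (pr ?X n ?y) = \<zero>[M n]"
   using sq'[OF Q1] by (simp only: n)
  also have "\<zero>[M n] \<oplus>[M n] \<zero>[M n] = \<zero>[M n]" using M by simp
  also have "\<zero>[M n] = cpt M M (wdeg bs + 3) \<zero>[?U (wdeg bs + 2)] ms"
   by (rule zero_Umod_component[OF ms, symmetric]) (simp_all add: n_def)
  finally show "cpt M M (wdeg bs + 3) (cpt ?U ?U 2 D' bs) ms =
    cpt M M (wdeg bs + 3) \<zero>[?U (wdeg bs + 2)] ms"
   unfolding v .
 qed
 have "D' = \<zero>[Coder R ?U 2]"
 proof (rule coder_eqI[OF U D' coder_zero_closed[OF U]])
  fix w assume w: "w \<in> words ?U"
  have "cpt ?U ?U 2 \<zero>[Coder R ?U 2] w = \<zero>[?U (wdeg w + 2)]"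
   by (rule mlin_zero[OF gm[OF gm_Coder[OF U]] gm[OF U] coder_component_mlin[OF U w refl]])
  then show "cpt ?U ?U 2 D' w = cpt ?U ?U 2 \<zero>[Coder R ?U 2] w"
   using zero[OF w] by simp
 qed
 then show ?thesis using P by (simp add: dg_structure_def D'_def)
qed

section \<open>Deformations and families\<close>

context
 fixes B :: "('k, 'b) gmod" and QB :: "('k, 'b) vfield"
 assumes BL: "dg_manifold_L R B QB"
begin

lemma B_facts [simp]: "gr B" "dg_structure R B QB" "QB \<in> coder B 1"
 using BL by (auto simp: dg_manifold_L_def dg_manifold_def dg_structure_def)

text \<open>For a vectorfield described by a family, every condition on a deformation other than the
  structure equation holds. The B-part of that equation is the equation on B, and its M-part is
  treated by \<open>mc_iff\<close>.\<close>

lemma deformation_iff: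
 assumes r: "fam_rel R M B Q \<phi>"
 shows "deformation R M q B QB Q \<longleftrightarrow> mexp R B (Umod R M) \<phi> \<in> dg_morphisms R B QB (Umod R M) (QU R M q)"
proof -
 let ?X = "dsum B M"
 have X [simp]: "gr ?X" by simp
 have \<phi>: "symf B (Umod R M) \<phi>" and \<phi>0: "\<phi> [] = \<zero>[Umod R M 0]" and Q: "Q \<in> coder ?X 1"
  and Qc: "!!w. w \<in> words ?X ==> cpt ?X ?X 1 Q w = (\<zero>[B (wdeg w + 1)], fam R M \<phi> w)"
  using r by (auto simp: fam_rel_def)
 let ?Q = "total_vf R M q B QB Q"
 note Qt = total_vf_coder[OF M B_facts(1) q_coder B_facts(3) Q]
 note comp = component_total_fam[OF M B_facts(1) q_coder B_facts(3) r]
 note pB = prB_dg[OF M B_facts(1) B_facts(3) Qt]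
 have pB: "prB R B M (d + 1) (?Q d x) = QB d (prB R B M d x)" if "x \<in> carrier (Sy ?X d)" for d x
  by (rule pB[OF _ that]) (simp add: comp)
 have famM: "fam R M \<phi> (inr_word B ms) = \<zero>[M (wdeg ms + 1)]" if "ms \<in> words M" for ms
  using fam_sorted[OF M B_facts(1) \<phi> _ that, of "[]"] \<phi>0 zero_Umod_component[OF that, of _ 0 1] by simp
 have c0: "cpt ?X ?X 1 Q [] = \<zero>[?X 1]"
  using Qc[of "[]"] famM[of "[]"] by simp
 have inM0: "Q d (inM R B M d x) = \<zero>[Sy ?X (d + 1)]" if x: "x \<in> carrier (Sy M d)" for d x
 proof (rule sym_ext[OF M _ _ mlin_zero_map _ x])
  show "lin (Sy M d) (Sy ?X (d + 1)) (%x. Q d (inM R B M d x))"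
   by (rule mlin_comp[OF smf_mlin[OF M X inM_smf[OF B_facts(1) M]] coder_mlin[OF X Q refl]])
  fix ms assume ms: "ms \<in> words M" "wdeg ms = d"
  have "Q d (inM R B M d (sm M ms)) = ss (Sy ?X (d + 1)) ms
    (%a b. sm ?X ((wdeg a + 1, cpt ?X ?X 1 Q (inr_word B a)) # inr_word B b))"
   using coder_smon[OF X Q, of "inr_word B ms" d] ms M by (simp add: inM_smon[OF B_facts(1) M] ssum_lmap)
  also have "... = \<zero>[Sy ?X (d + 1)]"
  proof (rule ssum_zero)
   fix a b assume "splits ms a b"
   then have ab: "a \<in> words M" "b \<in> words M" "d = wdeg a + wdeg b" using ms by (auto simp: splits_words splits_wdeg)
   have "cpt ?X ?X 1 Q (inr_word B a) = \<zero>[?X (wdeg a + 1)]"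
    using Qc[of "inr_word B a"] famM[OF ab(1)] ab M by simp
   then show "sm ?X ((wdeg a + 1, cpt ?X ?X 1 Q (inr_word B a)) # inr_word B b) = \<zero>[Sy ?X (d + 1)]"
    using symfun_zero_letter[OF smon_symfun[OF X] X, of "d + 1" "[]" "inr_word B b" "wdeg a + 1"] ab M by simp
  qed simp
  finally show "Q d (inM R B M d (sm M ms)) = \<zero>[Sy ?X (d + 1)]" .
 qed simp_all
 have fst0: "fst (pr ?X (wdeg w + 2) (?Q (wdeg w + 1) (?Q (wdeg w) (sm ?X w)))) = \<zero>[B (wdeg w + 2)]" if w: "w \<in> words ?X" for w
 proof -
  have x: "sm ?X w \<in> carrier (Sy ?X (wdeg w))" using w by (simp add: smon_closed)
  note x1 = coder_closed[OF X Qt x refl]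
  have x2: "?Q (wdeg w + 1) (?Q (wdeg w) (sm ?X w)) \<in> carrier (Sy ?X (wdeg w + 2))"
   by (rule coder_closed[OF X Qt x1]) simp
  have "prB R B M (wdeg w + 2) (?Q (wdeg w + 1) (?Q (wdeg w) (sm ?X w))) = QB (wdeg w + 1) (QB (wdeg w) (prB R B M (wdeg w) (sm ?X w)))"
   using pB[OF x1] pB[OF x] by (simp add: add.assoc)
  also have "... = \<zero>[Sy B (wdeg w + 2)]"
   by (rule dg_structure_sq[OF B_facts(1,3,2) smf_closed[OF X B_facts(1) prB_smf[OF B_facts(1) M] x]])
  finally have "fst (pr ?X (wdeg w + 2) (?Q (wdeg w + 1) (?Q (wdeg w) (sm ?X w)))) = pr B (wdeg w + 2) \<zero>[Sy B (wdeg w + 2)]"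
   using proj1_prB[OF B_facts(1) M x2] by simp
  also have "... = \<zero>[B (wdeg w + 2)]"
   by (rule mlin_zero[OF gm[OF gm_Sym] gm proj1_lift(1)]) simp_all
  finally show ?thesis .
 qed
 have "dg_structure R ?X ?Q \<longleftrightarrow> (\<forall>w\<in>words ?X. snd (pr ?X (wdeg w + 2) (?Q (wdeg w + 1) (?Q (wdeg w) (sm ?X w)))) = \<zero>[M (wdeg w + 2)])"
  unfolding dg_structure_iff[OF X Qt] using fst0 by (simp add: prod_eq_iff)
 also have "... \<longleftrightarrow> (\<forall>d. \<forall>x\<in>carrier (Sy B d).
   mexp R B (Umod R M) \<phi> (d + 1) (QB d x) = QU R M q d (mexp R B (Umod R M) \<phi> d x))"
  by (rule mc_iff[OF M B_facts(1) q_coder B_facts(3) dg \<phi> Qt comp])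
 also have "... \<longleftrightarrow> mexp R B (Umod R M) \<phi> \<in> dg_morphisms R B QB (Umod R M) (QU R M q)"
  using mexp_smf(1)[OF B_facts(1) gm_Umod[OF M] \<phi>] by (simp add: dg_morphisms_def)
 finally show ?thesis
  unfolding deformation_def using BL Q c0 inM0 pB prB_smf[OF B_facts(1) M] by (auto simp: dg_morphisms_def)
qed

text \<open>That the projection to B is a morphism forces the B-part of the vectorfield to vanish.
  Its M-part is cut into coderivations of S(M), one for each word in B.\<close>

lemma deformation_fam:
 assumes def: "deformation R M q B QB Q"
 obtains \<phi> where "fam_rel R M B Q \<phi>"
proof -
 let ?X = "dsum B M" and ?U = "Umod R M"
 have X [simp]: "gr ?X" by simp
 have Q: "Q \<in> coder ?X 1" and inM0: "!!d x. x \<in> carrier (Sy M d) ==> Q d (inM R B M d x) = \<zero>[Sy ?X (d + 1)]"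
  and p: "prB R B M \<in> dg_morphisms R ?X (total_vf R M q B QB Q) B QB"
  using def by (auto simp: deformation_def)
 let ?Q = "total_vf R M q B QB Q"
 note Qt = total_vf_coder[OF M B_facts(1) q_coder B_facts(3) Q]
 have fst0: "fst (cpt ?X ?X 1 Q w) = \<zero>[B (wdeg w + 1)]" if w: "w \<in> words ?X" for w
 proof -
  have x: "sm ?X w \<in> carrier (Sy ?X (wdeg w))" using w by (simp add: smon_closed)
  have c: "cpt B B 1 QB (fst_word w) \<in> carrier (B (wdeg w + 1))"
   "fst (cpt ?X ?X 1 Q w) \<in> carrier (B (wdeg w + 1))"
   using coder_component_closed[OF B_facts(1,3), of "fst_word w"] coder_component_closed[OF X Q w refl] w by auto
  have "fst (cpt ?X ?X 1 ?Q w) = pr B (wdeg w + 1) (prB R B M (wdeg w + 1) (?Q (wdeg w) (sm ?X w)))"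
   using proj1_prB[OF B_facts(1) M coder_closed[OF X Qt x refl]] by (simp add: component_def)
  also have "... = cpt B B 1 QB (fst_word w)"
   using p x w by (simp add: dg_morphisms_def prB_smon[OF B_facts(1) M] component_def)
  finally have *: "cpt B B 1 QB (fst_word w) \<oplus>[B (wdeg w + 1)] fst (cpt ?X ?X 1 Q w) =
    cpt B B 1 QB (fst_word w) \<oplus>[B (wdeg w + 1)] \<zero>[B (wdeg w + 1)]"
   using component_total_vf[OF M B_facts(1) q_coder B_facts(3) Q w] c by simp
  show ?thesis
   by (rule m_add_cancel[THEN iffD1, OF gm[OF B_facts(1)] c m_zero[OF gm[OF B_facts(1)]] *])
 qed
 define c where "c = (%w. snd (cpt ?X ?X 1 Q w))"
 have cs: "symf ?X (%d. M (d + 1)) c"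
  unfolding c_def
  by (rule symfun_mlin[OF coder_component_symfun[OF X Q], where h = "%d. snd"]) (use dsum_mlin(2)[OF B_facts(1) M] in auto)
 define \<phi>0 where "\<phi>0 = (%bs. vfield_of R M (wdeg bs + 1) (%ms. c (inl_word M bs @ inr_word B ms)))"
 have s: "symf M (%d. M (d + (wdeg bs + 1))) (%ms. c (inl_word M bs @ inr_word B ms))" if "bs \<in> words B" for bs
  using symfun_lmap[OF symfun_sandwich[OF cs, of "inl_word M bs" "[]"] dsum_mlin(4)[OF B_facts(1) M]] that M
  by (simp add: algebra_simps)
 have \<phi>0c: "cpt M M (wdeg bs + 1) (\<phi>0 bs) ms = c (inl_word M bs @ inr_word B ms)" if "bs \<in> words B" "ms \<in> words M" for bs ms
  unfolding \<phi>0_def by (rule component_vfield_of[OF M s[OF that(1)] that(2)])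
 have \<phi>0s: "symf B ?U \<phi>0"
 proof (rule symfun_UmodI[OF M])
  show "\<phi>0 bs \<in> coder M (wdeg bs + 1)" if "bs \<in> words B" for bs
   unfolding \<phi>0_def by (rule vfield_of_coder[OF M s[OF that]])
  fix ms assume ms: "ms \<in> words M"
  have "symf B (%d. M (d + wdeg ms + 1)) (%bs. c (inl_word M bs @ inr_word B ms))"
   using symfun_lmap[OF symfun_sandwich[OF cs, of "[]" "inr_word B ms"] dsum_mlin(3)[OF B_facts(1) M]] ms M by simp
  then show "symf B (%d. M (d + wdeg ms + 1)) (%bs. cpt M M (wdeg bs + 1) (\<phi>0 bs) ms)"
   by (rule symfun_cong) (use \<phi>0c ms in auto)
 qed simp
 \<comment> \<open>Because \<open>Q\<close> vanishes on the fibre over the distinguished point, the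
   components at the empty word are zero, and resetting that value leaves the functional
   unchanged.\<close>
 let ?\<phi> = "aug \<zero>[?U 0] \<phi>0"
 have \<phi>: "symf B ?U ?\<phi>" by (rule symfun_aug[OF \<phi>0s m_zero]) simp
 have P: "gr (%d. M (d + 1))" by (rule gmI) simp
 have c_fam: "c w = fam R M ?\<phi> w" if w: "w \<in> words ?X" for w
 proof (rule symfun_dsum_eqI[OF B_facts(1) M cs fam_symfun[OF M B_facts(1) \<phi>] P _ w])
  fix bs ms assume bs: "bs \<in> words B" and ms: "ms \<in> words M"
  show "c (inl_word M bs @ inr_word B ms) = fam R M ?\<phi> (inl_word M bs @ inr_word B ms)"
  proof (cases "bs = []")
   case True
   have "c (inr_word B ms) = snd (pr ?X (wdeg ms + 1) (Q (wdeg ms) (inM R B M (wdeg ms) (sm M ms))))"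
    using ms by (simp add: c_def component_def inM_smon[OF B_facts(1) M])
   also have "... = \<zero>[M (wdeg ms + 1)]"
    using ms mlin_zero[OF gm[OF gm_Sym[OF X]] gm[OF X] proj1_lift(1)[OF X]] by (simp add: inM0 smon_closed)
   finally show ?thesis
    using True fam_sorted[OF M B_facts(1) \<phi> bs ms] zero_Umod_component[OF ms, of _ 0 1] by simp
  next
   case False
   then show ?thesis
    using fam_sorted[OF M B_facts(1) \<phi> bs ms] \<phi>0c[OF bs ms] by simp
  qed
 qed
 show thesis
  by (rule that[of ?\<phi>]) (use \<phi> Q fst0 c_fam in \<open>simp add: fam_rel_def prod_eq_iff c_def\<close>)
qed

lemma fam_rel_classifies:
 assumes r: "fam_rel R M B Q \<phi>" and bs: "bs \<in> words B" and ms: "ms \<in> words M"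
 shows "cpt M M (wdeg bs + 1) (\<phi> bs) ms = snd (cpt (dsum B M) (dsum B M) 1 Q (inl_word M bs @ inr_word B ms))"
 using r fam_sorted[OF M B_facts(1) _ bs ms, of \<phi>] bs ms M by (simp add: fam_rel_def)

lemma fam_rel_unique:
 assumes r: "fam_rel R M B Q \<phi>" "fam_rel R M B Q' \<phi>'" and eq: "!!bs. bs \<in> words B ==> \<phi> bs = \<phi>' bs"
 shows "Q = Q'"
proof (rule coder_eqI[OF gm_dsum[OF B_facts(1) M]])
 fix w assume w: "w \<in> words (dsum B M)"
 have "fam R M \<phi> w = fam R M \<phi>' w"
  unfolding fam_def
 proof (intro ssum_cong refl)
  fix a b assume "splits w a b"
  then have "fst_word a \<in> words B" using w by (auto simp: splits_words)
  then show "cpt M M (wdeg a + 1) (\<phi> (fst_word a)) (snd_word b) = cpt M M (wdeg a + 1) (\<phi>' (fst_word a)) (snd_word b)"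
   by (simp add: eq)
 qed
 then show "cpt (dsum B M) (dsum B M) 1 Q w = cpt (dsum B M) (dsum B M) 1 Q' w"
  using r w by (simp add: fam_rel_def)
qed (use r in \<open>auto simp: fam_rel_def\<close>)

end

end

declare q_coder [simp del] B_facts [simp del]

end

section \<open>Morphisms into the canonical deformation\<close>

lemma fam_cong:
 assumes "!!bs. bs \<in> words B ==> \<psi> bs = \<psi>' bs" "w \<in> words (dsum B M)"
 shows "fam R M \<psi> w = fam R M \<psi>' w"
 unfolding fam_def
proof (intro ssum_cong refl)
 fix a b assume "splits w a b"
 then have "fst_word a \<in> words B" using assms(2) by (auto simp: splits_words)
 then show "component R M M (wdeg a + 1) (\<psi> (fst_word a)) (snd_word b) = component R M M (wdeg a + 1) (\<psi>' (fst_word a)) (snd_word b)"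
  by (simp add: assms(1))
qed

context ground
begin

context
 fixes M :: "('k, 'm) gmod" and q :: "('k, 'm) vfield"
 assumes M [simp]: "gr M" and dg: "dg_structure R M q"
begin

abbreviation (input) "UM \<equiv> Umod R M"
abbreviation (input) "XU \<equiv> dsum (Umod R M) M"
abbreviation (input) "PU \<equiv> QU R M q"
abbreviation (input) "QX \<equiv> total_vf R M q (Umod R M) (QU R M q) (Qcan R M)"

lemma Umod_dg_manifold_L: "dg_manifold_L R UM PU"
proof -
 have "cpt UM UM 1 PU [] = \<zero>[UM 1]"
  unfolding component_QU[OF M q_coder[OF M dg] words_simps(1)] by (simp add: QU_comp_def)
 then show ?thesis
  unfolding dg_manifold_L_def dg_manifold_def using QU_dg[OF M dg] gm_Umod[OF M] by blast
qed

lemma deformation_Qcan: "deformation R M q UM PU (Qcan R M)"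
proof -
 have U: "gr UM" by simp
 have id: "mexp R UM UM (can_fam R M) d x = x" if "x \<in> carrier (Sy UM d)" for d x
  using mexp_proj1[OF U that] by (simp add: can_fam_def[abs_def])
 have "mexp R UM UM (can_fam R M) \<in> dg_morphisms R UM PU UM PU"
  unfolding dg_morphisms_def
  using mexp_smf(1)[OF U U can_fam_symfun[OF M]] coder_closed[OF U QU_coder[OF M q_coder[OF M dg]] _ refl] by (simp add: id)
 then show ?thesis
  using deformation_iff[OF M dg Umod_dg_manifold_L fam_rel_Qcan[OF M dg]] by simp
qed

lemma QX_facts:
 shows QX_coder: "QX \<in> coder XU 1"
  and component_QX: "w \<in> words XU ==> cpt XU XU 1 QX w = (cpt UM UM 1 PU (fst_word w), fam R M (aug q (can_fam R M)) w)"
  and prB_QX: "x \<in> carrier (Sy XU d) ==> prB R UM M (d + 1) (QX d x) = PU d (prB R UM M d x)"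
 using deformation_Qcan component_total_fam[OF M gm_Umod[OF M] q_coder[OF M dg] QU_coder[OF M q_coder[OF M dg]] fam_rel_Qcan[OF M dg]]
 by (simp_all add: deformation_def dg_structure_def dg_morphisms_def)

context
 fixes B :: "('k, 'b) gmod" and QB :: "('k, 'b) vfield" and Q :: "('k, 'b \<times> 'm) vfield" and \<phi> :: "'b word => ('k, 'm) vfield"
 assumes def: "deformation R M q B QB Q" and rel: "fam_rel R M B Q \<phi>"
begin

abbreviation (input) "XB \<equiv> dsum B M"
abbreviation (input) "QT \<equiv> total_vf R M q B QB Q"

lemma def_facts [simp]: "dg_manifold_L R B QB" "gr B" "QB \<in> coder B 1" "symf B UM \<phi>"
 using def rel by (auto simp: deformation_def fam_rel_def dg_manifold_L_def dg_manifold_def dg_structure_def)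

lemma mexp_dg: "mexp R B UM \<phi> \<in> dg_morphisms R B QB UM PU"
 using deformation_iff[OF M dg def_facts(1) rel] def by simp

lemma QT_coder: "QT \<in> coder XB 1"
 and prB_QT: "x \<in> carrier (Sy XB d) ==> prB R B M (d + 1) (QT d x) = QB d (prB R B M d x)"
 using def by (auto simp: deformation_def dg_structure_def dg_morphisms_def)

context
 fixes F :: "int => ('k, 'b \<times> 'm) sym => ('k, ('k, 'm) vfield \<times> 'm) sym" and f
 assumes F: "F \<in> smf XB XU" and f: "f \<in> smf B UM"
  and FU: "!!d x. x \<in> carrier (Sy XB d) ==> prB R UM M d (F d x) = f d (prB R B M d x)"
  and FM: "!!d x. x \<in> carrier (Sy XB d) ==> prM R UM M d (F d x) = prM R B M d x"
begin

lemma X_gm [simp]: "gr XB" "gr XU" "gr UM"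
 by simp_all

lemma snd_QX_F:
 assumes w: "w \<in> words XB"
 shows "snd (pr XU (wdeg w + 1) (QX (wdeg w) (F (wdeg w) (sm XB w)))) = fam R M (aug q (cpt B UM 0 f)) w"
 by (rule fam_smf[OF M q_coder[OF M dg] def_facts(2) f F FU FM QX_coder _ w refl]) (simp_all add: component_QX)

lemma snd_F_QT:
 assumes w: "w \<in> words XB"
 shows "snd (pr XU (wdeg w + 1) (F (wdeg w + 1) (QT (wdeg w) (sm XB w)))) = fam R M (aug q \<phi>) w"
proof -
 have y: "QT (wdeg w) (sm XB w) \<in> carrier (Sy XB (wdeg w + 1))"
  using w by (intro coder_closed[OF X_gm(1) QT_coder _ refl] smon_closed) auto
 have "snd (pr XU (wdeg w + 1) (F (wdeg w + 1) (QT (wdeg w) (sm XB w)))) = snd (cpt XB XB 1 QT w)"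
  using proj1_prM[OF X_gm(3) M smf_closed[OF X_gm(1,2) F y]] FM[OF y] proj1_prM[OF def_facts(2) M y] by (simp add: component_def)
 then show ?thesis
  using component_total_fam[OF M def_facts(2) q_coder[OF M dg] def_facts(3) rel w] by simp
qed

text \<open>The M-parts of both sides of the commutation are the functionals of the families of
  \<open>f\<close> and of the deformation. On sorted words these are the components, and for
  nonempty \<open>bs\<close> the value \<open>q\<close> is out of sight.\<close>

lemma component_unique:
 assumes comm: "!!d x. x \<in> carrier (Sy XB d) ==> F (d + 1) (QT d x) = QX d (F d x)"
 shows "f = mexp R B UM \<phi>"
proof (rule smf_eqI[OF def_facts(2) X_gm(3) f mexp_smf(1)[OF def_facts(2) X_gm(3) def_facts(4)]])
 fix bs assume bs: "bs \<in> words B" "bs \<noteq> []"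
 let ?c = "cpt B UM 0 f"
 have c: "symf B UM ?c" by (rule smf_component_symfun[OF def_facts(2) X_gm(3) f])
 have q0: "q \<in> carrier (UM 0)" using q_coder[OF M dg] by simp
 have "?c bs = \<phi> bs"
 proof (rule coder_eqI[OF M fam_coder[OF M def_facts(2) c bs(1)] fam_coder[OF M def_facts(2) def_facts(4) bs(1)]])
  fix ms assume ms: "ms \<in> words M"
  let ?w = "inl_word M bs @ inr_word B ms"
  have w: "?w \<in> words XB" using bs ms by simp
  have "fam R M (aug q ?c) ?w = fam R M (aug q \<phi>) ?w"
   using snd_QX_F[OF w] snd_F_QT[OF w] comm[OF smon_closed[OF X_gm(1) w refl]] by simp
  then show "cpt M M (wdeg bs + 1) (?c bs) ms = cpt M M (wdeg bs + 1) (\<phi> bs) ms"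
   using fam_sorted[OF M def_facts(2) symfun_aug[OF c q0] bs(1) ms] fam_sorted[OF M def_facts(2) symfun_aug[OF def_facts(4) q0] bs(1) ms] bs(2)
   by simp
 qed
 then show "?c bs = cpt B UM 0 (mexp R B UM \<phi>) bs"
  using component_mexp[OF def_facts(2) X_gm(3) def_facts(4) bs] by simp
qed

context
 assumes f_eq: "f = mexp R B UM \<phi>"
begin

lemma f_dg: "x \<in> carrier (Sy B d) ==> f (d + 1) (QB d x) = PU d (f d x)"
 using mexp_dg f_eq by (simp add: dg_morphisms_def)

text \<open>The U-parts agree because \<open>f\<close> and the projections commute with the
  vectorfields, the M-parts because the family of \<open>f\<close> is that of the
  deformation.\<close>

lemma F_dg:
 assumes x: "x \<in> carrier (Sy XB d)"
 shows "F (d + 1) (QT d x) = QX d (F d x)"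
proof (rule dg_commute[OF X_gm(1,2) F QT_coder QX_coder _ x])
 fix w assume w: "w \<in> words XB"
 let ?x = "sm XB w" and ?d = "wdeg w"
 have x: "?x \<in> carrier (Sy XB ?d)" using w by (simp add: smon_closed)
 note y = coder_closed[OF X_gm(1) QT_coder x refl] and Fx = smf_closed[OF X_gm(1,2) F x]
 note Fy = smf_closed[OF X_gm(1,2) F y] and z = coder_closed[OF X_gm(2) QX_coder Fx refl]
 have "prB R UM M (?d + 1) (F (?d + 1) (QT ?d ?x)) = prB R UM M (?d + 1) (QX ?d (F ?d ?x))"
  using FU[OF y] FU[OF x] prB_QT[OF x] prB_QX[OF Fx] f_dg[OF smf_closed[OF X_gm(1) def_facts(2) prB_smf[OF def_facts(2) M] x]] by simp
 then have "fst (pr XU (?d + 1) (F (?d + 1) (QT ?d ?x))) = fst (pr XU (?d + 1) (QX ?d (F ?d ?x)))"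
  using proj1_prB[OF X_gm(3) M Fy] proj1_prB[OF X_gm(3) M z] by simp
 moreover have "fam R M (aug q (cpt B UM 0 f)) w = fam R M (aug q \<phi>) w"
  by (rule fam_cong[OF _ w])
   (simp add: aug_def f_eq component_mexp[OF def_facts(2) X_gm(3) def_facts(4)])
 ultimately show "pr XU (?d + 1) (F (?d + 1) (QT ?d ?x)) = pr XU (?d + 1) (QX ?d (F ?d ?x))"
  unfolding prod_eq_iff snd_QX_F[OF w] snd_F_QT[OF w] by simp
qed

text \<open>Compared by projections: both morphisms are the identity in the M-direction, and in the
  U-direction both send monomials of positive length to zero.\<close>

lemma F_inM: "gcomp (Sy M) F (inM R B M) = inM R UM M"
proof (rule pair_smf_eqI[OF X_gm(3) M M])
 note iB = inM_smf[OF def_facts(2) M] and iU = inM_smf[OF X_gm(3) M]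
 show "gcomp (Sy M) F (inM R B M) \<in> smf M XU"
  by (rule smf_comp[OF M X_gm(1,2) iB F])
 show "inM R UM M \<in> smf M XU" by (rule iU)
 fix d x assume x: "x \<in> carrier (Sy M d)"
 note ix = smf_closed[OF M X_gm(1) iB x]
 show "prM R UM M d (gcomp (Sy M) F (inM R B M) d x) = prM R UM M d (inM R UM M d x)"
  using x FM[OF ix] prM_inM[OF def_facts(2) M x] prM_inM[OF X_gm(3) M x] by (simp add: gcomp_def)
 have "f d (prB R B M d (inM R B M d x)) = prB R UM M d (inM R UM M d x)"
 proof (rule sym_ext[OF M gm[OF gm_Sym[OF X_gm(3)]] _ _ _ x])
  show "lin (Sy M d) (Sy UM d) (%x. f d (prB R B M d (inM R B M d x)))"
   by (rule mlin_comp[OF mlin_comp[OF smf_mlin[OF M X_gm(1) iB] smf_mlin[OF X_gm(1) def_facts(2) prB_smf[OF def_facts(2) M]]]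
    smf_mlin[OF def_facts(2) X_gm(3) f]])
  show "lin (Sy M d) (Sy UM d) (%x. prB R UM M d (inM R UM M d x))"
   by (rule mlin_comp[OF smf_mlin[OF M X_gm(2) iU] smf_mlin[OF X_gm(2,3) prB_smf[OF X_gm(3) M]]])
  fix w assume w: "w \<in> words M" "wdeg w = d"
  show "f d (prB R B M d (inM R B M d (sm M w))) = prB R UM M d (inM R UM M d (sm M w))"
   unfolding prB_inM[OF def_facts(2) M w(1) w(2)[symmetric]] prB_inM[OF X_gm(3) M w(1) w(2)[symmetric]]
   using w smf_one[OF def_facts(2) X_gm(3) f]
    mlin_zero[OF gm[OF gm_Sym[OF def_facts(2)]] gm[OF gm_Sym[OF X_gm(3)]] smf_mlin[OF def_facts(2) X_gm(3) f]]
   by auto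
 qed
 then show "prB R UM M d (gcomp (Sy M) F (inM R B M) d x) = prB R UM M d (inM R UM M d x)"
  using x FU[OF ix] by (simp add: gcomp_def)
qed

text \<open>The mediating morphism \<open>k\<close> has the projections \<open>g\<close> and the
  M-part of \<open>h\<close>. It commutes with the vectorfields: in the B-direction because
  \<open>g\<close> does, in the M-direction because \<open>h\<close> does and \<open>F\<close>
  preserves M-parts.\<close>

lemma F_cartesian: "cartesian TYPE('t) R XB QT XU QX B QB F f (prB R B M) (prB R UM M)"
 unfolding cartesian_def
proof (intro conjI allI impI ballI)
 show "gcomp (Sy XB) (prB R UM M) F = gcomp (Sy XB) f (prB R B M)"
  unfolding gcomp_eq_iff using FU by blast
 fix T :: "('k, 't) gmod" and q' g h
 assume "dg_manifold R T q'" and g: "g \<in> dg_morphisms R T q' B QB" and h: "h \<in> dg_morphisms R T q' XU QX"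
  and gh: "gcomp (Sy T) f g = gcomp (Sy T) (prB R UM M) h"
 then have T: "gr T" and q': "q' \<in> coder T 1" by (auto simp: dg_manifold_def dg_structure_def)
 have gs: "g \<in> smf T B" and gc: "!!d x. x \<in> carrier (Sy T d) ==> g (d + 1) (q' d x) = QB d (g d x)"
  and hs: "h \<in> smf T XU" and hc: "!!d x. x \<in> carrier (Sy T d) ==> h (d + 1) (q' d x) = QX d (h d x)"
  using g h by (auto simp: dg_morphisms_def)
 have gh: "f d (g d x) = prB R UM M d (h d x)" if "x \<in> carrier (Sy T d)" for d x
  using gh that unfolding gcomp_eq_iff by blast
 note cl = def_facts(2) X_gm
 have hM: "gcomp (Sy T) (prM R UM M) h \<in> smf T M"
  by (rule smf_comp[OF T X_gm(2) M hs prM_smf[OF X_gm(3) M]])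
 obtain k where k: "k \<in> smf T XB" and "gcomp (Sy T) (prB R B M) k = g"
  and "gcomp (Sy T) (prM R B M) k = gcomp (Sy T) (prM R UM M) h"
  by (rule pair_smf[OF def_facts(2) M T gs hM])
 then have kB': "gcomp (Sy T) (prB R B M) k = g"
  and kB: "!!d x. x \<in> carrier (Sy T d) ==> prB R B M d (k d x) = g d x"
  and kM: "!!d x. x \<in> carrier (Sy T d) ==> prM R B M d (k d x) = prM R UM M d (h d x)"
  by (blast, (simp add: gcomp_eq_left_iff[OF smf_ext[OF T def_facts(2) gs]] gcomp_eq_iff)+)
 have Fk: "F d (k d x) = h d x" if x: "x \<in> carrier (Sy T d)" for d x
 proof -
  have "gcomp (Sy T) F k = h"
  proof (rule pair_smf_eqI[OF X_gm(3) M T smf_comp[OF T X_gm(1,2) k F] hs])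
   fix d x assume x: "x \<in> carrier (Sy T d)"
   note kx = smf_closed[OF T X_gm(1) k x]
   show "prB R UM M d (gcomp (Sy T) F k d x) = prB R UM M d (h d x)"
    using x FU[OF kx] kB[OF x] gh[OF x] by (simp add: gcomp_def)
   show "prM R UM M d (gcomp (Sy T) F k d x) = prM R UM M d (h d x)"
    using x FM[OF kx] kM[OF x] by (simp add: gcomp_def)
  qed
  then show ?thesis using x by (auto simp: gcomp_eq_left_iff[OF smf_ext[OF T X_gm(2) hs]])
 qed
 \<comment> \<open>Since \<open>F\<close> preserves M-parts and commutes, the M-part of the
   vectorfield on B x M can be computed on U x M.\<close>
 have snd_Q: "snd (pr XB (d + 1) (QT d y)) = snd (pr XU (d + 1) (QX d (F d y)))" if y: "y \<in> carrier (Sy XB d)" for d y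
 proof -
  note Qy = coder_closed[OF X_gm(1) QT_coder y refl]
  show ?thesis
   using proj1_prM[OF def_facts(2) M Qy] FM[OF Qy] F_dg[OF y]
    proj1_prM[OF X_gm(3) M coder_closed[OF X_gm(2) QX_coder smf_closed[OF X_gm(1,2) F y] refl]] by simp
 qed
 have "k (d + 1) (q' d x) = QT d (k d x)" if x: "x \<in> carrier (Sy T d)" for d x
 proof (rule dg_commute[OF T X_gm(1) k q' QT_coder _ x])
  fix w assume w: "w \<in> words T"
  let ?x = "sm T w" and ?d = "wdeg w"
  have x: "?x \<in> carrier (Sy T ?d)" using w T by (simp add: smon_closed)
  note q'x = coder_closed[OF T q' x refl] and kx = smf_closed[OF T X_gm(1) k x]
  note kq'x = smf_closed[OF T X_gm(1) k q'x] and Qkx = coder_closed[OF X_gm(1) QT_coder kx refl]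
  have "fst (pr XB (?d + 1) (k (?d + 1) (q' ?d ?x))) = fst (pr XB (?d + 1) (QT ?d (k ?d ?x)))"
   using proj1_prB[OF def_facts(2) M kq'x] proj1_prB[OF def_facts(2) M Qkx] kB[OF q'x] gc[OF x] prB_QT[OF kx] kB[OF x] by simp
  moreover have "snd (pr XB (?d + 1) (k (?d + 1) (q' ?d ?x))) = snd (pr XB (?d + 1) (QT ?d (k ?d ?x)))"
   using proj1_prM[OF def_facts(2) M kq'x] kM[OF q'x] hc[OF x] snd_Q[OF kx] Fk[OF x]
    proj1_prM[OF X_gm(3) M coder_closed[OF X_gm(2) QX_coder smf_closed[OF T X_gm(2) hs x] refl]] by simp
  ultimately show "pr XB (?d + 1) (k (?d + 1) (q' ?d ?x)) = pr XB (?d + 1) (QT ?d (k ?d ?x))"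
   by (simp add: prod_eq_iff)
 qed
 with k have k_dg: "k \<in> dg_morphisms R T q' XB QT" by (simp add: dg_morphisms_def)
 have Fk': "gcomp (Sy T) F k = h"
  unfolding gcomp_eq_left_iff[OF smf_ext[OF T X_gm(2) hs]] using Fk by blast
 show "\<exists>!k. k \<in> dg_morphisms R T q' XB QT \<and> gcomp (Sy T) (prB R B M) k = g \<and> gcomp (Sy T) F k = h"
 proof (rule ex1I[of _ k])
  show "k \<in> dg_morphisms R T q' XB QT \<and> gcomp (Sy T) (prB R B M) k = g \<and> gcomp (Sy T) F k = h"
   using k_dg kB' Fk' by blast
  fix k' assume k': "k' \<in> dg_morphisms R T q' XB QT \<and> gcomp (Sy T) (prB R B M) k' = g \<and> gcomp (Sy T) F k' = h"
  then have ks: "k' \<in> smf T XB" by (simp add: dg_morphisms_def)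
  show "k' = k"
  proof (rule pair_smf_eqI[OF def_facts(2) M T ks k])
   fix d x assume x: "x \<in> carrier (Sy T d)"
   note k'x = smf_closed[OF T X_gm(1) ks x]
   \<comment> \<open>Both projections of a second solution are forced: the one to B is
     \<open>g\<close>, and the one to M is that of \<open>h\<close>, since \<open>F\<close>
     preserves it.\<close>
   have "prB R B M d (k' d x) = g d x" "F d (k' d x) = h d x"
    using k' x by (auto simp: gcomp_eq_left_iff[OF smf_ext[OF T def_facts(2) gs]] gcomp_eq_left_iff[OF smf_ext[OF T X_gm(2) hs]])
   then show "prB R B M d (k' d x) = prB R B M d (k d x)" "prM R B M d (k' d x) = prM R B M d (k d x)"
    using kB[OF x] kM[OF x] FM[OF k'x] by simp_all
  qed
 qed
qed

end
end

lemma deformation_morphism_exists: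
 "\<exists>F. deformation_morphism TYPE('t) R M q B QB Q UM PU (Qcan R M) F (mexp R B UM \<phi>) \<and>
   gcomp (Sy XB) (prM R UM M) F = prM R B M"
proof -
 have U: "gr UM" and X: "gr XB" and XU': "gr XU" by simp_all
 let ?f = "mexp R B UM \<phi>"
 have f: "?f \<in> smf B UM" by (rule mexp_smf(1)[OF def_facts(2) U def_facts(4)])
 obtain F where F: "F \<in> smf XB XU" and FU: "gcomp (Sy XB) (prB R UM M) F = gcomp (Sy XB) ?f (prB R B M)"
  and FM: "gcomp (Sy XB) (prM R UM M) F = prM R B M"
  by (rule pair_smf[OF U M X smf_comp[OF X def_facts(2) U prB_smf[OF def_facts(2) M] f] prM_smf[OF def_facts(2) M]])
 have FU': "!!d x. x \<in> carrier (Sy XB d) ==> prB R UM M d (F d x) = ?f d (prB R B M d x)"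
  using FU unfolding gcomp_eq_iff by blast
 have FM': "!!d x. x \<in> carrier (Sy XB d) ==> prM R UM M d (F d x) = prM R B M d x"
  using FM unfolding gcomp_eq_left_iff[OF smf_ext[OF X M prM_smf[OF def_facts(2) M]]] by blast
 have "deformation_morphism TYPE('t) R M q B QB Q UM PU (Qcan R M) F ?f"
  unfolding deformation_morphism_def
 proof (intro conjI)
  show "F \<in> dg_morphisms R XB QT XU QX"
   unfolding dg_morphisms_def using F F_dg[OF F f FU' FM' refl] by simp
 qed (rule mexp_dg F_cartesian[OF F f FU' FM' refl] F_inM[OF F f FU' FM' refl]; assumption)+
 then show ?thesis using FM by blast
qed

lemma deformation_morphism_unique:
 assumes m: "deformation_morphism TYPE('t) R M q B QB Q UM PU (Qcan R M) F f"
  and FM: "gcomp (Sy XB) (prM R UM M) F = prM R B M"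
 shows "f = mexp R B UM \<phi>"
proof -
 have X: "gr XB" by simp
 have F: "F \<in> smf XB XU" and f: "f \<in> smf B UM"
  and FU: "gcomp (Sy XB) (prB R UM M) F = gcomp (Sy XB) f (prB R B M)"
  and comm: "!!d x. x \<in> carrier (Sy XB d) ==> F (d + 1) (QT d x) = QX d (F d x)"
  using m by (auto simp: deformation_morphism_def dg_morphisms_def cartesian_def)
 show ?thesis
 proof (rule component_unique[OF F f _ _ comm])
  fix d x assume x: "x \<in> carrier (Sy XB d)"
  show "prB R UM M d (F d x) = f d (prB R B M d x)"
   using FU x unfolding gcomp_eq_iff by blast
  show "prM R UM M d (F d x) = prM R B M d x"
   using FM x unfolding gcomp_eq_left_iff[OF smf_ext[OF X M prM_smf[OF def_facts(2) M]]] by blast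
 qed
qed

declare def_facts [simp del] X_gm [simp del]

lemma classifies_mexp: "classifies R M B Q (mexp R B UM \<phi>)"
 unfolding classifies_def
 using fam_rel_classifies[OF M dg def_facts(1) rel] component_mexp[OF def_facts(2) gm_Umod[OF M] def_facts(4)]
 by (simp add: lmap_def)

end

section \<open>The one-to-one correspondence\<close>

context
 fixes B :: "('k, 'b) gmod" and QB :: "('k, 'b) vfield"
 assumes BL: "dg_manifold_L R B QB"
begin

text \<open>\<open>\<Phi>\<close> may use any family describing the deformation, as its values are
  pinned down only on words in B. For surjectivity the family is read off the components of
  \<open>f\<close>.\<close>

lemma deformations_bij_morphisms:
 fixes \<Phi>
 assumes \<Phi>: "!!Q. deformation R M q B QB Q ==> \<exists>\<phi>. fam_rel R M B Q \<phi> \<and> \<Phi> Q = mexp R B UM \<phi>"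
 shows "bij_betw \<Phi> {Q. deformation R M q B QB Q} (dg_morphisms R B QB UM PU)"
proof -
 note B = B_facts(1)[OF M dg BL]
 have U: "gr UM" by simp
 have eq: "\<phi> bs = \<phi>' bs" if r: "fam_rel R M B Q \<phi>" "fam_rel R M B Q' \<phi>'" and m: "mexp R B UM \<phi> = mexp R B UM \<phi>'" and bs: "bs \<in> words B"
  for Q Q' \<phi> \<phi>' bs
 proof (cases "bs = []")
  case False
  have "symf B UM \<phi>" "symf B UM \<phi>'" using r by (auto simp: fam_rel_def)
  from component_mexp[OF B U this(1) bs False] component_mexp[OF B U this(2) bs False] show ?thesis using m by simp
 qed (use r in \<open>simp add: fam_rel_def\<close>)
 have "inj_on \<Phi> {Q. deformation R M q B QB Q}"
 proof (rule inj_onI)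
  fix Q Q' assume "Q \<in> {Q. deformation R M q B QB Q}" "Q' \<in> {Q. deformation R M q B QB Q}" and e: "\<Phi> Q = \<Phi> Q'"
  then obtain \<phi> \<phi>' where r: "fam_rel R M B Q \<phi>" "fam_rel R M B Q' \<phi>'" and "\<Phi> Q = mexp R B UM \<phi>" "\<Phi> Q' = mexp R B UM \<phi>'"
   using \<Phi> by (metis mem_Collect_eq)
  then show "Q = Q'" using fam_rel_unique[OF M dg BL r] eq[OF r] e by simp
 qed
 moreover have "\<Phi> ` {Q. deformation R M q B QB Q} = dg_morphisms R B QB UM PU"
 proof (intro equalityI subsetI)
  fix f assume "f \<in> \<Phi> ` {Q. deformation R M q B QB Q}"
  then obtain Q where d: "deformation R M q B QB Q" "f = \<Phi> Q" by blast
  then obtain \<phi> where "fam_rel R M B Q \<phi>" "f = mexp R B UM \<phi>" using \<Phi> by blast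
  then show "f \<in> dg_morphisms R B QB UM PU" using mexp_dg[OF d(1)] by simp
 next
  fix f assume f: "f \<in> dg_morphisms R B QB UM PU"
  then have fs: "f \<in> smf B UM" by (simp add: dg_morphisms_def)
  let ?\<phi> = "aug \<zero>[UM 0] (cpt B UM 0 f)"
  have \<phi>: "symf B UM ?\<phi>" by (rule symfun_aug[OF smf_component_symfun[OF B U fs] m_zero[OF gm[OF U]]])
  define Q where "Q = vfield_of R (dsum B M) 1 (%w. (\<zero>[B (wdeg w + 1)], fam R M ?\<phi> w))"
  have r: "fam_rel R M B Q ?\<phi>" unfolding Q_def by (rule fam_relI[OF M B \<phi>]) simp_all
  have fm: "mexp R B UM ?\<phi> = f"
   by (rule smf_eqI[OF B U mexp_smf(1)[OF B U \<phi>] fs]) (simp add: component_mexp[OF B U \<phi>])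
  then have d: "deformation R M q B QB Q" using deformation_iff[OF M dg BL r] f by simp
  obtain \<phi>' where r': "fam_rel R M B Q \<phi>'" and e: "\<Phi> Q = mexp R B UM \<phi>'" using \<Phi>[OF d] by blast
  have "\<Phi> Q = f"
  proof -
   \<comment> \<open>Two families of the same vectorfield give the same morphism, by uniqueness of
     the classifying morphism.\<close>
   have "mexp R B UM \<phi>' = mexp R B UM ?\<phi>"
    using deformation_morphism_exists[OF d r'] deformation_morphism_unique[OF d r] by blast
   then show ?thesis using e fm by simp
  qed
  with d show "f \<in> \<Phi> ` {Q. deformation R M q B QB Q}" by blast
 qed
 ultimately show ?thesis by (simp add: bij_betw_def)
qed

end

end

end

theorem theorem2p9:
  fixes R :: "'k ring" and M :: "('k, 'm) gmod" and QM :: "('k, 'm) vfield"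
  assumes "ground_ring R" and "dg_manifold R M QM"
  shows "deformation R M QM (Umod R M) (QU R M QM) (Qcan R M) \<and>
    (\<forall>(B :: ('k, 'b) gmod) QB Q'. deformation R M QM B QB Q' \<longrightarrow>
       (\<exists>F f. deformation_morphism TYPE('t) R M QM B QB Q' (Umod R M) (QU R M QM) (Qcan R M) F f) \<and>
       (\<exists>!f. \<exists>F. deformation_morphism TYPE('t) R M QM B QB Q' (Umod R M) (QU R M QM) (Qcan R M) F f \<and>
          gcomp (Sym R (dsum B M)) (prM R (Umod R M) M) F = prM R B M)) \<and>
    (\<forall>(B :: ('k, 'b) gmod) QB. dg_manifold_L R B QB \<longrightarrow>
       (\<exists>\<Phi>. bij_betw \<Phi> {Q'. deformation R M QM B QB Q'} (dg_morphisms R B QB (Umod R M) (QU R M QM)) \<and>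
          (\<forall>Q'. deformation R M QM B QB Q' \<longrightarrow>
             classifies R M B Q' (\<Phi> Q') \<and>
             (\<exists>F. deformation_morphism TYPE('t) R M QM B QB Q' (Umod R M) (QU R M QM) (Qcan R M) F (\<Phi> Q') \<and>
                gcomp (Sym R (dsum B M)) (prM R (Umod R M) M) F = prM R B M))))"
proof -
  interpret ground R by unfold_locales (rule assms(1))
  have M: "graded_module R M" and dg: "dg_structure R M QM"
    using assms(2) by (simp_all add: dg_manifold_def)
  have fam: "\<exists>\<phi>. fam_rel R M B Q' \<phi>" if "deformation R M QM B QB Q'" for B :: "('k, 'b) gmod" and QB Q'
  proof -
    have "dg_manifold_L R B QB" using that by (simp add: deformation_def)
    then show ?thesis using deformation_fam[OF M dg _ that] by blast
  qed
  show ?thesis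
  proof (intro conjI allI impI)
    show "deformation R M QM (Umod R M) (QU R M QM) (Qcan R M)" by (rule deformation_Qcan[OF M dg])
    fix B :: "('k, 'b) gmod" and QB
    show "\<exists>F f. deformation_morphism TYPE('t) R M QM B QB Q' (Umod R M) (QU R M QM) (Qcan R M) F f"
      and "\<exists>!f. \<exists>F. deformation_morphism TYPE('t) R M QM B QB Q' (Umod R M) (QU R M QM) (Qcan R M) F f \<and>
          gcomp (Sym R (dsum B M)) (prM R (Umod R M) M) F = prM R B M" if d: "deformation R M QM B QB Q'" for Q'
    proof -
      obtain \<phi> where r: "fam_rel R M B Q' \<phi>" using fam[OF d] by blast
      note ex = deformation_morphism_exists[OF M dg d r, where 't = 't]
      then show "\<exists>F f. deformation_morphism TYPE('t) R M QM B QB Q' (Umod R M) (QU R M QM) (Qcan R M) F f" by blast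
      show "\<exists>!f. \<exists>F. deformation_morphism TYPE('t) R M QM B QB Q' (Umod R M) (QU R M QM) (Qcan R M) F f \<and>
          gcomp (Sym R (dsum B M)) (prM R (Umod R M) M) F = prM R B M"
      proof (rule ex1I[of _ "mexp R B (Umod R M) \<phi>"])
        show "f = mexp R B (Umod R M) \<phi>"
          if "\<exists>F. deformation_morphism TYPE('t) R M QM B QB Q' (Umod R M) (QU R M QM) (Qcan R M) F f \<and>
            gcomp (Sym R (dsum B M)) (prM R (Umod R M) M) F = prM R B M" for f
          using that deformation_morphism_unique[OF M dg d r, where 't = 't] by blast
      qed (rule ex)
    qed
    assume BL: "dg_manifold_L R B QB"
    \<comment> \<open>A family of \<open>Q'\<close> is pinned down only on words in B, so one is
      chosen; its exponential is the classifying morphism.\<close>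
    define \<Phi> where "\<Phi> = (\<lambda>Q'. mexp R B (Umod R M) (SOME \<phi>. fam_rel R M B Q' \<phi>))"
    have \<Phi>: "fam_rel R M B Q' (SOME \<phi>. fam_rel R M B Q' \<phi>)" if "deformation R M QM B QB Q'" for Q'
      using someI_ex[OF fam[OF that]] .
    show "\<exists>\<Phi>. bij_betw \<Phi> {Q'. deformation R M QM B QB Q'} (dg_morphisms R B QB (Umod R M) (QU R M QM)) \<and>
          (\<forall>Q'. deformation R M QM B QB Q' \<longrightarrow>
             classifies R M B Q' (\<Phi> Q') \<and>
             (\<exists>F. deformation_morphism TYPE('t) R M QM B QB Q' (Umod R M) (QU R M QM) (Qcan R M) F (\<Phi> Q') \<and>
                gcomp (Sym R (dsum B M)) (prM R (Umod R M) M) F = prM R B M))"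
    proof (intro exI[of _ \<Phi>] conjI allI impI)
      show "bij_betw \<Phi> {Q'. deformation R M QM B QB Q'} (dg_morphisms R B QB (Umod R M) (QU R M QM))"
        by (rule deformations_bij_morphisms[OF M dg BL]) (use \<Phi> in \<open>auto simp: \<Phi>_def\<close>)
      fix Q' assume d: "deformation R M QM B QB Q'"
      show "classifies R M B Q' (\<Phi> Q')"
        unfolding \<Phi>_def by (rule classifies_mexp[OF M dg d \<Phi>[OF d]])
      show "\<exists>F. deformation_morphism TYPE('t) R M QM B QB Q' (Umod R M) (QU R M QM) (Qcan R M) F (\<Phi> Q') \<and>
                gcomp (Sym R (dsum B M)) (prM R (Umod R M) M) F = prM R B M"
        unfolding \<Phi>_def by (rule deformation_morphism_exists[OF M dg d \<Phi>[OF d]])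
    qed
  qed
qed

end
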